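(* The bijections $E_l\colon FL(S)^S\times CW(S)\to\mathcal A^w_{\exp}(S)$ ($S$ a finite set) intertwine the operations on $\mathcal A^w_{\exp}$ with the following operations on pairs $(\lambda;\omega)$: 1. If $S_1\cap S_2=\emptyset$ and $(\lambda_i;\omega_i)\in FL(S_i)^{S_i}\times CW(S_i)$, then $E_l(\lambda_1;\omega_1)\sqcup E_l(\lambda_2;\omega_2)=E_l(\lambda_1\sqcup\lambda_2;\ \omega_1+\omega_2)$. 2. If $(\lambda_i;\omega_i)\in FL(S)^S\times CW(S)$ for $i=1,2$, then $E_l(\lambda_1;\omega_1)\ast E_l(\lambda_2;\omega_2)=E_l\big(\mathrm{BCH}_{tb}(\lambda_1,\lambda_2);\ e^{-\partial_{\lambda_2}}(\omega_1)+\omega_2\big)$. In the remaining items $(\lambda;\omega)\in FL(S)^S\times CW(S)$ and $a\in S$. 3. $d\eta^a(E_l(\lambda;\omega))=E_l\big((\lambda\setminus a)|_{a\to0};\ \omega|_{a\to 0}\big)$. 4. $dA^S(E_l(\lambda;\omega))=E_l\big(-\lambda;\ e^{\partial_\lambda}(\omega)-j(\lambda)\big)$. 5. $dS^S(E_l(\lambda;\omega))=E_l\big(-(-1)^{\deg}\lambda;\ (-1)^{\deg}(e^{\partial_\lambda}(\omega)-j(\lambda))\big)$. 6. If $b\neq c$ and $b,c\notin S\setminus\{a\}$, then $d\Delta^a_{bc}(E_l(\lambda;\omega))=E_l\big(((\lambda\setminus a)\sqcup(b\to\lambda_a,\,c\to\lambda_a))|_{a\to b+c};\ \omega|_{a\to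 b+c}\big)$. 7. If $b\notin S\setminus\{a\}$, then $d\sigma^a_b(E_l(\lambda;\omega))=E_l\big(((\lambda\setminus a)\sqcup(b\to\lambda_a))|_{a\to b};\ \omega|_{a\to b}\big)$.
   Context: **Free Lie algebras and cyclic words.** Everything is over $\mathbb Q$. $FL(S)$ is the degree-completed free Lie algebra on a finite set $S$ of degree 1 generators; $CW(S)$ is the degree-completed vector space spanned by non-empty cyclic words in the alphabet $S$; $FL(S)^S$ is the set of functions $\lambda=(\lambda_a)_{a\in S}$, with componentwise bracket $[\cdot,\cdot]$. For $\lambda\in FL(S)^S$, $\partial_\lambda$ is the derivation of $FL(S)$ with $\partial_\lambda(a)=[a,\lambda_a]$ for all $a\in S$; it acts componentwise on $FL(S)^S$, and acts on $CW(S)$ by extending to a derivation of the free associative algebra and descending to cyclic words. $[\lambda_1,\lambda_2]_{tb}=[\lambda_1,\lambda_2]+\partial_{\lambda_1}\lambda_2-\partial_{\lambda_2}\lambda_1$ is a Lie bracket on $FL(S)^S$, and $\mathrm{BCH}_{tb}$ is the Baker-Campbell-Hausdorff series $\mathrm{BCH}(x,y)=\log(e^xe^y)$ computed with it. $(-1)^{\deg}$ multiplies degree $k$ elements by $(-1)^k$ (componentwise on $FL(S)^S$). For $\gamma\in FL(S)$, written in the free associative algebra uniquely as $\gamma=\sum_{v\in S}\gamma_v v$, $\mathrm{div}_u\gamma\in CW(S)$ is the class of $u\gamma_u$ (e.g. $\mathrm{div}_u[[v,u],u]=-$ the cyclic word $uuv$). For $\lambda\in FL(S)^S$, $\mathrm{div}\,\lambda=\sum_{u\in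 S}\mathrm{div}_u\lambda_u$ and $j(\lambda)=\frac{e^{\partial_\lambda}-1}{\partial_\lambda}(\mathrm{div}\,\lambda)\in CW(S)$. $\lambda\setminus a$ is $\lambda$ with $a$ removed from its domain; $\lambda_1\sqcup\lambda_2$ is the union of functions with disjoint domains (with values included in the larger free Lie algebra); $(b\to\mu,\ldots)$ denotes the function with the indicated values; $|_{a\to\cdots}$ denotes substitution for the generator $a$ in all Lie series / cyclic words. **The space $\mathcal A^w(S)$.** An arrow diagram on $S$ consists of vertical upward-oriented strands labelled by $S$ (the skeleton) and a finite directed graph whose univalent vertices (ends) are attached at distinct points of the strands (a source end is a "tail", a sink end is a "head"), whose other vertices are trivalent with two incoming edges and one outgoing edge and with an ordering (left, right) of the incoming edges, and each of whose connected components has at least one end on the skeleton. Its degree is half the total number of vertices (ends and trivalent). A trivalent vertex with left input $p$ and right input $q$ is thought of as outputting the bracket $[p,q]$. $\mathcal A^w(S)$ is the degree completion of the span of arrow diagrams modulo: (AS) exchanging the two inputs of a trivalent vertex negates the diagram; (IHX) the Jacobi identity $[[p,q],r]+[[q,r],p]+[[r,p],q]=0$ applied locally; (STU$_1$) if the heads of edges $p,q$ are adjacent on a strand, ($p$ below $q$) $-$ ($q$ below $p$) $=$ the diagram with a single head there, on the edge output by a new vertex $[p,q]$; (STU$_2$) if the head of an edge $p$ and the tail of an edge $e$ are adjacent on a strand, (head below tail) $-$ (tail below head) $=$ the diagram with a single tail there, feeding as the left input of a new vertex whose right input is $p$ and whose output continues along $e$; (TC) adjacent tails on a strand may be exchanged.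 The co-product $\Box(D)$ is the sum over all ways of distributing the connected components of $D$ minus its skeleton between a left and a right co-factor; $\mathcal A^w_{\exp}(S)$ is the set of group-like elements, $\Box(Z)=Z\otimes Z$. **Operations on $\mathcal A^w$** (all preserve group-like elements). $D_1\sqcup D_2\in\mathcal A^w(S_1\sqcup S_2)$: side by side placement. $D_1\ast D_2$: stack $D_2$ on top of $D_1$. $d\eta^a$: delete strand $a$, giving $0$ if any arrow end is on $a$. $dA^a$: reverse strand $a$ and multiply by $-1$ for each head on $a$; $dA^S=\prod_{a\in S}dA^a$. $dS^a$: reverse strand $a$ and multiply by $-1$ for each head or tail on $a$; $dS^S=\prod_{a\in S}dS^a$. $d\Delta^a_{bc}$: replace strand $a$ by two parallel strands $b,c$ and sum over all ways of lifting each end on $a$ to $b$ or $c$. $d\sigma^a_b$: rename strand $a$ to $b$. **The map $E_l$.** $l\colon FL(S)^S\to\mathcal A^w(S)$ sends $\lambda$ to the sum over $a\in S$ of planting $\lambda_a$, written as a combination of bracket trees (the bracket $[p,q]$ being a vertex with left input $p$ and right input $q$), with its root as a head on strand $a$ and its leaves as tails on the strands matching their labels, so that the head is below all tails. $\iota\colon CW(S)\to\mathcal A^w(S)$ sends the cyclic word $a_1a_2\cdots a_k$ to $(-1)$ times the wheel obtained by closing up $z\mapsto[a_1,[a_2,\ldots,[a_k,z]\ldots]]$ into a directed cycle, the legs being tails on strands $a_1,\ldots,a_k$. $E_l(\lambda;\omega)=\exp(l\lambda)\ast\exp(\iota\omega)$, with exponentials taken using $\ast$; it is known that $E_l\colon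 FL(S)^S\times CW(S)\to\mathcal A^w_{\exp}(S)$ is a bijection. *)

theory Defs
  imports Complex_Main "HOL-Library.Function_Algebras" "HOL-Library.Multiset"
begin

text \<open>
  Formal series with rational coefficients in basis elements of a type are functions into
  \<^typ>\<open>rat\<close>; sums, differences and zero are pointwise. Finite label sets \<open>S\<close> are subsets of a
  type \<^typ>\<open>'a\<close> of labels.
\<close>

definition scale :: "rat \<Rightarrow> ('d \<Rightarrow> rat) \<Rightarrow> 'd \<Rightarrow> rat" where
  "scale r f = (\<lambda>x. r * f x)"

definition single :: "'d \<Rightarrow> 'd \<Rightarrow> rat" where
  "single x = (\<lambda>y. if y = x then 1 else 0)"

global_interpretation series: vector_space scale
  by standard (auto simp: scale_def fun_eq_iff algebra_simps)


section \<open>The completed free associative algebra\<close>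

type_synonym 'a ncs = "'a list \<Rightarrow> rat"

definition nc_one :: "'a ncs" where
  "nc_one = single []"

definition nc_gen :: "'a \<Rightarrow> 'a ncs" where
  "nc_gen x = single [x]"

definition nc_mult :: "'a ncs \<Rightarrow> 'a ncs \<Rightarrow> 'a ncs"  (infixl "\<odot>" 70) where
  "f \<odot> g = (\<lambda>w. \<Sum>i\<le>length w. f (take i w) * g (drop i w))"

definition nc_bracket :: "'a ncs \<Rightarrow> 'a ncs \<Rightarrow> 'a ncs" where
  "nc_bracket f g = f \<odot> g - g \<odot> f"

fun nc_pow :: "'a ncs \<Rightarrow> nat \<Rightarrow> 'a ncs" where
  "nc_pow f 0 = nc_one"
| "nc_pow f (Suc n) = f \<odot> nc_pow f n"

text \<open>
  The exponential of a series with zero constant term, and the logarithm of a series with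
  constant term one; the omitted summands do not contribute in the degree at hand.
\<close>

definition nc_exp :: "'a ncs \<Rightarrow> 'a ncs" where
  "nc_exp f = (\<lambda>w. \<Sum>n\<le>length w. nc_pow f n w / fact n)"

definition nc_log :: "'a ncs \<Rightarrow> 'a ncs" where
  "nc_log f = (\<lambda>w. \<Sum>n=1..length w. (-1) ^ (n + 1) / of_nat n * nc_pow (f - nc_one) n w)"

text \<open>
  Continuous linear extension of a map on words that does not decrease degrees. For series in
  a finite alphabet the index set is finite.
\<close>

definition nc_extend :: "('a list \<Rightarrow> 'a ncs) \<Rightarrow> 'a ncs \<Rightarrow> 'a ncs" where
  "nc_extend F f = (\<lambda>v. \<Sum>w | f w \<noteq> 0 \<and> length w \<le> length v. f w * F w v)"

text \<open>The algebra homomorphism sending each generator \<open>x\<close> to \<open>\<sigma> x\<close>.\<close>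

definition nc_subst :: "('a \<Rightarrow> 'a ncs) \<Rightarrow> 'a ncs \<Rightarrow> 'a ncs" where
  "nc_subst \<sigma> = nc_extend (\<lambda>w. foldr (\<lambda>x g. \<sigma> x \<odot> g) w nc_one)"

text \<open>The derivation \<open>\<partial>\<^bsub>L\<^esub>\<close> with \<open>a \<mapsto> [a, L a]\<close>.\<close>

definition nc_der :: "('a \<Rightarrow> 'a ncs) \<Rightarrow> 'a ncs \<Rightarrow> 'a ncs" where
  "nc_der L = nc_extend (\<lambda>w. \<Sum>i<length w.
     single (take i w) \<odot> nc_bracket (nc_gen (w ! i)) (L (w ! i)) \<odot> single (drop (Suc i) w))"

definition nc_sign_deg :: "'a ncs \<Rightarrow> 'a ncs" where
  "nc_sign_deg f = (\<lambda>w. (-1) ^ length w * f w)"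


section \<open>The completed free Lie algebra\<close>

datatype 'a btree = Leaf 'a | Br "'a btree" "'a btree"

fun leaves :: "'a btree \<Rightarrow> 'a list" where
  "leaves (Leaf x) = [x]"
| "leaves (Br s t) = leaves s @ leaves t"

fun nc_tree :: "'a btree \<Rightarrow> 'a ncs" where
  "nc_tree (Leaf x) = nc_gen x"
| "nc_tree (Br s t) = nc_bracket (nc_tree s) (nc_tree t)"

definition tree_series :: "'a set \<Rightarrow> ('a btree \<Rightarrow> rat) set" where
  "tree_series S = {T. \<forall>t. T t \<noteq> 0 \<longrightarrow> set (leaves t) \<subseteq> S}"

definition nc_trees :: "('a btree \<Rightarrow> rat) \<Rightarrow> 'a ncs" where
  "nc_trees T = (\<lambda>w. \<Sum>t | T t \<noteq> 0 \<and> length (leaves t) = length w. T t * nc_tree t w)"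

text \<open>
  The free Lie algebra is realised as the degree-completed Lie subalgebra generated by \<open>S\<close> in
  the free associative algebra, that is, as the set of all series of bracket trees.
\<close>

definition FL :: "'a set \<Rightarrow> 'a ncs set" where
  "FL S = nc_trees ` tree_series S"

text \<open>A way of writing a Lie series as a combination of bracket trees.\<close>

definition as_trees :: "'a set \<Rightarrow> 'a ncs \<Rightarrow> 'a btree \<Rightarrow> rat" where
  "as_trees S g = (SOME T. T \<in> tree_series S \<and> nc_trees T = g)"

text \<open>\<open>FL(S)\<^sup>S\<close>: functions on \<open>S\<close> are extended by zero to all labels.\<close>

definition FLS :: "'a set \<Rightarrow> ('a \<Rightarrow> 'a ncs) set" where
  "FLS S = {L. (\<forall>a\<in>S. L a \<in> FL S) \<and> (\<forall>a. a \<notin> S \<longrightarrow> L a = 0)}"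

definition fls_union :: "'a set \<Rightarrow> ('a \<Rightarrow> 'a ncs) \<Rightarrow> ('a \<Rightarrow> 'a ncs) \<Rightarrow> 'a \<Rightarrow> 'a ncs" where
  "fls_union S1 L1 L2 = (\<lambda>a. if a \<in> S1 then L1 a else L2 a)"

definition tb_bracket :: "('a \<Rightarrow> 'a ncs) \<Rightarrow> ('a \<Rightarrow> 'a ncs) \<Rightarrow> 'a \<Rightarrow> 'a ncs" where
  "tb_bracket L1 L2 = (\<lambda>a. nc_bracket (L1 a) (L2 a) + nc_der L1 (L2 a) - nc_der L2 (L1 a))"

text \<open>
  The series \<open>log (e\<^sup>x e\<^sup>y)\<close>, with \<open>x\<close> and \<open>y\<close> named \<^const>\<open>False\<close> and \<^const>\<open>True\<close>. To compute
  it with the bracket \<^const>\<open>tb_bracket\<close>, write it as a series of bracket trees and evaluate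
  these; a tree with \<open>n\<close> leaves has a value of degree at least \<open>n\<close>.
\<close>

definition bch_series :: "bool ncs" where
  "bch_series = nc_log (nc_exp (nc_gen False) \<odot> nc_exp (nc_gen True))"

fun tb_eval :: "('a \<Rightarrow> 'a ncs) \<Rightarrow> ('a \<Rightarrow> 'a ncs) \<Rightarrow> bool btree \<Rightarrow> 'a \<Rightarrow> 'a ncs" where
  "tb_eval L1 L2 (Leaf y) = (if y then L2 else L1)"
| "tb_eval L1 L2 (Br s t) = tb_bracket (tb_eval L1 L2 s) (tb_eval L1 L2 t)"

definition BCH_tb :: "('a \<Rightarrow> 'a ncs) \<Rightarrow> ('a \<Rightarrow> 'a ncs) \<Rightarrow> 'a \<Rightarrow> 'a ncs" where
  "BCH_tb L1 L2 = (\<lambda>a w. \<Sum>t | length (leaves t) \<le> length w.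
     as_trees UNIV bch_series t * tb_eval L1 L2 t a w)"


section \<open>Cyclic words\<close>

text \<open>A cyclic word is the set of all rotations of a non-empty word.\<close>

type_synonym 'a cws = "'a list set \<Rightarrow> rat"

definition cyc :: "'a list \<Rightarrow> 'a list set" where
  "cyc w = {rotate n w | n. True}"

definition cwords :: "'a set \<Rightarrow> 'a list set set" where
  "cwords S = {cyc w | w. w \<noteq> [] \<and> set w \<subseteq> S}"

definition cw_word :: "'a list set \<Rightarrow> 'a list" where
  "cw_word c = (SOME w. w \<in> c)"

abbreviation cw_length :: "'a list set \<Rightarrow> nat" where
  "cw_length c \<equiv> length (cw_word c)"

definition CW :: "'a set \<Rightarrow> 'a cws set" where
  "CW S = {\<omega>. \<forall>c. \<omega> c \<noteq> 0 \<longrightarrow> c \<in> cwords S}"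

text \<open>The projection from the free associative algebra and a linear section of it.\<close>

definition cw_class :: "'a ncs \<Rightarrow> 'a cws" where
  "cw_class f = (\<lambda>c. if c \<in> cwords UNIV then \<Sum>w\<in>c. f w else 0)"

definition cw_lift :: "'a cws \<Rightarrow> 'a ncs" where
  "cw_lift \<omega> = (\<lambda>w. if w \<noteq> [] \<and> w = cw_word (cyc w) then \<omega> (cyc w) else 0)"

definition cw_subst :: "('a \<Rightarrow> 'a ncs) \<Rightarrow> 'a cws \<Rightarrow> 'a cws" where
  "cw_subst \<sigma> \<omega> = cw_class (nc_subst \<sigma> (cw_lift \<omega>))"

definition cw_der :: "('a \<Rightarrow> 'a ncs) \<Rightarrow> 'a cws \<Rightarrow> 'a cws" where
  "cw_der L \<omega> = cw_class (nc_der L (cw_lift \<omega>))"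

definition cw_sign_deg :: "'a cws \<Rightarrow> 'a cws" where
  "cw_sign_deg \<omega> = (\<lambda>c. (-1) ^ cw_length c * \<omega> c)"

text \<open>
  The operators \<open>e\<^sup>D\<close> and \<open>(e\<^sup>D - 1) / D\<close> for a degree-increasing operator \<open>D\<close>: powers of \<open>D\<close>
  beyond the degree of \<open>c\<close> do not contribute to the coefficient of \<open>c\<close>.
\<close>

definition cw_exp_op :: "('a cws \<Rightarrow> 'a cws) \<Rightarrow> 'a cws \<Rightarrow> 'a cws" where
  "cw_exp_op D \<omega> = (\<lambda>c. \<Sum>n\<le>cw_length c. (D ^^ n) \<omega> c / fact n)"

definition cw_expm1_quot_op :: "('a cws \<Rightarrow> 'a cws) \<Rightarrow> 'a cws \<Rightarrow> 'a cws" where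
  "cw_expm1_quot_op D \<omega> = (\<lambda>c. \<Sum>n\<le>cw_length c. (D ^^ n) \<omega> c / fact (Suc n))"

text \<open>The coefficient \<open>\<gamma>\<^sub>u\<close> in \<open>\<gamma> = (\<Sum>v. \<gamma>\<^sub>v v)\<close> is the series \<open>\<lambda>w. \<gamma> (w @ [u])\<close>.\<close>

definition div_at :: "'a \<Rightarrow> 'a ncs \<Rightarrow> 'a cws" where
  "div_at u \<gamma> = cw_class (nc_gen u \<odot> (\<lambda>w. \<gamma> (w @ [u])))"

definition fls_div :: "'a set \<Rightarrow> ('a \<Rightarrow> 'a ncs) \<Rightarrow> 'a cws" where
  "fls_div S L = (\<Sum>u\<in>S. div_at u (L u))"

definition fls_j :: "'a set \<Rightarrow> ('a \<Rightarrow> 'a ncs) \<Rightarrow> 'a cws" where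
  "fls_j S L = cw_expm1_quot_op (cw_der L) (fls_div S L)"


section \<open>Arrow diagrams\<close>

text \<open>
  Edges carry names. A strand is the list, from bottom to top, of the ends on it; a trivalent
  vertex is the triple of its left input, right input and output edge.
\<close>

type_synonym edge = "nat list"

datatype arrow_end = Head edge | Tail edge

datatype 'a diagram =
  Diagram (strand: "'a \<Rightarrow> arrow_end list") (verts: "(edge \<times> edge \<times> edge) multiset")

fun end_edge :: "arrow_end \<Rightarrow> edge" where
  "end_edge (Head e) = e"
| "end_edge (Tail e) = e"

fun is_head :: "arrow_end \<Rightarrow> bool" where
  "is_head (Head e) = True"
| "is_head (Tail e) = False"

definition heads :: "'a diagram \<Rightarrow> edge multiset" where
  "heads D = (\<Sum>a | strand D a \<noteq> []. mset (map end_edge (filter is_head (strand D a))))"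

definition tails :: "'a diagram \<Rightarrow> edge multiset" where
  "tails D = (\<Sum>a | strand D a \<noteq> []. mset (map end_edge (filter (Not \<circ> is_head) (strand D a))))"

definition sources :: "'a diagram \<Rightarrow> edge multiset" where
  "sources D = tails D + image_mset (\<lambda>(p, q, r). r) (verts D)"

definition targets :: "'a diagram \<Rightarrow> edge multiset" where
  "targets D = heads D + image_mset (\<lambda>(p, q, r). p) (verts D) + image_mset (\<lambda>(p, q, r). q) (verts D)"

abbreviation edges :: "'a diagram \<Rightarrow> edge set" where
  "edges D \<equiv> set_mset (sources D)"

definition linked :: "'a diagram \<Rightarrow> (edge \<times> edge) set" where
  "linked D = {(e, e'). \<exists>p q r. (p, q, r) \<in># verts D \<and> {e, e'} \<subseteq> {p, q, r}}"

text \<open>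
  The second and third condition say that every edge has exactly one source and exactly one
  target, the last one that every connected component has an end on the skeleton.
\<close>

definition arrow_diagram :: "'a set \<Rightarrow> 'a diagram \<Rightarrow> bool" where
  "arrow_diagram S D \<longleftrightarrow>
     (\<forall>a. a \<notin> S \<longrightarrow> strand D a = []) \<and>
     (\<forall>e. count (sources D) e \<le> 1) \<and>
     sources D = targets D \<and>
     (\<forall>e \<in> edges D. \<exists>e'. (e, e') \<in> (linked D)\<^sup>* \<and> e' \<in># heads D + tails D)"

definition degree :: "'a diagram \<Rightarrow> nat" where
  "degree D = (size (heads D) + size (tails D) + size (verts D)) div 2"

fun map_end :: "(edge \<Rightarrow> edge) \<Rightarrow> arrow_end \<Rightarrow> arrow_end" where
  "map_end \<pi> (Head e) = Head (\<pi> e)"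
| "map_end \<pi> (Tail e) = Tail (\<pi> e)"

definition rename_edges :: "(edge \<Rightarrow> edge) \<Rightarrow> 'a diagram \<Rightarrow> 'a diagram" where
  "rename_edges \<pi> D = Diagram (\<lambda>a. map (map_end \<pi>) (strand D a))
     (image_mset (\<lambda>(p, q, r). (\<pi> p, \<pi> q, \<pi> r)) (verts D))"


section \<open>The space \<open>\<A>\<^sup>w(S)\<close>\<close>

text \<open>
  Besides the defining relations, \<open>iso\<close> identifies diagrams that differ in the names of their
  edges only. New edges in \<open>STU1\<close> and \<open>STU2\<close> are fresh because the diagram in which
  they occur is required to be an arrow diagram. In \<open>STU2\<close> the edges \<open>p\<close> and \<open>e\<close> may coincide.
\<close>

inductive_set relators :: "'a set \<Rightarrow> ('a diagram \<Rightarrow> rat) set" for S :: "'a set" where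
  iso: "\<lbrakk>arrow_diagram S D; inj_on \<pi> (edges D)\<rbrakk> \<Longrightarrow>
    single D - single (rename_edges \<pi> D) \<in> relators S"
| AS: "\<lbrakk>arrow_diagram S (Diagram s (V + {#(p, q, r)#}))\<rbrakk> \<Longrightarrow>
    single (Diagram s (V + {#(p, q, r)#})) + single (Diagram s (V + {#(q, p, r)#})) \<in> relators S"
| IHX: "\<lbrakk>arrow_diagram S (Diagram s (V + {#(p, q, x), (x, r, y)#}))\<rbrakk> \<Longrightarrow>
    single (Diagram s (V + {#(p, q, x), (x, r, y)#})) +
    single (Diagram s (V + {#(q, r, x), (x, p, y)#})) +
    single (Diagram s (V + {#(r, p, x), (x, q, y)#})) \<in> relators S"
| STU1: "\<lbrakk>arrow_diagram S (Diagram (s(a := xs @ [Head p, Head q] @ ys)) V);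
     arrow_diagram S (Diagram (s(a := xs @ [Head e] @ ys)) (V + {#(p, q, e)#}))\<rbrakk> \<Longrightarrow>
    single (Diagram (s(a := xs @ [Head p, Head q] @ ys)) V) -
    single (Diagram (s(a := xs @ [Head q, Head p] @ ys)) V) -
    single (Diagram (s(a := xs @ [Head e] @ ys)) (V + {#(p, q, e)#})) \<in> relators S"
| STU2: "\<lbrakk>arrow_diagram S (Diagram (s(a := xs @ [Head p, Tail e] @ ys)) V);
     arrow_diagram S (Diagram (s(a := xs @ [Tail f] @ ys)) (V + {#(f, p, e)#}))\<rbrakk> \<Longrightarrow>
    single (Diagram (s(a := xs @ [Head p, Tail e] @ ys)) V) -
    single (Diagram (s(a := xs @ [Tail e, Head p] @ ys)) V) -
    single (Diagram (s(a := xs @ [Tail f] @ ys)) (V + {#(f, p, e)#})) \<in> relators S"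
| TC: "\<lbrakk>arrow_diagram S (Diagram (s(a := xs @ [Tail d, Tail e] @ ys)) V)\<rbrakk> \<Longrightarrow>
    single (Diagram (s(a := xs @ [Tail d, Tail e] @ ys)) V) -
    single (Diagram (s(a := xs @ [Tail e, Tail d] @ ys)) V) \<in> relators S"

text \<open>
  The degree completion of the span of the diagrams. Since edges are named, there are infinitely
  many diagrams in each degree, of which only finitely many may occur.
\<close>

definition diagram_series :: "'a set \<Rightarrow> ('a diagram \<Rightarrow> rat) set" where
  "diagram_series S = {f. (\<forall>D. f D \<noteq> 0 \<longrightarrow> arrow_diagram S D) \<and>
     (\<forall>n. finite {D. f D \<noteq> 0 \<and> degree D = n})}"

definition degree_part :: "nat \<Rightarrow> ('a diagram \<Rightarrow> rat) \<Rightarrow> 'a diagram \<Rightarrow> rat" where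
  "degree_part n f = (\<lambda>D. if degree D = n then f D else 0)"

definition aw_rel :: "'a set \<Rightarrow> (('a diagram \<Rightarrow> rat) \<times> ('a diagram \<Rightarrow> rat)) set" where
  "aw_rel S = {(f, g). f \<in> diagram_series S \<and> g \<in> diagram_series S \<and>
     (\<forall>n. degree_part n (f - g) \<in> series.span (relators S))}"

type_synonym 'a aw = "('a diagram \<Rightarrow> rat) set"

definition Aw :: "'a set \<Rightarrow> 'a aw set" where
  "Aw S = diagram_series S // aw_rel S"

definition aw_class :: "'a set \<Rightarrow> ('a diagram \<Rightarrow> rat) \<Rightarrow> 'a aw" where
  "aw_class S f = aw_rel S `` {f}"


section \<open>Operations on \<open>\<A>\<^sup>w\<close>\<close>

text \<open>Linear extension of a degree-preserving map on diagrams.\<close>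

definition diagram_extend ::
    "('a diagram \<Rightarrow> 'a diagram \<Rightarrow> rat) \<Rightarrow> ('a diagram \<Rightarrow> rat) \<Rightarrow> 'a diagram \<Rightarrow> rat" where
  "diagram_extend F f = (\<lambda>E. \<Sum>D | f D \<noteq> 0 \<and> degree D = degree E. f D * F D E)"

text \<open>
  The induced map on the quotient, with values in \<open>\<A>\<^sup>w(S)\<close>: the union is over all
  representatives \<open>f\<close> of \<open>X\<close>, as in \<^theory>\<open>HOL.Equiv_Relations\<close>.
\<close>

definition aw_map ::
    "'a set \<Rightarrow> ('a diagram \<Rightarrow> 'a diagram \<Rightarrow> rat) \<Rightarrow> 'a aw \<Rightarrow> 'a aw" where
  "aw_map S F X = (\<Union>f\<in>X. aw_class S (diagram_extend F f))"

text \<open>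
  Put \<open>D2\<close> on top of \<open>D1\<close>, after making the names of edges disjoint. For diagrams on
  disjoint skeleta, each strand has ends of only one of the two diagrams, and this is
  side by side placement.
\<close>

definition stack :: "'a diagram \<Rightarrow> 'a diagram \<Rightarrow> 'a diagram" where
  "stack D1 D2 = (let D1' = rename_edges ((#) 0) D1; D2' = rename_edges ((#) 1) D2
     in Diagram (\<lambda>a. strand D1' a @ strand D2' a) (verts D1' + verts D2'))"

definition series_stack ::
    "('a diagram \<Rightarrow> rat) \<Rightarrow> ('a diagram \<Rightarrow> rat) \<Rightarrow> 'a diagram \<Rightarrow> rat" where
  "series_stack f g = (\<lambda>E. \<Sum>(D1, D2) | f D1 \<noteq> 0 \<and> g D2 \<noteq> 0 \<and> degree D1 + degree D2 = degree E.
     f D1 * g D2 * single (stack D1 D2) E)"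

definition aw_stack :: "'a set \<Rightarrow> 'a aw \<Rightarrow> 'a aw \<Rightarrow> 'a aw" where
  "aw_stack S X Y = (\<Union>f\<in>X. \<Union>g\<in>Y. aw_class S (series_stack f g))"

definition aw_disjoint_union :: "'a set \<Rightarrow> 'a set \<Rightarrow> 'a aw \<Rightarrow> 'a aw \<Rightarrow> 'a aw" where
  "aw_disjoint_union S1 S2 X Y = (\<Union>f\<in>X. \<Union>g\<in>Y. aw_class (S1 \<union> S2) (series_stack f g))"

definition d_eta :: "'a set \<Rightarrow> 'a \<Rightarrow> 'a aw \<Rightarrow> 'a aw" where
  "d_eta S a = aw_map (S - {a}) (\<lambda>D. if strand D a = [] then single D else 0)"

text \<open>
  The maps \<open>dA\<^sup>a\<close> for different \<open>a\<close> commute, and likewise \<open>dS\<^sup>a\<close>; for a set \<open>A\<close> of strands,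
  \<open>d_A S A\<close> and \<open>d_S S A\<close> are the products of these maps over all \<open>a\<close> in \<open>A\<close>.
\<close>

definition reverse_strands :: "'a set \<Rightarrow> 'a diagram \<Rightarrow> 'a diagram" where
  "reverse_strands A D =
     Diagram (\<lambda>a. if a \<in> A then rev (strand D a) else strand D a) (verts D)"

definition d_A :: "'a set \<Rightarrow> 'a set \<Rightarrow> 'a aw \<Rightarrow> 'a aw" where
  "d_A S A = aw_map S (\<lambda>D. scale ((-1) ^ (\<Sum>a\<in>A. length (filter is_head (strand D a))))
     (single (reverse_strands A D)))"

definition d_S :: "'a set \<Rightarrow> 'a set \<Rightarrow> 'a aw \<Rightarrow> 'a aw" where
  "d_S S A = aw_map S (\<lambda>D. scale ((-1) ^ (\<Sum>a\<in>A. length (strand D a)))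
     (single (reverse_strands A D)))"

text \<open>In the sum, \<open>I\<close> is the set of positions of the ends on \<open>a\<close> that are lifted to \<open>b\<close>.\<close>

definition d_Delta :: "'a set \<Rightarrow> 'a \<Rightarrow> 'a \<Rightarrow> 'a \<Rightarrow> 'a aw \<Rightarrow> 'a aw" where
  "d_Delta S a b c = aw_map (S - {a} \<union> {b, c}) (\<lambda>D. \<Sum>I\<in>Pow {..<length (strand D a)}.
     single (Diagram ((strand D)(a := [], b := nths (strand D a) I, c := nths (strand D a) (- I)))
       (verts D)))"

definition d_sigma :: "'a set \<Rightarrow> 'a \<Rightarrow> 'a \<Rightarrow> 'a aw \<Rightarrow> 'a aw" where
  "d_sigma S a b = aw_map (S - {a} \<union> {b}) (\<lambda>D.
     single (Diagram ((strand D)(a := [], b := strand D a)) (verts D)))"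


section \<open>The map \<open>E\<^sub>l\<close>\<close>

text \<open>
  The edges of a planted tree are named by their positions: the edge below a vertex named \<open>e\<close>
  has inputs \<open>0 # e\<close> and \<open>1 # e\<close>, and the root edge is \<open>[]\<close>.
\<close>

fun tree_verts :: "edge \<Rightarrow> 'a btree \<Rightarrow> (edge \<times> edge \<times> edge) multiset" where
  "tree_verts e (Leaf x) = {#}"
| "tree_verts e (Br s t) = {#(0 # e, 1 # e, e)#} + tree_verts (0 # e) s + tree_verts (1 # e) t"

fun tree_leaves :: "edge \<Rightarrow> 'a btree \<Rightarrow> ('a \<times> edge) list" where
  "tree_leaves e (Leaf x) = [(x, e)]"
| "tree_leaves e (Br s t) = tree_leaves (0 # e) s @ tree_leaves (1 # e) t"

definition plant :: "'a \<Rightarrow> 'a btree \<Rightarrow> 'a diagram" where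
  "plant a t = Diagram
     (\<lambda>b. (if b = a then [Head []] else []) @ [Tail e. (x, e) \<leftarrow> tree_leaves [] t, x = b])
     (tree_verts [] t)"

definition l_map :: "'a set \<Rightarrow> ('a \<Rightarrow> 'a ncs) \<Rightarrow> 'a diagram \<Rightarrow> rat" where
  "l_map S L = (\<lambda>D. \<Sum>a\<in>S. \<Sum>t | as_trees S (L a) t \<noteq> 0 \<and> length (leaves t) = degree D.
     as_trees S (L a) t * single (plant a t) D)"

text \<open>
  In the wheel of a word \<open>w\<close>, the \<open>i\<close>-th vertex has as left input the leg \<open>[0, i]\<close> and as right
  input the output \<open>[1, i + 1]\<close> of the next vertex, with indices modulo \<open>length w\<close>.
\<close>

definition wheel :: "'a list \<Rightarrow> 'a diagram" where
  "wheel w = Diagram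
     (\<lambda>b. [Tail [0, i]. i \<leftarrow> [0..<length w], w ! i = b])
     (mset (map (\<lambda>i. ([0, i], [1, Suc i mod length w], [1, i])) [0..<length w]))"

definition iota :: "'a cws \<Rightarrow> 'a diagram \<Rightarrow> rat" where
  "iota \<omega> = (\<lambda>D. \<Sum>c | \<omega> c \<noteq> 0 \<and> cw_length c = degree D. \<omega> c * (- single (wheel (cw_word c)) D))"

fun series_pow :: "('a diagram \<Rightarrow> rat) \<Rightarrow> nat \<Rightarrow> 'a diagram \<Rightarrow> rat" where
  "series_pow f 0 = single (Diagram (\<lambda>a. []) {#})"
| "series_pow f (Suc n) = series_stack f (series_pow f n)"

text \<open>The exponential of a series of diagrams of positive degrees.\<close>

definition series_exp :: "('a diagram \<Rightarrow> rat) \<Rightarrow> 'a diagram \<Rightarrow> rat" where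
  "series_exp f = (\<lambda>D. \<Sum>n\<le>degree D. series_pow f n D / fact n)"

definition E_l :: "'a set \<Rightarrow> ('a \<Rightarrow> 'a ncs) \<Rightarrow> 'a cws \<Rightarrow> 'a aw" where
  "E_l S L \<omega> = aw_stack S (aw_class S (series_exp (l_map S L))) (aw_class S (series_exp (iota \<omega>)))"

end

(*
  The classes of finite combinations of diagrams, graded by degree, form an algebra, and power series
  over it contain A^w(S). There E_l is exp(l(L)) exp(iota(w)), and everything follows from commutators:
  pushing the head of one planted tree through another tree or a wheel (STU_1, STU_2) gives
  [l(L), l(M)] = l([L, M]_tb) and [l(L), iota(w)] = iota(del_L w), whereas wheels commute (TC). Thus
  stacking is the Baker-Campbell-Hausdorff formula (applying the degree derivation to e^x e^y shows that
  its logarithm is a Lie series) together with exp(-l(L)) iota(w) exp(l(L)) = iota(exp(-del_L) w). Deleting, renaming and doubling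
  strands are homomorphisms that act on trees and wheels by substitution. Reversing all strands is an
  antihomomorphism; to bring the head of a planted tree below its leaves again it has to pass the
  leaves on its own strand, each of which closes up a wheel, so l(L) is mapped to
  -l(L) - iota(div L), and the formula for exp(x + c) with commuting conjugates of c produces j.
  Finally dS differs from dA by the sign of the degree.
*)

theory Submission
  imports Defs "HOL-Computational_Algebra.Formal_Power_Series"
begin

unbundle fps_syntax

section \<open>Exponentials, commutator formulas and the degree derivation in complete graded
  algebras\<close>

section \<open>Complete graded algebras\<close>

text \<open>Two obstacles shape the proof: the dependence on \<open>S\<close> and the infinite sums.
  The relations are restated without \<open>S\<close>, giving one quotient \<open>dq\<close> for all
  skeleta; each relation has all its diagrams on the same strands, so restriction to
  \<open>S\<close> shows that \<open>A^w(S)\<close> embeds. Completion comes afterwards: the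
  variable of \<open>fps\<close> records the degree, \<open>dq\<close> itself carries no grading,
  and an element of \<open>A^w(S)\<close> becomes a fibre \<open>aws S X\<close>. \<open>l\<close>
  uses arbitrarily chosen bracket trees. That the choice does not matter is the theorem of Dynkin,
  Specht and Wever: a functional on trees with AS and IHX is determined by the associative
  expansion. Planting is thus linear on words (\<open>tword\<close>), and identities between Lie
  series are tested in each degree on finite sums of trees. The recursion for the logarithm reads
  \<open>n f_n = u_n - (brackets of lower terms)\<close>. The series \<open>j\<close> comes from a
  differential equation: \<open>exp (s (x + c)) exp (- s x)\<close> is expanded in powers of
  \<open>c\<close>, and as \<open>c\<close> commutes with the iterated brackets
  \<open>(ad x)^i c\<close>, the part of order \<open>m\<close> is \<open>J^m / m!\<close>.\<close>

class rat_module = ab_group_add +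
  fixes qscale :: "rat \<Rightarrow> 'a \<Rightarrow> 'a" (infixr "*q" 72)
  assumes qscale_add_right: "r *q (x + y) = r *q x + r *q y"
    and qscale_add_left: "(r + s) *q x = r *q x + s *q x"
    and qscale_qscale: "r *q s *q x = (r * s) *q x"
    and qscale_one: "1 *q x = x"

class rat_algebra = rat_module + ring_1 +
  assumes qscale_mult_left: "(r *q x) * y = r *q (x * y)"
    and qscale_mult_right: "x * (r *q y) = r *q (x * y)"

global_interpretation qvs: vector_space "qscale :: rat \<Rightarrow> 'a :: rat_module \<Rightarrow> 'a"
  by standard (simp_all add: qscale_add_right qscale_add_left qscale_qscale qscale_one)

lemmas qscale_simps [simp] = qvs.scale_zero_left qvs.scale_zero_right qscale_one qscale_qscale
  qvs.scale_minus_left qvs.scale_minus_right qscale_mult_left qscale_mult_right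

lemmas qscale_distribs = qvs.scale_right_distrib qvs.scale_left_distrib
  qvs.scale_right_diff_distrib qvs.scale_left_diff_distrib

lemma qscale_of_nat: "of_nat n *q x = of_nat n * (x :: 'a :: rat_algebra)"
  by (induction n) (simp_all add: qscale_distribs algebra_simps)

definition ad :: "'a :: ring \<Rightarrow> 'a \<Rightarrow> 'a" where
  "ad x y = x * y - y * x"

lemma ad_add_right: "ad x (y + z) = ad x y + ad x z"
  and ad_add_left: "ad (x + y) z = ad x z + ad y z"
  and ad_minus_right: "ad x (- y) = - ad x y"
  and ad_minus_left: "ad (- x) y = - ad x y"
  and ad_diff_right: "ad x (y - z) = ad x y - ad x z"
  and ad_zero_right [simp]: "ad x 0 = 0"
  and ad_zero_left [simp]: "ad 0 x = 0"
  by (simp_all add: ad_def algebra_simps)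

lemma ad_sum_right: "ad x (\<Sum>i\<in>A. f i) = (\<Sum>i\<in>A. ad x (f i))"
  by (simp add: ad_def sum_distrib_left sum_distrib_right sum_subtractf)

lemma ad_qscale_right: "ad x (r *q y) = r *q ad x (y :: 'a :: rat_algebra)"
  and ad_qscale_left: "ad (r *q x) y = r *q ad x y"
  by (simp_all add: ad_def qscale_distribs)

lemma ad_mult_right: "ad x (y * z) = ad x y * z + y * ad x z"
  by (simp add: ad_def algebra_simps)

text \<open>Completeness is expressed without convergence: \<open>glim s\<close> takes its part of
  degree \<open>n\<close> from \<open>s n\<close>, for any sequence \<open>s\<close>. It is the
  usual limit as soon as the part of degree \<open>n\<close> is stationary from index
  \<open>n\<close> on. The class covers noncommutative series as well as power series over the
  diagram algebra, so the facts about exponentials are proved once.\<close>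

class cga = rat_algebra +
  fixes gpart :: "nat \<Rightarrow> 'a \<Rightarrow> 'a" and glim :: "(nat \<Rightarrow> 'a) \<Rightarrow> 'a"
  assumes gpart_add: "gpart n (x + y) = gpart n x + gpart n y"
    and gpart_qscale: "gpart n (r *q x) = r *q gpart n x"
    and gpart_one: "gpart n 1 = (if n = 0 then 1 else 0)"
    and gpart_mult: "gpart n (x * y) = (\<Sum>i\<le>n. gpart i x * gpart (n - i) y)"
    and gpart_glim: "gpart n (glim s) = gpart n (s n)"
    and gpart_ext: "(\<And>n. gpart n x = gpart n y) \<Longrightarrow> x = y"

lemma gpart_zero [simp]: "gpart n 0 = (0 :: 'a :: cga)"
  using gpart_add[of n "0 :: 'a" 0] by simp

lemma gpart_minus: "gpart n (- x) = - gpart n (x :: 'a :: cga)"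
  using gpart_add[of n x "- x"] by (simp add: eq_neg_iff_add_eq_0 add.commute)

lemma gpart_diff: "gpart n (x - y) = gpart n x - gpart n y"
  using gpart_add[of n x "- y"] by (simp add: gpart_minus)

lemma gpart_sum: "gpart n (\<Sum>i\<in>A. f i) = (\<Sum>i\<in>A. gpart n (f i))"
  by (induction A rule: infinite_finite_induct) (simp_all add: gpart_add)

text \<open>This is the sum of the series only if the \<open>k\<close>-th summand has order at least \<open>k\<close>.\<close>

definition gsum :: "(nat \<Rightarrow> 'a) \<Rightarrow> 'a :: cga" where
  "gsum s = glim (\<lambda>n. \<Sum>k\<le>n. s k)"

definition gord :: "nat \<Rightarrow> 'a :: cga \<Rightarrow> bool" where
  "gord k x \<longleftrightarrow> (\<forall>m<k. gpart m x = 0)"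

lemma gpart_gsum: "gpart n (gsum s) = (\<Sum>k\<le>n. gpart n (s k))"
  by (simp add: gsum_def gpart_glim gpart_sum)

lemma gordD: "gord k x \<Longrightarrow> m < k \<Longrightarrow> gpart m x = 0"
  by (simp add: gord_def)

lemma gord_0 [simp]: "gord 0 x"
  by (simp add: gord_def)

lemma gord_zero [simp]: "gord k 0"
  by (simp add: gord_def)

lemma gord_mono: "gord k x \<Longrightarrow> j \<le> k \<Longrightarrow> gord j x"
  by (simp add: gord_def)

lemma gord_add: "gord k x \<Longrightarrow> gord k y \<Longrightarrow> gord k (x + y)"
  by (simp add: gord_def gpart_add)

lemma gord_diff: "gord k x \<Longrightarrow> gord k y \<Longrightarrow> gord k (x - y)"
  by (simp add: gord_def gpart_diff)

lemma gord_minus: "gord k x \<Longrightarrow> gord k (- x)"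
  by (simp add: gord_def gpart_minus)

lemma gord_qscale: "gord k x \<Longrightarrow> gord k (r *q x)"
  by (simp add: gord_def gpart_qscale)

lemma gord_sum: "(\<And>i. i \<in> A \<Longrightarrow> gord k (f i)) \<Longrightarrow> gord k (\<Sum>i\<in>A. f i)"
  by (simp add: gord_def gpart_sum)

lemma gord_mult:
  assumes "gord i x" "gord j y"
  shows "gord (i + j) (x * y)"
  unfolding gord_def gpart_mult
proof (intro allI impI sum.neutral ballI)
  fix m l assume "m < i + j" "l \<in> {..m}"
  then have "l < i \<or> m - l < j" by auto
  then show "gpart l x * gpart (m - l) y = 0"
    using assms by (auto simp: gord_def)
qed

lemma gord_power: "gord 1 x \<Longrightarrow> gord k (x ^ k)"
  by (induction k) (use gord_mult[of 1 x] in auto)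

lemma gord_gsum: "(\<And>k. gord j (s k)) \<Longrightarrow> gord j (gsum s)"
  by (simp add: gord_def gpart_gsum)

text \<open>A summand of order at least \<open>k\<close> has no part of degree \<open>n < k\<close>,
  so the cut-off in \<open>gpart_gsum\<close> can be raised. Products need this, because the two
  factors must be cut off at a common bound.\<close>

lemma gpart_gsum_ge:
  assumes "\<And>k. gord k (s k)" "n \<le> N"
  shows "gpart n (gsum s) = (\<Sum>k\<le>N. gpart n (s k))"
  unfolding gpart_gsum
  by (rule sum.mono_neutral_left) (use assms in \<open>auto simp: gord_def\<close>)

lemma gsum_add: "gsum (\<lambda>k. s k + t k) = gsum s + gsum t"
  by (rule gpart_ext) (simp add: gpart_gsum gpart_add sum.distrib)

lemma gsum_minus: "gsum (\<lambda>k. - s k) = - gsum s"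
  by (rule gpart_ext) (simp add: gpart_gsum gpart_minus sum_negf)

lemma gsum_mult_left:
  assumes "\<And>k. gord k (s k)"
  shows "x * gsum s = gsum (\<lambda>k. x * s k)"
proof (rule gpart_ext)
  fix n
  have "gpart n (x * gsum s) = (\<Sum>i\<le>n. gpart i x * (\<Sum>k\<le>n. gpart (n - i) (s k)))"
    by (simp add: gpart_mult gpart_gsum_ge[OF assms, of _ n])
  also have "\<dots> = (\<Sum>k\<le>n. \<Sum>i\<le>n. gpart i x * gpart (n - i) (s k))"
    by (simp add: sum_distrib_left) (rule sum.swap)
  finally show "gpart n (x * gsum s) = gpart n (gsum (\<lambda>k. x * s k))"
    by (simp add: gpart_gsum gpart_mult)
qed

lemma gsum_mult_right:
  assumes "\<And>k. gord k (s k)"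
  shows "gsum s * x = gsum (\<lambda>k. s k * x)"
proof (rule gpart_ext)
  fix n
  have "gpart n (gsum s * x) = (\<Sum>i\<le>n. (\<Sum>k\<le>n. gpart i (s k)) * gpart (n - i) x)"
    by (simp add: gpart_mult gpart_gsum_ge[OF assms, of _ n])
  also have "\<dots> = (\<Sum>k\<le>n. \<Sum>i\<le>n. gpart i (s k) * gpart (n - i) x)"
    by (simp add: sum_distrib_right) (rule sum.swap)
  finally show "gpart n (gsum s * x) = gpart n (gsum (\<lambda>k. s k * x))"
    by (simp add: gpart_gsum gpart_mult)
qed

lemma gsum_mult:
  assumes s: "\<And>k. gord k (s k)" and t: "\<And>k. gord k (t k)"
  shows "gsum s * gsum t = gsum (\<lambda>k. \<Sum>i\<le>k. s i * t (k - i))"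
proof (rule gpart_ext)
  fix n
  have "gpart n (gsum s * gsum t) = gpart n (gsum (\<lambda>i. s i * gsum t))"
    by (simp add: gsum_mult_right[OF s])
  also have "\<dots> = (\<Sum>i\<le>n. \<Sum>j\<le>n. gpart n (s i * t j))"
    by (simp add: gpart_gsum gsum_mult_left[OF t])
  also have "\<dots> = (\<Sum>(i, j) \<in> {..n} \<times> {..n}. gpart n (s i * t j))"
    by (simp add: sum.cartesian_product)
  \<comment> \<open>Pairs with \<open>i + j > n\<close> contribute nothing, because a product of
    terms of orders \<open>i\<close> and \<open>j\<close> has order \<open>i + j\<close>; the rest
    is reindexed along the diagonals \<open>k = i + j\<close>.\<close>
  also have "\<dots> = (\<Sum>(i, j) \<in> {(i, j). i + j \<le> n}. gpart n (s i * t j))"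
  proof (rule sum.mono_neutral_right)
    show "\<forall>p\<in>{..n} \<times> {..n} - {(i, j). i + j \<le> n}. (case p of (i, j) \<Rightarrow> gpart n (s i * t j)) = 0"
      by (auto intro!: gordD[OF gord_mult[OF s t]])
  qed auto
  also have "{(i, j). i + j \<le> n} = (\<lambda>(k, i). (i, k - i)) ` (SIGMA k:{..n}. {..k})"
    by (auto simp: image_iff intro!: bexI[of _ "_ + _"]) simp_all
  also have "(\<Sum>(i, j) \<in> \<dots>. gpart n (s i * t j)) = (\<Sum>(k, i) \<in> (SIGMA k:{..n}. {..k}). gpart n (s i * t (k - i)))"
    by (subst sum.reindex) (auto simp: inj_on_def case_prod_beta)
  also have "\<dots> = (\<Sum>k\<le>n. \<Sum>i\<le>k. gpart n (s i * t (k - i)))"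
    by (rule sum.Sigma[symmetric]) auto
  finally show "gpart n (gsum s * gsum t) = gpart n (gsum (\<lambda>k. \<Sum>i\<le>k. s i * t (k - i)))"
    by (simp add: gpart_gsum gpart_sum)
qed

text \<open>Reindexing moves the cut-off as well: up to degree \<open>n\<close> the shifted sequence
  also uses \<open>s (Suc n)\<close>, which has no part of degree \<open>n\<close>.\<close>

lemma gsum_shift:
  assumes "\<And>k. gord k (s k)" "s 0 = 0"
  shows "gsum s = gsum (\<lambda>k. s (Suc k))"
proof (rule gpart_ext)
  fix n
  have "gpart n (gsum s) = (\<Sum>k\<le>Suc n. gpart n (s k))"
    by (rule gpart_gsum_ge[OF assms(1)]) simp
  then show "gpart n (gsum s) = gpart n (gsum (\<lambda>k. s (Suc k)))"
    by (subst (asm) sum.atMost_Suc_shift) (simp add: assms(2) gpart_gsum)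
qed

lemma gsum_qscale: "gsum (\<lambda>k. r *q s k) = r *q gsum (s :: nat \<Rightarrow> 'a :: cga)"
  by (rule gpart_ext) (simp add: gpart_gsum gpart_qscale qvs.scale_sum_right)

lemma gsum_single: "gsum (\<lambda>k. if k = 0 then x else 0) = (x :: 'a :: cga)"
  by (rule gpart_ext) (simp add: gpart_gsum if_distrib[of "gpart _"] cong: if_cong)

lemma gord_ad: "gord i x \<Longrightarrow> gord j y \<Longrightarrow> gord (i + j) (ad x (y :: 'a :: cga))"
  unfolding ad_def using gord_mult[of i x j y] gord_mult[of j y i x]
  by (auto intro: gord_diff simp: add.commute)

lemma gord_adpow: "gord 1 x \<Longrightarrow> gord j y \<Longrightarrow> gord (k + j) ((ad x ^^ k) (y :: 'a :: cga))"
  by (induction k) (use gord_ad[of 1 x] in auto)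


subsection \<open>Exponentials\<close>

definition gexp :: "'a :: cga \<Rightarrow> 'a" where
  "gexp x = gsum (\<lambda>k. (1 / fact k) *q x ^ k)"

lemma gord_exp_term: "gord 1 x \<Longrightarrow> gord k (r *q (x :: 'a :: cga) ^ k)"
  by (intro gord_qscale gord_power)

lemma gexp_0 [simp]: "gexp 0 = (1 :: 'a :: cga)"
proof -
  have "gexp (0 :: 'a) = gsum (\<lambda>k. if k = 0 then 1 else 0)"
    unfolding gexp_def by (rule arg_cong[of _ _ gsum]) (auto simp: fun_eq_iff power_0_left)
  then show ?thesis by (simp add: gsum_single)
qed

lemma binomial_commuting:
  assumes "x * y = y * (x :: 'a :: ring_1)"
  shows "(x + y) ^ n = (\<Sum>i\<le>n. of_nat (n choose i) * x ^ i * y ^ (n - i))"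
proof (induction n)
  case (Suc n)
  have c: "y * (of_nat (n choose i) * x ^ i * y ^ (n - i)) = of_nat (n choose i) * x ^ i * y ^ Suc (n - i)" for i
  proof -
    have "y * (of_nat (n choose i) * x ^ i * y ^ (n - i)) = of_nat (n choose i) * (y * x ^ i) * y ^ (n - i)"
      by (metis mult.assoc mult_of_nat_commute)
    also have "y * x ^ i = x ^ i * y"
      using power_commuting_commutes[OF assms] by simp
    finally show ?thesis by (simp add: mult.assoc)
  qed
  have d: "x * (of_nat (n choose i) * x ^ i * y ^ (n - i)) = of_nat (n choose i) * x ^ Suc i * y ^ (n - i)" for i
    by (metis mult.assoc mult_of_nat_commute power_Suc)
  have "(x + y) ^ Suc n = (\<Sum>i\<le>n. of_nat (n choose i) * x ^ Suc i * y ^ (n - i)) +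
      (\<Sum>i\<le>n. of_nat (n choose i) * x ^ i * y ^ Suc (n - i))"
    by (simp only: power_Suc Suc.IH distrib_right sum_distrib_left c d sum.distrib)
  also have "(\<Sum>i\<le>n. of_nat (n choose i) * x ^ Suc i * y ^ (n - i)) =
      (\<Sum>i\<le>Suc n. (if i = 0 then 0 else of_nat (n choose (i - 1))) * x ^ i * y ^ (Suc n - i))"
    by (subst sum.atMost_Suc_shift) simp
  also have "(\<Sum>i\<le>n. of_nat (n choose i) * x ^ i * y ^ Suc (n - i)) =
      (\<Sum>i\<le>Suc n. of_nat (n choose i) * x ^ i * y ^ (Suc n - i))"
    by (simp add: binomial_eq_0 Suc_diff_le)
  finally show ?case
    by (simp only: sum.distrib[symmetric] distrib_right[symmetric])
       (rule sum.cong, auto simp: choose_reduce_nat add.commute)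
qed simp

lemma gexp_add:
  assumes "gord 1 x" "gord 1 y" "x * y = y * (x :: 'a :: cga)"
  shows "gexp (x + y) = gexp x * gexp y"
proof -
  have *: "(1 / fact k) *q (x + y) ^ k =
      (\<Sum>i\<le>k. (1 / fact i) *q x ^ i * ((1 / fact (k - i)) *q y ^ (k - i)))" for k
    unfolding binomial_commuting[OF assms(3)] qvs.scale_sum_right
    by (rule sum.cong)
       (auto simp: binomial_fact simp flip: qscale_of_nat)
  show ?thesis
    unfolding gexp_def * by (rule gsum_mult[symmetric]) (use gord_exp_term assms in blast)+
qed

lemma gexp_minus_mult: "gord 1 x \<Longrightarrow> gexp (- x) * gexp x = (1 :: 'a :: cga)"
  and gexp_mult_minus: "gord 1 x \<Longrightarrow> gexp x * gexp (- x) = (1 :: 'a :: cga)"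
  using gexp_add[of "- x" x] gexp_add[of x "- x"] by (simp_all add: gord_minus)

lemma gexp_conjugate:
  assumes "g * h = 1" "h * g = 1" "gord 1 (x :: 'a :: cga)"
  shows "gexp (g * x * h) = g * gexp x * h"
proof -
  have p: "(g * x * h) ^ n = g * x ^ n * h" for n
  proof (induction n)
    case (Suc n)
    have "(g * x * h) ^ Suc n = g * x * (h * g) * x ^ n * h"
      by (simp only: power_Suc Suc.IH) (simp only: mult.assoc)
    then show ?case by (simp add: assms mult.assoc)
  qed (simp add: assms)
  have "gord k (g * ((1 / fact k) *q x ^ k))" for k
    using gord_mult[OF gord_0 gord_exp_term[OF assms(3)]] by simp
  then show ?thesis
    unfolding gexp_def p gsum_mult_left[OF gord_exp_term[OF assms(3)]]
    by (subst gsum_mult_right) simp_all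
qed

text \<open>Left multiplication by \<open>x\<close> is the sum of \<open>ad x\<close> and right
  multiplication by \<open>x\<close>, and these two operators commute; this is the binomial theorem
  for them.\<close>

lemma power_mult_eq_sum_ad:
  "x ^ n * y = (\<Sum>j\<le>n. of_nat (n choose j) * (ad x ^^ j) y * x ^ (n - j))" for x :: "'a :: ring_1"
proof (induction n)
  case (Suc n)
  have c: "x * (of_nat (n choose j) * (ad x ^^ j) y * x ^ (n - j)) =
      of_nat (n choose j) * (ad x ^^ Suc j) y * x ^ (n - j) +
      of_nat (n choose j) * (ad x ^^ j) y * x ^ Suc (n - j)" for j
  proof -
    have "x * (of_nat (n choose j) * (ad x ^^ j) y * x ^ (n - j)) =
        of_nat (n choose j) * (x * (ad x ^^ j) y) * x ^ (n - j)"
      by (metis mult.assoc mult_of_nat_commute)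
    also have "x * (ad x ^^ j) y = (ad x ^^ Suc j) y + (ad x ^^ j) y * x"
      by (simp add: ad_def)
    finally show ?thesis
      by (simp add: algebra_simps)
  qed
  have "x ^ Suc n * y = (\<Sum>j\<le>n. of_nat (n choose j) * (ad x ^^ Suc j) y * x ^ (n - j)) +
      (\<Sum>j\<le>n. of_nat (n choose j) * (ad x ^^ j) y * x ^ Suc (n - j))"
    by (simp only: power_Suc mult.assoc[of x] Suc.IH sum_distrib_left c sum.distrib)
  also have "(\<Sum>j\<le>n. of_nat (n choose j) * (ad x ^^ Suc j) y * x ^ (n - j)) =
      (\<Sum>j\<le>Suc n. (if j = 0 then 0 else of_nat (n choose (j - 1))) * (ad x ^^ j) y * x ^ (Suc n - j))"
    by (subst sum.atMost_Suc_shift) simp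
  also have "(\<Sum>j\<le>n. of_nat (n choose j) * (ad x ^^ j) y * x ^ Suc (n - j)) =
      (\<Sum>j\<le>Suc n. of_nat (n choose j) * (ad x ^^ j) y * x ^ (Suc n - j))"
    by (simp add: binomial_eq_0 Suc_diff_le)
  finally show ?case
    by (simp only: sum.distrib[symmetric] distrib_right[symmetric])
       (rule sum.cong, auto simp: choose_reduce_nat add.commute)
qed simp

text \<open>Division by \<open>n!\<close> turns \<open>power_mult_eq_sum_ad\<close> into a Cauchy
  product of \<open>e^(ad x) y\<close> with \<open>e^x\<close>.\<close>

lemma gexp_mult_eq_ad:
  assumes "gord 1 (x :: 'a :: cga)"
  shows "gexp x * y = gsum (\<lambda>j. (1 / fact j) *q (ad x ^^ j) y) * gexp x"
proof -
  have g: "gord k ((1 / fact k) *q (ad x ^^ k) y)" for k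
    using gord_adpow[OF assms, of 0] by (simp add: gord_qscale)
  have *: "((1 / fact k) *q x ^ k) * y =
      (\<Sum>j\<le>k. (1 / fact j) *q (ad x ^^ j) y * ((1 / fact (k - j)) *q x ^ (k - j)))" for k
    unfolding qscale_mult_left power_mult_eq_sum_ad qvs.scale_sum_right
    by (rule sum.cong) (auto simp: binomial_fact simp flip: qscale_of_nat)
  show ?thesis
    unfolding gexp_def gsum_mult[OF g gord_exp_term[OF assms]]
    by (subst gsum_mult_right) (simp_all only: gord_exp_term[OF assms] *)
qed

lemma gexp_conjugate_ad:
  assumes "gord 1 (x :: 'a :: cga)"
  shows "gexp x * y * gexp (- x) = gsum (\<lambda>j. (1 / fact j) *q (ad x ^^ j) y)"
  unfolding gexp_mult_eq_ad[OF assms, of y] mult.assoc gexp_mult_minus[OF assms] by simp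


subsection \<open>The degree derivation\<close>

text \<open>The Euler operator. The factor varies with the degree, so \<open>glim\<close> is used to
  put the parts together.\<close>

definition gder :: "'a :: cga \<Rightarrow> 'a" where
  "gder x = glim (\<lambda>n. of_nat n *q x)"

lemma gpart_gder: "gpart n (gder x) = of_nat n *q gpart n x"
  by (simp only: gder_def gpart_glim gpart_qscale)

lemma gord_gder: "gord k x \<Longrightarrow> gord k (gder x)"
  by (simp add: gord_def gpart_gder)

lemma gder_mult: "gder (x * y) = gder x * y + x * gder y"
proof (rule gpart_ext)
  fix n
  have "of_nat n *q (gpart i x * gpart (n - i) y) =
      (of_nat i *q gpart i x) * gpart (n - i) y + gpart i x * (of_nat (n - i) *q gpart (n - i) y)"
    if "i \<le> n" for i
    using that by (simp flip: qscale_distribs)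
  then show "gpart n (gder (x * y)) = gpart n (gder x * y + x * gder y)"
    by (simp add: gpart_gder gpart_mult gpart_add qvs.scale_sum_right flip: sum.distrib del: qscale_simps)
qed

lemma gder_one [simp]: "gder 1 = 0"
  by (rule gpart_ext) (simp add: gpart_gder gpart_one)

lemma gder_qscale: "gder (r *q x) = r *q gder x"
  by (rule gpart_ext) (simp add: gpart_gder gpart_qscale mult.commute)

lemma gder_gsum: "gder (gsum s) = gsum (\<lambda>k. gder (s k))"
  by (rule gpart_ext) (simp add: gpart_gder gpart_gsum qvs.scale_sum_right)

text \<open>By the Leibniz rule the derivative of \<open>x^n\<close> is the sum of the products
  \<open>x^i (gder x) x^(n-1-i)\<close>. Moving every \<open>x^i\<close> to the right by iterated
  commutators collects the sum of \<open>i choose j\<close> over \<open>i < n\<close>, which is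
  \<open>n choose (j + 1)\<close>.\<close>

lemma gder_power:
  "gder (x ^ n) = (\<Sum>j<n. of_nat (n choose Suc j) * (ad x ^^ j) (gder x) * x ^ (n - Suc j))"
proof (induction n)
  case (Suc n)
  have "gder (x ^ Suc n) = gder (x ^ n) * x + x ^ n * gder x"
    by (simp only: power_Suc2 gder_mult)
  also have "gder (x ^ n) * x =
      (\<Sum>j\<le>n. of_nat (n choose Suc j) * (ad x ^^ j) (gder x) * x ^ (n - j))"
  proof -
    have "gder (x ^ n) * x = (\<Sum>j<n. of_nat (n choose Suc j) * (ad x ^^ j) (gder x) * x ^ (n - j))"
      unfolding Suc.IH sum_distrib_right
      by (rule sum.cong) (auto simp: mult.assoc Suc_diff_Suc simp flip: power_Suc2)
    also have "\<dots> = (\<Sum>j\<le>n. of_nat (n choose Suc j) * (ad x ^^ j) (gder x) * x ^ (n - j))"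
      by (simp add: lessThan_Suc_atMost[symmetric] binomial_eq_0)
    finally show ?thesis .
  qed
  also have "x ^ n * gder x = (\<Sum>j\<le>n. of_nat (n choose j) * (ad x ^^ j) (gder x) * x ^ (n - j))"
    by (rule power_mult_eq_sum_ad)
  finally show ?case
    by (simp add: lessThan_Suc_atMost distrib_right add.commute flip: sum.distrib)
qed simp

text \<open>In \<open>gder_power\<close> the quotient \<open>(k + 1 choose j + 1) / (k + 1)!\<close>
  splits into \<open>1 / (j + 1)!\<close> and \<open>1 / (k - j)!\<close>, so the derivative is a
  Cauchy product of \<open>((e^(ad x) - 1) / ad x) (gder x)\<close> with the exponential.\<close>

lemma gder_gexp:
  assumes "gord 1 (x :: 'a :: cga)"
  shows "gder (gexp x) = gsum (\<lambda>j. (1 / fact (Suc j)) *q (ad x ^^ j) (gder x)) * gexp x"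
proof -
  let ?t = "\<lambda>j. (1 / fact (Suc j)) *q (ad x ^^ j) (gder x)"
  have g1: "gord (Suc k) (?t k)" for k
    using gord_adpow[OF assms gord_gder[OF assms]] by (auto intro: gord_qscale)
  then have g: "gord k (?t k)" for k
    using gord_mono by (metis le_SucI order_refl)
  have *: "gder ((1 / fact (Suc k)) *q x ^ Suc k) =
      (\<Sum>j\<le>k. ?t j * ((1 / fact (k - j)) *q x ^ (k - j)))" for k
    unfolding gder_qscale gder_power qvs.scale_sum_right lessThan_Suc_atMost
    by (rule sum.cong) (auto simp: binomial_fact simp del: fact_Suc binomial_Suc_Suc simp flip: qscale_of_nat)
  have "gder (gexp x) = gsum (\<lambda>k. gder ((1 / fact k) *q x ^ k))"
    by (simp add: gexp_def gder_gsum)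
  \<comment> \<open>The term \<open>k = 0\<close> is constant and has derivative 0, so the series
    may start with \<open>k = 1\<close>.\<close>
  also have "\<dots> = gsum (\<lambda>k. gder ((1 / fact (Suc k)) *q x ^ Suc k))"
  proof (rule gsum_shift)
    show "gord k (gder ((1 / fact k) *q x ^ k))" for k
      by (intro gord_gder gord_exp_term assms)
  qed (simp add: gder_qscale)
  also have "\<dots> = gsum ?t * gexp x"
    unfolding * gexp_def by (rule gsum_mult[symmetric]) (use g gord_exp_term[OF assms] in auto)
  finally show ?thesis .
qed


subsection \<open>The exponential in a semidirect product\<close>

text \<open>
  The coefficient of \<open>s\<^sup>k / k!\<close> in the part of degree \<open>m\<close> in \<open>c\<close> of
  \<open>exp (s (x + c)) exp (- s x)\<close>.
\<close>

fun semi_coeff :: "'a :: ring_1 \<Rightarrow> 'a \<Rightarrow> nat \<Rightarrow> nat \<Rightarrow> 'a" where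
  "semi_coeff x c 0 k = (if k = 0 then 1 else 0)"
| "semi_coeff x c (Suc m) 0 = 0"
| "semi_coeff x c (Suc m) (Suc k) = ad x (semi_coeff x c (Suc m) k) + c * semi_coeff x c m k"

lemma semi_coeff_eq_0: "k < m \<Longrightarrow> semi_coeff x c m k = 0"
  by (induction x c m k rule: semi_coeff.induct) auto

lemma ad_one [simp]: "ad x 1 = (0 :: 'a :: ring_1)"
  by (simp add: ad_def)

lemma gord_semi_coeff:
  assumes "gord 1 x" "gord 1 (c :: 'a :: cga)"
  shows "gord k (semi_coeff x c m k)"
  using assms
proof (induction x c m k rule: semi_coeff.induct)
  case (3 x c m k)
  then show ?case
    using gord_ad[of 1 x k "semi_coeff x c (Suc m) k"] gord_mult[of 1 c k "semi_coeff x c m k"]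
    by (auto intro: gord_add)
qed auto

text \<open>Let \<open>H(s) = exp (s (x + c)) exp (- s x)\<close>. Then
  \<open>H' = ad x H + c H\<close> and \<open>H(0) = 1\<close>, so the Taylor coefficients of
  \<open>H\<close> are the sums over \<open>m\<close> of \<open>semi_coeff x c m k\<close>. The
  formula compares coefficients of \<open>s^n / n!\<close> in
  \<open>exp (s (x + c)) = H(s) exp (s x)\<close>.\<close>

lemma power_semidirect:
  "(x + c) ^ n =
     (\<Sum>k\<le>n. of_nat (n choose k) * (\<Sum>m\<le>k. semi_coeff x c m k) * x ^ (n - k))"
    for x :: "'a :: ring_1"
proof (induction n)
  case (Suc n)
  define h where "h k = (\<Sum>m\<le>k. semi_coeff x c m k)" for k
  have h_Suc: "h (Suc k) = ad x (h k) + c * h k" for k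
  proof -
    have "h (Suc k) = (\<Sum>m\<le>k. ad x (semi_coeff x c (Suc m) k) + c * semi_coeff x c m k)"
      unfolding h_def by (subst sum.atMost_Suc_shift) simp
    also have "\<dots> = (\<Sum>m\<le>k. ad x (semi_coeff x c (Suc m) k)) + c * h k"
      by (simp add: sum.distrib sum_distrib_left h_def)
    also have "(\<Sum>m\<le>k. ad x (semi_coeff x c (Suc m) k)) = (\<Sum>m\<le>Suc k. ad x (semi_coeff x c m k))"
      by (subst sum.atMost_Suc_shift) simp
    also have "\<dots> = ad x (h k)"
      by (simp add: h_def ad_sum_right semi_coeff_eq_0)
    finally show ?thesis .
  qed
  have c: "(x + c) * (of_nat (n choose k) * h k * x ^ (n - k)) =
      of_nat (n choose k) * h (Suc k) * x ^ (n - k) + of_nat (n choose k) * h k * x ^ Suc (n - k)" for k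
  proof -
    have "(x + c) * (of_nat (n choose k) * h k * x ^ (n - k)) =
        of_nat (n choose k) * ((x + c) * h k) * x ^ (n - k)"
      by (metis mult.assoc mult_of_nat_commute)
    also have "(x + c) * h k = h (Suc k) + h k * x"
      by (simp add: h_Suc ad_def algebra_simps)
    finally show ?thesis
      by (simp add: algebra_simps)
  qed
  have "(x + c) ^ Suc n = (\<Sum>k\<le>n. of_nat (n choose k) * h (Suc k) * x ^ (n - k)) +
      (\<Sum>k\<le>n. of_nat (n choose k) * h k * x ^ Suc (n - k))"
    by (simp only: power_Suc Suc.IH h_def[symmetric] sum_distrib_left c sum.distrib)
  also have "(\<Sum>k\<le>n. of_nat (n choose k) * h (Suc k) * x ^ (n - k)) =
      (\<Sum>k\<le>Suc n. (if k = 0 then 0 else of_nat (n choose (k - 1))) * h k * x ^ (Suc n - k))"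
    by (subst sum.atMost_Suc_shift) simp
  also have "(\<Sum>k\<le>n. of_nat (n choose k) * h k * x ^ Suc (n - k)) =
      (\<Sum>k\<le>Suc n. of_nat (n choose k) * h k * x ^ (Suc n - k))"
    by (simp add: binomial_eq_0 Suc_diff_le)
  finally show ?case
    unfolding h_def[symmetric]
    by (simp only: sum.distrib[symmetric] distrib_right[symmetric])
       (rule sum.cong, auto simp: choose_reduce_nat add.commute)
qed simp

text \<open>Let \<open>P_m(s)\<close> be the sum of \<open>semi_coeff x c m k s^k / k!\<close> and
  \<open>J(s)\<close> the sum of \<open>s^(i+1) (ad x)^i c / (i+1)!\<close>. In coefficients this is
  \<open>(m + 1) P_(m+1) = J P_m\<close>: both sides solve
  \<open>F' = ad x F + (m + 1) c P_m\<close> with \<open>F(0) = 0\<close>. For the right side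
  \<open>c\<close> has to be moved past \<open>J\<close>, which is where \<open>comm\<close>
  enters.\<close>

lemma semi_coeff_Suc:
  fixes x c :: "'a :: rat_algebra"
  assumes comm: "\<And>i. c * (ad x ^^ i) c = (ad x ^^ i) c * c"
  shows "of_nat (Suc m) *q semi_coeff x c (Suc m) k =
    (\<Sum>i<k. of_nat (k choose Suc i) *q ((ad x ^^ i) c * semi_coeff x c m (k - Suc i)))"
proof (induction k arbitrary: m)
  case (Suc k)
  define p where "p = semi_coeff x c"
  define d where "d i = (ad x ^^ i) c" for i
  define Q where "Q m k = (\<Sum>i<k. of_nat (k choose Suc i) *q (d i * p m (k - Suc i)))" for m k
  have IH: "of_nat (Suc m) *q p (Suc m) k = Q m k" for m
    using Suc.IH by (simp add: p_def d_def Q_def)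
  have d_Suc: "ad x (d i) = d (Suc i)" and d0: "d 0 = c" for i
    by (simp_all add: d_def)
  have dp: "ad x (p m j) = p m (Suc j) - (if m = 0 then 0 else c * p (m - 1) j)" for j
    by (cases m) (simp_all add: p_def)
  have cd: "c * (d i * y) = d i * (c * y)" for i y
    using comm[of i] by (simp add: d_def mult.assoc[symmetric])
  have *: "ad x (d i * p m (k - Suc i)) = d (Suc i) * p m (k - Suc i) + d i * p m (k - i) -
      (if m = 0 then 0 else c * (d i * p (m - 1) (k - Suc i)))" if "i < k" for i
    using that by (simp add: ad_mult_right d_Suc dp algebra_simps cd Suc_diff_Suc)
  have "ad x (Q m k) = (\<Sum>i<k. of_nat (k choose Suc i) *q (d (Suc i) * p m (k - Suc i))) +
      (\<Sum>i<k. of_nat (k choose Suc i) *q (d i * p m (k - i))) -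
      (if m = 0 then 0 else c * Q (m - 1) k)"
    by (auto simp: Q_def ad_sum_right ad_qscale_right * qscale_distribs sum.distrib sum_subtractf sum_distrib_left)
  \<comment> \<open>Shifting the index by one adds the term \<open>i = 0\<close>, namely
    \<open>c * p m k\<close>; it is the inhomogeneous term of
    \<open>J' = ad x J + c\<close>.\<close>
  also have "(\<Sum>i<k. of_nat (k choose Suc i) *q (d (Suc i) * p m (k - Suc i))) =
      (\<Sum>i<Suc k. of_nat (k choose i) *q (d i * p m (k - i))) - c * p m k"
    by (subst sum.lessThan_Suc_shift) (simp add: d0)
  also have "(\<Sum>i<k. of_nat (k choose Suc i) *q (d i * p m (k - i))) =
      (\<Sum>i<Suc k. of_nat (k choose Suc i) *q (d i * p m (k - i)))"
    by (simp add: binomial_eq_0)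
  \<comment> \<open>By the induction hypothesis for \<open>m - 1\<close>, the sum
    \<open>Q (m - 1) k\<close> is \<open>m\<close> times \<open>p m k\<close>; with the term just
    split off, \<open>m + 1\<close> copies of \<open>c * p m k\<close> come together.\<close>
  also have "(if m = 0 then 0 else c * Q (m - 1) k) = of_nat m *q (c * p m k)"
    using IH[of "m - 1"] by (cases m) (simp_all flip: IH)
  finally have "ad x (Q m k) + of_nat (Suc m) *q (c * p m k) = Q m (Suc k)"
    by (simp add: Q_def qscale_distribs sum.distrib algebra_simps)
  moreover have "of_nat (Suc m) *q p (Suc m) (Suc k) =
      ad x (of_nat (Suc m) *q p (Suc m) k) + of_nat (Suc m) *q (c * p m k)"
    by (simp add: p_def qscale_distribs ad_qscale_right del: of_nat_Suc)
  ultimately show ?case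
    unfolding IH by (simp add: p_def d_def Q_def)
qed simp

text \<open>At \<open>s = 1\<close> the relation \<open>(m + 1) P_(m+1) = J P_m\<close> with
  \<open>P_0 = 1\<close> gives \<open>P_m = J^m / m!\<close>, and summation over \<open>m\<close>
  gives \<open>exp (x + c) exp (- x) = exp J\<close>.\<close>

lemma gexp_semidirect:
  fixes x c :: "'a :: cga"
  assumes x: "gord 1 x" and c: "gord 1 c"
    and comm: "\<And>i. c * (ad x ^^ i) c = (ad x ^^ i) c * c"
  shows "gexp (x + c) = gexp (gsum (\<lambda>i. (1 / fact (Suc i)) *q (ad x ^^ i) c)) * gexp x"
proof -
  define h where "h k = (\<Sum>m\<le>k. semi_coeff x c m k)" for k
  define J where "J = gsum (\<lambda>i. (1 / fact (Suc i)) *q (ad x ^^ i) c)"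
  define P where "P m = gsum (\<lambda>k. (1 / fact k) *q semi_coeff x c m k)" for m
  have gs: "gord k (r *q semi_coeff x c m k)" for r k m
    by (intro gord_qscale gord_semi_coeff x c)
  have gh: "gord k (r *q h k)" for k r
    unfolding h_def by (intro gord_qscale gord_sum gord_semi_coeff x c)
  have ga1: "gord (Suc i) (r *q (ad x ^^ i) c)" for r i
    using gord_adpow[OF x c, of i] by (simp add: gord_qscale)
  then have ga: "gord i (r *q (ad x ^^ i) c)" for r i
    using gord_mono by (metis le_SucI order_refl)
  have gJ: "gord 1 J"
    unfolding J_def by (rule gord_gsum) (rule gord_mono[OF ga1], simp)
  have JP: "J * P m = of_nat (Suc m) *q P (Suc m)" for m
  proof -
    have "J * P m = gsum (\<lambda>k. \<Sum>i\<le>k. (1 / fact (Suc i)) *q (ad x ^^ i) c *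
        ((1 / fact (k - i)) *q semi_coeff x c m (k - i)))"
      unfolding J_def P_def by (rule gsum_mult[OF ga gs])
    also have "\<dots> = gsum (\<lambda>k. (1 / fact (Suc k)) *q of_nat (Suc m) *q semi_coeff x c (Suc m) (Suc k))"
      unfolding semi_coeff_Suc[OF comm] qvs.scale_sum_right lessThan_Suc_atMost
      by (intro arg_cong[of _ _ gsum] ext sum.cong)
         (auto simp: binomial_fact simp del: fact_Suc binomial_Suc_Suc)
    also have "\<dots> = gsum (\<lambda>k. (1 / fact k) *q of_nat (Suc m) *q semi_coeff x c (Suc m) k)"
      by (rule gsum_shift[symmetric]) (simp_all add: gs del: of_nat_Suc)
    also have "\<dots> = of_nat (Suc m) *q P (Suc m)"
      unfolding P_def gsum_qscale[symmetric] by (simp add: mult.commute del: of_nat_Suc)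
    finally show ?thesis .
  qed
  have "P 0 = gsum (\<lambda>k. if k = 0 then 1 else 0)"
    unfolding P_def by (rule arg_cong[of _ _ gsum]) auto
  then have P0: "P 0 = 1"
    by (simp add: gsum_single)
  have JP': "(1 / fact m) *q J ^ m = P m" for m
  proof (induction m)
    case (Suc m)
    have "(1 / fact (Suc m)) *q J ^ Suc m = (1 / of_nat (Suc m)) *q (J * ((1 / fact m) *q J ^ m))"
      by simp
    then show ?case
      by (simp add: Suc JP del: of_nat_Suc)
  qed (simp add: P0)
  have "gexp J = gsum P"
    by (simp add: gexp_def JP')
  \<comment> \<open>Interchange of the sums over \<open>m\<close> and \<open>k\<close>. Since
    \<open>semi_coeff\<close> vanishes for \<open>k < m\<close>, the square reduces to the triangle
    \<open>m \<le> k\<close>, whose inner sums are the \<open>h k\<close>.\<close>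
  also have "\<dots> = gsum (\<lambda>k. (1 / fact k) *q h k)"
  proof (rule gpart_ext)
    fix n
    have "gpart n (gsum P) = (\<Sum>k\<le>n. \<Sum>m\<le>n. (1 / fact k) *q gpart n (semi_coeff x c m k))"
      unfolding gpart_gsum P_def gpart_qscale by (rule sum.swap)
    also have "\<dots> = (\<Sum>k\<le>n. \<Sum>m\<le>k. (1 / fact k) *q gpart n (semi_coeff x c m k))"
      by (rule sum.cong[OF refl], rule sum.mono_neutral_right) (auto simp: semi_coeff_eq_0)
    finally show "gpart n (gsum P) = gpart n (gsum (\<lambda>k. (1 / fact k) *q h k))"
      by (simp add: gpart_gsum gpart_qscale h_def gpart_sum qvs.scale_sum_right)
  qed
  finally have "gexp J * gexp x = gsum (\<lambda>k. \<Sum>i\<le>k. (1 / fact i) *q h i * ((1 / fact (k - i)) *q x ^ (k - i)))"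
    by (simp only: gexp_def gsum_mult[OF gh gord_exp_term[OF x]])
  also have "\<dots> = gexp (x + c)"
    unfolding gexp_def power_semidirect h_def[symmetric] qvs.scale_sum_right
    by (intro arg_cong[of _ _ gsum] ext sum.cong)
       (auto simp: binomial_fact simp flip: qscale_of_nat)
  finally show ?thesis by (simp add: J_def)
qed

text \<open>Multiplicativity is asked for powers of \<open>x\<close> only, so the rule applies to
  antihomomorphisms such as reversal of strands as well as to homomorphisms.\<close>

lemma gexp_hom:
  fixes h :: "'a :: cga \<Rightarrow> 'b :: cga"
  assumes "\<And>x y. h (x + y) = h x + h y" "\<And>r x. h (r *q x) = r *q h x"
    and "\<And>n. h (x ^ n) = h x ^ n" and "\<And>n x. gpart n (h x) = h (gpart n x)"
  shows "h (gexp x) = gexp (h x)"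
proof (rule gpart_ext)
  fix n
  have [simp]: "h 0 = 0"
    using assms(2)[of 0 0] by simp
  have s: "h (\<Sum>k\<le>N. f k) = (\<Sum>k\<le>N. h (f k))" for f and N :: nat
    by (induction N) (simp_all add: assms(1))
  show "gpart n (h (gexp x)) = gpart n (gexp (h x))"
    by (simp add: assms(4) gexp_def gpart_gsum s) (simp add: assms(2) gpart_qscale flip: assms(3,4))
qed


subsection \<open>Power series as a complete graded algebra\<close>

text \<open>The grading is by the exponent of the variable alone; the coefficients are arbitrary
  elements of an ungraded algebra.\<close>

instantiation fps :: (rat_algebra) cga
begin

definition qscale_fps :: "rat \<Rightarrow> 'a fps \<Rightarrow> 'a fps" where
  "qscale_fps r f = Abs_fps (\<lambda>n. r *q f $ n)"

definition gpart_fps :: "nat \<Rightarrow> 'a fps \<Rightarrow> 'a fps" where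
  "gpart_fps n f = Abs_fps (\<lambda>m. if m = n then f $ n else 0)"

definition glim_fps :: "(nat \<Rightarrow> 'a fps) \<Rightarrow> 'a fps" where
  "glim_fps s = Abs_fps (\<lambda>n. s n $ n)"

instance
proof
  fix x y :: "'a fps" and n :: nat
  show "x = y" if "\<And>n. gpart n x = gpart n y"
  proof (rule fps_ext)
    fix n
    show "x $ n = y $ n"
      using arg_cong[OF that[of n], of "\<lambda>f. f $ n"] by (simp add: gpart_fps_def)
  qed
  show "gpart n (x * y) = (\<Sum>i\<le>n. gpart i x * gpart (n - i) y)"
  proof (rule fps_ext)
    fix m
    have "(\<Sum>j=0..m. gpart i x $ j * gpart (n - i) y $ (m - j)) = (if m = n then x $ i * y $ (n - i) else 0)"
      if "i \<le> n" for i
    proof -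
      have "(\<Sum>j=0..m. gpart i x $ j * gpart (n - i) y $ (m - j)) =
          (\<Sum>j=0..m. if j = i then x $ i * gpart (n - i) y $ (m - i) else 0)"
        by (rule sum.cong) (auto simp: gpart_fps_def)
      also have "\<dots> = (if m = n then x $ i * y $ (n - i) else 0)"
        using that by (auto simp: gpart_fps_def)
      finally show ?thesis .
    qed
    then show "gpart n (x * y) $ m = (\<Sum>i\<le>n. gpart i x * gpart (n - i) y) $ m"
      by (simp add: fps_sum_nth fps_mult_nth) (simp add: gpart_fps_def fps_mult_nth atMost_atLeast0)
  qed
qed (auto simp: fps_eq_iff qscale_fps_def gpart_fps_def glim_fps_def qscale_distribs fps_mult_nth
    qvs.scale_sum_right)

end

lemma fps_qscale_nth [simp]: "(r *q f) $ n = r *q f $ n"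
  by (simp add: qscale_fps_def)

lemma gord_fps_iff: "gord k f \<longleftrightarrow> (\<forall>m<k. f $ m = 0)"
  by (auto simp: gord_def gpart_fps_def fps_eq_iff)

lemma fps_gsum_nth: "gsum s $ n = (\<Sum>k\<le>n. s k $ n)"
  by (simp add: gsum_def glim_fps_def fps_sum_nth)

section \<open>The free associative algebra as a complete graded algebra, and substitution into
  power series\<close>

section \<open>Noncommutative series\<close>

lemma sum_fun_apply: "(\<Sum>i\<in>A. f i) x = (\<Sum>i\<in>A. f i x)"
  by (induction A rule: infinite_finite_induct) auto

lemma nc_mult_single [simp]: "single u \<odot> single v = single (u @ v)"
proof
  fix w :: "'a list"
  have "(single u \<odot> single v) w = (\<Sum>i\<le>length w. if i = length u then single (u @ v) w else 0)"
    unfolding nc_mult_def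
  proof (rule sum.cong[OF refl])
    fix i assume "i \<in> {..length w}"
    then have iff: "take i w = u \<and> drop i w = v \<longleftrightarrow> i = length u \<and> w = u @ v"
      by (metis append_eq_conv_conj append_take_drop_id atMost_iff length_take min.absorb2)
    have "single u (take i w) * single v (drop i w) = (if take i w = u \<and> drop i w = v then 1 else 0)"
      by (simp add: single_def)
    also have "\<dots> = (if i = length u then single (u @ v) w else 0)"
      unfolding iff by (simp add: single_def)
    finally show "single u (take i w) * single v (drop i w) = (if i = length u then single (u @ v) w else 0)" .
  qed
  also have "\<dots> = single (u @ v) w"
    by (auto simp: single_def)
  finally show "(single u \<odot> single v) w = single (u @ v) w" .
qed

lemma nc_mult_add_left: "(f + g) \<odot> h = f \<odot> h + g \<odot> h"
  and nc_mult_add_right: "h \<odot> (f + g) = h \<odot> f + h \<odot> g"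
  and nc_mult_diff_left: "(f - g) \<odot> h = f \<odot> h - g \<odot> h"
  and nc_mult_diff_right: "h \<odot> (f - g) = h \<odot> f - h \<odot> g"
  and nc_mult_scale_left: "scale r f \<odot> h = scale r (f \<odot> h)"
  and nc_mult_scale_right: "h \<odot> scale r f = scale r (h \<odot> f)"
  and nc_mult_zero_left [simp]: "0 \<odot> h = 0"
  and nc_mult_zero_right [simp]: "h \<odot> 0 = 0"
  by (auto simp: nc_mult_def fun_eq_iff scale_def algebra_simps sum.distrib sum_subtractf sum_distrib_left)

lemma nc_mult_assoc: "(f \<odot> g) \<odot> h = f \<odot> (g \<odot> h)"
proof
  fix w :: "'a list"
  have "((f \<odot> g) \<odot> h) w = (\<Sum>i\<le>length w. \<Sum>j\<le>i. f (take j w) * g (drop j (take i w)) * h (drop i w))"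
    by (auto simp: nc_mult_def sum_distrib_right min_absorb2 intro!: sum.cong)
  also have "\<dots> = (\<Sum>(i, j)\<in>(SIGMA i:{..length w}. {..i}). f (take j w) * g (drop j (take i w)) * h (drop i w))"
    by (rule sum.Sigma) auto
  also have "\<dots> = (\<Sum>(j, k)\<in>(SIGMA j:{..length w}. {..length w - j}).
      f (take j w) * (g (take k (drop j w)) * h (drop k (drop j w))))"
    by (rule sum.reindex_bij_witness[of _ "\<lambda>(j, k). (j + k, j)" "\<lambda>(i, j). (j, i - j)"])
       (auto simp: drop_take mult.assoc)
  also have "\<dots> = (\<Sum>j\<le>length w. \<Sum>k\<le>length w - j. f (take j w) * (g (take k (drop j w)) * h (drop k (drop j w))))"
    by (rule sum.Sigma[symmetric]) auto
  finally show "((f \<odot> g) \<odot> h) w = (f \<odot> (g \<odot> h)) w"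
    by (simp add: nc_mult_def sum_distrib_left)
qed

lemma nc_one_mult [simp]: "nc_one \<odot> f = f"
proof
  fix w
  have "(nc_one \<odot> f) w = (\<Sum>i\<le>length w. if i = 0 then f w else 0)"
    unfolding nc_mult_def nc_one_def single_def by (rule sum.cong) auto
  then show "(nc_one \<odot> f) w = f w" by simp
qed

lemma nc_mult_one [simp]: "f \<odot> nc_one = f"
proof
  fix w
  have "(f \<odot> nc_one) w = (\<Sum>i\<le>length w. if i = length w then f w else 0)"
    unfolding nc_mult_def nc_one_def single_def by (rule sum.cong) auto
  then show "(f \<odot> nc_one) w = f w" by simp
qed

lemma nc_bracket_add_left: "nc_bracket (f + g) h = nc_bracket f h + nc_bracket g h"
  and nc_bracket_add_right: "nc_bracket h (f + g) = nc_bracket h f + nc_bracket h g"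
  and nc_bracket_scale_left: "nc_bracket (scale r f) h = scale r (nc_bracket f h)"
  and nc_bracket_scale_right: "nc_bracket h (scale r f) = scale r (nc_bracket h f)"
  and nc_bracket_zero_left [simp]: "nc_bracket 0 h = 0"
  and nc_bracket_zero_right [simp]: "nc_bracket h 0 = 0"
  by (simp_all add: nc_bracket_def nc_mult_add_left nc_mult_add_right nc_mult_scale_left
      nc_mult_scale_right series.scale_right_diff_distrib)

definition nc_part :: "nat \<Rightarrow> 'a ncs \<Rightarrow> 'a ncs" where
  "nc_part n f = (\<lambda>w. if length w = n then f w else 0)"

lemma nc_part_mult: "nc_part n (f \<odot> g) = (\<Sum>i\<le>n. nc_part i f \<odot> nc_part (n - i) g)"
proof
  fix w :: "'a list"
  have "(\<Sum>j\<le>length w. nc_part i f (take j w) * nc_part (n - i) g (drop j w)) =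
      (if length w = n then f (take i w) * g (drop i w) else 0)" if "i \<le> n" for i
  proof -
    have "(\<Sum>j\<le>length w. nc_part i f (take j w) * nc_part (n - i) g (drop j w)) =
        (\<Sum>j\<le>length w. if j = i then (if length w = n then f (take i w) * g (drop i w) else 0) else 0)"
      by (rule sum.cong) (use that in \<open>auto simp: nc_part_def\<close>)
    then show ?thesis using that by auto
  qed
  then show "nc_part n (f \<odot> g) w = (\<Sum>i\<le>n. nc_part i f \<odot> nc_part (n - i) g) w"
    by (simp add: sum_fun_apply nc_mult_def) (simp add: nc_part_def)
qed

text \<open>On functions the product is already the pointwise one, so the concatenation product
  needs a type of its own before series can be an instance of \<open>ring_1\<close> and
  \<open>cga\<close>.\<close>

typedef 'a nca = "UNIV :: 'a ncs set" morphisms series_of Series_of ..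

setup_lifting type_definition_nca

instantiation nca :: (type) ring_1
begin

lift_definition zero_nca :: "'a nca" is 0 .
lift_definition one_nca :: "'a nca" is nc_one .
lift_definition plus_nca :: "'a nca \<Rightarrow> 'a nca \<Rightarrow> 'a nca" is "(+)" .
lift_definition minus_nca :: "'a nca \<Rightarrow> 'a nca \<Rightarrow> 'a nca" is "(-)" .
lift_definition uminus_nca :: "'a nca \<Rightarrow> 'a nca" is uminus .
lift_definition times_nca :: "'a nca \<Rightarrow> 'a nca \<Rightarrow> 'a nca" is "(\<odot>)" .

instance
proof
  fix x y z :: "'a nca"
  show "x * y * z = x * (y * z)" by transfer (rule nc_mult_assoc)
  show "(x + y) * z = x * z + y * z" by transfer (rule nc_mult_add_left)
  show "x * (y + z) = x * y + x * z" by transfer (rule nc_mult_add_right)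
  show "(0 :: 'a nca) \<noteq> 1"
    by transfer (metis nc_one_def single_def zero_fun_apply zero_neq_one)
  show "x + y + z = x + (y + z)" "x + y = y + x" "0 + x = x" "- x + x = 0" "x - y = x + - y"
    "1 * x = x" "x * 1 = x"
    by (transfer, simp add: fun_eq_iff)+
qed

end

instantiation nca :: (type) cga
begin

lift_definition qscale_nca :: "rat \<Rightarrow> 'a nca \<Rightarrow> 'a nca" is scale .
lift_definition gpart_nca :: "nat \<Rightarrow> 'a nca \<Rightarrow> 'a nca" is nc_part .
lift_definition glim_nca :: "(nat \<Rightarrow> 'a nca) \<Rightarrow> 'a nca" is "\<lambda>s w. s (length w) w" .

instance
proof
  fix x y z :: "'a nca" and r s :: rat and n :: nat and S :: "nat \<Rightarrow> 'a nca"
  show "(r *q x) * y = r *q (x * y)" by transfer (rule nc_mult_scale_left)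
  show "x * (r *q y) = r *q (x * y)" by transfer (rule nc_mult_scale_right)
  show "gpart n (x * y) = (\<Sum>i\<le>n. gpart i x * gpart (n - i) y)"
  proof -
    have sum: "series_of (\<Sum>i\<in>A. f i) = (\<Sum>i\<in>A. series_of (f i))" for f :: "nat \<Rightarrow> 'a nca" and A
      by (induction A rule: infinite_finite_induct) (simp_all add: zero_nca.rep_eq plus_nca.rep_eq)
    show ?thesis
      by (rule series_of_inject[THEN iffD1])
         (simp add: sum gpart_nca.rep_eq times_nca.rep_eq nc_part_mult)
  qed
  show "gpart n (glim S) = gpart n (S n)"
    by transfer (simp add: nc_part_def fun_eq_iff)
  show "x = y" if "\<And>n. gpart n x = gpart n y"
  proof -
    have "series_of x w = series_of y w" for w
    proof -
      have "series_of (gpart (length w) x) w = series_of (gpart (length w) y) w"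
        by (simp only: that)
      then show ?thesis by (simp add: gpart_nca.rep_eq nc_part_def)
    qed
    then show ?thesis by (intro series_of_inject[THEN iffD1] ext)
  qed
  show "r *q (x + y) = r *q x + r *q y" "(r + s) *q x = r *q x + s *q x"
    "r *q s *q x = (r * s) *q x" "1 *q x = x"
    by (transfer; simp add: series.scale_right_distrib series.scale_left_distrib)+
  show "gpart n (x + y) = gpart n x + gpart n y" "gpart n (r *q x) = r *q gpart n x"
    "gpart n (1 :: 'a nca) = (if n = 0 then 1 else 0)"
    by (transfer; simp add: nc_part_def scale_def nc_one_def single_def fun_eq_iff)+
qed

end

lemma series_of_simps:
  "series_of 0 = 0" "series_of 1 = nc_one" "series_of (x + y) = series_of x + series_of y"
  "series_of (x - y) = series_of x - series_of y" "series_of (- x) = - series_of x"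
  "series_of (x * y) = series_of x \<odot> series_of y" "series_of (r *q x) = scale r (series_of x)"
  "series_of (gpart n x) = nc_part n (series_of x)" "series_of (Series_of f) = f"
  by (simp_all add: zero_nca.rep_eq one_nca.rep_eq plus_nca.rep_eq minus_nca.rep_eq uminus_nca.rep_eq
      times_nca.rep_eq qscale_nca.rep_eq gpart_nca.rep_eq Series_of_inverse)

lemma series_of_sum: "series_of (\<Sum>i\<in>A. f i) = (\<Sum>i\<in>A. series_of (f i))"
  by (induction A rule: infinite_finite_induct) (simp_all add: series_of_simps)

lemma series_of_power: "series_of (x ^ n) = nc_pow (series_of x) n"
  by (induction n) (simp_all add: series_of_simps)

lemma series_of_ad: "series_of (ad x y) = nc_bracket (series_of x) (series_of y)"
  by (simp add: ad_def nc_bracket_def series_of_simps)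

lemma series_of_gsum: "series_of (gsum s) w = (\<Sum>k\<le>length w. series_of (s k) w)"
  by (simp add: gsum_def glim_nca.rep_eq series_of_sum sum_fun_apply)

lemma series_of_gexp: "series_of (gexp x) = nc_exp (series_of x)"
  by (rule ext) (simp add: gexp_def series_of_gsum series_of_simps scale_def series_of_power nc_exp_def)

lemma gord_1_nca_iff: "gord 1 x \<longleftrightarrow> series_of x [] = 0"
  by (auto simp: gord_def series_of_inject[symmetric] series_of_simps nc_part_def fun_eq_iff)


subsection \<open>Substitution into power series in one variable\<close>

definition psub :: "rat fps \<Rightarrow> 'a :: cga \<Rightarrow> 'a" where
  "psub P x = gsum (\<lambda>k. P $ k *q x ^ k)"

lemma psub_mult:
  assumes "gord 1 x"
  shows "psub (P * Q) x = psub P x * psub Q x"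
  unfolding psub_def gsum_mult[OF gord_exp_term[OF assms] gord_exp_term[OF assms]]
  by (auto intro!: arg_cong[of _ _ gsum] sum.cong
      simp: fun_eq_iff fps_mult_nth qvs.scale_sum_left atMost_atLeast0 simp flip: power_add)

lemma psub_1 [simp]: "psub 1 x = 1"
  unfolding psub_def
  by (subst gsum_single[symmetric]) (auto intro!: arg_cong[of _ _ gsum])

lemma psub_power: "gord 1 x \<Longrightarrow> psub (P ^ n) x = psub P x ^ n"
  by (induction n) (simp_all add: psub_mult)

text \<open>Since \<open>Q ^ k\<close> starts in degree \<open>k\<close>, only finitely many pairs
  of indices matter in each degree and the double sum may be interchanged.\<close>

lemma psub_compose:
  assumes "gord 1 x" "Q $ 0 = 0"
  shows "psub (P oo Q) x = psub P (psub Q x)"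
proof (rule gpart_ext)
  fix n
  have "gpart n (psub P (psub Q x)) = (\<Sum>k\<le>n. \<Sum>m\<le>n. (P $ k * (Q ^ k) $ m) *q gpart n (x ^ m))"
    unfolding psub_def[of P] psub_power[OF assms(1), symmetric]
    by (simp add: gpart_gsum gpart_qscale psub_def qvs.scale_sum_right)
  also have "\<dots> = (\<Sum>m\<le>n. \<Sum>k\<le>n. (P $ k * (Q ^ k) $ m) *q gpart n (x ^ m))"
    by (rule sum.swap)
  also have "\<dots> = (\<Sum>m\<le>n. \<Sum>k\<le>m. (P $ k * (Q ^ k) $ m) *q gpart n (x ^ m))"
    by (rule sum.cong[OF refl], rule sum.mono_neutral_right)
       (auto simp: startsby_zero_power_prefix[OF assms(2)])
  also have "\<dots> = gpart n (psub (P oo Q) x)"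
    by (simp add: psub_def gpart_gsum gpart_qscale fps_compose_nth qvs.scale_sum_left gpart_sum atMost_atLeast0)
  finally show "gpart n (psub (P oo Q) x) = gpart n (psub P (psub Q x))" ..
qed

lemma gexp_eq_psub: "gexp x = psub (fps_exp 1) x"
  by (simp add: gexp_def psub_def)

text \<open>\<open>fps_ln 1\<close> is the series of \<open>log (1 + X)\<close>. The identity
  \<open>exp (log (1 + X)) = 1 + X\<close> holds for rational power series and is carried over by
  compatibility of \<open>psub\<close> with composition.\<close>

lemma gexp_psub_ln:
  assumes "gord 1 x"
  shows "gexp (psub (fps_ln 1) x) = 1 + x"
proof -
  have "(fps_exp 1 - 1) oo fps_ln 1 = (fps_X :: rat fps)"
    unfolding fps_ln_fps_exp_inv[OF one_neq_zero] by (rule fps_inv_right) simp_all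
  then have "fps_exp 1 oo fps_ln 1 = (1 + fps_X :: rat fps)"
    by (simp add: fps_compose_sub_distrib algebra_simps)
  then have "gexp (psub (fps_ln 1) x) = psub (1 + fps_X) x"
    by (simp add: gexp_eq_psub flip: psub_compose[OF assms])
  also have "\<dots> = psub 1 x + psub fps_X x"
    by (simp add: psub_def qscale_distribs gsum_add)
  also have "psub fps_X x = gsum (\<lambda>k. fps_X $ Suc k *q x ^ Suc k)"
    unfolding psub_def by (rule gsum_shift) (use gord_exp_term[OF assms] in auto)
  also have "\<dots> = gsum (\<lambda>k. if k = 0 then x else 0)"
    by (rule arg_cong[of _ _ gsum]) (auto simp: fun_eq_iff fps_X_def)
  finally show ?thesis by (simp add: gsum_single)
qed


section \<open>Lie elements, the Baker-Campbell-Hausdorff series and Dynkin's formula\<close>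

section \<open>Lie series\<close>

lemma leaves_not_Nil [simp]: "leaves t \<noteq> []"
  by (induction t) auto

lemma finite_trees_le: "finite S \<Longrightarrow> finite {t. set (leaves t) \<subseteq> S \<and> length (leaves t) \<le> n}"
proof (induction n)
  case (Suc n)
  let ?A = "{t. set (leaves t) \<subseteq> S \<and> length (leaves t) \<le> n}"
  have "{t. set (leaves t) \<subseteq> S \<and> length (leaves t) \<le> Suc n} \<subseteq> Leaf ` S \<union> (\<lambda>(s, t). Br s t) ` (?A \<times> ?A)"
  proof
    fix t assume t: "t \<in> {t. set (leaves t) \<subseteq> S \<and> length (leaves t) \<le> Suc n}"
    show "t \<in> Leaf ` S \<union> (\<lambda>(s, t). Br s t) ` (?A \<times> ?A)"
    proof (cases t)
      case (Br u v)
      have "1 \<le> length (leaves u)" "1 \<le> length (leaves v)"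
        by (simp_all add: Suc_le_eq)
      moreover have  "length (leaves u) + length (leaves v) \<le> Suc n" "set (leaves u) \<subseteq> S" "set (leaves v) \<subseteq> S"
        using t by (simp_all add: Br)
      moreover from calculation have "length (leaves u) \<le> n" "length (leaves v) \<le> n"
        by linarith+
      ultimately have "(u, v) \<in> ?A \<times> ?A"
        by simp
      then show ?thesis
        unfolding Br by (intro UnI2) (rule image_eqI[of _ _ "(u, v)"], simp_all)
    qed (use t in auto)
  qed
  then show ?case
    using Suc by (auto intro: finite_subset)
qed simp

lemma finite_trees: "finite S \<Longrightarrow> finite {t. set (leaves t) \<subseteq> S \<and> length (leaves t) = n}"
  by (rule finite_subset[OF _ finite_trees_le[of S n]]) auto

lemma nc_tree_eq_0:
  "length w \<noteq> length (leaves t) \<Longrightarrow> nc_tree t w = 0"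
proof (induction t arbitrary: w)
  case (Leaf x)
  then show ?case by (auto simp: nc_gen_def single_def)
next
  case (Br s t)
  have *: "nc_tree s (take i w) * nc_tree t (drop i w) = 0" "nc_tree t (take i w) * nc_tree s (drop i w) = 0"
    if "i \<le> length w" for i
  proof -
    have "length (take i w) \<noteq> length (leaves s) \<or> length (drop i w) \<noteq> length (leaves t)"
      "length (take i w) \<noteq> length (leaves t) \<or> length (drop i w) \<noteq> length (leaves s)"
      using that Br.prems by auto
    then show "nc_tree s (take i w) * nc_tree t (drop i w) = 0" "nc_tree t (take i w) * nc_tree s (drop i w) = 0"
      using Br.IH by auto
  qed
  then show ?case
    by (simp add: nc_bracket_def nc_mult_def sum.neutral del: mult_eq_0_iff)
qed

lemma nc_mult_support:
  assumes "(f \<odot> g) w \<noteq> 0" "\<And>w. f w \<noteq> 0 \<Longrightarrow> set w \<subseteq> A" "\<And>w. g w \<noteq> 0 \<Longrightarrow> set w \<subseteq> B"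
  shows "set w \<subseteq> A \<union> B"
proof -
  obtain i where "f (take i w) * g (drop i w) \<noteq> 0"
    using assms(1) unfolding nc_mult_def by (auto elim: sum.not_neutral_contains_not_neutral)
  then have "set (take i w) \<subseteq> A" "set (drop i w) \<subseteq> B"
    using assms(2,3) by auto
  then show ?thesis
    by (metis append_take_drop_id set_append Un_mono)
qed

lemma nc_tree_support: "nc_tree t w \<noteq> 0 \<Longrightarrow> set w \<subseteq> set (leaves t)"
proof (induction t arbitrary: w)
  case (Leaf x)
  then show ?case by (auto simp: nc_gen_def single_def split: if_splits)
next
  case (Br s t)
  have "(nc_tree s \<odot> nc_tree t) w \<noteq> 0 \<or> (nc_tree t \<odot> nc_tree s) w \<noteq> 0"
    using Br.prems by (auto simp: nc_bracket_def)
  then show ?case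
  proof
    assume "(nc_tree s \<odot> nc_tree t) w \<noteq> 0"
    from nc_mult_support[OF this Br.IH] show ?thesis by simp
  next
    assume "(nc_tree t \<odot> nc_tree s) w \<noteq> 0"
    from nc_mult_support[OF this Br.IH(2,1)] show ?thesis by auto
  qed
qed

definition lie_span :: "'a set \<Rightarrow> nat \<Rightarrow> 'a ncs set" where
  "lie_span S n = series.span (nc_tree ` {t. set (leaves t) \<subseteq> S \<and> length (leaves t) = n})"

lemma nc_tree_in_lie_span: "set (leaves t) \<subseteq> S \<Longrightarrow> length (leaves t) = n \<Longrightarrow> nc_tree t \<in> lie_span S n"
  unfolding lie_span_def by (rule series.span_base) auto

lemma lie_span_0: "0 \<in> lie_span S n"
  and lie_span_add: "f \<in> lie_span S n \<Longrightarrow> g \<in> lie_span S n \<Longrightarrow> f + g \<in> lie_span S n"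
  and lie_span_scale: "f \<in> lie_span S n \<Longrightarrow> scale r f \<in> lie_span S n"
  and lie_span_diff: "f \<in> lie_span S n \<Longrightarrow> g \<in> lie_span S n \<Longrightarrow> f - g \<in> lie_span S n"
  and lie_span_sum: "(\<And>i. i \<in> A \<Longrightarrow> h i \<in> lie_span S n) \<Longrightarrow> (\<Sum>i\<in>A. h i) \<in> lie_span S n"
  by (simp_all add: lie_span_def series.span_zero series.span_add series.span_scale series.span_diff
      series.span_sum)

lemma lie_span_induct [consumes 1, case_names zero add]:
  assumes "f \<in> lie_span S n" "P 0"
    and "\<And>c t g. set (leaves t) \<subseteq> S \<Longrightarrow> length (leaves t) = n \<Longrightarrow> g \<in> lie_span S n \<Longrightarrow> P g \<Longrightarrow> P (scale c (nc_tree t) + g)"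
  shows "P f"
proof -
  have "f \<in> lie_span S n \<and> P f"
    using assms(1) unfolding lie_span_def
  proof (induction rule: series.span_induct_alt)
    case (step c x y)
    then show ?case
      using assms(3) unfolding lie_span_def
      by (auto simp del: plus_fun_apply intro: series.span_add series.span_scale series.span_base)
  qed (use assms(2) series.span_zero in \<open>auto simp del: zero_fun_apply\<close>)
  then show ?thesis ..
qed

lemma lie_span_bracket:
  assumes "f \<in> lie_span S m" "g \<in> lie_span S n"
  shows "nc_bracket f g \<in> lie_span S (m + n)"
  using assms(1)
proof (induction rule: lie_span_induct)
  case (add c s f)
  have "nc_bracket (nc_tree s) g \<in> lie_span S (m + n)"
    using assms(2)
  proof (induction rule: lie_span_induct)
    case (add d t g)
    have "nc_bracket (nc_tree s) (nc_tree t) \<in> lie_span S (m + n)"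
      using nc_tree_in_lie_span[of "Br s t" S "m + n"] add(1,2) \<open>set (leaves s) \<subseteq> S\<close> \<open>length (leaves s) = m\<close>
      by simp
    then show ?case
      using add by (simp add: nc_bracket_add_right nc_bracket_scale_right lie_span_add lie_span_scale del: plus_fun_apply)
  qed (simp add: lie_span_0 del: zero_fun_apply)
  then show ?case
    using add by (simp add: nc_bracket_add_left nc_bracket_scale_left lie_span_add lie_span_scale del: plus_fun_apply)
qed (simp add: lie_span_0 del: zero_fun_apply)

lemma lie_span_homogeneous:
  assumes "f \<in> lie_span S n" "f w \<noteq> 0"
  shows "length w = n" "set w \<subseteq> S"
proof -
  have "f w \<noteq> 0 \<longrightarrow> length w = n \<and> set w \<subseteq> S"
    using assms(1)
  proof (induction rule: lie_span_induct)
    case (add c t g)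
    have "nc_tree t w \<noteq> 0 \<or> g w \<noteq> 0" if "(scale c (nc_tree t) + g) w \<noteq> 0"
      using that by (auto simp: scale_def)
    moreover have "length w = n \<and> set w \<subseteq> S" if "nc_tree t w \<noteq> 0"
      using nc_tree_support[OF that] nc_tree_eq_0[of w t] that add(1,2) by blast
    ultimately show ?case
      using add.IH by blast
  qed simp
  with assms(2) show "length w = n" "set w \<subseteq> S" by auto
qed

lemma nc_part_nc_trees:
  assumes "finite S" "T \<in> tree_series S"
  shows "nc_part n (nc_trees T) =
    (\<Sum>t | set (leaves t) \<subseteq> S \<and> length (leaves t) = n. scale (T t) (nc_tree t))"
proof
  fix w :: "'a list"
  have "nc_part n (nc_trees T) w = (if length w = n then (\<Sum>t | T t \<noteq> 0 \<and> length (leaves t) = n. T t * nc_tree t w) else 0)"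
    by (auto simp: nc_part_def nc_trees_def)
  also have "(\<Sum>t | T t \<noteq> 0 \<and> length (leaves t) = n. T t * nc_tree t w) =
      (\<Sum>t | set (leaves t) \<subseteq> S \<and> length (leaves t) = n. T t * nc_tree t w)"
    by (rule sum.mono_neutral_left) (use assms finite_trees in \<open>auto simp: tree_series_def\<close>)
  also have "(if length w = n then \<dots> else 0) =
      (\<Sum>t | set (leaves t) \<subseteq> S \<and> length (leaves t) = n. T t * nc_tree t w)"
    by (auto simp: nc_tree_eq_0)
  finally show "nc_part n (nc_trees T) w =
      (\<Sum>t | set (leaves t) \<subseteq> S \<and> length (leaves t) = n. scale (T t) (nc_tree t)) w"
    by (simp add: sum_fun_apply scale_def)
qed

lemma span_image_finite:
  assumes "finite A" "f \<in> series.span (g ` A)"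
  shows "\<exists>c. f = (\<Sum>t\<in>A. scale (c t) (g t))"
  using assms(2)
proof (induction rule: series.span_induct_alt)
  case base
  then show ?case by (intro exI[of _ "\<lambda>_. 0"]) simp
next
  case (step c x y)
  then obtain d t where d: "y = (\<Sum>t\<in>A. scale (d t) (g t))" "x = g t" "t \<in> A" by auto
  have "(\<Sum>s\<in>A. scale ((if s = t then c else 0) + d s) (g s)) =
      (\<Sum>s\<in>A. (if s = t then scale c (g s) else 0)) + (\<Sum>s\<in>A. scale (d s) (g s))"
    by (auto simp: series.scale_left_distrib sum.distrib[symmetric] intro!: sum.cong)
  then show ?case
    using d assms(1) by (intro exI[of _ "\<lambda>s. (if s = t then c else 0) + d s"]) simp
qed

text \<open>Over a finite alphabet each degree has finitely many trees, so a homogeneous part is a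
  finite combination. Coefficients chosen separately in all degrees fit together to one series of
  trees, since a tree occurs only in the degree given by its leaves. Closure properties of
  \<open>FL\<close> thereby follow from those of spans.\<close>

lemma FL_iff:
  assumes "finite S"
  shows "f \<in> FL S \<longleftrightarrow> (\<forall>n. nc_part n f \<in> lie_span S n)"
proof
  assume "f \<in> FL S"
  then obtain T where T: "f = nc_trees T" "T \<in> tree_series S"
    by (auto simp: FL_def)
  show "\<forall>n. nc_part n f \<in> lie_span S n"
    unfolding T(1) nc_part_nc_trees[OF assms T(2)]
    by (auto intro!: lie_span_sum lie_span_scale nc_tree_in_lie_span)
next
  assume *: "\<forall>n. nc_part n f \<in> lie_span S n"
  have "\<exists>c. nc_part n f = (\<Sum>t | set (leaves t) \<subseteq> S \<and> length (leaves t) = n. scale (c t) (nc_tree t))" for n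
    by (rule span_image_finite[OF finite_trees[OF assms]]) (use * in \<open>simp add: lie_span_def\<close>)
  then have "\<exists>c. \<forall>n. nc_part n f = (\<Sum>t | set (leaves t) \<subseteq> S \<and> length (leaves t) = n. scale (c n t) (nc_tree t))"
    by (intro choice allI)
  then obtain c where c: "nc_part n f = (\<Sum>t | set (leaves t) \<subseteq> S \<and> length (leaves t) = n. scale (c n t) (nc_tree t))" for n
    by blast
  define T where "T t = (if set (leaves t) \<subseteq> S then c (length (leaves t)) t else 0)" for t
  have T: "T \<in> tree_series S"
    by (auto simp: T_def tree_series_def)
  have "nc_part n (nc_trees T) = nc_part n f" for n
    unfolding nc_part_nc_trees[OF assms T] c by (rule sum.cong) (auto simp: T_def)
  then have "nc_trees T w = f w" for w
    by (metis nc_part_def)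
  then have "f = nc_trees T"
    by auto
  then show "f \<in> FL S"
    unfolding FL_def using T by (rule image_eqI)
qed

lemma FL_eq_0:
  assumes "finite S" "f \<in> FL S"
  shows "f [] = 0"
proof (rule ccontr)
  assume "f [] \<noteq> 0"
  have "nc_part 0 f \<in> lie_span S 0"
    using assms FL_iff by auto
  moreover have "{t. set (leaves t) \<subseteq> S \<and> length (leaves t) = 0} = {}"
    by auto
  ultimately have "nc_part 0 f = 0"
    by (simp only: lie_span_def image_empty series.span_empty) simp
  then show False
    using \<open>f [] \<noteq> 0\<close> by (auto simp: nc_part_def fun_eq_iff split: if_splits)
qed

lemma FL_support:
  assumes "finite S" "f \<in> FL S" "f w \<noteq> 0"
  shows "set w \<subseteq> S"
  using lie_span_homogeneous(2)[of "nc_part (length w) f" S "length w" w] assms FL_iff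
  by (auto simp: nc_part_def)


subsection \<open>The Baker-Campbell-Hausdorff series is a Lie series\<close>

text \<open>The invariant of the recursion for the logarithm: what is already known to be Lie when
  degree \<open>n\<close> is treated.\<close>

definition lie_below :: "nat \<Rightarrow> 'a nca \<Rightarrow> bool" where
  "lie_below n x \<longleftrightarrow> (\<forall>m<n. series_of (gpart m x) \<in> lie_span UNIV m)"

text \<open>Both arguments have order at least 1, so a bracket in degree \<open>n\<close> only
  involves parts of degrees strictly between 0 and \<open>n\<close>. A bracket is therefore known
  one degree further than its arguments.\<close>

lemma lie_below_ad:
  assumes "gord 1 x" "gord 1 y" "lie_below n x" "lie_below n y"
  shows "lie_below (Suc n) (ad x y)"
  unfolding lie_below_def
proof (intro allI impI)
  fix m assume "m < Suc n"
  have "gpart m (x * y) = (\<Sum>i\<le>m. gpart i x * gpart (m - i) y)"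
    by (rule gpart_mult)
  moreover have "gpart m (y * x) = (\<Sum>i\<le>m. gpart (m - i) y * gpart i x)"
    unfolding gpart_mult
    by (rule sum.reindex_bij_witness[of _ "\<lambda>i. m - i" "\<lambda>i. m - i"]) auto
  ultimately have "gpart m (ad x y) = (\<Sum>i\<le>m. ad (gpart i x) (gpart (m - i) y))"
    by (simp add: ad_def gpart_diff sum_subtractf)
  moreover have "series_of (ad (gpart i x) (gpart (m - i) y)) \<in> lie_span UNIV m" if "i \<le> m" for i
  proof (cases "i = 0 \<or> i = m")
    case True
    then have "gpart i x = 0 \<or> gpart (m - i) y = 0"
      using assms(1,2) gordD by fastforce
    then show ?thesis by (auto simp: series_of_simps lie_span_0)
  next
    case False
    then have "i < n" "m - i < n"
      using that \<open>m < Suc n\<close> by auto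
    then have "nc_bracket (series_of (gpart i x)) (series_of (gpart (m - i) y)) \<in> lie_span UNIV (i + (m - i))"
      using assms by (intro lie_span_bracket) (auto simp: lie_below_def)
    then show ?thesis
      using that by (simp add: series_of_ad)
  qed
  ultimately show "series_of (gpart m (ad x y)) \<in> lie_span UNIV m"
    by (auto simp: series_of_sum intro: lie_span_sum)
qed

lemma lie_below_mono: "lie_below n x \<Longrightarrow> m \<le> n \<Longrightarrow> lie_below m x"
  by (auto simp: lie_below_def)

lemma lie_below_adpow:
  assumes "gord 1 x" "gord 1 y" "lie_below n x" "lie_below n y"
  shows "lie_below (Suc n) ((ad x ^^ Suc j) y) \<and> gord 1 ((ad x ^^ Suc j) y)"
proof (induction j)
  case 0
  then show ?case
    using assms lie_below_ad gord_ad[of 1 x 1 y] by (auto intro: gord_mono)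
next
  case (Suc j)
  then have "lie_below n ((ad x ^^ Suc j) y)" "gord 1 ((ad x ^^ Suc j) y)"
    by (auto intro: lie_below_mono)
  then have "lie_below (Suc n) (ad x ((ad x ^^ Suc j) y))" "gord (1 + 1) (ad x ((ad x ^^ Suc j) y))"
    using assms lie_below_ad gord_ad by blast+
  then show ?case
    by (auto intro: gord_mono)
qed

lemma lie_below_gen: "lie_below n (Series_of (nc_gen v))"
proof -
  have "nc_part m (nc_gen v) = (if m = 1 then nc_tree (Leaf v) else 0)" for m
    by (auto simp: nc_part_def nc_gen_def single_def fun_eq_iff)
  then show ?thesis
    unfolding lie_below_def series_of_simps
    using nc_tree_in_lie_span[of "Leaf v" UNIV 1] by (auto simp: lie_span_0)
qed

lemma gder_gen: "gder (Series_of (nc_gen v)) = Series_of (nc_gen v)"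
proof (rule gpart_ext)
  show "gpart n (gder (Series_of (nc_gen v))) = gpart n (Series_of (nc_gen v))" for n
    unfolding gpart_gder series_of_inject[symmetric] series_of_simps
    by (auto simp: nc_part_def nc_gen_def single_def fun_eq_iff scale_def)
qed

lemma gder_gexp_gen:
  fixes v
  defines "x \<equiv> Series_of (nc_gen v)"
  shows "gder (gexp x) = x * gexp x"
proof -
  have "gord 1 x"
    unfolding x_def gord_1_nca_iff by (simp add: series_of_simps nc_gen_def single_def)
  then have "gder (gexp x) = gsum (\<lambda>j. (1 / fact (Suc j)) *q (ad x ^^ j) x) * gexp x"
    using gder_gexp gder_gen by (metis x_def)
  also have "gsum (\<lambda>j. (1 / fact (Suc j)) *q (ad x ^^ j) x) = gsum (\<lambda>j. if j = 0 then x else 0)"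
  proof (rule arg_cong[of _ _ gsum], rule ext)
    fix j
    have "ad x x = 0" by (simp add: ad_def)
    then have "(ad x ^^ j) x = (if j = 0 then x else 0)"
      by (induction j) auto
    then show "(1 / fact (Suc j)) *q (ad x ^^ j) x = (if j = 0 then x else 0)"
      by simp
  qed
  finally show ?thesis by (simp add: gsum_single)
qed

text \<open>Applying \<open>gder\<close> to \<open>g = e^x e^y\<close> gives \<open>u g\<close> with
  \<open>u = x + e^(ad x) y\<close>, an explicit Lie series. From \<open>g = e^f\<close> the same
  derivative is \<open>u' g\<close>, where \<open>u'\<close> is the series of
  \<open>(ad f)^j (gder f) / (j + 1)!\<close>. Hence \<open>u' = u\<close>, and in degree
  \<open>n\<close> this expresses \<open>n f_n\<close> by \<open>u_n\<close> and brackets of parts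
  of \<open>f\<close> of lower degree.\<close>

lemma nc_exp_bch_series: "nc_exp bch_series = nc_exp (nc_gen False) \<odot> nc_exp (nc_gen True)"
  and bch_series_Nil: "bch_series [] = 0"
  and bch_series_in_FL: "bch_series \<in> FL UNIV"
proof -
  define x where "x = Series_of (nc_gen False)"
  define y where "y = Series_of (nc_gen True)"
  define g where "g = gexp x * gexp y"
  define f where "f = psub (fps_ln 1) (g - 1)"
  have x: "gord 1 x" and y: "gord 1 y"
    unfolding x_def y_def gord_1_nca_iff by (simp_all add: series_of_simps nc_gen_def single_def)
  have g: "gord 1 (g - 1)"
    unfolding g_def gord_1_nca_iff
    by (simp add: series_of_simps series_of_gexp nc_exp_def nc_mult_def nc_one_def single_def)
  have sign_fps: "series_of g = nc_exp (nc_gen False) \<odot> nc_exp (nc_gen True)"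
    by (simp add: g_def x_def y_def series_of_simps series_of_gexp)
  have sf: "series_of f = bch_series"
  proof
    fix w
    have "series_of f w = (\<Sum>k\<le>length w. fps_ln 1 $ k * nc_pow (series_of g - nc_one) k w)"
      by (simp add: f_def psub_def series_of_gsum series_of_simps series_of_power scale_def)
    also have "\<dots> = (\<Sum>k=1..length w. fps_ln 1 $ k * nc_pow (series_of g - nc_one) k w)"
      by (rule sum.mono_neutral_right) (auto simp: not_le Suc_le_eq)
    also have "\<dots> = bch_series w"
      unfolding bch_series_def nc_log_def sign_fps
      by (rule sum.cong) (auto simp: fps_ln_nth power_eq_if)
    finally show "series_of f w = bch_series w" .
  qed
  have ef: "gexp f = g"
    using gexp_psub_ln[OF g] by (simp add: f_def)
  then show "nc_exp bch_series = nc_exp (nc_gen False) \<odot> nc_exp (nc_gen True)"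
    by (metis series_of_gexp sf sign_fps)
  show nil: "bch_series [] = 0"
    by (simp add: bch_series_def nc_log_def)
  then have f: "gord 1 f"
    unfolding gord_1_nca_iff sf .
  define u where "u = x + gsum (\<lambda>j. (1 / fact j) *q (ad x ^^ j) y)"
  define u' where "u' = gsum (\<lambda>j. (1 / fact (Suc j)) *q (ad f ^^ j) (gder f))"
  have "gder g = x * gexp x * gexp y + gexp x * (y * gexp y)"
    unfolding g_def gder_mult by (simp add: x_def y_def gder_gexp_gen)
  also have "\<dots> = u * g"
    unfolding u_def g_def distrib_right mult.assoc[symmetric] gexp_mult_eq_ad[OF x, of y] ..
  finally have "u' * g = u * g"
    using gder_gexp[OF f] by (simp add: ef u'_def)
  \<comment> \<open>\<open>g = gexp f\<close> is invertible with inverse \<open>gexp (- f)\<close>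
    and can be cancelled.\<close>
  then have "u' * (gexp f * gexp (- f)) = u * (gexp f * gexp (- f))"
    by (simp add: ef flip: mult.assoc)
  then have uu: "u' = u"
    by (simp add: gexp_mult_minus[OF f])
  have lx: "lie_below n x" and ly: "lie_below n y" for n
    by (simp_all add: x_def y_def lie_below_gen)
  have lxy: "series_of (gpart n ((ad x ^^ j) y)) \<in> lie_span UNIV n" for n j
    using lie_below_adpow[OF x y lx ly, of n] lx[of "Suc n"] ly[of "Suc n"]
    by (cases j) (auto simp: lie_below_def)
  have lu: "series_of (gpart n u) \<in> lie_span UNIV n" for n
    unfolding u_def gpart_add gpart_gsum gpart_qscale
    using lx[of "Suc n"] lxy
    by (auto simp: lie_below_def series_of_simps(1-7) series_of_sum intro!: lie_span_add lie_span_sum lie_span_scale)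
  have "lie_below n f" for n
  proof (induction n)
    case (Suc n)
    have "lie_below n (gder f)"
      using Suc by (auto simp: lie_below_def gpart_gder series_of_simps(1-7) intro: lie_span_scale)
    then have l: "series_of (gpart n ((ad f ^^ Suc j) (gder f))) \<in> lie_span UNIV n" for j
      using lie_below_adpow[OF f gord_gder[OF f] Suc, of j] by (auto simp: lie_below_def)
    have "gpart n u = (\<Sum>j\<le>n. (1 / fact (Suc j)) *q gpart n ((ad f ^^ j) (gder f)))"
      unfolding uu[symmetric] u'_def gpart_gsum gpart_qscale ..
    \<comment> \<open>The summand \<open>j = 0\<close> is \<open>gder f\<close> itself and
      contributes \<open>n f_n\<close>; all others contain a bracket and are Lie by the induction
      hypothesis.\<close>
    also have "\<dots> = of_nat n *q gpart n f +
        (\<Sum>j\<in>{1..n}. (1 / fact (Suc j)) *q gpart n ((ad f ^^ j) (gder f)))"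
      by (simp add: atMost_atLeast0 sum.atLeast_Suc_atMost[of 0 n] gpart_gder del: fact_Suc)
    finally have "of_nat n *q gpart n f = gpart n u -
        (\<Sum>j\<in>{1..n}. (1 / fact (Suc j)) *q gpart n ((ad f ^^ j) (gder f)))"
      by simp
    moreover have "series_of \<dots> \<in> lie_span UNIV n"
      unfolding series_of_simps(1-7) series_of_sum
    proof (intro lie_span_diff lie_span_sum lie_span_scale lu)
      fix j assume "j \<in> {1..n}"
      then show "series_of (gpart n ((ad f ^^ j) (gder f))) \<in> lie_span UNIV n"
        using l[of "j - 1"] by simp
    qed
    ultimately have "series_of ((1 / of_nat n) *q of_nat n *q gpart n f) \<in> lie_span UNIV n"
      by (simp only: series_of_simps(7) lie_span_scale)
    \<comment> \<open>Division by \<open>n\<close> says nothing in degree 0; there \<open>f\<close>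
      vanishes because it has order 1.\<close>
    moreover have "series_of (gpart 0 f) = 0"
      using gordD[OF f] by (simp add: series_of_simps)
    ultimately have "series_of (gpart n f) \<in> lie_span UNIV n"
      by (cases "n = 0") (auto simp: lie_span_0)
    with Suc show ?case
      by (auto simp: lie_below_def less_Suc_eq)
  qed (simp add: lie_below_def)
  then have "nc_part n bch_series \<in> lie_span UNIV n" for n
    by (metis lessI lie_below_def series_of_simps(8) sf)
  then show "bch_series \<in> FL UNIV"
    by (subst FL_iff) auto
qed

lemmas fun_apply = plus_fun_apply zero_fun_apply minus_apply uminus_apply

text \<open>
  These rules would rewrite inside the eta-expanded series that rule instantiation leaves behind.
\<close>

declare fun_apply [simp del]


subsection \<open>Linear functionals on words\<close>

definition fsupp :: "('b \<Rightarrow> rat) \<Rightarrow> bool" where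
  "fsupp f \<longleftrightarrow> finite {x. f x \<noteq> 0}"

lemma fsupp_0 [simp]: "fsupp 0"
  and fsupp_single [simp]: "fsupp (single x)"
  by (simp_all add: fsupp_def single_def fun_apply)

lemma fsupp_add [simp, intro]: "fsupp f \<Longrightarrow> fsupp g \<Longrightarrow> fsupp (f + g)"
  unfolding fsupp_def by (rule finite_subset[of _ "{x. f x \<noteq> 0} \<union> {x. g x \<noteq> 0}"]) (auto simp: fun_apply)

lemma fsupp_diff [simp, intro]: "fsupp f \<Longrightarrow> fsupp g \<Longrightarrow> fsupp (f - g)"
  unfolding fsupp_def by (rule finite_subset[of _ "{x. f x \<noteq> 0} \<union> {x. g x \<noteq> 0}"]) (auto simp: fun_apply)

lemma fsupp_scale [simp, intro]: "fsupp f \<Longrightarrow> fsupp (scale r f)"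
  unfolding fsupp_def by (erule finite_subset[rotated]) (auto simp: scale_def)

lemma fsupp_sum [simp, intro]: "(\<And>i. i \<in> I \<Longrightarrow> fsupp (h i)) \<Longrightarrow> fsupp (\<Sum>i\<in>I. h i)"
  by (induction I rule: infinite_finite_induct) auto

lemma fsupp_expand: "fsupp f \<Longrightarrow> (\<Sum>x | f x \<noteq> 0. scale (f x) (single x)) = f"
proof
  fix y assume f: "fsupp f"
  have "(\<Sum>x | f x \<noteq> 0. scale (f x) (single x)) y = (\<Sum>x | f x \<noteq> 0. if x = y then f y else 0)"
    unfolding sum_fun_apply by (rule sum.cong) (auto simp: scale_def single_def)
  also have "\<dots> = f y"
    using f by (simp add: fsupp_def)
  finally show "(\<Sum>x | f x \<noteq> 0. scale (f x) (single x)) y = f y" .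
qed

lemma fsupp_induct [consumes 1, case_names zero add]:
  assumes "fsupp f" "P 0" "\<And>c x g. fsupp g \<Longrightarrow> P g \<Longrightarrow> P (scale c (single x) + g)"
  shows "P f"
proof -
  have "P (\<Sum>x\<in>A. scale (c x) (single x)) \<and> fsupp (\<Sum>x\<in>A. scale (c x) (single x))" if "finite A" for A c
    using that
  proof (induction A)
    case empty
    show ?case using assms(2) by (simp)
  next
    case (insert x A)
    then show ?case using assms(3)[OF conjunct2[OF insert.IH] conjunct1[OF insert.IH], of "c x" x]
      by auto
  qed
  from this[of "{x. f x \<noteq> 0}" f] assms(1) show ?thesis
    by (simp add: fsupp_expand) (simp add: fsupp_def)
qed

text \<open>On a function of infinite support the sum takes the default value 0, hence the
  \<open>fsupp\<close> hypotheses in the additivity rules.\<close>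

definition lin :: "('b \<Rightarrow> 'v :: rat_module) \<Rightarrow> ('b \<Rightarrow> rat) \<Rightarrow> 'v" where
  "lin \<phi> f = (\<Sum>x | f x \<noteq> 0. f x *q \<phi> x)"

lemma lin_superset: "finite A \<Longrightarrow> (\<And>x. f x \<noteq> 0 \<Longrightarrow> x \<in> A) \<Longrightarrow> lin \<phi> f = (\<Sum>x\<in>A. f x *q \<phi> x)"
  unfolding lin_def by (rule sum.mono_neutral_left) auto

lemma lin_0 [simp]: "lin \<phi> 0 = 0"
  by (simp add: lin_def fun_apply)

lemma lin_single [simp]: "lin \<phi> (single x) = \<phi> x"
  by (subst lin_superset[of "{x}"]) (auto simp: single_def split: if_splits)

lemma lin_add: "fsupp f \<Longrightarrow> fsupp g \<Longrightarrow> lin \<phi> (f + g) = lin \<phi> f + lin \<phi> g"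
  unfolding fsupp_def
  by (subst (1 2 3) lin_superset[of "{x. f x \<noteq> 0} \<union> {x. g x \<noteq> 0}"])
     (auto simp: qscale_distribs sum.distrib fun_apply)

lemma lin_scale: "lin \<phi> (scale r f) = r *q lin \<phi> f"
  by (cases "r = 0") (auto simp: lin_def scale_def qvs.scale_sum_right)

lemma lin_diff: "fsupp f \<Longrightarrow> fsupp g \<Longrightarrow> lin \<phi> (f - g) = lin \<phi> f - lin \<phi> g"
  unfolding fsupp_def
  by (subst (1 2 3) lin_superset[of "{x. f x \<noteq> 0} \<union> {x. g x \<noteq> 0}"])
     (auto simp: qscale_distribs sum_subtractf fun_apply)

lemma lin_sum: "(\<And>i. i \<in> I \<Longrightarrow> fsupp (h i)) \<Longrightarrow> lin \<phi> (\<Sum>i\<in>I. h i) = (\<Sum>i\<in>I. lin \<phi> (h i))"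
  by (induction I rule: infinite_finite_induct) (auto simp: lin_add fsupp_sum)

lemma lin_cong: "(\<And>x. f x \<noteq> 0 \<Longrightarrow> \<phi> x = \<psi> x) \<Longrightarrow> lin \<phi> f = lin \<psi> f"
  unfolding lin_def by (rule sum.cong) auto

lemma lin_scale_fun: "lin (\<lambda>x. r *q \<phi> x) f = r *q lin \<phi> f"
  by (simp add: lin_def qvs.scale_sum_right mult.commute)

lemma lin_swap: "lin (\<lambda>x. lin (\<lambda>y. \<phi> x y) g) f = lin (\<lambda>y. lin (\<lambda>x. \<phi> x y) f) g"
  by (simp add: lin_def qvs.scale_sum_right mult.commute) (rule sum.swap)

lemma fsupp_nc_mult [simp, intro]:
  assumes "fsupp f" "fsupp g"
  shows "fsupp (f \<odot> g)"
  using assms(1)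
proof (induction rule: fsupp_induct)
  case (add c u f)
  have "fsupp (single u \<odot> g)"
    using assms(2)
    by (induction rule: fsupp_induct)
       (auto simp: nc_mult_add_right nc_mult_scale_right)
  then show ?case
    using add by (auto simp: nc_mult_add_left nc_mult_scale_left)
qed (auto)

lemma lin_nc_mult:
  assumes "fsupp f" "fsupp g"
  shows "lin \<phi> (f \<odot> g) = lin (\<lambda>u. lin (\<lambda>v. \<phi> (u @ v)) g) f"
  using assms(1)
proof (induction rule: fsupp_induct)
  case (add c u f)
  have "lin \<phi> (single u \<odot> g) = lin (\<lambda>v. \<phi> (u @ v)) g"
    using assms(2)
  proof (induction rule: fsupp_induct)
    case (add d v g)
    then show ?case
      by (simp add: nc_mult_add_right nc_mult_scale_right lin_add lin_scale fsupp_scale fsupp_nc_mult)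
  qed (simp)
  then show ?case
    using add assms(2)
    by (simp add: nc_mult_add_left nc_mult_scale_left lin_add lin_scale fsupp_scale fsupp_nc_mult)
qed (simp)

lemma fsupp_nc_tree [simp, intro]: "fsupp (nc_tree t)"
  by (induction t) (auto simp: nc_gen_def nc_bracket_def)

text \<open>
  Repeated use of the Jacobi identity replaces a tree that hangs on a path or on a wheel
  by the words of its associative expansion.
\<close>

lemma tree_expand:
  assumes "\<And>us s t vs. G (us @ [Br s t] @ vs) = G (us @ [s, t] @ vs) - G (us @ [t, s] @ vs)"
  shows "G (us @ [t] @ vs) = lin (\<lambda>w. G (us @ map Leaf w @ vs)) (nc_tree t)"
proof (induction t arbitrary: us vs)
  case (Leaf x)
  then show ?case by (simp add: nc_gen_def)
next
  case (Br s t)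
  have st: "G (us @ [s, t] @ vs) = lin (\<lambda>w. G (us @ map Leaf w @ vs)) (nc_tree s \<odot> nc_tree t)"
    using Br(1)[of us "[t] @ vs"] Br(2)[of "us @ map Leaf _" vs]
    by (simp add: lin_nc_mult)
  have ts: "G (us @ [t, s] @ vs) = lin (\<lambda>w. G (us @ map Leaf w @ vs)) (nc_tree t \<odot> nc_tree s)"
    using Br(2)[of us "[s] @ vs"] Br(1)[of "us @ map Leaf _" vs]
    by (simp add: lin_nc_mult)
  show ?case
    unfolding assms st ts nc_tree.simps nc_bracket_def
    by (rule lin_diff[symmetric]) (auto intro: fsupp_nc_mult)
qed

text \<open>For a non-empty word this is the right-normed bracket
  \<open>[w1, [w2, ... [w(n-1), wn]]]\<close>, its image under the Dynkin operator.\<close>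

definition rnorm :: "'a list \<Rightarrow> 'a btree" where
  "rnorm w = foldr Br (map Leaf (butlast w)) (Leaf (last w))"

lemma rnorm_append: "v \<noteq> [] \<Longrightarrow> rnorm (u @ v) = foldr Br (map Leaf u) (rnorm v)"
  by (simp add: rnorm_def butlast_append)

text \<open>\<open>foldr Br us z\<close> is the tree \<open>[u1, [u2, ... [uk, z]]]\<close>, so the
  axioms are AS and IHX at an arbitrary place of the right spine. Relations deeper inside the trees
  \<open>us\<close> then follow from Dynkin's formula.\<close>

locale lie_functional =
  fixes g :: "'a btree \<Rightarrow> 'v :: rat_module"
  assumes antisym: "g (foldr Br us (Br s t)) = - g (foldr Br us (Br t s))"
    and jacobi: "g (foldr Br us (Br (Br s t) z)) =
      g (foldr Br us (Br s (Br t z))) - g (foldr Br us (Br t (Br s z)))"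
begin

text \<open>The theorem of Dynkin, Specht and Wever.\<close>

lemma dynkin_aux:
  "of_nat (length (leaves t)) *q g (foldr Br us t) = lin (\<lambda>w. g (foldr Br us (rnorm w))) (nc_tree t)"
proof (induction t arbitrary: us)
  case (Leaf x)
  then show ?case by (simp add: nc_gen_def rnorm_def)
next
  case (Br s t)
  have ne: "v \<noteq> []" if "nc_tree r v \<noteq> 0" for v and r :: "'a btree"
    using that nc_tree_eq_0[of v r] by auto
  \<comment> \<open>The left factor is absorbed first: \<open>tree_expand\<close>, read from right
    to left along the spine, reassembles its words to the subtree \<open>s\<close>. The induction
    hypothesis for \<open>t\<close> in the context \<open>us @ [s]\<close> then contributes the
    factor \<open>length (leaves t)\<close>. The opposite product contributes the number of leaves
    of \<open>s\<close>, with a sign that antisymmetry removes.\<close>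
  have prod: "lin (\<lambda>w. g (foldr Br us (rnorm w))) (nc_tree s \<odot> nc_tree t) =
      of_nat (length (leaves t)) *q g (foldr Br us (Br s t))"
    if IH: "\<And>us. of_nat (length (leaves t)) *q g (foldr Br us t) = lin (\<lambda>w. g (foldr Br us (rnorm w))) (nc_tree t)"
    for s t
  proof -
    have "lin (\<lambda>w. g (foldr Br us (rnorm w))) (nc_tree s \<odot> nc_tree t) =
        lin (\<lambda>v. lin (\<lambda>u. g (foldr Br us (rnorm (u @ v)))) (nc_tree s)) (nc_tree t)"
      by (simp add: lin_nc_mult) (rule lin_swap)
    also have "\<dots> = lin (\<lambda>v. g (foldr Br us (Br s (rnorm v)))) (nc_tree t)"
    proof (rule lin_cong)
      fix v assume "nc_tree t v \<noteq> 0"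
      then have "v \<noteq> []" by (rule ne)
      define G where "G ls = g (foldr Br us (foldr Br ls (rnorm v)))" for ls
      have "G ([] @ [s] @ []) = lin (\<lambda>w. G ([] @ map Leaf w @ [])) (nc_tree s)"
      proof (rule tree_expand)
        fix us' s t vs
        show "G (us' @ [Br s t] @ vs) = G (us' @ [s, t] @ vs) - G (us' @ [t, s] @ vs)"
          using jacobi[of "us @ us'" s t "foldr Br vs (rnorm v)"] by (simp add: G_def)
      qed
      then show "lin (\<lambda>u. g (foldr Br us (rnorm (u @ v)))) (nc_tree s) = g (foldr Br us (Br s (rnorm v)))"
        by (simp add: G_def rnorm_append[OF \<open>v \<noteq> []\<close>])
    qed
    also have "\<dots> = of_nat (length (leaves t)) *q g (foldr Br us (Br s t))"
      using IH[of "us @ [s]"] by simp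
    finally show ?thesis .
  qed
  show ?case
    using prod[OF Br.IH(2), of s] prod[OF Br.IH(1), of t] antisym[of us t s]
    by (simp add: nc_bracket_def lin_diff fsupp_nc_mult qscale_distribs)
qed

text \<open>Dividing by the degree shows that \<open>g t\<close> depends on \<open>nc_tree t\<close>
  only, that is, on the Lie element and not on the way in which it is bracketed.\<close>

lemma dynkin: "g t = lin (\<lambda>w. (1 / of_nat (length w)) *q g (rnorm w)) (nc_tree t)"
proof -
  have "lin (\<lambda>w. (1 / of_nat (length w)) *q g (rnorm w)) (nc_tree t) =
      lin (\<lambda>w. (1 / of_nat (length (leaves t))) *q g (rnorm w)) (nc_tree t)"
    by (rule lin_cong) (metis nc_tree_eq_0)
  also have "\<dots> = g t"
    using dynkin_aux[of t "[]", symmetric] by (simp add: lin_scale_fun)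
  finally show ?thesis ..
qed

end


subsection \<open>Evaluation of series in two variables\<close>

text \<open>Words are grouped by length because \<open>gsum\<close> stops at index \<open>n\<close>
  in degree \<open>n\<close>; if all \<open>X v\<close> have order at least 1, words of length
  \<open>k\<close> have values of order at least \<open>k\<close>.\<close>

definition weval :: "(bool \<Rightarrow> 'b :: cga) \<Rightarrow> bool ncs \<Rightarrow> 'b" where
  "weval X f = gsum (\<lambda>k. \<Sum>w | length w = k. f w *q prod_list (map X w))"

fun tree_eval :: "(bool \<Rightarrow> 'b :: cga) \<Rightarrow> bool btree \<Rightarrow> 'b" where
  "tree_eval X (Leaf v) = X v"
| "tree_eval X (Br s t) = ad (tree_eval X s) (tree_eval X t)"

lemma finite_bool_words [simp]: "finite {w :: bool list. length w = k}"
  using finite_lists_length_eq[of "UNIV :: bool set" k] by simp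

context
  fixes X :: "bool \<Rightarrow> 'b :: cga"
  assumes X: "\<And>v. gord 1 (X v)"
begin

lemma gord_word: "gord (length w) (prod_list (map X w))"
proof (induction w)
  case (Cons v w)
  then show ?case using gord_mult[OF X Cons, of v] by simp
qed simp

lemma gord_weval: "gord k (\<Sum>w | length w = k. f w *q prod_list (map X w))"
  by (rule gord_sum) (use gord_word in \<open>auto intro: gord_qscale\<close>)

lemma weval_diff: "weval X (f - g) = weval X f - weval X g"
  using gsum_add[of "\<lambda>k. \<Sum>w | length w = k. f w *q prod_list (map X w)"
      "\<lambda>k. - (\<Sum>w | length w = k. g w *q prod_list (map X w))"]
  by (simp add: weval_def gsum_minus qscale_distribs sum_subtractf fun_apply)

lemma weval_mult: "weval X (f \<odot> g) = weval X f * weval X g"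
proof -
  let ?p = "\<lambda>w. prod_list (map X w)"
  have "(\<Sum>w | length w = k. (f \<odot> g) w *q ?p w) =
      (\<Sum>i\<le>k. (\<Sum>u | length u = i. f u *q ?p u) * (\<Sum>v | length v = k - i. g v *q ?p v))" for k
  proof -
    have "(\<Sum>w | length w = k. (f \<odot> g) w *q ?p w) =
        (\<Sum>w | length w = k. \<Sum>i\<le>k. (f (take i w) * g (drop i w)) *q (?p (take i w) * ?p (drop i w)))"
      by (rule sum.cong) (auto simp: nc_mult_def qvs.scale_sum_left simp flip: prod_list.append map_append)
    also have "\<dots> = (\<Sum>i\<le>k. \<Sum>w | length w = k. (f (take i w) * g (drop i w)) *q (?p (take i w) * ?p (drop i w)))"
      by (rule sum.swap)
    also have "\<dots> = (\<Sum>i\<le>k. \<Sum>(u, v)\<in>{u. length u = i} \<times> {v. length v = k - i}. (f u * g v) *q (?p u * ?p v))"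
    proof (rule sum.cong[OF refl])
      fix i assume "i \<in> {..k}"
      then show "(\<Sum>w | length w = k. (f (take i w) * g (drop i w)) *q (?p (take i w) * ?p (drop i w))) =
          (\<Sum>(u, v)\<in>{u. length u = i} \<times> {v. length v = k - i}. (f u * g v) *q (?p u * ?p v))"
        by (intro sum.reindex_bij_witness[of _ "\<lambda>(u, v). u @ v" "\<lambda>w. (take i w, drop i w)"]) auto
    qed
    finally show ?thesis
      by (simp add: sum_product sum.cartesian_product case_prod_beta mult.commute[of "g _"])
  qed
  then show ?thesis
    unfolding weval_def gsum_mult[OF gord_weval gord_weval] by simp
qed

lemma weval_one: "weval X nc_one = 1"
proof -
  have "(\<Sum>w | length w = k. nc_one w *q prod_list (map X w)) = (if k = 0 then 1 else 0)" for k
    by (auto simp: nc_one_def single_def intro!: sum.neutral)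
  then show ?thesis
    by (simp add: weval_def gsum_single)
qed

lemma weval_gen: "weval X (nc_gen v) = X v"
proof (rule gpart_ext)
  fix n
  have *: "(\<Sum>w | length w = k. nc_gen v w *q prod_list (map X w)) = (if k = 1 then X v else 0)" for k
  proof -
    have "(\<Sum>w | length w = k. nc_gen v w *q prod_list (map X w)) =
        (\<Sum>w | length w = k. if w = [v] then X v else 0)"
      by (rule sum.cong) (auto simp: nc_gen_def single_def)
    then show ?thesis by auto
  qed
  show "gpart n (weval X (nc_gen v)) = gpart n (X v)"
    using gordD[OF X, of 0 v]
    by (cases n) (simp_all add: weval_def gpart_gsum * if_distrib[of "gpart _"] cong: if_cong)
qed

lemma weval_nc_tree: "weval X (nc_tree t) = tree_eval X t"
  by (induction t) (simp_all add: weval_gen nc_bracket_def weval_diff weval_mult ad_def)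

lemma weval_nc_pow: "weval X (nc_pow f n) = weval X f ^ n"
  by (induction n) (simp_all add: weval_one weval_mult)

lemma weval_nc_exp:
  assumes "f [] = 0"
  shows "weval X (nc_exp f) = gexp (weval X f)"
proof (rule gpart_ext)
  fix n
  \<comment> \<open>\<open>nc_exp\<close> stops at the length of the word. Higher powers vanish on
    the word since \<open>f\<close> has no constant term, so one bound can be used for all words
    that matter in degree \<open>n\<close>.\<close>
  have z: "nc_pow f m w = 0" if "length w < m" for m w
  proof -
    have "gord m (Series_of f ^ m)"
      using assms by (intro gord_power) (unfold gord_1_nca_iff, simp add: series_of_simps)
    then have "series_of (gpart (length w) (Series_of f ^ m)) = 0"
      using that by (simp add: gordD series_of_simps)
    then show ?thesis
      by (simp add: series_of_simps series_of_power nc_part_def fun_eq_iff fun_apply split: if_splits)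
  qed
  have "nc_exp f w = (\<Sum>m\<le>n. (1 / fact m) * nc_pow f m w)" if "length w \<le> n" for w
  proof -
    have "nc_exp f w = (\<Sum>m\<le>length w. (1 / fact m) * nc_pow f m w)"
      by (simp add: nc_exp_def)
    also have "\<dots> = (\<Sum>m\<le>n. (1 / fact m) * nc_pow f m w)"
      by (rule sum.mono_neutral_left) (use that z in auto)
    finally show ?thesis .
  qed
  then have "gpart n (weval X (nc_exp f)) =
      (\<Sum>k\<le>n. \<Sum>w | length w = k. \<Sum>m\<le>n. (1 / fact m) *q nc_pow f m w *q gpart n (prod_list (map X w)))"
    by (simp add: weval_def gpart_gsum gpart_sum gpart_qscale qvs.scale_sum_left)
  also have "\<dots> = (\<Sum>m\<le>n. \<Sum>k\<le>n. \<Sum>w | length w = k. (1 / fact m) *q nc_pow f m w *q gpart n (prod_list (map X w)))"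
    by (simp only: sum.swap[of _ "{..n}" "{w. length w = _}"]) (rule sum.swap)
  also have "\<dots> = (\<Sum>m\<le>n. (1 / fact m) *q gpart n (weval X (nc_pow f m)))"
    by (simp add: weval_def gpart_gsum gpart_sum gpart_qscale qvs.scale_sum_right)
  finally show "gpart n (weval X (nc_exp f)) = gpart n (gexp (weval X f))"
    by (simp add: gexp_def gpart_gsum gpart_qscale weval_nc_pow)
qed

text \<open>Evaluation sends brackets to commutators, so the words can be regrouped by the trees
  from which they come. The bound on the leaves is the one in \<open>BCH_tb\<close>.\<close>

lemma gpart_weval_nc_trees:
  "gpart n (weval X (nc_trees T)) = (\<Sum>t | length (leaves t) \<le> n. T t *q gpart n (tree_eval X t))"
proof -
  let ?p = "\<lambda>w. gpart n (prod_list (map X w))"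
  have fin: "finite {t :: bool btree. length (leaves t) = k}" for k
    using finite_trees[of "UNIV :: bool set" k] by simp
  have tree: "(\<Sum>w | length w = length (leaves t). nc_tree t w *q ?p w) = gpart n (tree_eval X t)"
    if "length (leaves t) \<le> n" for t
  proof -
    have "(\<Sum>w | length w = k. nc_tree t w *q ?p w) =
        (if k = length (leaves t) then (\<Sum>w | length w = length (leaves t). nc_tree t w *q ?p w) else 0)" for k
      by (auto simp: nc_tree_eq_0)
    then have "gpart n (weval X (nc_tree t)) = (\<Sum>k\<le>n. if k = length (leaves t) then
        (\<Sum>w | length w = length (leaves t). nc_tree t w *q ?p w) else 0)"
      by (simp add: weval_def gpart_gsum gpart_sum gpart_qscale)
    then show ?thesis using that by (simp add: weval_nc_tree)
  qed
  have "gpart n (weval X (nc_trees T)) =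
      (\<Sum>k\<le>n. \<Sum>w | length w = k. \<Sum>t | length (leaves t) = k. (T t * nc_tree t w) *q ?p w)"
  proof -
    have "nc_trees T w = (\<Sum>t | length (leaves t) = k. T t * nc_tree t w)" if "length w = k" for w k
      unfolding nc_trees_def using that
      by (intro sum.mono_neutral_left) (use fin in auto)
    then show ?thesis
      by (simp add: weval_def gpart_gsum gpart_sum gpart_qscale qvs.scale_sum_left)
  qed
  also have "\<dots> = (\<Sum>k\<le>n. \<Sum>t | length (leaves t) = k. \<Sum>w | length w = k. (T t * nc_tree t w) *q ?p w)"
    by (intro sum.cong refl sum.swap)
  also have "\<dots> = (\<Sum>k\<le>n. \<Sum>t | length (leaves t) = k. T t *q gpart n (tree_eval X t))"
    by (intro sum.cong refl) (auto simp flip: tree simp: qvs.scale_sum_right)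
  also have "\<dots> = (\<Sum>(k, t)\<in>(SIGMA k:{..n}. {t. length (leaves t) = k}). T t *q gpart n (tree_eval X t))"
    by (rule sum.Sigma) (use fin in auto)
  also have "\<dots> = (\<Sum>t | length (leaves t) \<le> n. T t *q gpart n (tree_eval X t))"
    by (rule sum.reindex_bij_witness[of _ "\<lambda>t. (length (leaves t), t)" snd]) auto
  finally show ?thesis .
qed

end

lemma nc_gen_Nil [simp]: "nc_gen x [] = 0"
  by (simp add: nc_gen_def single_def)

text \<open>The identity in two free variables is transported by evaluation. \<open>Z\<close> is
  described by its parts so that the trees may first be evaluated in another Lie algebra:
  \<open>BCH_tb\<close> uses the bracket on \<open>FL(S)^S\<close>, which is mapped to
  commutators.\<close>

lemma gexp_mult_gexp_bch:
  assumes "\<And>v. gord 1 (X v)" "nc_trees T = bch_series"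
    and "\<And>n. gpart n Z = (\<Sum>t | length (leaves t) \<le> n. T t *q gpart n (tree_eval X t))"
  shows "gexp (X False) * gexp (X True) = gexp Z"
proof -
  have "weval X (nc_exp bch_series) = gexp (X False) * gexp (X True)"
    unfolding nc_exp_bch_series
    by (simp add: weval_mult[of X, OF assms(1)] weval_nc_exp[of X, OF assms(1)] weval_gen[of X, OF assms(1)])
  moreover have "weval X (nc_exp bch_series) = gexp (weval X bch_series)"
    by (rule weval_nc_exp) (simp_all only: assms(1) bch_series_Nil)
  moreover have "weval X bch_series = Z"
    by (rule gpart_ext) (simp add: assms(3) gpart_weval_nc_trees[of X, OF assms(1)] flip: assms(2))
  ultimately show ?thesis by simp
qed

section \<open>Arrow diagrams as lists of labelled ends, with one set of relations for all
  skeleta\<close>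

section \<open>Linearised arrow diagrams\<close>

text \<open>
  A list of ends, each with the label of its strand, determines the strands as sublists. Ends on
  different strands may be exchanged in the list without changing the diagram.
\<close>

type_synonym 'a items = "('a \<times> arrow_end) list"
type_synonym vertices = "(edge \<times> edge \<times> edge) multiset"

definition ld :: "'a items \<Rightarrow> vertices \<Rightarrow> 'a diagram" where
  "ld its V = Diagram (\<lambda>b. map snd (filter (\<lambda>i. fst i = b) its)) V"

definition ends :: "'a items \<Rightarrow> arrow_end multiset" where
  "ends its = mset (map snd its)"

lemma ends_simps [simp]: "ends [] = {#}" "ends (i # its) = {#snd i#} + ends its"
  "ends (its @ its') = ends its + ends its'" "ends (rev its) = ends its"
  by (simp_all add: ends_def)

abbreviation hds :: "arrow_end multiset \<Rightarrow> edge multiset" where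
  "hds E \<equiv> image_mset end_edge (filter_mset is_head E)"

abbreviation tls :: "arrow_end multiset \<Rightarrow> edge multiset" where
  "tls E \<equiv> image_mset end_edge (filter_mset (Not \<circ> is_head) E)"

definition outs :: "vertices \<Rightarrow> edge multiset" where
  "outs V = image_mset (\<lambda>(p, q, r). r) V"

definition ins :: "vertices \<Rightarrow> edge multiset" where
  "ins V = image_mset (\<lambda>(p, q, r). p) V + image_mset (\<lambda>(p, q, r). q) V"

lemma outs_simps [simp]: "outs {#} = {#}" "outs (add_mset (p, q, r) V) = add_mset r (outs V)"
  "outs (V + W) = outs V + outs W"
  by (simp_all add: outs_def)

lemma ins_simps [simp]: "ins {#} = {#}" "ins (add_mset (p, q, r) V) = {#p, q#} + ins V"
  "ins (V + W) = ins V + ins W"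
  by (simp_all add: ins_def)

definition lnk :: "vertices \<Rightarrow> (edge \<times> edge) set" where
  "lnk V = {(e, e'). \<exists>p q r. (p, q, r) \<in># V \<and> {e, e'} \<subseteq> {p, q, r}}"

definition names :: "arrow_end multiset \<Rightarrow> vertices \<Rightarrow> edge set" where
  "names E V = set_mset (tls E + outs V)"

text \<open>The conditions of \<open>arrow_diagram\<close> except the one on strand labels. They
  depend on the ends only through their multiset, so permuting or relabelling ends needs no new
  check.\<close>

definition agood :: "arrow_end multiset \<Rightarrow> vertices \<Rightarrow> bool" where
  "agood E V \<longleftrightarrow> (\<forall>e. count (tls E + outs V) e \<le> 1) \<and> tls E + outs V = hds E + ins V \<and>
     (\<forall>e\<in>names E V. \<exists>e'. (e, e') \<in> (lnk V)\<^sup>* \<and> e' \<in># hds E + tls E)"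

lemma sum_strands:
  assumes "finite A" "fst ` set its \<subseteq> A"
  shows "(\<Sum>a\<in>A. mset (map f (filter P (map snd (filter (\<lambda>i. fst i = a) its))))) =
    image_mset f (filter_mset P (ends its))"
  using assms(2)
proof (induction its)
  case (Cons i its)
  have "(\<Sum>a\<in>A. mset (map f (filter P (map snd (filter (\<lambda>i. fst i = a) (i # its)))))) =
     (\<Sum>a\<in>A. (if a = fst i then image_mset f (filter_mset P {#snd i#}) else {#}) +
       mset (map f (filter P (map snd (filter (\<lambda>i. fst i = a) its)))))"
    by (rule sum.cong) auto
  also have "\<dots> = image_mset f (filter_mset P {#snd i#}) + image_mset f (filter_mset P (ends its))"
    using Cons assms(1) by (subst sum.distrib) simp
  finally show ?case by simp
qed simp

lemma strand_ld: "strand (ld its V) b = map snd (filter (\<lambda>i. fst i = b) its)"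
  and verts_ld [simp]: "verts (ld its V) = V"
  by (simp_all add: ld_def)

lemma strand_ld_empty_iff: "strand (ld its V) b = [] \<longleftrightarrow> b \<notin> fst ` set its"
  by (auto simp: strand_ld filter_empty_conv)

lemma support_ld: "{b. strand (ld its V) b \<noteq> []} = fst ` set its"
  by (auto simp: strand_ld_empty_iff)

lemma heads_ld: "heads (ld its V) = hds (ends its)"
  unfolding heads_def support_ld unfolding strand_ld by (rule sum_strands) auto

lemma tails_ld: "tails (ld its V) = tls (ends its)"
  unfolding tails_def support_ld unfolding strand_ld by (rule sum_strands) auto

lemma sources_ld: "sources (ld its V) = tls (ends its) + outs V"
  by (simp add: sources_def tails_ld outs_def)

lemma arrow_diagram_ld: "arrow_diagram S (ld its V) \<longleftrightarrow> fst ` set its \<subseteq> S \<and> agood (ends its) V"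
proof -
  have "(\<forall>a. a \<notin> S \<longrightarrow> strand (ld its V) a = []) \<longleftrightarrow> fst ` set its \<subseteq> S"
    by (auto simp: strand_ld_empty_iff)
  moreover have "targets (ld its V) = hds (ends its) + ins V"
    by (simp add: targets_def heads_ld ins_def)
  ultimately show ?thesis
    by (simp add: arrow_diagram_def agood_def names_def sources_ld heads_ld tails_ld linked_def lnk_def)
qed

lemma size_outs [simp]: "size (outs V) = size V"
  by (simp add: outs_def)

lemma size_ins [simp]: "size (ins V) = 2 * size V"
  by (simp add: ins_def)

text \<open>Counting sources and targets gives
  \<open>tails + vertices = heads + 2 * vertices\<close>, where \<open>vertices\<close> are the
  trivalent ones; hence half of all vertices, ends included, is the number of tails.\<close>

lemma degree_ld: "agood (ends its) V \<Longrightarrow> degree (ld its V) = size (tls (ends its))"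
proof -
  assume "agood (ends its) V"
  then have "size (tls (ends its) + outs V) = size (hds (ends its) + ins V)"
    by (simp add: agood_def)
  then show ?thesis
    by (simp add: degree_def heads_ld tails_ld)
qed

lemma ld_swap: "a \<noteq> b \<Longrightarrow> ld (us @ (a, x) # (b, y) # vs) V = ld (us @ (b, y) # (a, x) # vs) V"
  by (auto simp: ld_def)

lemma linearise:
  assumes "finite {b. s b \<noteq> []}"
  shows "\<exists>its. (\<forall>b. map snd (filter (\<lambda>i. fst i = b) its) = s b)"
proof -
  have "\<exists>its. \<forall>b. map snd (filter (\<lambda>i. fst i = b) its) = (if b \<in> A then s b else [])" if "finite A" for A
    using that
  proof (induction A)
    case (insert a A)
    then obtain its where its: "\<And>b. map snd (filter (\<lambda>i. fst i = b) its) = (if b \<in> A then s b else [])"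
      by blast
    have "map snd (filter (\<lambda>i. fst i = b) (map (Pair a) (s a) @ its)) = (if b \<in> insert a A then s b else [])" for b
      using its[of b] insert.hyps(2) by (cases "a = b") (auto simp: filter_map o_def)
    then show ?case by blast
  qed (auto intro: exI[of _ "[]"])
  from this[OF assms] obtain its where
    "\<And>b. map snd (filter (\<lambda>i. fst i = b) its) = (if b \<in> {b. s b \<noteq> []} then s b else [])"
    by blast
  then have "map snd (filter (\<lambda>i. fst i = b) its) = s b" for b
    by (cases "s b") simp_all
  then show ?thesis by blast
qed

lemma linearise_ld: "finite {b. s b \<noteq> []} \<Longrightarrow> \<exists>its. \<forall>V. Diagram s V = ld its V"
proof -
  assume "finite {b. s b \<noteq> []}"
  from linearise[OF this] obtain its where "\<forall>b. map snd (filter (\<lambda>i. fst i = b) its) = s b" ..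
  then have "\<forall>V. Diagram s V = ld its V"
    by (simp add: ld_def)
  then show ?thesis ..
qed

text \<open>\<open>us\<close> and \<open>vs\<close> are chosen before \<open>mid\<close> and
  \<open>V\<close>, so that all diagrams of one relation are linearised in the same way.\<close>

lemma linearise_at:
  assumes "finite {b. s b \<noteq> []}"
  shows "\<exists>us vs. \<forall>mid V. Diagram (s(a := xs @ mid @ ys)) V = ld (us @ map (Pair a) mid @ vs) V"
proof -
  have "finite {b. (s(a := [])) b \<noteq> []}"
    using assms by (rule finite_subset[rotated]) auto
  from linearise[OF this] obtain its where
    its: "\<And>b. map snd (filter (\<lambda>i. fst i = b) its) = (s(a := [])) b" by blast
  have "Diagram (s(a := xs @ mid @ ys)) V = ld ((its @ map (Pair a) xs) @ map (Pair a) mid @ map (Pair a) ys) V" for mid V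
    using its by (auto simp: ld_def fun_eq_iff filter_map o_def)
  then show ?thesis by blast
qed

definition ren_items :: "(edge \<Rightarrow> edge) \<Rightarrow> 'a items \<Rightarrow> 'a items" where
  "ren_items \<pi> its = map (\<lambda>(a, x). (a, map_end \<pi> x)) its"

definition ren_verts :: "(edge \<Rightarrow> edge) \<Rightarrow> vertices \<Rightarrow> vertices" where
  "ren_verts \<pi> V = image_mset (\<lambda>(p, q, r). (\<pi> p, \<pi> q, \<pi> r)) V"

lemma ren_items_simps [simp]: "ren_items \<pi> [] = []"
  "ren_items \<pi> ((a, x) # its) = (a, map_end \<pi> x) # ren_items \<pi> its"
  "ren_items \<pi> (its @ its') = ren_items \<pi> its @ ren_items \<pi> its'"
  "fst ` set (ren_items \<pi> its) = fst ` set its"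
  by (simp_all add: ren_items_def image_image case_prod_beta)

lemma ren_verts_simps [simp]: "ren_verts \<pi> {#} = {#}"
  "ren_verts \<pi> (add_mset (p, q, r) V) = add_mset (\<pi> p, \<pi> q, \<pi> r) (ren_verts \<pi> V)"
  "ren_verts \<pi> (V + W) = ren_verts \<pi> V + ren_verts \<pi> W"
  by (simp_all add: ren_verts_def)

lemma rename_ld: "rename_edges \<pi> (ld its V) = ld (ren_items \<pi> its) (ren_verts \<pi> V)"
  by (auto simp: rename_edges_def ld_def ren_items_def ren_verts_def filter_map o_def case_prod_beta fun_eq_iff)

lemma ends_ren: "ends (ren_items \<pi> its) = image_mset (map_end \<pi>) (ends its)"
  by (simp add: ends_def ren_items_def case_prod_beta image_mset.compositionality o_def)

lemma map_end_simps [simp]: "end_edge (map_end \<pi> x) = \<pi> (end_edge x)" "is_head (map_end \<pi> x) = is_head x"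
  by (cases x; simp)+

lemma hds_ren: "hds (image_mset (map_end \<pi>) E) = image_mset \<pi> (hds E)"
  and tls_ren: "tls (image_mset (map_end \<pi>) E) = image_mset \<pi> (tls E)"
  by (simp_all add: filter_mset_image_mset image_mset.compositionality o_def)

lemma outs_ren: "outs (ren_verts \<pi> V) = image_mset \<pi> (outs V)"
  and ins_ren: "ins (ren_verts \<pi> V) = image_mset \<pi> (ins V)"
  by (simp_all add: outs_def ins_def ren_verts_def image_mset.compositionality o_def case_prod_beta)

lemma lnk_ren: "(e, e') \<in> (lnk V)\<^sup>* \<Longrightarrow> (\<pi> e, \<pi> e') \<in> (lnk (ren_verts \<pi> V))\<^sup>*"
proof (induction rule: rtrancl_induct)
  case (step y z)
  then obtain p q r where "(p, q, r) \<in># V" "{y, z} \<subseteq> {p, q, r}"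
    by (auto simp: lnk_def)
  then have "(\<pi> p, \<pi> q, \<pi> r) \<in># ren_verts \<pi> V" "{\<pi> y, \<pi> z} \<subseteq> {\<pi> p, \<pi> q, \<pi> r}"
    by (force simp: ren_verts_def)+
  then have "(\<pi> y, \<pi> z) \<in> lnk (ren_verts \<pi> V)"
    by (auto simp: lnk_def)
  with step.IH show ?case by (rule rtrancl_into_rtrancl)
qed simp

lemma names_ren: "names (image_mset (map_end \<pi>) E) (ren_verts \<pi> V) = \<pi> ` names E V"
  by (auto simp: names_def tls_ren outs_ren)

lemma count_le_1_image:
  assumes "\<forall>e. count M e \<le> 1" "inj_on f (set_mset M)"
  shows "\<forall>e. count (image_mset f M) e \<le> 1"
proof
  fix e
  show "count (image_mset f M) e \<le> 1"
  proof (cases "e \<in> f ` set_mset M")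
    case True
    then obtain x where x: "x \<in># M" "e = f x" by auto
    then have "f -` {e} \<inter> set_mset M = {x}"
      using assms(2) by (auto dest: inj_onD)
    then have "count (image_mset f M) e = count M x"
      by (simp add: count_image_mset)
    then show ?thesis using assms(1) by simp
  next
    case False
    then have "e \<notin># image_mset f M" by auto
    then have "count (image_mset f M) e = 0" by (simp only: not_in_iff)
    then show ?thesis by simp
  qed
qed

lemma agood_ren:
  assumes "agood E V" "inj_on \<pi> (names E V)"
  shows "agood (image_mset (map_end \<pi>) E) (ren_verts \<pi> V)"
  unfolding agood_def names_ren
proof (intro conjI)
  have *: "tls (image_mset (map_end \<pi>) E) + outs (ren_verts \<pi> V) = image_mset \<pi> (tls E + outs V)"
    by (simp add: tls_ren outs_ren)
  show "\<forall>e. count (tls (image_mset (map_end \<pi>) E) + outs (ren_verts \<pi> V)) e \<le> 1"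
    unfolding * using assms unfolding agood_def names_def by (intro count_le_1_image) blast+
  show "tls (image_mset (map_end \<pi>) E) + outs (ren_verts \<pi> V) =
      hds (image_mset (map_end \<pi>) E) + ins (ren_verts \<pi> V)"
    unfolding * using assms(1) by (simp add: agood_def hds_ren ins_ren)
  show "\<forall>e\<in>\<pi> ` names E V. \<exists>e'. (e, e') \<in> (lnk (ren_verts \<pi> V))\<^sup>* \<and>
      e' \<in># hds (image_mset (map_end \<pi>) E) + tls (image_mset (map_end \<pi>) E)"
  proof
    fix e assume "e \<in> \<pi> ` names E V"
    then obtain x where x: "x \<in> names E V" "e = \<pi> x" by auto
    then obtain y where "(x, y) \<in> (lnk V)\<^sup>*" "y \<in># hds E + tls E"
      using assms(1) by (auto simp: agood_def)
    then show "\<exists>e'. (e, e') \<in> (lnk (ren_verts \<pi> V))\<^sup>* \<and>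
        e' \<in># hds (image_mset (map_end \<pi>) E) + tls (image_mset (map_end \<pi>) E)"
      using lnk_ren x(2) by (intro exI[of _ "\<pi> y"]) (auto simp: hds_ren tls_ren)
  qed
qed

lemma lnk_mono: "V \<subseteq># W \<Longrightarrow> (lnk V)\<^sup>* \<subseteq> (lnk W)\<^sup>*"
  by (rule rtrancl_mono) (auto simp: lnk_def dest: mset_subset_eqD)

lemma agood_union:
  assumes "agood E V" "agood E' V'" "names E V \<inter> names E' V' = {}"
  shows "agood (E + E') (V + V')"
  unfolding agood_def
proof (intro conjI allI ballI)
  fix e
  have "count (tls E + outs V) e \<le> 1" "count (tls E' + outs V') e \<le> 1"
    using assms(1,2) unfolding agood_def by blast+
  moreover have "e \<notin># tls E + outs V \<or> e \<notin># tls E' + outs V'"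
    using assms(3) unfolding names_def by blast
  then have "count (tls E + outs V) e = 0 \<or> count (tls E' + outs V') e = 0"
    by (simp only: not_in_iff)
  ultimately have "count (tls E + outs V) e + count (tls E' + outs V') e \<le> 1"
    by linarith
  then show "count (tls (E + E') + outs (V + V')) e \<le> 1"
    by simp
next
  have "tls E + outs V = hds E + ins V" "tls E' + outs V' = hds E' + ins V'"
    using assms by (auto simp: agood_def)
  then show "tls (E + E') + outs (V + V') = hds (E + E') + ins (V + V')"
    by (simp add: ac_simps) (metis (no_types, lifting) union_assoc union_lcomm)
next
  fix e assume "e \<in> names (E + E') (V + V')"
  then have "e \<in> names E V \<or> e \<in> names E' V'"
    by (auto simp: names_def)
  then have "\<exists>e'. (e, e') \<in> (lnk V)\<^sup>* \<union> (lnk V')\<^sup>* \<and> e' \<in># hds (E + E') + tls (E + E')"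
  proof
    assume "e \<in> names E V"
    with assms(1) obtain e' where "(e, e') \<in> (lnk V)\<^sup>*" "e' \<in># hds E + tls E"
      by (auto simp: agood_def)
    then show ?thesis by (intro exI[of _ e']) auto
  next
    assume "e \<in> names E' V'"
    with assms(2) obtain e' where "(e, e') \<in> (lnk V')\<^sup>*" "e' \<in># hds E' + tls E'"
      by (auto simp: agood_def)
    then show ?thesis by (intro exI[of _ e']) auto
  qed
  then show "\<exists>e'. (e, e') \<in> (lnk (V + V'))\<^sup>* \<and> e' \<in># hds (E + E') + tls (E + E')"
    using lnk_mono[of V "V + V'"] lnk_mono[of V' "V + V'"] by auto
qed

lemma agood_change_verts:
  assumes "agood E V" "outs V' = outs V" "ins V' = ins V" "lnk V \<subseteq> (lnk V')\<^sup>*"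
  shows "agood E V'"
proof -
  have "(lnk V)\<^sup>* \<subseteq> (lnk V')\<^sup>*"
    using assms(4) rtrancl_subset_rtrancl by blast
  then show ?thesis
    using assms(1-3) unfolding agood_def names_def by (metis (no_types, lifting) subsetD)
qed

lemma agood_AS: "agood E (V + {#(p, q, r)#}) \<Longrightarrow> agood E (V + {#(q, p, r)#})"
  by (erule agood_change_verts) (auto simp: lnk_def add_mset_commute)

text \<open>The relation rotates \<open>p\<close>, \<open>q\<close>, \<open>r\<close>, so only
  connectivity has to be checked, and after the rotation the five edges are still joined through
  \<open>x\<close>. A second application gives the third diagram of the relation.\<close>

lemma agood_IHX:
  assumes "agood E (V + {#(p, q, x), (x, r, y)#})"
  shows "agood E (V + {#(q, r, x), (x, p, y)#})"
  using assms
proof (rule agood_change_verts)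
  let ?W = "V + {#(q, r, x), (x, p, y)#}"
  have t: "(a, b) \<in> lnk ?W" if "{a, b} \<subseteq> {q, r, x} \<or> {a, b} \<subseteq> {x, p, y}" for a b
    using that unfolding lnk_def by auto
  have all: "(a, b) \<in> (lnk ?W)\<^sup>*" if "{a, b} \<subseteq> {p, q, r, x, y}" for a b
  proof -
    have "(a, x) \<in> lnk ?W"
      by (rule t) (use that in auto)
    moreover have "(x, b) \<in> lnk ?W"
      by (rule t) (use that in auto)
    ultimately show ?thesis by (meson converse_rtrancl_into_rtrancl r_into_rtrancl)
  qed
  show "lnk (V + {#(p, q, x), (x, r, y)#}) \<subseteq> (lnk ?W)\<^sup>*"
  proof (rule subrelI)
    fix a b assume "(a, b) \<in> lnk (V + {#(p, q, x), (x, r, y)#})"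
    then obtain u v w where uvw: "(u, v, w) \<in># V + {#(p, q, x), (x, r, y)#}" "{a, b} \<subseteq> {u, v, w}"
      by (auto simp: lnk_def)
    show "(a, b) \<in> (lnk ?W)\<^sup>*"
    proof (cases "(u, v, w) \<in># V")
      case True
      then have "(a, b) \<in> lnk ?W"
        using uvw(2) unfolding lnk_def by auto
      then show ?thesis ..
    next
      case False
      then show ?thesis using uvw by (intro all) auto
    qed
  qed
qed auto


subsection \<open>Relations between linearised diagrams\<close>

text \<open>No label set occurs, in contrast to \<open>relators\<close>. All skeleta thus share one
  quotient, in which stacking and side by side placement are the same product and operations may
  change the set of strands.\<close>

inductive_set ldrel :: "('a diagram \<Rightarrow> rat) set" where
  iso: "agood (ends its) V \<Longrightarrow> inj_on \<pi> (names (ends its) V) \<Longrightarrow>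
    single (ld its V) - single (ld (ren_items \<pi> its) (ren_verts \<pi> V)) \<in> ldrel"
| AS: "agood (ends its) (V + {#(p, q, r)#}) \<Longrightarrow>
    single (ld its (V + {#(p, q, r)#})) + single (ld its (V + {#(q, p, r)#})) \<in> ldrel"
| IHX: "agood (ends its) (V + {#(p, q, x), (x, r, y)#}) \<Longrightarrow>
    single (ld its (V + {#(p, q, x), (x, r, y)#})) + single (ld its (V + {#(q, r, x), (x, p, y)#})) +
    single (ld its (V + {#(r, p, x), (x, q, y)#})) \<in> ldrel"
| STU1: "agood (ends (us @ [(a, Head p), (a, Head q)] @ vs)) V \<Longrightarrow>
    agood (ends (us @ [(a, Head e)] @ vs)) (V + {#(p, q, e)#}) \<Longrightarrow>
    single (ld (us @ [(a, Head p), (a, Head q)] @ vs) V) -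
    single (ld (us @ [(a, Head q), (a, Head p)] @ vs) V) -
    single (ld (us @ [(a, Head e)] @ vs) (V + {#(p, q, e)#})) \<in> ldrel"
| STU2: "agood (ends (us @ [(a, Head p), (a, Tail e)] @ vs)) V \<Longrightarrow>
    agood (ends (us @ [(a, Tail f)] @ vs)) (V + {#(f, p, e)#}) \<Longrightarrow>
    single (ld (us @ [(a, Head p), (a, Tail e)] @ vs) V) -
    single (ld (us @ [(a, Tail e), (a, Head p)] @ vs) V) -
    single (ld (us @ [(a, Tail f)] @ vs) (V + {#(f, p, e)#})) \<in> ldrel"
| TC: "agood (ends (us @ [(a, Tail d), (a, Tail e)] @ vs)) V \<Longrightarrow>
    single (ld (us @ [(a, Tail d), (a, Tail e)] @ vs) V) -
    single (ld (us @ [(a, Tail e), (a, Tail d)] @ vs) V) \<in> ldrel"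

definition good :: "'a diagram \<Rightarrow> bool" where
  "good D \<longleftrightarrow> (\<exists>its V. D = ld its V \<and> agood (ends its) V)"

lemma good_ld: "good (ld its V) \<longleftrightarrow> agood (ends its) V"
proof
  assume "good (ld its V)"
  then obtain its' where its': "ld its V = ld its' V" "agood (ends its') V"
    unfolding good_def by (metis verts_ld)
  then have "arrow_diagram UNIV (ld its V)"
    by (simp add: arrow_diagram_ld)
  then show "agood (ends its) V"
    by (simp add: arrow_diagram_ld)
qed (auto simp: good_def)

lemma finite_support_arrow_diagram:
  "finite S \<Longrightarrow> arrow_diagram S (Diagram s V) \<Longrightarrow> finite {b. s b \<noteq> []}"
  by (rule finite_subset[of _ S]) (auto simp: arrow_diagram_def)

lemma arrow_diagram_eq_ld:
  assumes "finite S" "arrow_diagram S D"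
  shows "\<exists>its. D = ld its (verts D) \<and> fst ` set its \<subseteq> S \<and> agood (ends its) (verts D)"
proof -
  have "D = Diagram (strand D) (verts D)" by simp
  moreover from this have "finite {b. strand D b \<noteq> []}"
    using assms finite_support_arrow_diagram by metis
  ultimately obtain its where "D = ld its (verts D)"
    using linearise_ld by metis
  then show ?thesis
    using assms(2) arrow_diagram_ld by metis
qed

lemma arrow_diagram_imp_good: "finite S \<Longrightarrow> arrow_diagram S D \<Longrightarrow> good D"
  using arrow_diagram_eq_ld unfolding good_def by blast

lemma relators_subset_ldrel:
  assumes "finite S"
  shows "relators S \<subseteq> ldrel"
proof
  fix r assume "r \<in> relators S"
  then show "r \<in> ldrel"
  proof cases
    case (iso D \<pi>)
    from arrow_diagram_eq_ld[OF assms iso(2)] obtain its where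
      its: "D = ld its (verts D)" "agood (ends its) (verts D)" by blast
    have "edges D = names (ends its) (verts D)"
      by (subst its(1)) (simp add: sources_ld names_def)
    then have "single (ld its (verts D)) - single (ld (ren_items \<pi> its) (ren_verts \<pi> (verts D))) \<in> ldrel"
      using its iso(3) by (intro ldrel.iso) auto
    then show ?thesis
      unfolding iso(1) rename_ld[symmetric] its(1)[symmetric] .
  next
    case (AS s V p q r)
    obtain its where its: "\<And>V. Diagram s V = ld its V"
      using linearise_ld[OF finite_support_arrow_diagram[OF assms AS(2)]] by blast
    show ?thesis
      using AS(2) unfolding AS(1) its by (intro ldrel.AS) (simp add: arrow_diagram_ld)
  next
    case (IHX s V p q x r y)
    obtain its where its: "\<And>V. Diagram s V = ld its V"
      using linearise_ld[OF finite_support_arrow_diagram[OF assms IHX(2)]] by blast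
    show ?thesis
      using IHX(2) unfolding IHX(1) its by (intro ldrel.IHX) (simp add: arrow_diagram_ld)
  next
    case (STU1 s a xs p q ys V e)
    have "finite {b. s b \<noteq> []}"
      using finite_support_arrow_diagram[OF assms STU1(2)]
      by (rule finite_subset[rotated, OF finite.insertI[of _ a]]) (auto split: if_splits)
    from linearise_at[OF this, of a xs ys] obtain us vs where
      *: "\<And>mid V. Diagram (s(a := xs @ mid @ ys)) V = ld (us @ map (Pair a) mid @ vs) V" by blast
    show ?thesis
      using STU1(2,3) ldrel.STU1[of us a p q vs V e] unfolding STU1(1) * by (simp add: arrow_diagram_ld)
  next
    case (STU2 s a xs p e ys V f)
    have "finite {b. s b \<noteq> []}"
      using finite_support_arrow_diagram[OF assms STU2(2)]
      by (rule finite_subset[rotated, OF finite.insertI[of _ a]]) (auto split: if_splits)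
    from linearise_at[OF this, of a xs ys] obtain us vs where
      *: "\<And>mid V. Diagram (s(a := xs @ mid @ ys)) V = ld (us @ map (Pair a) mid @ vs) V" by blast
    show ?thesis
      using STU2(2,3) ldrel.STU2[of us a p e vs V f] unfolding STU2(1) * by (simp add: arrow_diagram_ld)
  next
    case (TC s a xs d e ys V)
    have "finite {b. s b \<noteq> []}"
      using finite_support_arrow_diagram[OF assms TC(2)]
      by (rule finite_subset[rotated, OF finite.insertI[of _ a]]) (auto split: if_splits)
    from linearise_at[OF this, of a xs ys] obtain us vs where
      *: "\<And>mid V. Diagram (s(a := xs @ mid @ ys)) V = ld (us @ map (Pair a) mid @ vs) V" by blast
    show ?thesis
      using TC(2) ldrel.TC[of us a d e vs V] unfolding TC(1) * by (simp add: arrow_diagram_ld)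
  qed
qed

lemma ldrel_good: "r \<in> ldrel \<Longrightarrow> r D \<noteq> 0 \<Longrightarrow> good D"
proof (induction rule: ldrel.induct)
  case (iso its V \<pi>)
  then show ?case
    by (auto simp: single_def fun_apply good_ld ends_ren agood_ren split: if_splits)
next
  case (AS its V p q r)
  then show ?case
    using agood_AS[OF AS(1)] by (auto simp: single_def fun_apply good_ld split: if_splits)
next
  case (IHX its V p q x r y)
  then show ?case
    using agood_IHX[OF IHX(1)] agood_IHX[OF agood_IHX[OF IHX(1)]]
    by (auto simp: single_def fun_apply good_ld split: if_splits)
qed (auto simp: single_def fun_apply good_ld add_mset_commute split: if_splits)

lemma fsupp_ldrel: "r \<in> ldrel \<Longrightarrow> fsupp r"
  by (induction rule: ldrel.induct) auto

definition on_strands :: "'a set \<Rightarrow> 'a diagram \<Rightarrow> bool" where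
  "on_strands S D \<longleftrightarrow> (\<forall>a. a \<notin> S \<longrightarrow> strand D a = [])"

lemma on_strands_ld: "on_strands S (ld its V) \<longleftrightarrow> fst ` set its \<subseteq> S"
  by (auto simp: on_strands_def strand_ld_empty_iff)

definition restrict :: "'a set \<Rightarrow> ('a diagram \<Rightarrow> rat) \<Rightarrow> 'a diagram \<Rightarrow> rat" where
  "restrict S f = (\<lambda>D. if on_strands S D then f D else 0)"

lemma restrict_simps:
  "restrict S (f + g) = restrict S f + restrict S g"
  "restrict S (f - g) = restrict S f - restrict S g"
  "restrict S (scale r f) = scale r (restrict S f)"
  "restrict S 0 = 0"
  "restrict S (single D) = (if on_strands S D then single D else 0)"
  by (auto simp: restrict_def fun_eq_iff scale_def single_def fun_apply)

text \<open>All diagrams in a relator have ends on the same strands, so restriction to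
  \<open>S\<close> either keeps the relator or kills it.\<close>

lemma restrict_ldrel:
  assumes "r \<in> ldrel"
  shows "restrict S r = 0 \<or> restrict S r \<in> relators S"
proof -
  \<comment> \<open>The original relations modify a strand by function update, the linearised ones
    modify a list; one choice of \<open>s\<close>, \<open>xs\<close>, \<open>ys\<close> has to serve
    all diagrams of a relation.\<close>
  have upd: "\<exists>s xs ys. \<forall>mid V. ld (us @ map (Pair a) mid @ vs) V = Diagram (s(a := xs @ mid @ ys)) V"
    for us vs :: "'a items" and a
  proof (intro exI allI)
    show "ld (us @ map (Pair a) mid @ vs) V = Diagram
      ((\<lambda>b. map snd (filter (\<lambda>i. fst i = b) (us @ vs)))(a := map snd (filter (\<lambda>i. fst i = a) us) @ mid @
        map snd (filter (\<lambda>i. fst i = a) vs))) V" for mid V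
      by (auto simp: ld_def fun_eq_iff filter_map o_def)
  qed
  show ?thesis
  using assms
proof cases
  case (iso its V \<pi>)
  have "edges (ld its V) = names (ends its) V"
    by (simp add: sources_ld names_def)
  then show ?thesis
    using iso relators.iso[of S "ld its V" \<pi>]
    by (auto simp: restrict_simps on_strands_ld arrow_diagram_ld rename_ld)
next
  case (AS its V p q r)
  then show ?thesis
    using relators.AS[of S "strand (ld its V)" V p q r] arrow_diagram_ld[of S its "V + {#(p, q, r)#}"]
    by (auto simp: restrict_simps on_strands_ld) (auto simp: ld_def)
next
  case (IHX its V p q x r y)
  then show ?thesis
    using relators.IHX[of S "strand (ld its V)" V p q x r y] arrow_diagram_ld[of S its "V + {#(p, q, x), (x, r, y)#}"]
    by (auto simp: restrict_simps on_strands_ld) (auto simp: ld_def)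
next
  case (STU1 us a p q vs V e)
  from upd[of us a vs] obtain s xs ys where
    eq: "\<And>mid V. ld (us @ map (Pair a) mid @ vs) V = Diagram (s(a := xs @ mid @ ys)) V" by blast
  note eqs = eq[of "[Head p, Head q]", unfolded list.map] eq[of "[Head q, Head p]", unfolded list.map] eq[of "[Head e]", unfolded list.map]
  show ?thesis
  proof (cases "insert a (fst ` set (us @ vs)) \<subseteq> S")
    case True
    have "r \<in> relators S"
      unfolding STU1(1) eqs
      by (rule relators.STU1; unfold eqs[symmetric]; use STU1 True in \<open>auto simp: arrow_diagram_ld\<close>)
    moreover have "restrict S r = r"
      using True unfolding STU1(1) by (simp add: restrict_simps on_strands_ld)
    ultimately show ?thesis by simp
  next
    case False
    then have "restrict S r = 0"
      unfolding STU1(1) by (auto simp: restrict_simps on_strands_ld)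
    then show ?thesis ..
  qed
next
  case (STU2 us a p e vs V f)
  from upd[of us a vs] obtain s xs ys where
    eq: "\<And>mid V. ld (us @ map (Pair a) mid @ vs) V = Diagram (s(a := xs @ mid @ ys)) V" by blast
  note eqs = eq[of "[Head p, Tail e]", unfolded list.map] eq[of "[Tail e, Head p]", unfolded list.map] eq[of "[Tail f]", unfolded list.map]
  show ?thesis
  proof (cases "insert a (fst ` set (us @ vs)) \<subseteq> S")
    case True
    have "r \<in> relators S"
      unfolding STU2(1) eqs
      by (rule relators.STU2; unfold eqs[symmetric]; use STU2 True in \<open>auto simp: arrow_diagram_ld\<close>)
    moreover have "restrict S r = r"
      using True unfolding STU2(1) by (simp add: restrict_simps on_strands_ld)
    ultimately show ?thesis by simp
  next
    case False
    then have "restrict S r = 0"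
      unfolding STU2(1) by (auto simp: restrict_simps on_strands_ld)
    then show ?thesis ..
  qed
next
  case (TC us a d e vs V)
  from upd[of us a vs] obtain s xs ys where
    eq: "\<And>mid V. ld (us @ map (Pair a) mid @ vs) V = Diagram (s(a := xs @ mid @ ys)) V" by blast
  note eqs = eq[of "[Tail d, Tail e]", unfolded list.map] eq[of "[Tail e, Tail d]", unfolded list.map]
  show ?thesis
  proof (cases "insert a (fst ` set (us @ vs)) \<subseteq> S")
    case True
    have "r \<in> relators S"
      unfolding TC(1) eqs
      by (rule relators.TC; unfold eqs[symmetric]; use TC True in \<open>auto simp: arrow_diagram_ld\<close>)
    moreover have "restrict S r = r"
      using True unfolding TC(1) by (simp add: restrict_simps on_strands_ld)
    ultimately show ?thesis by simp
  next
    case False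
    then have "restrict S r = 0"
      unfolding TC(1) by (auto simp: restrict_simps on_strands_ld)
    then show ?thesis ..
  qed
qed
qed

text \<open>Relations that use strands outside \<open>S\<close> create no new relations on
  \<open>S\<close>. Together with \<open>relators_subset_ldrel\<close> this embeds the finite
  combinations on \<open>S\<close> modulo \<open>relators S\<close> into the common
  quotient.\<close>

lemma restrict_span_ldrel: "r \<in> series.span ldrel \<Longrightarrow> restrict S r \<in> series.span (relators S)"
proof (induction rule: series.span_induct_alt)
  case (step c x y)
  then show ?case
    using restrict_ldrel[of x S]
    by (auto simp: restrict_simps intro: series.span_add series.span_scale series.span_base)
qed (simp add: restrict_simps series.span_zero)

section \<open>The quotient by the relations and its stacking product\<close>

section \<open>The algebra of finite combinations of arrow diagrams\<close>

definition dcarrier :: "('a diagram \<Rightarrow> rat) set" where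
  "dcarrier = {f. fsupp f \<and> (\<forall>D. f D \<noteq> 0 \<longrightarrow> good D)}"

definition drel :: "('a diagram \<Rightarrow> rat) \<Rightarrow> ('a diagram \<Rightarrow> rat) \<Rightarrow> bool" where
  "drel f g \<longleftrightarrow> f \<in> dcarrier \<and> g \<in> dcarrier \<and> f - g \<in> series.span ldrel"

lemma dcarrier_0 [simp]: "0 \<in> dcarrier"
  and dcarrier_single: "good D \<Longrightarrow> single D \<in> dcarrier"
  and dcarrier_scale: "f \<in> dcarrier \<Longrightarrow> scale r f \<in> dcarrier"
  by (simp_all add: dcarrier_def fun_apply fsupp_scale)
     (simp_all add: single_def scale_def)

lemma dcarrier_add: "f \<in> dcarrier \<Longrightarrow> g \<in> dcarrier \<Longrightarrow> f + g \<in> dcarrier"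
  and dcarrier_diff: "f \<in> dcarrier \<Longrightarrow> g \<in> dcarrier \<Longrightarrow> f - g \<in> dcarrier"
  by (auto simp: dcarrier_def fun_apply) (metis add_0 diff_self)+

lemma ldrel_dcarrier: "r \<in> ldrel \<Longrightarrow> r \<in> dcarrier"
  by (auto simp: dcarrier_def fsupp_ldrel ldrel_good)

lemma drel_refl: "drel f f \<longleftrightarrow> f \<in> dcarrier"
  by (auto simp: drel_def series.span_zero)

lemma part_equivp_drel: "part_equivp (drel :: ('a diagram \<Rightarrow> rat) \<Rightarrow> _)"
proof (rule part_equivpI)
  show "\<exists>x :: 'a diagram \<Rightarrow> rat. drel x x"
    by (rule exI[of _ 0]) (simp add: drel_refl)
  show "symp (drel :: ('a diagram \<Rightarrow> rat) \<Rightarrow> _)"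
  proof (rule sympI)
    fix f g :: "'a diagram \<Rightarrow> rat"
    assume "drel f g"
    then show "drel g f"
      using series.span_neg[of "f - g" ldrel] by (simp add: drel_def)
  qed
  show "transp (drel :: ('a diagram \<Rightarrow> rat) \<Rightarrow> _)"
  proof (rule transpI)
    fix f g h :: "'a diagram \<Rightarrow> rat"
    assume "drel f g" "drel g h"
    then show "drel f h"
      using series.span_add[of "f - g" ldrel "g - h"] by (simp add: drel_def)
  qed
qed

\<comment> \<open>The quotient is partial because functions on diagrams also include infinite
  combinations and graphs that are not arrow diagrams; only \<open>dcarrier\<close> is divided by
  the relations.\<close>
quotient_type 'a dq = "'a diagram \<Rightarrow> rat" / partial: drel
  by (rule part_equivp_drel)

instantiation dq :: (type) rat_module
begin

lift_definition zero_dq :: "'a dq" is 0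
  by (simp add: drel_refl)

lift_definition plus_dq :: "'a dq \<Rightarrow> 'a dq \<Rightarrow> 'a dq" is "(+)"
proof -
  fix f f' g g' :: "'a diagram \<Rightarrow> rat"
  assume "drel f f'" "drel g g'"
  then show "drel (f + g) (f' + g')"
    using series.span_add[of "f - f'" ldrel "g - g'"] by (simp add: drel_def dcarrier_add algebra_simps)
qed

lift_definition minus_dq :: "'a dq \<Rightarrow> 'a dq \<Rightarrow> 'a dq" is "(-)"
proof -
  fix f f' g g' :: "'a diagram \<Rightarrow> rat"
  assume "drel f f'" "drel g g'"
  then show "drel (f - g) (f' - g')"
    using series.span_diff[of "f - f'" ldrel "g - g'"] by (simp add: drel_def dcarrier_diff algebra_simps)
qed

lift_definition uminus_dq :: "'a dq \<Rightarrow> 'a dq" is "\<lambda>f. 0 - f"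
proof -
  fix f f' :: "'a diagram \<Rightarrow> rat"
  assume "drel f f'"
  then show "drel (0 - f) (0 - f')"
    using series.span_neg[of "f - f'" ldrel] dcarrier_diff[of 0 f] dcarrier_diff[of 0 f'] by (simp add: drel_def)
qed

lift_definition qscale_dq :: "rat \<Rightarrow> 'a dq \<Rightarrow> 'a dq" is scale
proof -
  fix r and f f' :: "'a diagram \<Rightarrow> rat"
  assume "drel f f'"
  then show "drel (scale r f) (scale r f')"
    using series.span_scale[of "f - f'" ldrel r]
    by (simp add: drel_def dcarrier_scale series.scale_right_diff_distrib)
qed

instance
proof
  fix a b c :: "'a dq" and r s :: rat
  show "a + b + c = a + (b + c)" "a + b = b + a" "0 + a = a" "- a + a = 0" "a - b = a + - b"
    "r *q (a + b) = r *q a + r *q b" "(r + s) *q a = r *q a + s *q a" "r *q s *q a = (r * s) *q a"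
    "1 *q a = a"
    by (transfer; simp add: drel_refl dcarrier_add dcarrier_diff dcarrier_scale algebra_simps
        series.scale_right_distrib series.scale_left_distrib)+
qed

end

text \<open>Graphs that are not arrow diagrams are sent to 0 to make the map total.\<close>

lift_definition cl :: "'a diagram \<Rightarrow> 'a dq" is "\<lambda>D. if good D then single D else 0"
  by (simp add: drel_refl dcarrier_single)

lemma abs_dq_eq_lin:
  assumes "f \<in> dcarrier"
  shows "abs_dq f = lin cl f"
proof -
  have "abs_dq (\<Sum>D\<in>A. scale (c D) (single D)) = (\<Sum>D\<in>A. c D *q cl D) \<and>
      (\<Sum>D\<in>A. scale (c D) (single D)) \<in> dcarrier" if "finite A" "\<forall>D\<in>A. good D" for A :: "'a diagram set" and c
    using that
  proof (induction A)
    case empty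
    then show ?case by (simp add: zero_dq.abs_eq)
  next
    case (insert D A)
    have D: "scale (c D) (single D) \<in> dcarrier"
      using insert.prems by (simp add: dcarrier_scale dcarrier_single)
    have "abs_dq (scale (c D) (single D)) = c D *q cl D"
      using insert.prems by (simp add: cl.abs_eq qscale_dq.abs_eq drel_refl dcarrier_single)
    then show ?case
      using insert D by (simp add: dcarrier_add drel_refl flip: plus_dq.abs_eq)
  qed
  from this[of "{D. f D \<noteq> 0}" f] assms show ?thesis
    by (simp add: fsupp_expand dcarrier_def lin_def) (simp add: fsupp_def)
qed

lemma lin_cl_eq_iff: "f \<in> dcarrier \<Longrightarrow> g \<in> dcarrier \<Longrightarrow> lin cl f = lin cl g \<longleftrightarrow> f - g \<in> series.span ldrel"
  using Quotient_rel[OF Quotient_dq, of f g]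
  by (simp add: abs_dq_eq_lin drel_refl) (simp add: drel_def abs_dq_eq_lin)

lemma dq_rep: "\<exists>f\<in>dcarrier. x = lin cl f"
proof -
  have "drel (rep_dq x) (rep_dq x)" "abs_dq (rep_dq x) = x"
    by (rule Quotient_rep_reflp[OF Quotient_dq] Quotient_abs_rep[OF Quotient_dq])+
  then show ?thesis
    by (metis abs_dq_eq_lin drel_refl)
qed

lemma dq_induct [case_names zero add]:
  assumes "P 0" "\<And>c D x. good D \<Longrightarrow> P x \<Longrightarrow> P (c *q cl D + x)"
  shows "P (x :: 'a dq)"
proof -
  have "P (\<Sum>D\<in>A. c D *q cl D)" if "finite A" "\<forall>D\<in>A. good D" for A c
    using that by (induction A) (auto simp: assms)
  moreover obtain f where "f \<in> dcarrier" "x = lin cl f"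
    using dq_rep by blast
  ultimately show ?thesis
    by (simp add: lin_def dcarrier_def fsupp_def)
qed

definition resp :: "('a diagram \<Rightarrow> 'v :: rat_module) \<Rightarrow> bool" where
  "resp \<phi> \<longleftrightarrow> (\<forall>r\<in>ldrel. lin \<phi> r = 0)"

lemma resp_cl: "resp cl"
  unfolding resp_def
proof
  fix r :: "'a diagram \<Rightarrow> rat" assume "r \<in> ldrel"
  then have "lin cl r = lin cl 0"
    by (subst lin_cl_eq_iff) (auto simp: ldrel_dcarrier series.span_base)
  then show "lin cl r = 0" by simp
qed

lemma respI [case_names iso AS IHX STU1 STU2 TC]:
  assumes "\<And>its V \<pi>. agood (ends its) V \<Longrightarrow> inj_on \<pi> (names (ends its) V) \<Longrightarrow>
      \<phi> (ld its V) = \<phi> (ld (ren_items \<pi> its) (ren_verts \<pi> V))"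
    and "\<And>its V p q r. agood (ends its) (V + {#(p, q, r)#}) \<Longrightarrow>
      \<phi> (ld its (V + {#(p, q, r)#})) = - \<phi> (ld its (V + {#(q, p, r)#}))"
    and "\<And>its V p q x r y. agood (ends its) (V + {#(p, q, x), (x, r, y)#}) \<Longrightarrow>
      \<phi> (ld its (V + {#(p, q, x), (x, r, y)#})) + \<phi> (ld its (V + {#(q, r, x), (x, p, y)#})) +
      \<phi> (ld its (V + {#(r, p, x), (x, q, y)#})) = 0"
    and "\<And>us a p q vs V e. agood (ends (us @ [(a, Head p), (a, Head q)] @ vs)) V \<Longrightarrow>
      agood (ends (us @ [(a, Head e)] @ vs)) (V + {#(p, q, e)#}) \<Longrightarrow>
      \<phi> (ld (us @ [(a, Head p), (a, Head q)] @ vs) V) =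
      \<phi> (ld (us @ [(a, Head q), (a, Head p)] @ vs) V) + \<phi> (ld (us @ [(a, Head e)] @ vs) (V + {#(p, q, e)#}))"
    and "\<And>us a p e vs V f. agood (ends (us @ [(a, Head p), (a, Tail e)] @ vs)) V \<Longrightarrow>
      agood (ends (us @ [(a, Tail f)] @ vs)) (V + {#(f, p, e)#}) \<Longrightarrow>
      \<phi> (ld (us @ [(a, Head p), (a, Tail e)] @ vs) V) =
      \<phi> (ld (us @ [(a, Tail e), (a, Head p)] @ vs) V) + \<phi> (ld (us @ [(a, Tail f)] @ vs) (V + {#(f, p, e)#}))"
    and "\<And>us a d e vs V. agood (ends (us @ [(a, Tail d), (a, Tail e)] @ vs)) V \<Longrightarrow>
      \<phi> (ld (us @ [(a, Tail d), (a, Tail e)] @ vs) V) = \<phi> (ld (us @ [(a, Tail e), (a, Tail d)] @ vs) V)"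
  shows "resp \<phi>"
  unfolding resp_def
proof
  fix r :: "'a diagram \<Rightarrow> rat" assume "r \<in> ldrel"
  then show "lin \<phi> r = 0"
  proof induction
    case (iso its V \<pi>) then show ?case by (simp add: lin_diff assms(1))
  next
    case (AS its V p q r) then show ?case by (simp add: lin_add assms(2)[unfolded add_mset_add_single[symmetric]])
  next
    case (IHX its V p q x r y) then show ?case using assms(3)[OF IHX] by (simp add: lin_add)
  next
    case (STU1 us a p q vs V e) then show ?case using assms(4)[OF STU1] by (simp add: lin_diff)
  next
    case (STU2 us a p e vs V f) then show ?case using assms(5)[OF STU2] by (simp add: lin_diff)
  next
    case (TC us a d e vs V) then show ?case using assms(6)[OF TC] by (simp add: lin_diff)
  qed
qed

lemma resp_iso: "resp \<phi> \<Longrightarrow> agood (ends its) V \<Longrightarrow> inj_on \<pi> (names (ends its) V) \<Longrightarrow>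
    \<phi> (ld its V) = \<phi> (ld (ren_items \<pi> its) (ren_verts \<pi> V))"
  using bspec[OF resp_def[THEN iffD1] ldrel.iso] by (simp add: lin_diff)

lemma resp_AS: "resp \<phi> \<Longrightarrow> agood (ends its) (V + {#(p, q, r)#}) \<Longrightarrow>
    \<phi> (ld its (V + {#(p, q, r)#})) = - \<phi> (ld its (V + {#(q, p, r)#}))"
  using bspec[OF resp_def[THEN iffD1] ldrel.AS] by (simp add: lin_add eq_neg_iff_add_eq_0)

lemma resp_IHX: "resp \<phi> \<Longrightarrow> agood (ends its) (V + {#(p, q, x), (x, r, y)#}) \<Longrightarrow>
    \<phi> (ld its (V + {#(p, q, x), (x, r, y)#})) + \<phi> (ld its (V + {#(q, r, x), (x, p, y)#})) +
    \<phi> (ld its (V + {#(r, p, x), (x, q, y)#})) = 0"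
  using bspec[OF resp_def[THEN iffD1] ldrel.IHX] by (simp add: lin_add)

lemma resp_STU1: "resp \<phi> \<Longrightarrow> agood (ends (us @ [(a, Head p), (a, Head q)] @ vs)) V \<Longrightarrow>
    agood (ends (us @ [(a, Head e)] @ vs)) (V + {#(p, q, e)#}) \<Longrightarrow>
    \<phi> (ld (us @ [(a, Head p), (a, Head q)] @ vs) V) =
    \<phi> (ld (us @ [(a, Head q), (a, Head p)] @ vs) V) + \<phi> (ld (us @ [(a, Head e)] @ vs) (V + {#(p, q, e)#}))"
  using bspec[OF resp_def[THEN iffD1] ldrel.STU1] by (simp add: lin_diff diff_eq_eq add.commute)

lemma resp_STU2: "resp \<phi> \<Longrightarrow> agood (ends (us @ [(a, Head p), (a, Tail e)] @ vs)) V \<Longrightarrow>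
    agood (ends (us @ [(a, Tail f)] @ vs)) (V + {#(f, p, e)#}) \<Longrightarrow>
    \<phi> (ld (us @ [(a, Head p), (a, Tail e)] @ vs) V) =
    \<phi> (ld (us @ [(a, Tail e), (a, Head p)] @ vs) V) + \<phi> (ld (us @ [(a, Tail f)] @ vs) (V + {#(f, p, e)#}))"
  using bspec[OF resp_def[THEN iffD1] ldrel.STU2] by (simp add: lin_diff diff_eq_eq add.commute)

lemma resp_TC: "resp \<phi> \<Longrightarrow> agood (ends (us @ [(a, Tail d), (a, Tail e)] @ vs)) V \<Longrightarrow>
    \<phi> (ld (us @ [(a, Tail d), (a, Tail e)] @ vs) V) = \<phi> (ld (us @ [(a, Tail e), (a, Tail d)] @ vs) V)"
  using bspec[OF resp_def[THEN iffD1] ldrel.TC] by (simp add: lin_diff)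

lemma resp_span:
  assumes "resp \<phi>" "r \<in> series.span ldrel"
  shows "lin \<phi> r = 0"
proof -
  have "fsupp r \<and> lin \<phi> r = 0"
    using assms(2)
  proof (induction rule: series.span_induct_alt)
    case (step c x y)
    then show ?case
      using assms(1) by (auto simp: lin_add lin_scale fsupp_ldrel resp_def)
  qed simp
  then show ?thesis ..
qed

definition dlift :: "('a diagram \<Rightarrow> 'v :: rat_module) \<Rightarrow> 'a dq \<Rightarrow> 'v" where
  "dlift \<phi> x = lin \<phi> (SOME f. f \<in> dcarrier \<and> x = lin cl f)"

lemma dlift_lin:
  assumes "resp \<phi>" "f \<in> dcarrier"
  shows "dlift \<phi> (lin cl f) = lin \<phi> f"
proof -
  define g where "g = (SOME g. g \<in> dcarrier \<and> lin cl f = lin cl g)"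
  have g: "g \<in> dcarrier \<and> lin cl f = lin cl g"
    unfolding g_def by (rule someI[of _ f]) (simp add: assms)
  then have "f - g \<in> series.span ldrel"
    using lin_cl_eq_iff assms by blast
  then have "lin \<phi> (f - g) = 0"
    by (rule resp_span[OF assms(1)])
  then have "lin \<phi> f = lin \<phi> g"
    using g assms by (simp add: lin_diff dcarrier_def)
  then show ?thesis
    by (simp add: dlift_def g_def)
qed

lemma dlift_cl: "resp \<phi> \<Longrightarrow> good D \<Longrightarrow> dlift \<phi> (cl D) = \<phi> D"
  using dlift_lin[of \<phi> "single D"] by (simp add: dcarrier_single)

lemma dlift_add: "resp \<phi> \<Longrightarrow> dlift \<phi> (x + y) = dlift \<phi> x + dlift \<phi> y"
proof -
  assume r: "resp \<phi>"
  obtain f g where fg: "f \<in> dcarrier" "x = lin cl f" "g \<in> dcarrier" "y = lin cl g"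
    using dq_rep by metis
  then have "x + y = lin cl (f + g)"
    by (simp add: lin_add dcarrier_def)
  then show ?thesis
    using fg r by (simp add: dlift_lin dcarrier_add) (simp add: lin_add dcarrier_def)
qed

lemma dlift_scale: "resp \<phi> \<Longrightarrow> dlift \<phi> (r *q x) = r *q dlift \<phi> x"
proof -
  assume r: "resp \<phi>"
  obtain f where f: "f \<in> dcarrier" "x = lin cl f"
    using dq_rep by metis
  then have "r *q x = lin cl (scale r f)"
    by (simp add: lin_scale)
  then show ?thesis
    using f r by (simp add: dlift_lin dcarrier_scale) (simp add: lin_scale)
qed

lemma dlift_0: "resp \<phi> \<Longrightarrow> dlift \<phi> 0 = 0"
  using dlift_scale[of \<phi> 0 0] by simp


subsection \<open>Multiplication\<close>

lemma stack_ld: "stack (ld its V) (ld its' V') =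
    ld (ren_items ((#) 0) its @ ren_items ((#) 1) its') (ren_verts ((#) 0) V + ren_verts ((#) 1) V')"
  unfolding stack_def Let_def rename_ld by (simp add: ld_def)

lemma ren_items_cong: "(\<And>e. e \<in> end_edge ` set_mset (ends its) \<Longrightarrow> \<pi> e = \<rho> e) \<Longrightarrow> ren_items \<pi> its = ren_items \<rho> its"
proof -
  assume *: "\<And>e. e \<in> end_edge ` set_mset (ends its) \<Longrightarrow> \<pi> e = \<rho> e"
  have "map_end \<pi> x = map_end \<rho> x" if "(a, x) \<in> set its" for a x
  proof -
    have "x \<in># ends its"
      using that by (force simp: ends_def)
    then have "\<pi> (end_edge x) = \<rho> (end_edge x)"
      using * by blast
    then show ?thesis by (cases x) simp_all
  qed
  then show ?thesis
    by (auto simp: ren_items_def)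
qed

lemma ren_verts_cong: "(\<And>e. e \<in># outs V + ins V \<Longrightarrow> \<pi> e = \<rho> e) \<Longrightarrow> ren_verts \<pi> V = ren_verts \<rho> V"
  unfolding ren_verts_def
proof (rule image_mset_cong)
  fix v assume *: "\<And>e. e \<in># outs V + ins V \<Longrightarrow> \<pi> e = \<rho> e" and v: "v \<in># V"
  obtain p q r where "v = (p, q, r)" by (cases v)
  with v have "p \<in># ins V" "q \<in># ins V" "r \<in># outs V"
    by (force simp: ins_def outs_def)+
  then show "(case v of (p, q, r) \<Rightarrow> (\<pi> p, \<pi> q, \<pi> r)) = (case v of (p, q, r) \<Rightarrow> (\<rho> p, \<rho> q, \<rho> r))"
    using * \<open>v = (p, q, r)\<close> by simp
qed

lemma agood_names:
  assumes "agood E V"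
  shows "end_edge ` set_mset E \<subseteq> names E V" "set_mset (outs V + ins V) \<subseteq> names E V"
proof -
  have eq: "set_mset (tls E + outs V) = set_mset (hds E + ins V)"
    using assms unfolding agood_def by metis
  have "end_edge x \<in> names E V" if "x \<in># E" for x
  proof (cases "is_head x")
    case True
    then have "end_edge x \<in># hds E + ins V" using that by auto
    then show ?thesis using eq unfolding names_def by blast
  next
    case False
    then show ?thesis using that by (auto simp: names_def)
  qed
  then show "end_edge ` set_mset E \<subseteq> names E V" by blast
  have "set_mset (ins V) \<subseteq> names E V"
    unfolding names_def eq by simp
  then show "set_mset (outs V + ins V) \<subseteq> names E V"
    by (auto simp: names_def)
qed

lemma ren_id:
  assumes "agood (ends its) V" "\<And>e. e \<in> names (ends its) V \<Longrightarrow> \<pi> e = e"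
  shows "ren_items \<pi> its = its" "ren_verts \<pi> V = V"
proof -
  have "map_end (\<lambda>e. e) x = x" for x
    by (cases x) auto
  then have "ren_items (\<lambda>e. e) its = its" "ren_verts (\<lambda>e. e) V = V"
    by (simp_all add: ren_items_def ren_verts_def)
  moreover have "ren_items \<pi> its = ren_items (\<lambda>e. e) its"
    by (rule ren_items_cong) (use agood_names(1)[OF assms(1)] assms(2) in auto)
  moreover have "ren_verts \<pi> V = ren_verts (\<lambda>e. e) V"
    by (rule ren_verts_cong) (use agood_names(2)[OF assms(1)] assms(2) in auto)
  ultimately show "ren_items \<pi> its = its" "ren_verts \<pi> V = V"
    by simp_all
qed

lemma ren_ren: "ren_items \<pi> (ren_items \<rho> its) = ren_items (\<pi> \<circ> \<rho>) its"
  "ren_verts \<pi> (ren_verts \<rho> V) = ren_verts (\<pi> \<circ> \<rho>) V"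
proof -
  have "map_end \<pi> (map_end \<rho> x) = map_end (\<pi> \<circ> \<rho>) x" for x
    by (cases x) auto
  then show "ren_items \<pi> (ren_items \<rho> its) = ren_items (\<pi> \<circ> \<rho>) its"
    by (simp add: ren_items_def case_prod_beta)
  show "ren_verts \<pi> (ren_verts \<rho> V) = ren_verts (\<pi> \<circ> \<rho>) V"
    by (induction V) auto
qed

text \<open>Relations are local, so inserting one between fixed ends \<open>A\<close> and
  \<open>B\<close> and next to fixed vertices \<open>W\<close> gives a relation of the same kind.
  Disjointness of names is used twice: for the result to be an arrow diagram, and for renaming the
  inserted edges while the context is kept.\<close>

lemma resp_context:
  assumes W: "agood (ends (A @ B)) W" "inj \<rho>" "names (ends (A @ B)) W \<inter> range \<rho> = {}"
    and \<phi>: "\<And>its V. agood (ends its) V \<Longrightarrow> \<phi> (ld its V) = cl (ld (A @ ren_items \<rho> its @ B) (W + ren_verts \<rho> V))"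
  shows "resp \<phi>"
proof -
  have g: "agood (ends (A @ ren_items \<rho> its @ B)) (W + ren_verts \<rho> V)" if "agood (ends its) V" for its V
  proof -
    have "agood (ends (A @ B) + ends (ren_items \<rho> its)) (W + ren_verts \<rho> V)"
      unfolding ends_ren using W that
      by (intro agood_union agood_ren) (auto simp: names_ren intro: inj_on_subset)
    then show ?thesis by (simp add: ac_simps)
  qed
  show ?thesis
  proof (rule respI)
    fix its :: "'a items" and V and \<pi> :: "edge \<Rightarrow> edge"
    assume g1: "agood (ends its) V" "inj_on \<pi> (names (ends its) V)"
    have g4: "agood (ends (ren_items \<pi> its)) (ren_verts \<pi> V)"
      using agood_ren[OF g1] by (simp add: ends_ren)
    \<comment> \<open>The renaming \<open>\<pi>\<close> transported along \<open>\<rho>\<close> and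
      extended by the identity to the names of the context.\<close>
    define \<pi>' where "\<pi>' e = (if e \<in> range \<rho> then \<rho> (\<pi> (inv \<rho> e)) else e)" for e
    have p: "\<pi>' (\<rho> e) = \<rho> (\<pi> e)" for e
      using W(2) by (simp add: \<pi>'_def)
    have idn: "\<pi>' e = e" if "e \<in> names (ends (A @ B)) W" for e
      using that W(3) by (auto simp: \<pi>'_def)
    from ren_id[OF W(1) idn] have id: "ren_items \<pi>' A = A" "ren_items \<pi>' B = B" "ren_verts \<pi>' W = W"
      by (auto simp: append_eq_append_conv ren_items_def)
    have "cl (ld (A @ ren_items \<rho> its @ B) (W + ren_verts \<rho> V)) =
        cl (ld (ren_items \<pi>' (A @ ren_items \<rho> its @ B)) (ren_verts \<pi>' (W + ren_verts \<rho> V)))"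
    proof (rule resp_iso[OF resp_cl g[OF g1(1)]])
      have n: "names (ends (A @ ren_items \<rho> its @ B)) (W + ren_verts \<rho> V) =
          names (ends (A @ B)) W \<union> \<rho> ` names (ends its) V"
        by (auto simp: names_def ends_ren tls_ren outs_ren)
      have "inj_on \<pi>' (names (ends (A @ B)) W)"
        by (rule inj_onI) (simp only: idn)
      moreover have "inj_on \<pi>' (\<rho> ` names (ends its) V)"
        using W(2) g1(2) by (auto simp: inj_on_def p)
      moreover have "\<pi>' ` names (ends (A @ B)) W \<inter> \<pi>' ` \<rho> ` names (ends its) V = {}"
      proof -
        have "\<pi>' ` names (ends (A @ B)) W \<subseteq> names (ends (A @ B)) W"
          by (auto simp only: idn)
        moreover have "\<pi>' ` \<rho> ` names (ends its) V \<subseteq> range \<rho>"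
          by (auto simp: p)
        ultimately show ?thesis using W(3) by blast
      qed
      ultimately show "inj_on \<pi>' (names (ends (A @ ren_items \<rho> its @ B)) (W + ren_verts \<rho> V))"
        unfolding n inj_on_Un by blast
    qed
    also have "ren_items \<pi>' (A @ ren_items \<rho> its @ B) = A @ ren_items \<rho> (ren_items \<pi> its) @ B"
      by (simp add: id ren_ren) (rule arg_cong[of _ _ "\<lambda>\<pi>. ren_items \<pi> its"], simp add: fun_eq_iff p)
    also have "ren_verts \<pi>' (W + ren_verts \<rho> V) = W + ren_verts \<rho> (ren_verts \<pi> V)"
      by (simp add: id ren_ren) (rule arg_cong[of _ _ "\<lambda>\<pi>. ren_verts \<pi> V"], simp add: fun_eq_iff p)
    finally show "\<phi> (ld its V) = \<phi> (ld (ren_items \<pi> its) (ren_verts \<pi> V))"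
      using \<phi> g1 g4 by simp
  next
    fix its :: "'a items" and V p q r
    assume g1: "agood (ends its) (V + {#(p, q, r)#})"
    then show "\<phi> (ld its (V + {#(p, q, r)#})) = - \<phi> (ld its (V + {#(q, p, r)#}))"
      using resp_AS[OF resp_cl, of "A @ ren_items \<rho> its @ B" "W + ren_verts \<rho> V" "\<rho> p" "\<rho> q" "\<rho> r"]
        g[OF g1] \<phi>[OF g1] \<phi>[OF agood_AS[OF g1]] by simp
  next
    fix its :: "'a items" and V p q x r y
    assume g1: "agood (ends its) (V + {#(p, q, x), (x, r, y)#})"
    then show "\<phi> (ld its (V + {#(p, q, x), (x, r, y)#})) + \<phi> (ld its (V + {#(q, r, x), (x, p, y)#})) +
        \<phi> (ld its (V + {#(r, p, x), (x, q, y)#})) = 0"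
      using resp_IHX[OF resp_cl, of "A @ ren_items \<rho> its @ B" "W + ren_verts \<rho> V" "\<rho> p" "\<rho> q" "\<rho> x" "\<rho> r" "\<rho> y"]
        g[OF g1] \<phi>[OF g1] \<phi>[OF agood_IHX[OF g1]] \<phi>[OF agood_IHX[OF agood_IHX[OF g1]]] by simp
  next
    fix us vs :: "'a items" and a p q V e
    assume g1: "agood (ends (us @ [(a, Head p), (a, Head q)] @ vs)) V"
      and g2: "agood (ends (us @ [(a, Head e)] @ vs)) (V + {#(p, q, e)#})"
    have g3: "agood (ends (us @ [(a, Head q), (a, Head p)] @ vs)) V"
      using g1 by (simp add: add_mset_commute)
    show "\<phi> (ld (us @ [(a, Head p), (a, Head q)] @ vs) V) =
        \<phi> (ld (us @ [(a, Head q), (a, Head p)] @ vs) V) + \<phi> (ld (us @ [(a, Head e)] @ vs) (V + {#(p, q, e)#}))"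
      using resp_STU1[OF resp_cl, of "A @ ren_items \<rho> us" a "\<rho> p" "\<rho> q" "ren_items \<rho> vs @ B" "W + ren_verts \<rho> V" "\<rho> e"]
        g[OF g1] g[OF g2] \<phi>[OF g1] \<phi>[OF g2] \<phi>[OF g3] by simp
  next
    fix us vs :: "'a items" and a p e V f
    assume g1: "agood (ends (us @ [(a, Head p), (a, Tail e)] @ vs)) V"
      and g2: "agood (ends (us @ [(a, Tail f)] @ vs)) (V + {#(f, p, e)#})"
    have g3: "agood (ends (us @ [(a, Tail e), (a, Head p)] @ vs)) V"
      using g1 by (simp add: add_mset_commute)
    show "\<phi> (ld (us @ [(a, Head p), (a, Tail e)] @ vs) V) =
        \<phi> (ld (us @ [(a, Tail e), (a, Head p)] @ vs) V) + \<phi> (ld (us @ [(a, Tail f)] @ vs) (V + {#(f, p, e)#}))"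
      using resp_STU2[OF resp_cl, of "A @ ren_items \<rho> us" a "\<rho> p" "\<rho> e" "ren_items \<rho> vs @ B" "W + ren_verts \<rho> V" "\<rho> f"]
        g[OF g1] g[OF g2] \<phi>[OF g1] \<phi>[OF g2] \<phi>[OF g3] by simp
  next
    fix us vs :: "'a items" and a d e V
    assume g1: "agood (ends (us @ [(a, Tail d), (a, Tail e)] @ vs)) V"
    have g3: "agood (ends (us @ [(a, Tail e), (a, Tail d)] @ vs)) V"
      using g1 by (simp add: add_mset_commute)
    show "\<phi> (ld (us @ [(a, Tail d), (a, Tail e)] @ vs) V) = \<phi> (ld (us @ [(a, Tail e), (a, Tail d)] @ vs) V)"
      using resp_TC[OF resp_cl, of "A @ ren_items \<rho> us" a "\<rho> d" "\<rho> e" "ren_items \<rho> vs @ B" "W + ren_verts \<rho> V"]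
        g[OF g1] \<phi>[OF g1] \<phi>[OF g3] by simp
  qed
qed

lemma resp_stack_right: "good D \<Longrightarrow> resp (\<lambda>E. cl (stack D E))"
proof -
  assume "good D"
  then obtain its V where D: "D = ld its V" "agood (ends its) V"
    by (auto simp: good_def)
  show ?thesis
  proof (rule resp_context[of "ren_items ((#) 0) its" "[]" "ren_verts ((#) 0) V" "(#) 1"])
    show "agood (ends (ren_items ((#) 0) its @ [])) (ren_verts ((#) 0) V)"
      using agood_ren[OF D(2), of "(#) 0"] by (simp add: ends_ren)
    show "names (ends (ren_items ((#) 0) its @ [])) (ren_verts ((#) 0) V) \<inter> range ((#) 1) = {}"
      by (auto simp: ends_ren names_ren)
  qed (simp_all add: D stack_ld)
qed

lemma resp_stack_left: "good E \<Longrightarrow> resp (\<lambda>D. cl (stack D E))"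
proof -
  assume "good E"
  then obtain its V where E: "E = ld its V" "agood (ends its) V"
    by (auto simp: good_def)
  show ?thesis
  proof (rule resp_context[of "[]" "ren_items ((#) 1) its" "ren_verts ((#) 1) V" "(#) 0"])
    show "agood (ends ([] @ ren_items ((#) 1) its)) (ren_verts ((#) 1) V)"
      using agood_ren[OF E(2), of "(#) 1"] by (simp add: ends_ren)
    show "names (ends ([] @ ren_items ((#) 1) its)) (ren_verts ((#) 1) V) \<inter> range ((#) 0) = {}"
      by (auto simp: ends_ren names_ren)
  qed (simp_all add: E stack_ld add.commute)
qed

definition dmult :: "'a dq \<Rightarrow> 'a dq \<Rightarrow> 'a dq" where
  "dmult x y = dlift (\<lambda>D. dlift (\<lambda>E. cl (stack D E)) y) x"

text \<open>The functional in the left factor contains a lift in the right factor, which respects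
  the relations when \<open>D\<close> is \<open>good\<close>; hence the case distinction. Expanding
  \<open>y\<close> in finitely many diagrams and interchanging the sums reduces the claim to
  \<open>resp_stack_left\<close>.\<close>

lemma resp_dmult: "resp (\<lambda>D. if good D then dlift (\<lambda>E. cl (stack D E)) y else 0)"
  unfolding resp_def
proof
  fix r :: "'a diagram \<Rightarrow> rat"
  assume r: "r \<in> ldrel"
  obtain f where f: "f \<in> dcarrier" "y = lin cl f"
    using dq_rep by blast
  have "lin (\<lambda>D. if good D then dlift (\<lambda>E. cl (stack D E)) y else 0) r = lin (\<lambda>D. lin (\<lambda>E. cl (stack D E)) f) r"
    using ldrel_good[OF r] by (intro lin_cong) (auto simp: f dlift_lin resp_stack_right)
  also have "\<dots> = lin (\<lambda>E. lin (\<lambda>D. cl (stack D E)) r) f"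
    by (rule lin_swap)
  also have "\<dots> = lin (\<lambda>E. 0) f"
    using f r resp_stack_left by (intro lin_cong) (auto simp: dcarrier_def resp_def)
  finally show "lin (\<lambda>D. if good D then dlift (\<lambda>E. cl (stack D E)) y else 0) r = 0"
    by (simp add: lin_def)
qed

lemma dmult_alt: "dmult x y = dlift (\<lambda>D. if good D then dlift (\<lambda>E. cl (stack D E)) y else 0) x"
  unfolding dmult_def dlift_def[of _ x]
proof (rule lin_cong)
  fix D
  assume "(SOME f. f \<in> dcarrier \<and> x = lin cl f) D \<noteq> 0"
  moreover have "(SOME f. f \<in> dcarrier \<and> x = lin cl f) \<in> dcarrier \<and> x = lin cl (SOME f. f \<in> dcarrier \<and> x = lin cl f)"
    by (rule someI_ex[where P = "\<lambda>f. f \<in> dcarrier \<and> x = lin cl f"]) (use dq_rep[of x] in blast)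
  ultimately have "good D"
    by (auto simp: dcarrier_def)
  then show "dlift (\<lambda>E. cl (stack D E)) y = (if good D then dlift (\<lambda>E. cl (stack D E)) y else 0)"
    by simp
qed

lemma dmult_cl: "good D \<Longrightarrow> good E \<Longrightarrow> dmult (cl D) (cl E) = cl (stack D E)"
  by (simp add: dmult_alt dlift_cl resp_dmult resp_stack_right)

lemma dmult_add_left: "dmult (x + y) z = dmult x z + dmult y z"
  and dmult_scale_left: "dmult (r *q x) z = r *q dmult x z"
  by (simp_all add: dmult_alt dlift_add dlift_scale resp_dmult)

lemma dmult_0_left: "dmult 0 z = 0"
  using dmult_scale_left[of 0 0 z] by simp

lemma dmult_cl_add_right: "good D \<Longrightarrow> dmult (cl D) (y + z) = dmult (cl D) y + dmult (cl D) z"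
  and dmult_cl_scale_right: "good D \<Longrightarrow> dmult (cl D) (r *q y) = r *q dmult (cl D) y"
  by (simp_all add: dmult_alt dlift_cl resp_dmult dlift_add dlift_scale resp_stack_right)

lemma dmult_add_right: "dmult x (y + z) = dmult x y + dmult x z"
  by (induction x rule: dq_induct)
     (simp_all add: dmult_0_left dmult_add_left dmult_scale_left dmult_cl_add_right qscale_distribs)

lemma dmult_scale_right: "dmult x (r *q y) = r *q dmult x y"
  by (induction x rule: dq_induct)
     (simp_all add: dmult_0_left dmult_add_left dmult_scale_left dmult_cl_scale_right qscale_distribs mult.commute)

lemma dmult_0_right: "dmult z 0 = 0"
  using dmult_scale_right[of z 0 0] by simp

text \<open>\<open>stack\<close> prefixes the names with 0 or 1. If they were disjoint before,
  removing the prefix by \<open>tl\<close> is injective on the names in use, and \<open>iso\<close>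
  identifies the result with plain concatenation.\<close>

lemma dmult_ld:
  assumes "agood (ends its) V" "agood (ends its') V'" "names (ends its) V \<inter> names (ends its') V' = {}"
  shows "dmult (cl (ld its V)) (cl (ld its' V')) = cl (ld (its @ its') (V + V'))"
proof -
  let ?its = "ren_items ((#) 0) its @ ren_items ((#) 1) its'"
  let ?V = "ren_verts ((#) 0) V + ren_verts ((#) 1) V'"
  have n: "names (ends ?its) ?V = (#) 0 ` names (ends its) V \<union> (#) 1 ` names (ends its') V'"
    by (auto simp: names_def ends_ren tls_ren outs_ren)
  have g: "agood (ends ?its) ?V"
    unfolding ends_simps ends_ren
    by (intro agood_union agood_ren assms) (auto simp: names_ren)
  have "cl (ld ?its ?V) = cl (ld (ren_items tl ?its) (ren_verts tl ?V))"
    by (rule resp_iso[OF resp_cl g]) (unfold n, use assms(3) in \<open>auto simp: inj_on_def\<close>)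
  moreover have "ren_items tl ?its = its @ its'" "ren_verts tl ?V = V + V'"
    using ren_id[OF assms(1), of "\<lambda>e. e"] ren_id[OF assms(2), of "\<lambda>e. e"]
    by (simp_all add: ren_ren o_def)
  moreover have "dmult (cl (ld its V)) (cl (ld its' V')) = cl (ld ?its ?V)"
    using assms by (simp add: dmult_cl good_ld stack_ld)
  ultimately show ?thesis by simp
qed

text \<open>Prescribing the first number of all names makes products computable by concatenation; 0,
  1 and 2 give three pairwise disjoint representatives for associativity.\<close>

lemma cl_fresh:
  assumes "good D"
  shows "\<exists>its V. cl D = cl (ld its V) \<and> agood (ends its) V \<and> names (ends its) V \<subseteq> range ((#) k)"
proof -
  obtain its V where D: "D = ld its V" "agood (ends its) V"
    using assms by (auto simp: good_def)
  have "cl D = cl (ld (ren_items ((#) k) its) (ren_verts ((#) k) V))"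
    unfolding D(1) by (rule resp_iso[OF resp_cl D(2)]) simp
  moreover have "agood (ends (ren_items ((#) k) its)) (ren_verts ((#) k) V)"
    unfolding ends_ren by (rule agood_ren[OF D(2)]) simp
  ultimately show ?thesis
    by (intro exI conjI) (auto simp: ends_ren names_ren)
qed

lemma dmult_assoc_cl:
  assumes "good D" "good E" "good F"
  shows "dmult (dmult (cl D) (cl E)) (cl F) = dmult (cl D) (dmult (cl E) (cl F))"
proof -
  from cl_fresh[OF assms(1), of 0] obtain its1 V1 where
    1: "cl D = cl (ld its1 V1)" "agood (ends its1) V1" "names (ends its1) V1 \<subseteq> range ((#) 0)" by blast
  from cl_fresh[OF assms(2), of 1] obtain its2 V2 where
    2: "cl E = cl (ld its2 V2)" "agood (ends its2) V2" "names (ends its2) V2 \<subseteq> range ((#) 1)" by blast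
  from cl_fresh[OF assms(3), of 2] obtain its3 V3 where
    3: "cl F = cl (ld its3 V3)" "agood (ends its3) V3" "names (ends its3) V3 \<subseteq> range ((#) 2)" by blast
  have d: "names (ends its1) V1 \<inter> names (ends its2) V2 = {}" "names (ends its2) V2 \<inter> names (ends its3) V3 = {}"
    "names (ends its1) V1 \<inter> names (ends its3) V3 = {}"
    using 1(3) 2(3) 3(3) by fastforce+
  have n: "names (ends (its1 @ its2)) (V1 + V2) \<inter> names (ends its3) V3 = {}"
    "names (ends its1) V1 \<inter> names (ends (its2 @ its3)) (V2 + V3) = {}"
    using d by (auto simp: names_def)
  have "agood (ends (its1 @ its2)) (V1 + V2)" "agood (ends (its2 @ its3)) (V2 + V3)"
    using 1 2 3 d by (auto intro: agood_union)
  then show ?thesis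
    using 1 2 3 d n by (simp add: dmult_ld add.assoc)
qed

lemma dmult_assoc: "dmult (dmult x y) z = dmult x (dmult y z)"
proof (induction x rule: dq_induct)
  case (add c D x)
  have "dmult (dmult (cl D) y) z = dmult (cl D) (dmult y z)"
  proof (induction y rule: dq_induct)
    case (add d E y)
    have "dmult (dmult (cl D) (cl E)) z = dmult (cl D) (dmult (cl E) z)"
    proof (induction z rule: dq_induct)
      case (add e F z)
      then show ?case
        using \<open>good D\<close> \<open>good E\<close>
        by (simp add: dmult_add_right dmult_scale_right dmult_assoc_cl)
    qed (simp add: dmult_0_right)
    with add show ?case
      by (simp add: dmult_add_left dmult_add_right dmult_scale_left dmult_scale_right)
  qed (simp add: dmult_0_left dmult_0_right)
  with add show ?case
    by (simp add: dmult_add_left dmult_scale_left)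
qed (simp add: dmult_0_left)

lemma agood_empty [simp]: "agood {#} {#}"
  by (simp add: agood_def names_def)

lemma ld_eq_empty_iff: "ld its V = ld [] {#} \<longleftrightarrow> its = [] \<and> V = {#}"
proof
  assume eq: "ld its V = ld [] {#}"
  have "fst ` set its = {b. strand (ld its V) b \<noteq> []}"
    by (rule support_ld[symmetric])
  also have "\<dots> = {}"
    unfolding eq support_ld by simp
  finally show "its = [] \<and> V = {#}"
    using arg_cong[OF eq, of verts] by simp
qed simp

text \<open>Only \<open>iso\<close> can involve the empty diagram, and then both of its terms are
  empty and cancel. The coefficient at the empty diagram is thus well defined on the quotient and
  separates 1 from 0, as \<open>ring_1\<close> demands.\<close>

lemma ldrel_empty: "r \<in> ldrel \<Longrightarrow> r (ld [] {#}) = 0"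
  by (induction rule: ldrel.induct)
     (auto simp: single_def fun_apply ren_items_def ren_verts_def
        ld_eq_empty_iff[unfolded eq_commute[of _ "ld [] {#}"]])

lemma cl_empty_neq_0: "cl (ld [] {#}) \<noteq> 0"
proof
  assume "cl (ld [] {#}) = (0 :: 'a dq)"
  then have "lin cl (single (ld [] {#})) = (lin cl 0 :: 'a dq)"
    by simp
  then have "single (ld [] {#}) \<in> series.span (ldrel :: ('a diagram \<Rightarrow> rat) set)"
    by (subst (asm) lin_cl_eq_iff) (simp_all add: dcarrier_single good_ld)
  then have "single (ld [] {#}) (ld [] {#} :: 'a diagram) = 0"
    by (induction rule: series.span_induct_alt) (auto simp: fun_apply scale_def ldrel_empty)
  then show False by (simp add: single_def)
qed

instantiation dq :: (type) rat_algebra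
begin

definition one_dq :: "'a dq" where "one_dq = cl (ld [] {#})"
definition times_dq :: "'a dq \<Rightarrow> 'a dq \<Rightarrow> 'a dq" where "times_dq = dmult"

instance
proof
  fix x y z :: "'a dq" and r
  show "x * y * z = x * (y * z)" "(x + y) * z = x * z + y * z" "x * (y + z) = x * y + x * z"
    "r *q x * y = r *q (x * y)" "x * r *q y = r *q (x * y)"
    by (simp_all add: times_dq_def dmult_assoc dmult_add_left dmult_add_right dmult_scale_left dmult_scale_right)
  show "(0 :: 'a dq) \<noteq> 1"
    using cl_empty_neq_0 by (metis one_dq_def)
  have n: "names {#} {#} = {}" by (simp add: names_def)
  show "1 * x = x"
  proof (induction x rule: dq_induct)
    case (add c D x)
    then obtain its V where "D = ld its V" "agood (ends its) V" by (auto simp: good_def)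
    with add show ?case
      using dmult_ld[of "[]" "{#}" its V] n
      by (simp add: times_dq_def one_dq_def dmult_add_right dmult_scale_right)
  qed (simp add: times_dq_def dmult_0_right)
  show "x * 1 = x"
  proof (induction x rule: dq_induct)
    case (add c D x)
    then obtain its V where "D = ld its V" "agood (ends its) V" by (auto simp: good_def)
    with add show ?case
      using dmult_ld[of its V "[]" "{#}"] n
      by (simp add: times_dq_def one_dq_def dmult_add_left dmult_scale_left)
  qed (simp add: times_dq_def dmult_0_left)
qed

end

lemma mult_cl: "good D \<Longrightarrow> good E \<Longrightarrow> cl D * cl E = cl (stack D E)"
  by (simp add: times_dq_def dmult_cl)

lemma mult_cl_ld:
  "agood (ends its) V \<Longrightarrow> agood (ends its') V' \<Longrightarrow> names (ends its) V \<inter> names (ends its') V' = {} \<Longrightarrow>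
    cl (ld its V) * cl (ld its' V') = cl (ld (its @ its') (V + V'))"
  by (simp add: times_dq_def dmult_ld)

section \<open>Planted trees and wheels: normal forms, commutators and reversal\<close>

section \<open>Trees and wheels\<close>

lemma sym_lnk: "(x, y) \<in> (lnk V)\<^sup>* \<Longrightarrow> (y, x) \<in> (lnk V)\<^sup>*"
proof -
  have "sym (lnk V)"
    unfolding lnk_def sym_def by blast
  then show "(x, y) \<in> (lnk V)\<^sup>* \<Longrightarrow> (y, x) \<in> (lnk V)\<^sup>*"
    using sym_rtrancl symD by metis
qed

lemma lnkI: "(p, q, r) \<in># V \<Longrightarrow> {x, y} \<subseteq> {p, q, r} \<Longrightarrow> (x, y) \<in> lnk V"
  unfolding lnk_def by blast

text \<open>Common form of both STU relations: two ends are traded for one, with a new vertex and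
  one new edge \<open>f\<close>, which is added once to the sources and once to the targets. Edges
  that lose their end stay connected to the skeleton through \<open>f\<close>.\<close>

lemma agood_replace:
  assumes "agood E V" "tls E' + outs V' = tls E + outs V + {#f#}" "hds E' + ins V' = hds E + ins V + {#f#}"
    and "f \<notin> names E V" "V \<subseteq># V'" "f \<in># hds E' + tls E'"
    and "\<And>e. e \<in># hds E + tls E \<Longrightarrow> e \<in># hds E' + tls E' \<or> (e, f) \<in> (lnk V')\<^sup>*"
  shows "agood E' V'"
  unfolding agood_def
proof (intro conjI allI ballI)
  fix e
  have "count (tls E + outs V) e \<le> 1"
    using assms(1) unfolding agood_def by blast
  moreover have "count (tls E + outs V) f = 0"
    using assms(4) unfolding names_def by (simp only: not_in_iff)
  ultimately show "count (tls E' + outs V') e \<le> 1"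
    unfolding assms(2) by (cases "e = f") auto
next
  have "tls E + outs V = hds E + ins V"
    using assms(1) unfolding agood_def by blast
  then show "tls E' + outs V' = hds E' + ins V'"
    unfolding assms(2,3) by simp
next
  fix e assume "e \<in> names E' V'"
  then have "e \<in> names E V \<or> e = f"
    unfolding names_def assms(2) by auto
  then show "\<exists>e'. (e, e') \<in> (lnk V')\<^sup>* \<and> e' \<in># hds E' + tls E'"
  proof
    assume "e \<in> names E V"
    then obtain e' where "(e, e') \<in> (lnk V)\<^sup>*" "e' \<in># hds E + tls E"
      using assms(1) unfolding agood_def by blast
    then have "(e, e') \<in> (lnk V')\<^sup>*" "e' \<in># hds E' + tls E' \<or> (e', f) \<in> (lnk V')\<^sup>*"
      using lnk_mono[OF assms(5)] assms(7) by blast+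
    then show ?thesis
      using assms(6) by (meson rtrancl_trans)
  next
    assume "e = f"
    then show ?thesis using assms(6) by blast
  qed
qed

lemma agood_STU2:
  assumes "agood (E + {#Head p, Tail e#}) V" "f \<notin> names (E + {#Head p, Tail e#}) V"
  shows "agood (E + {#Tail f#}) (V + {#(f, p, e)#})"
proof (rule agood_replace[OF assms(1) _ _ assms(2)])
  have "(x, f) \<in> (lnk (V + {#(f, p, e)#}))\<^sup>*" if "x = p \<or> x = e" for x
    by (rule r_into_rtrancl, rule lnkI[of f p e]) (use that in auto)
  then show "x \<in># hds (E + {#Tail f#}) + tls (E + {#Tail f#}) \<or> (x, f) \<in> (lnk (V + {#(f, p, e)#}))\<^sup>*"
    if "x \<in># hds (E + {#Head p, Tail e#}) + tls (E + {#Head p, Tail e#})" for x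
    using that by auto
qed auto

lemma agood_STU1:
  assumes "agood (E + {#Head p, Head q#}) V" "e \<notin> names (E + {#Head p, Head q#}) V"
  shows "agood (E + {#Head e#}) (V + {#(p, q, e)#})"
proof (rule agood_replace[OF assms(1) _ _ assms(2)])
  have "(x, e) \<in> (lnk (V + {#(p, q, e)#}))\<^sup>*" if "x = p \<or> x = q" for x
    by (rule r_into_rtrancl, rule lnkI[of p q e]) (use that in auto)
  then show "x \<in># hds (E + {#Head e#}) + tls (E + {#Head e#}) \<or> (x, e) \<in> (lnk (V + {#(p, q, e)#}))\<^sup>*"
    if "x \<in># hds (E + {#Head p, Head q#}) + tls (E + {#Head p, Head q#})" for x
    using that by auto
qed auto

lemma fresh_name: "\<exists>f. f \<notin> names E V"
  using ex_new_if_finite[of "names E V"] by (simp add: names_def infinite_UNIV_listI)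


subsection \<open>Moving ends\<close>

definition tl_items :: "('a \<times> edge) list \<Rightarrow> 'a items" where
  "tl_items ts = map (\<lambda>(x, e). (x, Tail e)) ts"

lemma tl_items_simps [simp]: "tl_items [] = []" "tl_items ((x, e) # ts) = (x, Tail e) # tl_items ts"
  "tl_items (ts @ ts') = tl_items ts @ tl_items ts'"
  by (simp_all add: tl_items_def)

lemma rev_tl_items: "rev (tl_items ts) = tl_items (rev ts)"
  by (simp add: tl_items_def rev_map)

lemma ends_tl_items: "ends (tl_items ts) = image_mset (\<lambda>(x, e). Tail e) (mset ts)"
  by (induction ts) (auto simp: tl_items_def)

lemma hds_tl_items [simp]: "hds (ends (tl_items ts)) = {#}"
  and tls_tl_items [simp]: "tls (ends (tl_items ts)) = mset (map snd ts)"
  by (induction ts) (auto simp: tl_items_def)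

lemma cl_swap_tails:
  assumes "agood (ends (us @ (x, Tail d) # (y, Tail e) # vs)) V"
  shows "cl (ld (us @ (x, Tail d) # (y, Tail e) # vs) V) = cl (ld (us @ (y, Tail e) # (x, Tail d) # vs) V)"
proof (cases "x = y")
  case True
  then show ?thesis using resp_TC[OF resp_cl, of us x d e vs V] assms by simp
qed (simp add: ld_swap)

text \<open>Adjacent tails commute by TC on the same strand and by the freedom of linearisation on
  different ones, so a block of tails is a multiset.\<close>

lemma cl_permute_tails:
  assumes "mset ts = mset ts'" "agood (ends (us @ tl_items ts @ vs)) V"
  shows "cl (ld (us @ tl_items ts @ vs) V) = cl (ld (us @ tl_items ts' @ vs) V)"
  using assms
proof (induction ts' arbitrary: us ts)
  case (Cons t ts')
  obtain x e where t: "t = (x, e)" by (cases t)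
  have "t \<in> set ts"
    using Cons.prems(1) by (metis list.set_intros(1) mset_eq_setD)
  then obtain ps qs where ts: "ts = ps @ t # qs"
    by (meson split_list)
  have move: "cl (ld (us @ tl_items ps @ (x, Tail e) # ws) V) = cl (ld (us @ (x, Tail e) # tl_items ps @ ws) V)"
    if "agood (ends (us @ tl_items ps @ (x, Tail e) # ws)) V" for ps ws
    using that
  proof (induction ps arbitrary: ws rule: rev_induct)
    case (snoc p ps)
    obtain y d where p: "p = (y, d)" by (cases p)
    have "cl (ld (us @ tl_items (ps @ [p]) @ (x, Tail e) # ws) V) =
        cl (ld ((us @ tl_items ps) @ (y, Tail d) # (x, Tail e) # ws) V)"
      by (simp add: p)
    also have "\<dots> = cl (ld ((us @ tl_items ps) @ (x, Tail e) # (y, Tail d) # ws) V)"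
      by (rule cl_swap_tails) (use snoc.prems in \<open>simp add: p\<close>)
    also have "\<dots> = cl (ld (us @ (x, Tail e) # tl_items ps @ (y, Tail d) # ws) V)"
      using snoc.IH[of "(y, Tail d) # ws"] snoc.prems by (simp add: p add_mset_commute)
    finally show ?case by (simp add: p)
  qed simp
  have g: "agood (ends (us @ (x, Tail e) # tl_items (ps @ qs) @ vs)) V"
    using Cons.prems(2) by (simp add: ts t)
  have "cl (ld (us @ tl_items ts @ vs) V) = cl (ld (us @ tl_items ps @ (x, Tail e) # tl_items qs @ vs) V)"
    by (simp add: ts t)
  also have "\<dots> = cl (ld (us @ (x, Tail e) # tl_items ps @ tl_items qs @ vs) V)"
    by (rule move) (use Cons.prems(2) in \<open>simp add: ts t\<close>)
  also have "\<dots> = cl (ld ((us @ [(x, Tail e)]) @ tl_items (ps @ qs) @ vs) V)"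
    by simp
  also have "\<dots> = cl (ld ((us @ [(x, Tail e)]) @ tl_items ts' @ vs) V)"
    by (rule Cons.IH) (use Cons.prems(1) g in \<open>auto simp: ts\<close>)
  finally show ?case by (simp add: t)
qed simp

text \<open>The common source of the commutators and of the divergence. While the head moves down
  through a block of tails, only tails on its own strand cost an STU_2 term, in which the head is
  absorbed by a vertex on the edge of that tail. Each correction is a separate diagram, so one fresh
  name \<open>f\<close> serves all of them.\<close>

lemma head_past_tails:
  assumes "agood (ends (us @ tl_items ts @ (b, Head p) # vs)) V"
    and "f \<notin> names (ends (us @ tl_items ts @ (b, Head p) # vs)) V"
  shows "cl (ld (us @ tl_items ts @ (b, Head p) # vs) V) =
    cl (ld (us @ (b, Head p) # tl_items ts @ vs) V) -
    (\<Sum>i<length ts. if fst (ts ! i) = b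
      then cl (ld (us @ tl_items (ts[i := (b, f)]) @ vs) (V + {#(f, p, snd (ts ! i))#})) else 0)"
  using assms
proof (induction ts arbitrary: vs rule: rev_induct)
  case (snoc t ts)
  obtain x e where t: "t = (x, e)" by (cases t)
  let ?E = "ends us + (ends (tl_items ts) + ends vs)"
  have g: "agood (?E + {#Head p, Tail e#}) V" and f: "f \<notin> names (?E + {#Head p, Tail e#}) V"
    using snoc.prems by (simp_all add: t add_mset_commute add.assoc)
  define err where "err = cl (ld (us @ tl_items ts @ (b, Tail f) # vs) (V + {#(f, p, e)#}))"
  have step: "cl (ld (us @ tl_items ts @ (x, Tail e) # (b, Head p) # vs) V) =
      cl (ld (us @ tl_items ts @ (b, Head p) # (x, Tail e) # vs) V) - (if x = b then err else 0)"
  proof (cases "x = b")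
    case True
    then show ?thesis
      using resp_STU2[OF resp_cl, of "us @ tl_items ts" b p e vs V f] g agood_STU2[OF g f]
      by (simp add: err_def add_mset_commute)
  next
    case False
    then show ?thesis using ld_swap[of x b "us @ tl_items ts" "Tail e" "Head p" vs V] by simp
  qed
  have "cl (ld (us @ tl_items (ts @ [t]) @ (b, Head p) # vs) V) =
      cl (ld (us @ tl_items ts @ (b, Head p) # (x, Tail e) # vs) V) - (if x = b then err else 0)"
    using step by (simp add: t)
  also have "cl (ld (us @ tl_items ts @ (b, Head p) # (x, Tail e) # vs) V) =
      cl (ld (us @ (b, Head p) # tl_items ts @ (x, Tail e) # vs) V) -
      (\<Sum>i<length ts. if fst (ts ! i) = b
        then cl (ld (us @ tl_items (ts[i := (b, f)]) @ (x, Tail e) # vs) (V + {#(f, p, snd (ts ! i))#})) else 0)"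
    by (rule snoc.IH) (use g f in \<open>simp_all add: add_mset_commute\<close>)
  \<comment> \<open>The top tail \<open>t\<close> has already been passed and is unchanged in the
    corrections for \<open>ts\<close>, so it can be counted as the last member of their
    block.\<close>
  also have "(\<Sum>i<length ts. if fst (ts ! i) = b
        then cl (ld (us @ tl_items (ts[i := (b, f)]) @ (x, Tail e) # vs) (V + {#(f, p, snd (ts ! i))#})) else 0) =
      (\<Sum>i<length ts. if fst ((ts @ [t]) ! i) = b
        then cl (ld (us @ tl_items ((ts @ [t])[i := (b, f)]) @ vs) (V + {#(f, p, snd ((ts @ [t]) ! i))#})) else 0)"
    by (rule sum.cong) (auto simp: nth_append list_update_append t)
  finally show ?case
    by (auto simp: err_def t algebra_simps)
qed simp


subsection \<open>Labelled trees\<close>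

text \<open>Bracket trees with a name for every edge, because the relations speak of named edges.
  The name at a bracket is that of its output edge; \<open>lab\<close> assigns the names by position
  that \<open>plant\<close> uses.\<close>

datatype 'a ltree = LL 'a edge | LB edge "'a ltree" "'a ltree"

fun rt :: "'a ltree \<Rightarrow> edge" where
  "rt (LL x e) = e"
| "rt (LB e S T) = e"

fun lverts :: "'a ltree \<Rightarrow> vertices" where
  "lverts (LL x e) = {#}"
| "lverts (LB e S T) = {#(rt S, rt T, e)#} + lverts S + lverts T"

fun ltails :: "'a ltree \<Rightarrow> ('a \<times> edge) list" where
  "ltails (LL x e) = [(x, e)]"
| "ltails (LB e S T) = ltails S @ ltails T"

fun lnames :: "'a ltree \<Rightarrow> edge list" where
  "lnames (LL x e) = [e]"
| "lnames (LB e S T) = e # lnames S @ lnames T"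

fun shape :: "'a ltree \<Rightarrow> 'a btree" where
  "shape (LL x e) = Leaf x"
| "shape (LB e S T) = Br (shape S) (shape T)"

fun lren :: "(edge \<Rightarrow> edge) \<Rightarrow> 'a ltree \<Rightarrow> 'a ltree" where
  "lren \<pi> (LL x e) = LL x (\<pi> e)"
| "lren \<pi> (LB e S T) = LB (\<pi> e) (lren \<pi> S) (lren \<pi> T)"

fun lab :: "edge \<Rightarrow> 'a btree \<Rightarrow> 'a ltree" where
  "lab e (Leaf x) = LL x e"
| "lab e (Br s t) = LB e (lab (0 # e) s) (lab (1 # e) t)"

lemma lab_simps [simp]: "rt (lab e t) = e" "shape (lab e t) = t" "lverts (lab e t) = tree_verts e t"
  "ltails (lab e t) = tree_leaves e t"
proof -
  show r: "rt (lab e t) = e" for e and t :: "'a btree" by (cases t) auto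
  show "shape (lab e t) = t" "lverts (lab e t) = tree_verts e t" "ltails (lab e t) = tree_leaves e t"
    by (induction t arbitrary: e) (auto simp: r)
qed

lemma length_ltails: "length (ltails T) = length (leaves (shape T))"
  and fst_ltails: "map fst (ltails T) = leaves (shape T)"
  by (induction T) auto

lemma lnames_lab: "n \<in> set (lnames (lab e t)) \<Longrightarrow> \<exists>u. n = u @ e"
proof (induction t arbitrary: e)
  case (Br s t)
  then have "n = e \<or> (\<exists>u. n = u @ 0 # e) \<or> (\<exists>u. n = u @ 1 # e)"
    by auto
  then show ?case
    by (metis append.left_neutral append.assoc append_Cons)
qed auto

lemma distinct_lnames_lab: "distinct (lnames (lab e t))"
proof (induction t arbitrary: e)
  case (Br s t)
  have "set (lnames (lab (0 # e) s)) \<inter> set (lnames (lab (1 # e) t)) = {}"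
    by (auto dest!: lnames_lab)
  moreover have "e \<notin> set (lnames (lab (k # e) r))" for k and r :: "'a btree"
    by (auto dest!: lnames_lab)
  ultimately show ?case using Br by simp
qed simp

lemma ltree_sources: "mset (map snd (ltails T)) + outs (lverts T) = mset (lnames T)"
  by (induction T) (auto simp: ac_simps)

lemma ltree_targets: "add_mset (rt T) (ins (lverts T)) = mset (lnames T)"
proof (induction T)
  case (LB e S T)
  have "add_mset e (ins (lverts (LB e S T))) =
      add_mset e (add_mset (rt S) (ins (lverts S)) + add_mset (rt T) (ins (lverts T)))"
    by simp
  then show ?case
    unfolding LB by simp
qed simp

lemma lren_simps: "rt (lren \<pi> T) = \<pi> (rt T)" "lverts (lren \<pi> T) = ren_verts \<pi> (lverts T)"
  "ltails (lren \<pi> T) = map (\<lambda>(x, e). (x, \<pi> e)) (ltails T)"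
proof -
  show r: "rt (lren \<pi> T) = \<pi> (rt T)" for T :: "'a ltree" by (cases T) auto
  show "lverts (lren \<pi> T) = ren_verts \<pi> (lverts T)" "ltails (lren \<pi> T) = map (\<lambda>(x, e). (x, \<pi> e)) (ltails T)"
    by (induction T) (auto simp: r)
qed

lemma length_lnames: "Suc (length (lnames T)) = 2 * length (leaves (shape T))"
  by (induction T) auto

lemma lren_eq: "shape S = shape T \<Longrightarrow> map \<pi> (lnames S) = lnames T \<Longrightarrow> lren \<pi> S = T"
proof (induction S arbitrary: T)
  case (LL x e) then show ?case by (cases T) auto
next
  case (LB e S1 S2)
  then obtain e' T1 T2 where T: "T = LB e' T1 T2" by (cases T) auto
  then have "length (map \<pi> (lnames S1)) = length (lnames T1)"
    using LB.prems(1) length_lnames[of S1] length_lnames[of T1] by simp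
  then have "map \<pi> (lnames S1) = lnames T1" "map \<pi> (lnames S2) = lnames T2" "\<pi> e = e'"
    using LB.prems(2) unfolding T by simp_all
  then show ?case
    using LB.IH(1)[of T1] LB.IH(2)[of T2] LB.prems(1) by (simp add: T)
qed

lemma lnk_rt: "e \<in> set (lnames T) \<Longrightarrow> (e, rt T) \<in> (lnk (lverts T))\<^sup>*"
proof (induction T)
  case (LB y S T)
  let ?V = "lverts (LB y S T)"
  have "(rt S, y) \<in> lnk ?V" "(rt T, y) \<in> lnk ?V"
    by (rule lnkI[of "rt S" "rt T" y]; simp)+
  moreover have "(lnk (lverts S))\<^sup>* \<subseteq> (lnk ?V)\<^sup>*" "(lnk (lverts T))\<^sup>* \<subseteq> (lnk ?V)\<^sup>*"
    by (rule lnk_mono; simp add: subset_mset.add_increasing subset_mset.add_increasing2)+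
  ultimately show ?case
    using LB by (auto intro: rtrancl_into_rtrancl)
qed simp

lemma ltails_subset_lnames: "snd ` set (ltails T) \<subseteq> set (lnames T)"
  by (induction T) auto

lemma ltails_not_Nil [simp]: "ltails T \<noteq> []"
  by (induction T) auto

definition planted :: "'a \<Rightarrow> 'a ltree \<Rightarrow> 'a diagram" where
  "planted a T = ld ((a, Head (rt T)) # tl_items (ltails T)) (lverts T)"

lemma agood_planted:
  assumes "distinct (lnames T)"
  shows "agood (ends ((a, Head (rt T)) # tl_items (ltails T))) (lverts T)"
proof -
  let ?E = "ends ((a, Head (rt T)) # tl_items (ltails T))"
  have s: "tls ?E + outs (lverts T) = mset (lnames T)"
    using ltree_sources[of T] by simp
  have t: "hds ?E + ins (lverts T) = mset (lnames T)"
    using ltree_targets[of T] by simp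
  show ?thesis
    unfolding agood_def names_def s t
  proof (intro conjI allI ballI)
    show "count (mset (lnames T)) e \<le> 1" for e
      using assms by (simp add: distinct_count_atmost_1)
    show "\<exists>e'. (e, e') \<in> (lnk (lverts T))\<^sup>* \<and> e' \<in># hds ?E + tls ?E" if "e \<in># mset (lnames T)" for e
      using that lnk_rt[of e T] by (intro exI[of _ "rt T"]) simp
  qed simp
qed

definition PT :: "'a \<Rightarrow> 'a btree \<Rightarrow> 'a dq" where
  "PT a t = cl (plant a t)"

lemma plant_eq_planted: "plant a t = planted a (lab [] t)"
proof -
  have "concat (map (\<lambda>(x, e). if x = b then [Tail e] else []) ts) = map snd (filter (\<lambda>i. fst i = b) (tl_items ts))"
    for b and ts :: "('a \<times> edge) list"
    by (induction ts) auto
  then show ?thesis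
    by (auto simp: plant_def planted_def ld_def fun_eq_iff)
qed

lemma agood_distinct:
  assumes "agood E V" "tls E + outs V = mset xs"
  shows "distinct xs"
  unfolding distinct_count_atmost_1
proof
  fix x
  have "count (mset xs) x \<le> 1"
    using assms unfolding agood_def by metis
  moreover have "count (mset xs) x = 0 \<longleftrightarrow> x \<notin> set xs"
    by simp
  ultimately show "count (mset xs) x = (if x \<in> set xs then 1 else 0)"
    by (cases "count (mset xs) x") auto
qed

lemma rename_lists:
  assumes "distinct xs" "distinct ys" "length xs = length ys"
  shows "\<exists>\<pi>. inj_on \<pi> (set xs) \<and> map \<pi> xs = ys"
proof -
  define \<pi> where "\<pi> x = the (map_of (zip xs ys) x)" for x
  have m: "map \<pi> xs = ys"
    using assms by (intro nth_equalityI) (auto simp: \<pi>_def map_of_zip_nth)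
  then have "inj_on \<pi> (set xs)"
    using assms by (metis distinct_map)
  with m show ?thesis by blast
qed

lemma cl_planted:
  assumes "distinct (lnames T)"
  shows "cl (planted a T) = PT a (shape T)"
proof -
  let ?T = "lab [] (shape T)"
  obtain \<pi> where \<pi>: "inj_on \<pi> (set (lnames T))" "map \<pi> (lnames T) = lnames ?T"
    using rename_lists[OF assms distinct_lnames_lab[of "[]" "shape T"]] length_lnames[of T] length_lnames[of ?T] by auto
  have n: "names (ends ((a, Head (rt T)) # tl_items (ltails T))) (lverts T) = set (lnames T)"
    using arg_cong[OF ltree_sources[of T], of set_mset] by (simp add: names_def)
  have r: "lren \<pi> T = ?T"
    by (rule lren_eq) (simp_all add: \<pi>)
  have "ren_items \<pi> ((a, Head (rt T)) # tl_items (ltails T)) = (a, Head (rt ?T)) # tl_items (ltails ?T)"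
    unfolding r[symmetric] lren_simps by (auto simp: ren_items_def tl_items_def)
  moreover have "ren_verts \<pi> (lverts T) = lverts ?T"
    unfolding r[symmetric] lren_simps ..
  ultimately show ?thesis
    using resp_iso[OF resp_cl agood_planted[OF assms, of a], of \<pi>] \<pi>(1)
    unfolding n by (simp add: PT_def plant_eq_planted planted_def)
qed

text \<open>Criterion for recognising a planted tree: by TC the order of the tails does not matter,
  and the names only have to be distinct, which the diagram condition ensures.\<close>

lemma cl_eq_PT:
  assumes "agood (ends ((a, Head (rt T)) # tl_items ts)) V" "V = lverts T" "mset ts = mset (ltails T)"
  shows "cl (ld ((a, Head (rt T)) # tl_items ts) V) = PT a (shape T)"
proof -
  have "mset (map snd ts) = mset (map snd (ltails T))"
    using assms(3) by (metis mset_map)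
  then have "distinct (lnames T)"
    using assms(1,2) ltree_sources[of T] by (intro agood_distinct[of _ V]) auto
  moreover have "cl (ld ([(a, Head (rt T))] @ tl_items ts @ []) V) = cl (ld ([(a, Head (rt T))] @ tl_items (ltails T) @ []) V)"
    by (rule cl_permute_tails) (use assms in auto)
  ultimately show ?thesis
    using cl_planted[of T a] by (simp add: planted_def assms(2))
qed

lemma good_plant: "good (plant a t)"
  unfolding plant_eq_planted planted_def good_ld by (rule agood_planted[OF distinct_lnames_lab])


subsection \<open>Chains and wheels\<close>

text \<open>
  A chain is a path of vertices whose left inputs are trees; each tree comes with the output edge of
  its vertex, which is the right input of the preceding vertex.
\<close>

type_synonym 'a chain = "('a ltree \<times> edge) list"

fun fedge :: "'a chain \<Rightarrow> edge \<Rightarrow> edge" where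
  "fedge [] z = z"
| "fedge ((T, c) # ws) z = c"

fun cverts :: "'a chain \<Rightarrow> edge \<Rightarrow> vertices" where
  "cverts [] z = {#}"
| "cverts ((T, c) # ws) z = {#(rt T, fedge ws z, c)#} + lverts T + cverts ws z"

fun ctails :: "'a chain \<Rightarrow> ('a \<times> edge) list" where
  "ctails [] = []"
| "ctails ((T, c) # ws) = ltails T @ ctails ws"

fun cnames :: "'a chain \<Rightarrow> edge list" where
  "cnames [] = []"
| "cnames ((T, c) # ws) = c # lnames T @ cnames ws"

abbreviation cshape :: "'a chain \<Rightarrow> 'a btree list" where
  "cshape ws \<equiv> map (\<lambda>w. shape (fst w)) ws"

lemma fedge_append: "fedge (us @ vs) z = fedge us (fedge vs z)"
  by (cases "(us, z)" rule: fedge.cases) auto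

lemma cverts_append: "cverts (us @ vs) z = cverts us (fedge vs z) + cverts vs z"
  by (induction us z rule: cverts.induct) (auto simp: fedge_append ac_simps)

lemma ctails_append: "ctails (us @ vs) = ctails us @ ctails vs"
  by (induction us rule: ctails.induct) auto

lemma chain_sources: "mset (map snd (ctails ws)) + outs (cverts ws z) = mset (cnames ws)"
proof (induction ws z rule: cverts.induct)
  case (2 T c ws z)
  have "mset (map snd (ctails ((T, c) # ws))) + outs (cverts ((T, c) # ws) z) =
      add_mset c (mset (map snd (ltails T)) + outs (lverts T) + (mset (map snd (ctails ws)) + outs (cverts ws z)))"
    by (simp add: ac_simps)
  then show ?case unfolding 2 ltree_sources by simp
qed simp

lemma chain_targets: "add_mset (fedge ws z) (ins (cverts ws z)) = add_mset z (mset (cnames ws))"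
proof (induction ws z rule: cverts.induct)
  case (2 T c ws z)
  have "add_mset (fedge ((T, c) # ws) z) (ins (cverts ((T, c) # ws) z)) =
      add_mset c (add_mset (rt T) (ins (lverts T)) + add_mset (fedge ws z) (ins (cverts ws z)))"
    by simp
  then show ?case unfolding 2 ltree_targets by simp
qed simp

lemma lnk_chain:
  "e \<in> set (cnames ws) \<Longrightarrow> \<exists>e'\<in>snd ` set (ctails ws). (e, e') \<in> (lnk (cverts ws z))\<^sup>*"
proof (induction ws z rule: cverts.induct)
  case (2 T c ws z)
  let ?V = "cverts ((T, c) # ws) z"
  show ?case
  proof (cases "e \<in> set (cnames ws)")
    case True
    then obtain e' where "e' \<in> snd ` set (ctails ws)" "(e, e') \<in> (lnk (cverts ws z))\<^sup>*"
      using 2 by blast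
    moreover have "(lnk (cverts ws z))\<^sup>* \<subseteq> (lnk ?V)\<^sup>*"
      by (rule lnk_mono) simp
    ultimately show ?thesis by auto
  next
    case False
    have m: "(lnk (lverts T))\<^sup>* \<subseteq> (lnk ?V)\<^sup>*"
      by (rule lnk_mono) (simp add: subset_mset.add_increasing subset_mset.add_increasing2)
    have "(c, rt T) \<in> lnk ?V"
      by (rule lnkI[of "rt T" "fedge ws z" c]) auto
    then have "(e, rt T) \<in> (lnk ?V)\<^sup>*"
      using False 2(2) lnk_rt[of e T] m by auto
    moreover obtain x e' where e': "(x, e') \<in> set (ltails T)"
      using ltails_not_Nil[of T] by (metis list.set_intros(1) neq_Nil_conv surj_pair)
    then have "(rt T, e') \<in> (lnk ?V)\<^sup>*"
      using ltails_subset_lnames[of T] lnk_rt[of e' T] m sym_lnk by (metis image_subset_iff snd_conv subsetD)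
    ultimately show ?thesis
      using e' by (intro bexI[of _ e']) (auto intro: rtrancl_trans image_eqI[of _ _ "(x, e')"])
  qed
qed simp

text \<open>\<open>fedge ws []\<close> is the output edge of the first vertex; inserting it as the
  end of the chain closes the path to a cycle. The default \<open>[]\<close> is reached only for the
  empty chain.\<close>

definition wverts :: "'a chain \<Rightarrow> vertices" where
  "wverts ws = cverts ws (fedge ws [])"

lemma wverts_Cons: "wverts ((T, c) # ws) = cverts ((T, c) # ws) c"
  by (simp add: wverts_def)

lemma wheel_sources: "mset (map snd (ctails ws)) + outs (wverts ws) = mset (cnames ws)"
  unfolding wverts_def by (rule chain_sources)

lemma wheel_targets: "ws \<noteq> [] \<Longrightarrow> ins (wverts ws) = mset (cnames ws)"
  using chain_targets[of ws "fedge ws []"] by (cases ws rule: cnames.cases) (auto simp: wverts_def)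

lemma agood_wheel:
  assumes "distinct (cnames ws)" "ws \<noteq> []"
  shows "agood (ends (tl_items (ctails ws))) (wverts ws)"
proof -
  let ?E = "ends (tl_items (ctails ws))"
  have s: "tls ?E + outs (wverts ws) = mset (cnames ws)"
    using wheel_sources[of ws] by simp
  have t: "hds ?E + ins (wverts ws) = mset (cnames ws)"
    using wheel_targets[of ws] assms by simp
  show ?thesis
    unfolding agood_def names_def s t
  proof (intro conjI allI ballI)
    show "count (mset (cnames ws)) e \<le> 1" for e
      using assms(1) by (simp add: distinct_count_atmost_1)
    show "\<exists>e'. (e, e') \<in> (lnk (wverts ws))\<^sup>* \<and> e' \<in># hds ?E + tls ?E" if "e \<in># mset (cnames ws)" for e
      using that lnk_chain[of e ws "fedge ws []"] by (auto simp: wverts_def)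
  qed simp
qed

definition wlab :: "'a btree list \<Rightarrow> 'a chain" where
  "wlab ts = map (\<lambda>i. (lab [0, i] (ts ! i), [1, i])) [0..<length ts]"

text \<open>Wheels are needed with whole trees as spokes, since pushing a planted tree through a leg
  produces such a spoke. The sign in \<open>iota\<close> is not included.\<close>

definition WH :: "'a btree list \<Rightarrow> 'a dq" where
  "WH ts = cl (ld (tl_items (ctails (wlab ts))) (wverts (wlab ts)))"

lemma cshape_wlab: "cshape (wlab ts) = ts"
  by (rule nth_equalityI) (auto simp: wlab_def)

lemma cnames_eq: "cnames ws = concat (map (\<lambda>(T, c). c # lnames T) ws)"
  by (induction ws rule: cnames.induct) auto

lemma distinct_cnames_wlab: "distinct (cnames (wlab ts))"
proof -
  have "distinct (concat (map (\<lambda>i. [1, i] # lnames (lab [0, i] (ts ! i))) is))" if "distinct is" for "is" :: "nat list"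
    using that
  proof (induction "is")
    case (Cons i "is")
    have "u @ [0, i] \<noteq> v @ [0, j]" "u @ [0, i] \<noteq> [1, j]" "[1, j] \<noteq> u @ [0, i]" if "i \<noteq> j" for u v j
      using that by (auto simp: append_eq_Cons_conv Cons_eq_append_conv)
    moreover have "u @ [0, i] \<noteq> [1, i]" "[1, i] \<noteq> u @ [0, i]" for u
      by (auto simp: append_eq_Cons_conv Cons_eq_append_conv)
    ultimately show ?case
      using Cons distinct_lnames_lab[of "[0, i]" "ts ! i"]
      by (fastforce dest!: lnames_lab)
  qed simp
  from this[of "[0..<length ts]"] show ?thesis
    by (simp add: cnames_eq wlab_def o_def)
qed

fun cren :: "(edge \<Rightarrow> edge) \<Rightarrow> 'a chain \<Rightarrow> 'a chain" where
  "cren \<pi> [] = []"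
| "cren \<pi> ((T, c) # ws) = (lren \<pi> T, \<pi> c) # cren \<pi> ws"

lemma cren_simps: "ws \<noteq> [] \<Longrightarrow> fedge (cren \<pi> ws) z' = \<pi> (fedge ws z)"
  "cverts (cren \<pi> ws) (\<pi> z) = ren_verts \<pi> (cverts ws z)"
  "ctails (cren \<pi> ws) = map (\<lambda>(x, e). (x, \<pi> e)) (ctails ws)"
proof -
  have f: "fedge (cren \<pi> ws) (\<pi> z) = \<pi> (fedge ws z)" for ws :: "'a chain" and \<pi>
    by (cases ws rule: cnames.cases) auto
  show "ws \<noteq> [] \<Longrightarrow> fedge (cren \<pi> ws) z' = \<pi> (fedge ws z)"
    by (cases ws rule: cnames.cases) auto
  show "cverts (cren \<pi> ws) (\<pi> z) = ren_verts \<pi> (cverts ws z)"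
    by (induction \<pi> ws rule: cren.induct) (auto simp: f lren_simps)
  show "ctails (cren \<pi> ws) = map (\<lambda>(x, e). (x, \<pi> e)) (ctails ws)"
    by (induction \<pi> ws rule: cren.induct) (auto simp: lren_simps)
qed

lemma length_cnames: "length (cnames ws) = (\<Sum>t\<leftarrow>cshape ws. 2 * length (leaves t))"
proof (induction ws rule: cnames.induct)
  case (2 T c ws)
  then show ?case using length_lnames[of T] by simp
qed simp

lemma cren_eq: "cshape us = cshape vs \<Longrightarrow> map \<pi> (cnames us) = cnames vs \<Longrightarrow> cren \<pi> us = vs"
proof (induction us arbitrary: vs rule: cnames.induct)
  case (2 T c us)
  then obtain S d vs' where vs: "vs = (S, d) # vs'" by (cases vs) auto
  with 2(2) have "length (map \<pi> (lnames T)) = length (lnames S)"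
    using length_lnames[of T] length_lnames[of S] by simp
  then have "map \<pi> (lnames T) = lnames S" "map \<pi> (cnames us) = cnames vs'" "\<pi> c = d"
    using 2(3) unfolding vs by simp_all
  then show ?case
    using 2(1)[of vs'] 2(2) lren_eq[of T S \<pi>] by (simp add: vs)
qed simp

lemma cl_eq_WH:
  assumes "agood (ends (tl_items ts)) V" "V = wverts ws" "mset ts = mset (ctails ws)" "ws \<noteq> []"
  shows "cl (ld (tl_items ts) V) = WH (cshape ws)"
proof -
  let ?ws = "wlab (cshape ws)"
  have "mset (map snd ts) = mset (map snd (ctails ws))"
    using assms(3) by (metis mset_map)
  then have d: "distinct (cnames ws)"
    using assms(1,2) wheel_sources[of ws] by (intro agood_distinct[of _ V]) auto
  obtain \<pi> where \<pi>: "inj_on \<pi> (set (cnames ws))" "map \<pi> (cnames ws) = cnames ?ws"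
    using rename_lists[OF d distinct_cnames_wlab[of "cshape ws"]] length_cnames[of ws] length_cnames[of ?ws] by (auto simp: cshape_wlab)
  have n: "names (ends (tl_items (ctails ws))) (wverts ws) = set (cnames ws)"
    using arg_cong[OF wheel_sources[of ws], of set_mset] by (simp add: names_def)
  have r: "cren \<pi> ws = ?ws"
    by (rule cren_eq) (simp_all add: \<pi> cshape_wlab)
  have "cl (ld ([] @ tl_items ts @ []) V) = cl (ld ([] @ tl_items (ctails ws) @ []) V)"
    by (rule cl_permute_tails) (use assms in auto)
  also have "\<dots> = cl (ld (ren_items \<pi> (tl_items (ctails ws))) (ren_verts \<pi> (wverts ws)))"
    using resp_iso[OF resp_cl agood_wheel[OF d assms(4)], of \<pi>] \<pi>(1) unfolding n by (simp add: assms(2))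
  also have "ren_items \<pi> (tl_items (ctails ws)) = tl_items (ctails ?ws)"
    unfolding r[symmetric] cren_simps by (auto simp: ren_items_def tl_items_def)
  also have "ren_verts \<pi> (wverts ws) = wverts ?ws"
    unfolding r[symmetric] wverts_def cren_simps(1)[OF assms(4), of \<pi> "[]" "[]"] cren_simps(2) ..
  finally show ?thesis unfolding WH_def append_Nil append_Nil2 .
qed

definition ctree :: "'a chain \<Rightarrow> 'a ltree \<Rightarrow> 'a ltree" where
  "ctree ws T = foldr (\<lambda>(U, c) T. LB c U T) ws T"

lemma ctree_simps: "rt (ctree ws T) = fedge ws (rt T)"
  "lverts (ctree ws T) = cverts ws (rt T) + lverts T"
  "ltails (ctree ws T) = ctails ws @ ltails T"
  "shape (ctree ws T) = foldr Br (cshape ws) (shape T)"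
proof -
  show r: "rt (ctree ws T) = fedge ws (rt T)" for ws
    by (cases ws rule: cnames.cases) (auto simp: ctree_def)
  show "lverts (ctree ws T) = cverts ws (rt T) + lverts T"
    by (induction ws rule: cnames.induct) (use r in \<open>auto simp: ctree_def\<close>)
  show "ltails (ctree ws T) = ctails ws @ ltails T" "shape (ctree ws T) = foldr Br (cshape ws) (shape T)"
    by (induction ws rule: cnames.induct) (auto simp: ctree_def)
qed

lemma lab_foldr: "\<exists>ws e. lab e0 (foldr Br us t) = ctree ws (lab e t) \<and> cshape ws = us"
proof (induction us arbitrary: e0)
  case Nil
  then show ?case by (intro exI[of _ "[]"] exI[of _ e0]) (simp add: ctree_def)
next
  case (Cons u us)
  from Cons[of "1 # e0"] obtain ws e where "lab (1 # e0) (foldr Br us t) = ctree ws (lab e t)" "cshape ws = us"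
    by blast
  then show ?case
    by (intro exI[of _ "(lab (0 # e0) u, e0) # ws"] exI[of _ e]) (simp add: ctree_def)
qed

lemma PT_rep:
  "\<exists>ws e. cshape ws = us \<and> PT a (foldr Br us t) = cl (planted a (ctree ws (lab e t))) \<and>
    agood (ends ((a, Head (rt (ctree ws (lab e t)))) # tl_items (ltails (ctree ws (lab e t))))) (lverts (ctree ws (lab e t)))"
proof -
  obtain ws e where w: "lab [] (foldr Br us t) = ctree ws (lab e t)" "cshape ws = us"
    using lab_foldr by blast
  have "agood (ends ((a, Head (rt (lab [] (foldr Br us t)))) # tl_items (ltails (lab [] (foldr Br us t)))))
      (lverts (lab [] (foldr Br us t)))"
    by (rule agood_planted[OF distinct_lnames_lab])
  then have "agood (ends ((a, Head (rt (ctree ws (lab e t)))) # tl_items (ltails (ctree ws (lab e t)))))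
      (lverts (ctree ws (lab e t)))"
    unfolding w .
  moreover have "PT a (foldr Br us t) = cl (planted a (ctree ws (lab e t)))"
    unfolding PT_def plant_eq_planted w ..
  ultimately show ?thesis
    using w(2) by blast
qed

text \<open>Antisymmetry is AS at a vertex of the spine. The Jacobi identity is IHX in its cyclic
  form, brought into the required shape by three uses of antisymmetry. With this, Dynkin's formula
  applies to planting.\<close>

global_interpretation PT: lie_functional "PT a :: 'a btree \<Rightarrow> 'a dq" for a
proof
  have antisym: "PT a (foldr Br us (Br s t)) = - PT a (foldr Br us (Br t s))" for us s t
  proof -
    obtain ws e where w: "cshape ws = us"
      "PT a (foldr Br us (Br s t)) = cl (planted a (ctree ws (lab e (Br s t))))"
      and g: "agood (ends ((a, Head (rt (ctree ws (lab e (Br s t))))) # tl_items (ltails (ctree ws (lab e (Br s t))))))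
        (lverts (ctree ws (lab e (Br s t))))"
      using PT_rep[of us a "Br s t"] by (elim exE conjE)
    define S where "S = lab (0 # e) s"
    define T where "T = lab (1 # e) t"
    define ts where "ts = ctails ws @ ltails S @ ltails T"
    define W where "W = cverts ws e + lverts S + lverts T"
    have V: "lverts (ctree ws (LB e S T)) = W + {#(rt S, rt T, e)#}"
      "lverts (ctree ws (LB e T S)) = W + {#(rt T, rt S, e)#}"
      by (simp_all add: ctree_simps W_def)
    have l: "lab e (Br s t) = LB e S T"
      by (simp add: S_def T_def)
    have g: "agood (ends ((a, Head (fedge ws e)) # tl_items ts)) (W + {#(rt S, rt T, e)#})"
      using g unfolding l V by (simp add: ctree_simps ts_def)
    have "cl (planted a (ctree ws (LB e S T))) = - cl (ld ((a, Head (fedge ws e)) # tl_items ts) (W + {#(rt T, rt S, e)#}))"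
      unfolding planted_def V using resp_AS[OF resp_cl g] by (simp add: ctree_simps ts_def)
    also have "cl (ld ((a, Head (fedge ws e)) # tl_items ts) (W + {#(rt T, rt S, e)#})) = PT a (shape (ctree ws (LB e T S)))"
      using cl_eq_PT[of a "ctree ws (LB e T S)" ts] agood_AS[OF g] V(2)
      by (simp add: ctree_simps ts_def)
    finally show ?thesis
      by (simp add: w l ctree_simps) (simp add: S_def T_def)
  qed
  show "PT a (foldr Br us (Br s t)) = - PT a (foldr Br us (Br t s))" for us s t
    by (rule antisym)
  have ihx: "PT a (foldr Br us (Br (Br p q) r)) + PT a (foldr Br us (Br (Br q r) p)) +
      PT a (foldr Br us (Br (Br r p) q)) = 0" for us p q r
  proof -
    obtain ws e where w: "cshape ws = us"
      "PT a (foldr Br us (Br (Br p q) r)) = cl (planted a (ctree ws (lab e (Br (Br p q) r))))"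
      and g: "agood (ends ((a, Head (rt (ctree ws (lab e (Br (Br p q) r))))) # tl_items (ltails (ctree ws (lab e (Br (Br p q) r))))))
        (lverts (ctree ws (lab e (Br (Br p q) r))))"
      using PT_rep[of us a "Br (Br p q) r"] by (elim exE conjE)
    define x where "x = 0 # e"
    define P where "P = lab (0 # x) p"
    define Q where "Q = lab (1 # x) q"
    define R where "R = lab (1 # e) r"
    define ts where "ts = ctails ws @ ltails P @ ltails Q @ ltails R"
    define W where "W = cverts ws e + lverts P + lverts Q + lverts R"
    have V: "lverts (ctree ws (LB e (LB x P Q) R)) = W + {#(rt P, rt Q, x), (x, rt R, e)#}"
      "lverts (ctree ws (LB e (LB x Q R) P)) = W + {#(rt Q, rt R, x), (x, rt P, e)#}"
      "lverts (ctree ws (LB e (LB x R P) Q)) = W + {#(rt R, rt P, x), (x, rt Q, e)#}"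
      by (simp_all add: ctree_simps W_def)
    have l: "lab e (Br (Br p q) r) = LB e (LB x P Q) R"
      by (simp add: x_def P_def Q_def R_def)
    have g: "agood (ends ((a, Head (fedge ws e)) # tl_items ts)) (W + {#(rt P, rt Q, x), (x, rt R, e)#})"
      using g unfolding l V by (simp add: ctree_simps ts_def)
    have g2: "agood (ends ((a, Head (fedge ws e)) # tl_items ts)) (W + {#(rt Q, rt R, x), (x, rt P, e)#})"
      by (rule agood_IHX[OF g])
    have g3: "agood (ends ((a, Head (fedge ws e)) # tl_items ts)) (W + {#(rt R, rt P, x), (x, rt Q, e)#})"
      by (rule agood_IHX[OF g2])
    have "cl (ld ((a, Head (fedge ws e)) # tl_items ts) (W + {#(rt P, rt Q, x), (x, rt R, e)#})) =
        PT a (shape (ctree ws (LB e (LB x P Q) R)))"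
      using cl_eq_PT[of a "ctree ws (LB e (LB x P Q) R)" ts] g V(1) by (simp add: ctree_simps ts_def)
    moreover have "cl (ld ((a, Head (fedge ws e)) # tl_items ts) (W + {#(rt Q, rt R, x), (x, rt P, e)#})) =
        PT a (shape (ctree ws (LB e (LB x Q R) P)))"
      using cl_eq_PT[of a "ctree ws (LB e (LB x Q R) P)" ts] g2 V(2) by (simp add: ctree_simps ts_def)
    moreover have "cl (ld ((a, Head (fedge ws e)) # tl_items ts) (W + {#(rt R, rt P, x), (x, rt Q, e)#})) =
        PT a (shape (ctree ws (LB e (LB x R P) Q)))"
      using cl_eq_PT[of a "ctree ws (LB e (LB x R P) Q)" ts] g3 V(3) by (simp add: ctree_simps ts_def)
    ultimately show ?thesis
      using resp_IHX[OF resp_cl g] by (simp add: ctree_simps w(1)) (simp add: P_def Q_def R_def)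
  qed
  show "PT a (foldr Br us (Br (Br s t) z)) = PT a (foldr Br us (Br s (Br t z))) - PT a (foldr Br us (Br t (Br s z)))"
    for us s t z
    using ihx[of us s t z] antisym[of us "Br t z" s] antisym[of us "Br z s" t] antisym[of "us @ [t]" z s]
    by (simp add: algebra_simps eq_neg_iff_add_eq_0)
qed


subsection \<open>Relations between wheels\<close>

lemma agood_wlab: "ts \<noteq> [] \<Longrightarrow> agood (ends (tl_items (ctails (wlab ts)))) (wverts (wlab ts))"
  by (rule agood_wheel[OF distinct_cnames_wlab]) (simp add: wlab_def)

lemma wverts_rotate: "wverts (us @ vs) = wverts (vs @ us)"
proof (cases "us = [] \<or> vs = []")
  case False
  then have "fedge us x = fedge us y" "fedge vs x = fedge vs y" for x y
    by (cases us rule: cnames.cases; cases vs rule: cnames.cases; simp)+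
  then show ?thesis
    unfolding wverts_def cverts_append fedge_append by (metis add.commute)
qed auto

lemma WH_rotate: "WH (us @ vs) = WH (vs @ us)"
proof (cases "us @ vs = []")
  case False
  define ws1 where "ws1 = take (length us) (wlab (us @ vs))"
  define ws2 where "ws2 = drop (length us) (wlab (us @ vs))"
  have w: "wlab (us @ vs) = ws1 @ ws2"
    by (simp add: ws1_def ws2_def)
  have "cshape ws1 = take (length us) (cshape (wlab (us @ vs)))" "cshape ws2 = drop (length us) (cshape (wlab (us @ vs)))"
    by (simp_all add: ws1_def ws2_def take_map drop_map)
  then have sh: "cshape ws1 = us" "cshape ws2 = vs"
    unfolding cshape_wlab by simp_all
  have "WH (us @ vs) = cl (ld (tl_items (ctails (ws1 @ ws2))) (wverts (ws1 @ ws2)))"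
    by (simp only: WH_def w)
  also have "\<dots> = WH (cshape (ws2 @ ws1))"
    using agood_wlab[OF False] False unfolding w
    by (intro cl_eq_WH) (auto simp: wverts_rotate ctails_append sh[symmetric])
  finally show ?thesis by (simp add: sh)
qed simp

text \<open>IHX is applied at the vertex \<open>x\<close> that is the root of the spoke
  \<open>[s, t]\<close>. To read the other two diagrams as wheels, the left inputs must be the
  spokes: this takes one AS for the second diagram and two for the third, which gives the
  signs.\<close>

lemma WH_Br_Cons: "WH (Br s t # us) = WH (s # t # us) - WH (t # s # us)"
proof -
  obtain X y ws where w: "wlab (Br s t # us) = (X, y) # ws"
    by (cases "wlab (Br s t # us)") (auto simp: wlab_def)
  have sh: "shape X = Br s t" "cshape ws = us"
    using cshape_wlab[of "Br s t # us"] w by auto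
  then obtain x S T where X: "X = LB x S T" "shape S = s" "shape T = t"
    by (cases X) auto
  define r where "r = fedge ws y"
  define ts where "ts = ltails S @ ltails T @ ctails ws"
  define W where "W = lverts S + lverts T + cverts ws y"
  have f: "fedge ws (fedge ws z) = fedge ws z" for z
    by (cases ws rule: cnames.cases) auto
  have V: "wverts ((X, y) # ws) = W + {#(rt S, rt T, x), (x, r, y)#}"
    "wverts ((S, y) # (T, x) # ws) = W + {#(rt T, r, x), (rt S, x, y)#}"
    "wverts ((T, y) # (S, x) # ws) = W + {#(rt S, r, x), (rt T, x, y)#}"
    by (simp_all add: wverts_Cons W_def r_def X add_mset_commute)
  have WX: "WH (Br s t # us) = cl (ld (tl_items ts) (W + {#(rt S, rt T, x), (x, r, y)#}))"
    unfolding WH_def w V by (simp add: X ts_def)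
  have g: "agood (ends (tl_items ts)) (W + {#(rt S, rt T, x), (x, r, y)#})"
    using agood_wlab[of "Br s t # us"] unfolding w V by (simp add: X ts_def)
  note g2 = agood_IHX[OF g]
  note g3 = agood_IHX[OF g2]
  have ihx: "cl (ld (tl_items ts) (W + {#(rt S, rt T, x), (x, r, y)#})) +
      cl (ld (tl_items ts) (W + {#(rt T, r, x), (x, rt S, y)#})) +
      cl (ld (tl_items ts) (W + {#(r, rt S, x), (x, rt T, y)#})) = 0"
    using resp_IHX[OF resp_cl g] .
  have g2': "agood (ends (tl_items ts)) (W + {#(rt T, r, x)#} + {#(x, rt S, y)#})"
    using g2 by (simp add: add_mset_commute)
  have "cl (ld (tl_items ts) (W + {#(rt T, r, x), (x, rt S, y)#})) =
      - cl (ld (tl_items ts) (W + {#(rt T, r, x), (rt S, x, y)#}))"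
    using resp_AS[OF resp_cl g2'] by (simp add: add_mset_commute)
  also have "cl (ld (tl_items ts) (W + {#(rt T, r, x), (rt S, x, y)#})) = WH (cshape ((S, y) # (T, x) # ws))"
    using agood_AS[OF g2'] V(2) by (intro cl_eq_WH) (simp_all add: ts_def add_mset_commute)
  finally have 2: "cl (ld (tl_items ts) (W + {#(rt T, r, x), (x, rt S, y)#})) = - WH (s # t # us)"
    by (simp add: X sh)
  have g3': "agood (ends (tl_items ts)) (W + {#(r, rt S, x)#} + {#(x, rt T, y)#})"
    using g3 by (simp add: add_mset_commute)
  have g3'': "agood (ends (tl_items ts)) (W + {#(rt T, x, y)#} + {#(r, rt S, x)#})"
    using agood_AS[OF g3'] by (simp add: add_mset_commute)
  have "cl (ld (tl_items ts) (W + {#(r, rt S, x), (x, rt T, y)#})) =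
      - cl (ld (tl_items ts) (W + {#(rt T, x, y)#} + {#(r, rt S, x)#}))"
    using resp_AS[OF resp_cl g3'] by (simp add: add_mset_commute)
  also have "cl (ld (tl_items ts) (W + {#(rt T, x, y)#} + {#(r, rt S, x)#})) =
      - cl (ld (tl_items ts) (W + {#(rt T, x, y)#} + {#(rt S, r, x)#}))"
    by (rule resp_AS[OF resp_cl g3''])
  also have "cl (ld (tl_items ts) (W + {#(rt T, x, y)#} + {#(rt S, r, x)#})) = WH (cshape ((T, y) # (S, x) # ws))"
    using agood_AS[OF g3''] V(3) by (intro cl_eq_WH) (simp_all add: ts_def add_mset_commute)
  finally have 3: "cl (ld (tl_items ts) (W + {#(r, rt S, x), (x, rt T, y)#})) = WH (t # s # us)"
    by (simp add: X sh)
  show ?thesis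
    using ihx unfolding WX 2 3 by (simp add: algebra_simps eq_neg_iff_add_eq_0)
qed

lemma WH_Br: "WH (us @ [Br s t] @ vs) = WH (us @ [s, t] @ vs) - WH (us @ [t, s] @ vs)"
  using WH_Br_Cons[of s t "vs @ us"] WH_rotate[of us "Br s t # vs"] WH_rotate[of us "s # t # vs"]
    WH_rotate[of us "t # s # vs"] by simp

lemmas WH_expand = tree_expand[where G = WH, OF WH_Br]


subsection \<open>Commutators of trees and wheels\<close>

text \<open>The \<open>i\<close>-th leaf \<open>x\<close> becomes \<open>[x, u]\<close>: the effect
  of a derivation with \<open>x \<mapsto> [x, u]\<close> on one leaf, and also what STU_2 produces
  there.\<close>

fun bsub :: "nat \<Rightarrow> 'a btree \<Rightarrow> 'a btree \<Rightarrow> 'a btree" where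
  "bsub i u (Leaf x) = (if i = 0 then Br (Leaf x) u else Leaf x)"
| "bsub i u (Br s t) = (if i < length (leaves s) then Br (bsub i u s) t else Br s (bsub (i - length (leaves s)) u t))"

text \<open>The named version of \<open>bsub\<close>: the old name of the leaf passes to the output
  of the new vertex, and the leaf receives the new name \<open>f\<close>, as in STU_2.\<close>

fun lsub :: "nat \<Rightarrow> edge \<Rightarrow> 'a ltree \<Rightarrow> 'a ltree \<Rightarrow> 'a ltree" where
  "lsub i f U (LL x e) = (if i = 0 then LB e (LL x f) U else LL x e)"
| "lsub i f U (LB e S T) = (if i < length (ltails S) then LB e (lsub i f U S) T
     else LB e S (lsub (i - length (ltails S)) f U T))"

lemma lsub_simps:
  "rt (lsub i f U T) = rt T"
  "shape (lsub i f U T) = bsub i (shape U) (shape T)"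
  "i < length (ltails T) \<Longrightarrow>
    lverts (lsub i f U T) = lverts T + lverts U + {#(f, rt U, snd (ltails T ! i))#}"
  "i < length (ltails T) \<Longrightarrow>
    mset (ltails (lsub i f U T)) = mset ((ltails T)[i := (fst (ltails T ! i), f)]) + mset (ltails U)"
proof -
  show r: "rt (lsub i f U T) = rt T" for i T by (cases T) auto
  show "shape (lsub i f U T) = bsub i (shape U) (shape T)"
    by (induction T arbitrary: i) (auto simp: length_ltails)
  show "i < length (ltails T) \<Longrightarrow>
      lverts (lsub i f U T) = lverts T + lverts U + {#(f, rt U, snd (ltails T ! i))#}"
    by (induction T arbitrary: i) (auto simp: r nth_append)
  show "i < length (ltails T) \<Longrightarrow>
      mset (ltails (lsub i f U T)) = mset ((ltails T)[i := (fst (ltails T ! i), f)]) + mset (ltails U)"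
    by (induction T arbitrary: i) (auto simp: nth_append list_update_append)
qed

lemma fst_ltails_nth: "i < length (leaves (shape T)) \<Longrightarrow> fst (ltails T ! i) = leaves (shape T) ! i"
  using nth_map[of i "ltails T" fst] by (simp add: length_ltails fst_ltails)

lemma planted_disjoint:
  fixes s t :: "'a btree"
  obtains S T where "shape S = s" "shape T = t" "distinct (lnames S)" "distinct (lnames T)"
    "set (lnames S) \<inter> set (lnames T) = {}"
proof
  show "set (lnames (lab [0] s)) \<inter> set (lnames (lab [1] t)) = {}"
    by (auto dest!: lnames_lab)
qed (simp_all add: distinct_lnames_lab)

lemma names_planted [simp]: "names (add_mset (Head (rt T)) (ends (tl_items (ltails T)))) (lverts T) = set (lnames T)"
  using arg_cong[OF ltree_sources[of T], of set_mset] by (simp add: names_def)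

lemma agood_two:
  assumes "distinct (lnames S)" "distinct (lnames T)" "set (lnames S) \<inter> set (lnames T) = {}"
  shows "agood ({#Head (rt S), Head (rt T)#} + (ends (tl_items (ltails S)) + ends (tl_items (ltails T)))) (lverts S + lverts T)"
  using agood_union[OF agood_planted[OF assms(1), of undefined] agood_planted[OF assms(2), of undefined]] assms(3)
  by (simp add: ac_simps add_mset_commute)

text \<open>In the product the tree \<open>T\<close> stands above \<open>S\<close>. Moving its head
  down past the leaves of \<open>S\<close> brings both heads to the bottom; a leaf of
  \<open>S\<close> on strand \<open>b\<close> leaves a correction in which \<open>T\<close> is
  grafted at that leaf.\<close>

lemma PT_mult:
  assumes "distinct (lnames S)" "distinct (lnames T)" "set (lnames S) \<inter> set (lnames T) = {}"
    and f: "f \<notin> set (lnames S) \<union> set (lnames T)"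
  shows "PT a (shape S) * PT b (shape T) =
    cl (ld ((a, Head (rt S)) # (b, Head (rt T)) # tl_items (ltails S @ ltails T)) (lverts S + lverts T)) -
    (\<Sum>i<length (leaves (shape S)). if leaves (shape S) ! i = b then PT a (bsub i (shape T) (shape S)) else 0)"
proof -
  let ?V = "lverts S + lverts T"
  note g = agood_two[OF assms(1-3)]
  have n: "names ({#Head (rt S), Head (rt T)#} + (ends (tl_items (ltails S)) + ends (tl_items (ltails T)))) ?V =
      set (lnames S) \<union> set (lnames T)"
    using names_planted[of S] names_planted[of T] by (auto simp: names_def)
  have g': "agood (ends ([(a, Head (rt S))] @ tl_items (ltails S) @ (b, Head (rt T)) # tl_items (ltails T))) ?V"
    using g by (simp add: add_mset_commute)
  have f': "f \<notin> names (ends ([(a, Head (rt S))] @ tl_items (ltails S) @ (b, Head (rt T)) # tl_items (ltails T))) ?V"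
    using f n by (simp add: add_mset_commute)
  have "PT a (shape S) * PT b (shape T) =
      cl (ld ([(a, Head (rt S))] @ tl_items (ltails S) @ (b, Head (rt T)) # tl_items (ltails T)) ?V)"
    unfolding cl_planted[OF assms(1), symmetric] cl_planted[OF assms(2), symmetric] planted_def
    by (subst mult_cl_ld) (use assms agood_planted[of S a] agood_planted[of T b] in simp_all)
  also have "\<dots> = cl (ld ([(a, Head (rt S))] @ (b, Head (rt T)) # tl_items (ltails S) @ tl_items (ltails T)) ?V) -
      (\<Sum>i<length (ltails S). if fst (ltails S ! i) = b
        then cl (ld ([(a, Head (rt S))] @ tl_items ((ltails S)[i := (b, f)]) @ tl_items (ltails T))
          (?V + {#(f, rt T, snd (ltails S ! i))#})) else 0)"
    by (rule head_past_tails[OF g' f'])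
  also have "(\<Sum>i<length (ltails S). if fst (ltails S ! i) = b
        then cl (ld ([(a, Head (rt S))] @ tl_items ((ltails S)[i := (b, f)]) @ tl_items (ltails T))
          (?V + {#(f, rt T, snd (ltails S ! i))#})) else 0) =
      (\<Sum>i<length (leaves (shape S)). if leaves (shape S) ! i = b then PT a (bsub i (shape T) (shape S)) else 0)"
    unfolding length_ltails
  proof (intro sum.cong refl, unfold lessThan_iff)
    fix i assume i: "i < length (leaves (shape S))"
    then have i': "i < length (ltails S)" by (simp add: length_ltails)
    obtain x e where xe: "ltails S ! i = (x, e)" by (cases "ltails S ! i")
    have "cl (ld ([(a, Head (rt S))] @ tl_items ((ltails S)[i := (b, f)]) @ tl_items (ltails T))
        (?V + {#(f, rt T, e)#})) = PT a (bsub i (shape T) (shape S))" if "x = b"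
    proof -
      define R where "R = mset (remove1 (x, e) (ltails S))"
      have "(x, e) \<in> set (ltails S)"
        using i' nth_mem[OF i'] unfolding xe by simp
      then have m: "mset (ltails S) = add_mset (x, e) R"
        by (simp add: R_def)
      have m': "mset ((ltails S)[i := (b, f)]) = add_mset (b, f) R"
        by (subst mset_update[OF i']) (simp add: xe m)
      let ?E = "{#Head (rt S)#} + (image_mset (\<lambda>(x, e). Tail e) R + ends (tl_items (ltails T)))"
      have "agood (?E + {#Head (rt T), Tail e#}) ?V"
        using g m by (simp add: ends_tl_items add_mset_commute)
      moreover have "f \<notin> names (?E + {#Head (rt T), Tail e#}) ?V"
        using f n m by (simp add: ends_tl_items add_mset_commute)
      ultimately have "agood (?E + {#Tail f#}) (?V + {#(f, rt T, e)#})"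
        by (rule agood_STU2)
      then have "agood (ends ((a, Head (rt (lsub i f T S))) # tl_items ((ltails S)[i := (b, f)] @ ltails T))) (?V + {#(f, rt T, e)#})"
        by (simp add: lsub_simps ends_tl_items m' add_mset_commute)
      then have "cl (ld ((a, Head (rt (lsub i f T S))) # tl_items ((ltails S)[i := (b, f)] @ ltails T)) (?V + {#(f, rt T, e)#})) =
          PT a (shape (lsub i f T S))"
        by (rule cl_eq_PT) (use i' xe that in \<open>simp_all add: lsub_simps\<close>)
      then show ?thesis by (simp add: lsub_simps)
    qed
    then show "(if fst (ltails S ! i) = b
        then cl (ld ([(a, Head (rt S))] @ tl_items ((ltails S)[i := (b, f)]) @ tl_items (ltails T))
          (?V + {#(f, rt T, snd (ltails S ! i))#})) else 0) =
        (if leaves (shape S) ! i = b then PT a (bsub i (shape T) (shape S)) else 0)"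
      using fst_ltails_nth[OF i] xe by auto
  qed
  finally show ?thesis by simp
qed

text \<open>Once both products have their heads at the bottom, the tails agree up to order and the
  heads differ by an exchange. On a common strand it costs an STU_1 term, and the corrections of the
  two products supply the other sums. These are the three terms of the bracket on
  \<open>FL(S)^S\<close>.\<close>

lemma PT_commutator:
  "PT a s * PT b t - PT b t * PT a s = (if a = b then PT a (Br s t) else 0) +
    (\<Sum>i<length (leaves t). if leaves t ! i = a then PT b (bsub i s t) else 0) -
    (\<Sum>i<length (leaves s). if leaves s ! i = b then PT a (bsub i t s) else 0)"
proof -
  obtain S T where ST: "shape S = s" "shape T = t" "distinct (lnames S)" "distinct (lnames T)"
    "set (lnames S) \<inter> set (lnames T) = {}"
    by (rule planted_disjoint)
  obtain f where f: "f \<notin> set (lnames S) \<union> set (lnames T)"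
    using ex_new_if_finite[of "set (lnames S) \<union> set (lnames T)"] by (auto simp: infinite_UNIV_listI)
  let ?V = "lverts S + lverts T"
  let ?ts = "ltails S @ ltails T"
  note g = agood_two[OF ST(3-5)]
  have n: "names ({#Head (rt S), Head (rt T)#} + (ends (tl_items (ltails S)) + ends (tl_items (ltails T)))) ?V =
      set (lnames S) \<union> set (lnames T)"
    using names_planted[of S] names_planted[of T] by (auto simp: names_def)
  have "cl (ld ((a, Head (rt S)) # (b, Head (rt T)) # tl_items ?ts) ?V) =
      cl (ld ((b, Head (rt T)) # (a, Head (rt S)) # tl_items ?ts) ?V) + (if a = b then PT a (Br s t) else 0)"
  proof (cases "a = b")
    case True
    have "agood ((ends (tl_items (ltails S)) + ends (tl_items (ltails T))) + {#Head f#}) (?V + {#(rt S, rt T, f)#})"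
      by (rule agood_STU1) (use g f n in \<open>simp_all add: add_mset_commute\<close>)
    then have g1: "agood (ends ([(a, Head f)] @ tl_items ?ts)) (?V + {#(rt S, rt T, f)#})"
      by simp
    have "cl (ld ((a, Head (rt (LB f S T))) # tl_items ?ts) (?V + {#(rt S, rt T, f)#})) = PT a (shape (LB f S T))"
      by (rule cl_eq_PT) (use g1 in auto)
    then show ?thesis
      using resp_STU1[OF resp_cl, of "[]" a "rt S" "rt T" "tl_items ?ts" ?V f] g g1 True ST(1,2)
      by (simp add: add_mset_commute)
  qed (use ld_swap[of a b "[]"] in simp)
  also have "cl (ld ((b, Head (rt T)) # (a, Head (rt S)) # tl_items ?ts) ?V) =
      cl (ld ((b, Head (rt T)) # (a, Head (rt S)) # tl_items (ltails T @ ltails S)) (lverts T + lverts S))"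
    using cl_permute_tails[of ?ts "ltails T @ ltails S" "[(b, Head (rt T)), (a, Head (rt S))]" "[]" ?V] g
    by (simp add: add_mset_commute add.commute)
  finally show ?thesis
    using PT_mult[OF ST(3-5) f, of a b, unfolded ST(1,2)] PT_mult[OF ST(4,3), of f b a, unfolded ST(1,2)] ST(5) f
    by (simp add: Int_commute Un_commute algebra_simps)
qed

lemma ren_tl_items: "ren_items \<pi> (tl_items ts) = tl_items (map (\<lambda>(x, e). (x, \<pi> e)) ts)"
  by (auto simp: ren_items_def tl_items_def)

lemma cl_tails_commute:
  assumes "agood (ends (tl_items ts)) V" "agood (ends (tl_items us)) W"
  shows "cl (ld (tl_items ts) V) * cl (ld (tl_items us) W) = cl (ld (tl_items us) W) * cl (ld (tl_items ts) V)"
proof -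
  define ts' where "ts' = map (\<lambda>(x, e). (x, 0 # e)) ts"
  define us' where "us' = map (\<lambda>(x, e). (x, 1 # e)) us"
  define V' where "V' = ren_verts ((#) 0) V"
  define W' where "W' = ren_verts ((#) 1) W"
  have c: "cl (ld (tl_items ts) V) = cl (ld (tl_items ts') V')" "cl (ld (tl_items us) W) = cl (ld (tl_items us') W')"
    unfolding ts'_def us'_def V'_def W'_def ren_tl_items[symmetric]
    by (rule resp_iso[OF resp_cl]; use assms in simp)+
  have g: "agood (ends (tl_items ts')) V'" "agood (ends (tl_items us')) W'"
    unfolding ts'_def us'_def V'_def W'_def ren_tl_items[symmetric] ends_ren
    by (rule agood_ren; use assms in simp)+
  have n: "names (ends (tl_items ts')) V' \<subseteq> range ((#) 0)" "names (ends (tl_items us')) W' \<subseteq> range ((#) 1)"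
    unfolding ts'_def us'_def V'_def W'_def ren_tl_items[symmetric] ends_ren names_ren by auto
  then have d: "names (ends (tl_items ts')) V' \<inter> names (ends (tl_items us')) W' = {}"
    by auto
  have "cl (ld ([] @ tl_items (ts' @ us') @ []) (V' + W')) = cl (ld ([] @ tl_items (us' @ ts') @ []) (V' + W'))"
    by (rule cl_permute_tails) (use agood_union[OF g d] in simp_all)
  then show ?thesis
    using mult_cl_ld[OF g d] mult_cl_ld[OF g(2,1)] d unfolding c by (simp add: add.commute Int_commute)
qed

lemma wlab_leaves: "wlab (map Leaf w) = map (\<lambda>i. (LL (w ! i) [0, i], [1, i])) [0..<length w]"
  by (auto simp: wlab_def)

lemma ctails_leaves: "ctails (map (\<lambda>i. (LL (x i) (e i), c i)) is) = map (\<lambda>i. (x i, e i)) is"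
  by (induction "is") auto

lemma wheel_eq: "wheel w = ld (tl_items (ctails (wlab (map Leaf w)))) (wverts (wlab (map Leaf w)))"
proof -
  define g where "g i = (LL (w ! i) [0, i], [1, i])" for i
  have v: "cverts (map g [k..<n]) z = mset (map (\<lambda>i. ([0, i], if Suc i < n then [1, Suc i] else z, [1, i])) [k..<n])"
    for k n z
  proof (induction "n - k" arbitrary: k)
    case (Suc m)
    then have k: "k < n" "[k..<n] = k # [Suc k..<n]"
      by (simp_all add: upt_conv_Cons)
    have "fedge (map g [Suc k..<n]) z = (if Suc k < n then [1, Suc k] else z)"
      by (simp add: g_def upt_conv_Cons)
    then show ?case
      using Suc.hyps(1)[of "Suc k"] Suc.hyps(2) k by (simp add: g_def)
  qed simp
  have f: "fedge (map g [0..<length w]) [] = [1, 0]" if "w \<noteq> []"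
    using that by (simp add: g_def upt_conv_Cons)
  have "wverts (wlab (map Leaf w)) =
      mset (map (\<lambda>i. ([0, i], [1, Suc i mod length w], [1, i])) [0..<length w])"
  proof (cases "w = []")
    case False
    have "wverts (wlab (map Leaf w)) = cverts (map g [0..<length w]) [1, 0]"
      unfolding wverts_def wlab_leaves g_def[symmetric] f[OF False] ..
    also have "\<dots> = mset (map (\<lambda>i. ([0, i], [1, Suc i mod length w], [1, i])) [0..<length w])"
      unfolding v by (rule arg_cong[of _ _ mset], rule map_cong)
        (auto simp: not_less less_Suc_eq dest: le_antisym[of "length w"])
    finally show ?thesis .
  qed (simp add: wlab_def wverts_def)
  moreover have "concat (map (\<lambda>i. if w ! i = b then [Tail [0, i]] else []) is) =
      map snd (filter (\<lambda>i. fst i = b) (tl_items (map (\<lambda>i. (w ! i, [0, i])) is)))" for b "is"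
    by (induction "is") auto
  ultimately show ?thesis
    by (simp add: wheel_def ld_def wlab_leaves ctails_leaves)
qed

lemma agood_wlab': "agood (ends (tl_items (ctails (wlab ts)))) (wverts (wlab ts))"
  using agood_wlab[of ts] by (cases "ts = []") (auto simp: wlab_def wverts_def)

lemma cl_wheel: "cl (wheel w) = WH (map Leaf w)"
  by (simp add: wheel_eq WH_def)

lemma good_wheel: "good (wheel w)"
  unfolding wheel_eq good_ld by (rule agood_wlab')

lemma WH_commute: "WH ts * WH us = WH us * WH ts"
  unfolding WH_def by (rule cl_tails_commute[OF agood_wlab' agood_wlab'])

lemma chain_update:
  assumes "i < length ws" "ws ! i = (U, c)" "rt U' = rt U"
  shows "fedge (ws[i := (U', c)]) z = fedge ws z"
    and "cverts (ws[i := (U', c)]) z + lverts U = cverts ws z + lverts U'"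
    and "mset (ctails (ws[i := (U', c)])) + mset (ltails U) = mset (ctails ws) + mset (ltails U')"
proof -
  define us where "us = take i ws"
  define vs where "vs = drop (Suc i) ws"
  have w: "ws = us @ (U, c) # vs" "ws[i := (U', c)] = us @ (U', c) # vs"
    using assms(1,2) id_take_nth_drop[of i ws] upd_conv_take_nth_drop[of i ws] by (simp_all add: us_def vs_def)
  show "fedge (ws[i := (U', c)]) z = fedge ws z"
    unfolding w(2) unfolding w(1) by (simp add: fedge_append)
  show "cverts (ws[i := (U', c)]) z + lverts U = cverts ws z + lverts U'"
    unfolding w(2) unfolding w(1) by (simp add: cverts_append assms(3) ac_simps)
  show "mset (ctails (ws[i := (U', c)])) + mset (ltails U) = mset (ctails ws) + mset (ltails U')"
    unfolding w(2) unfolding w(1) by (simp add: ctails_append ac_simps)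
qed

text \<open>A wheel has no heads, so the only work is to move the head of the tree down past the
  legs of the wheel; a leg on strand \<open>a\<close> becomes the spoke \<open>[a, s]\<close>. The
  head is above the legs in the product that is subtracted, which makes the sign positive.\<close>

lemma PT_WH_commutator:
  "PT a s * WH (map Leaf w) - WH (map Leaf w) * PT a s =
    (\<Sum>i<length w. if w ! i = a then WH ((map Leaf w)[i := Br (Leaf a) s]) else 0)"
proof -
  define T where "T = lab [2, 0] s"
  define ws where "ws = wlab (map Leaf w)"
  define tw where "tw = ctails ws"
  have tw: "tw = map (\<lambda>i. (w ! i, [0, i])) [0..<length w]"
    by (simp add: tw_def ws_def wlab_leaves ctails_leaves)
  have ws: "length ws = length w" "\<And>i. i < length w \<Longrightarrow> ws ! i = (LL (w ! i) [0, i], [1, i])" "cshape ws = map Leaf w"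
    using cshape_wlab[of "map Leaf w"] by (simp_all add: ws_def wlab_leaves)
  have dT: "distinct (lnames T)" "shape T = s"
    by (simp_all add: T_def distinct_lnames_lab)
  have gw: "agood (ends (tl_items tw)) (wverts ws)"
    unfolding tw_def ws_def by (rule agood_wlab')
  have gT: "agood (ends ((a, Head (rt T)) # tl_items (ltails T))) (lverts T)"
    by (rule agood_planted[OF dT(1)])
  have nw: "names (ends (tl_items tw)) (wverts ws) = set (cnames ws)"
    using arg_cong[OF wheel_sources[of ws], of set_mset] by (simp add: names_def tw_def)
  have "x \<notin> set (lnames T)" if "x \<in> set (cnames ws)" for x
    using that by (auto simp: ws_def wlab_leaves cnames_eq T_def append_eq_Cons_conv Cons_eq_append_conv dest!: lnames_lab)
  then have d: "set (cnames ws) \<inter> set (lnames T) = {}"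
    by blast
  let ?V = "wverts ws + lverts T"
  let ?E = "ends (tl_items tw) + ends (tl_items (ltails T))"
  have g: "agood (add_mset (Head (rt T)) ?E) ?V"
    using agood_union[OF gw gT] d by (simp add: nw)
  obtain f where f: "f \<notin> names (add_mset (Head (rt T)) ?E) ?V"
    using fresh_name by blast
  have c1: "PT a s = cl (ld ((a, Head (rt T)) # tl_items (ltails T)) (lverts T))"
    using cl_planted[OF dT(1), of a] by (simp add: dT planted_def)
  have c2: "WH (map Leaf w) = cl (ld (tl_items tw) (wverts ws))"
    by (simp add: WH_def tw_def ws_def)
  have 1: "PT a s * WH (map Leaf w) = cl (ld ([(a, Head (rt T))] @ tl_items (ltails T @ tw) @ []) ?V)"
    unfolding c1 c2 using d by (subst mult_cl_ld[OF gT gw]) (auto simp: nw add.commute)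
  also have "\<dots> = cl (ld ([(a, Head (rt T))] @ tl_items (tw @ ltails T) @ []) ?V)"
    by (rule cl_permute_tails) (use g in \<open>simp_all add: add.commute\<close>)
  finally have 1: "PT a s * WH (map Leaf w) = cl (ld ((a, Head (rt T)) # tl_items tw @ tl_items (ltails T)) ?V)"
    by simp
  have "WH (map Leaf w) * PT a s = cl (ld ([] @ tl_items tw @ (a, Head (rt T)) # tl_items (ltails T)) ?V)"
    unfolding c1 c2 using d by (subst mult_cl_ld[OF gw gT]) (auto simp: nw)
  also have "\<dots> = cl (ld ([] @ (a, Head (rt T)) # tl_items tw @ tl_items (ltails T)) ?V) -
      (\<Sum>i<length tw. if fst (tw ! i) = a
        then cl (ld ([] @ tl_items (tw[i := (a, f)]) @ tl_items (ltails T)) (?V + {#(f, rt T, snd (tw ! i))#})) else 0)"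
    by (rule head_past_tails) (use g f in simp_all)
  also have "(\<Sum>i<length tw. if fst (tw ! i) = a
        then cl (ld ([] @ tl_items (tw[i := (a, f)]) @ tl_items (ltails T)) (?V + {#(f, rt T, snd (tw ! i))#})) else 0) =
      (\<Sum>i<length w. if w ! i = a then WH ((map Leaf w)[i := Br (Leaf a) s]) else 0)"
  proof (rule sum.cong)
    fix i assume "i \<in> {..<length w}"
    then have i: "i < length w" "i < length tw" "i < length ws" by (simp_all add: tw ws)
    have ti: "tw ! i = (w ! i, [0, i])"
      using i by (simp add: tw)
    have "cl (ld (tl_items (tw[i := (a, f)] @ ltails T)) (?V + {#(f, rt T, [0, i])#})) =
        WH ((map Leaf w)[i := Br (Leaf a) s])" if a: "w ! i = a"
    proof -
      define R where "R = mset tw - {#(a, [0, i])#}"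
      have "(a, [0, i]) \<in> set tw"
        using nth_mem[OF i(2)] ti a by simp
      then have m: "mset tw = add_mset (a, [0, i]) R"
        by (simp add: R_def)
      have m': "mset (tw[i := (a, f)]) = add_mset (a, f) R"
        by (subst mset_update[OF i(2)]) (simp add: ti m a)
      let ?F = "image_mset (\<lambda>(x, e). Tail e) R + ends (tl_items (ltails T))"
      have "agood (?F + {#Tail f#}) (?V + {#(f, rt T, [0, i])#})"
        by (rule agood_STU2) (use g f m in \<open>simp_all add: ends_tl_items add_mset_commute\<close>)
      then have ga: "agood (ends (tl_items (tw[i := (a, f)] @ ltails T))) (?V + {#(f, rt T, [0, i])#})"
        by (simp add: ends_tl_items m')
      let ?ws = "ws[i := (LB [0, i] (LL a f) T, [1, i])]"
      note cu = chain_update[OF i(3) ws(2)[OF i(1)], of "LB [0, i] (LL a f) T", simplified]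
      have "cl (ld (tl_items (tw[i := (a, f)] @ ltails T)) (?V + {#(f, rt T, [0, i])#})) = WH (cshape ?ws)"
      proof (rule cl_eq_WH[OF ga])
        show "?V + {#(f, rt T, [0, i])#} = wverts ?ws"
          unfolding wverts_def using cu(1,2) by (simp add: add.commute)
        have "add_mset (a, [0, i]) (mset (ctails ?ws)) = add_mset (a, [0, i]) (add_mset (a, f) R + mset (ltails T))"
          using cu(3) a m by (simp add: tw_def)
        then show "mset (tw[i := (a, f)] @ ltails T) = mset (ctails ?ws)"
          by (simp add: m')
        show "?ws \<noteq> []"
          using i(3) by auto
      qed
      also have "cshape ?ws = (map Leaf w)[i := Br (Leaf a) s]"
        using ws(3) by (simp add: map_update dT)
      finally show ?thesis .
    qed
    then show "(if fst (tw ! i) = a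
        then cl (ld ([] @ tl_items (tw[i := (a, f)]) @ tl_items (ltails T)) (?V + {#(f, rt T, snd (tw ! i))#})) else 0) =
        (if w ! i = a then WH ((map Leaf w)[i := Br (Leaf a) s]) else 0)"
      by (simp add: ti)
  qed (simp add: tw)
  finally show ?thesis
    unfolding 1 by simp
qed


subsection \<open>Reversing a planted tree\<close>

text \<open>
  Moving the head of a planted tree past its own leaf number \<open>i\<close> closes the path from
  the root to this leaf; \<open>us\<close> are the trees hanging on the part of the path that has
  already been followed.
\<close>

fun clos :: "'a \<Rightarrow> 'a btree list \<Rightarrow> 'a btree \<Rightarrow> nat \<Rightarrow> 'a dq" where
  "clos a us (Leaf x) i = WH (Leaf a # us)"
| "clos a us (Br s t) i = (if i < length (leaves s) then - clos a (us @ [t]) s i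
     else clos a (us @ [s]) t (i - length (leaves s)))"

text \<open>Induction along the path to leaf \<open>i\<close>, with the finished part of the path
  collected in the chain \<open>ws\<close>. A step through a right input extends the chain directly,
  one through a left input only after AS; this explains the sign in \<open>clos\<close>.\<close>

lemma cl_eq_clos:
  assumes "i < length (ltails T)" "fst (ltails T ! i) = a" "agood (ends (tl_items ts)) V"
    and "V = cverts ws (rt T) + lverts T + {#(f, fedge ws (rt T), snd (ltails T ! i))#}"
    and "mset ts = mset (ctails ws) + mset ((ltails T)[i := (a, f)])"
  shows "cl (ld (tl_items ts) V) = clos a (cshape ws) (shape T) i"
  using assms
proof (induction T arbitrary: i V ws)
  case (LL x e)
  then have "cl (ld (tl_items ts) V) = WH (cshape ((LL a f, e) # ws))"
    by (intro cl_eq_WH) (auto simp: wverts_Cons)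
  with LL show ?case by simp
next
  case (LB y S U)
  show ?case
  proof (cases "i < length (ltails S)")
    case True
    define W where "W = cverts ws y + lverts S + lverts U + {#(f, fedge ws y, snd (ltails S ! i))#}"
    have V: "V = W + {#(rt S, rt U, y)#}"
      using LB.prems(4) True by (simp add: W_def nth_append)
    have g: "agood (ends (tl_items ts)) (W + {#(rt U, rt S, y)#})"
      using LB.prems(3) unfolding V by (rule agood_AS)
    have "cl (ld (tl_items ts) V) = - cl (ld (tl_items ts) (W + {#(rt U, rt S, y)#}))"
      unfolding V by (rule resp_AS[OF resp_cl]) (use LB.prems(3) V in simp)
    also have "cl (ld (tl_items ts) (W + {#(rt U, rt S, y)#})) = clos a (cshape (ws @ [(U, y)])) (shape S) i"
      by (rule LB.IH(1)[OF _ _ g])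
         (use True LB.prems in \<open>simp_all add: W_def cverts_append fedge_append ctails_append nth_append list_update_append\<close>)
    finally show ?thesis
      using True by (simp add: length_ltails)
  next
    case False
    have "cl (ld (tl_items ts) V) = clos a (cshape (ws @ [(S, y)])) (shape U) (i - length (ltails S))"
      by (rule LB.IH(2)[OF _ _ LB.prems(3)])
         (use False LB.prems in \<open>simp_all add: cverts_append fedge_append ctails_append nth_append list_update_append\<close>)
    then show ?thesis
      using False by (simp add: length_ltails)
  qed
qed

text \<open>Reversal leaves the head above all leaves. When it passes a leaf on its own strand, the
  root edge becomes an input of a new vertex whose output is the edge of that leaf, so the path
  between them closes up to a cycle.\<close>

lemma cl_rev_planted:
  assumes "distinct (lnames T)"
  shows "cl (ld (rev ((a, Head (rt T)) # tl_items (ltails T))) (lverts T)) = PT a (shape T) -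
    (\<Sum>i<length (leaves (shape T)). if leaves (shape T) ! i = a then clos a [] (shape T) i else 0)"
proof -
  let ?V = "lverts T"
  have g: "agood (add_mset (Head (rt T)) (ends (tl_items (ltails T)))) ?V"
    using agood_planted[OF assms, of a] by simp
  obtain f where f: "f \<notin> names (add_mset (Head (rt T)) (ends (tl_items (ltails T)))) ?V"
    using fresh_name by blast
  have "cl (ld (rev ((a, Head (rt T)) # tl_items (ltails T))) ?V) =
      cl (ld ([] @ tl_items (rev (ltails T)) @ [(a, Head (rt T))]) ?V)"
    by (simp add: rev_tl_items)
  also have "\<dots> = cl (ld ([] @ tl_items (ltails T) @ [(a, Head (rt T))]) ?V)"
    by (rule cl_permute_tails) (use g in \<open>simp_all add: ends_tl_items\<close>)
  also have "\<dots> = cl (ld ([] @ (a, Head (rt T)) # tl_items (ltails T) @ []) ?V) -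
      (\<Sum>i<length (ltails T). if fst (ltails T ! i) = a
        then cl (ld ([] @ tl_items ((ltails T)[i := (a, f)]) @ []) (?V + {#(f, rt T, snd (ltails T ! i))#})) else 0)"
    by (rule head_past_tails) (use g f in simp_all)
  also have "(\<Sum>i<length (ltails T). if fst (ltails T ! i) = a
        then cl (ld ([] @ tl_items ((ltails T)[i := (a, f)]) @ []) (?V + {#(f, rt T, snd (ltails T ! i))#})) else 0) =
      (\<Sum>i<length (leaves (shape T)). if leaves (shape T) ! i = a then clos a [] (shape T) i else 0)"
  proof (rule sum.cong)
    fix i assume "i \<in> {..<length (leaves (shape T))}"
    then have i: "i < length (leaves (shape T))" "i < length (ltails T)" by (simp_all add: length_ltails)
    obtain x e where xe: "ltails T ! i = (x, e)" by (cases "ltails T ! i")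
    have "cl (ld (tl_items ((ltails T)[i := (a, f)])) (?V + {#(f, rt T, e)#})) = clos a [] (shape T) i" if "x = a"
    proof -
      define R where "R = mset (ltails T) - {#(a, e)#}"
      have "(a, e) \<in> set (ltails T)"
        using nth_mem[OF i(2)] xe that by simp
      then have m: "mset (ltails T) = add_mset (a, e) R"
        by (simp add: R_def)
      have m': "mset ((ltails T)[i := (a, f)]) = add_mset (a, f) R"
        by (subst mset_update[OF i(2)]) (simp add: xe m that)
      have "agood (image_mset (\<lambda>(x, e). Tail e) R + {#Tail f#}) (?V + {#(f, rt T, e)#})"
        by (rule agood_STU2) (use g f m in \<open>simp_all add: ends_tl_items add_mset_commute del: names_planted\<close>)
      then have "agood (ends (tl_items ((ltails T)[i := (a, f)]))) (?V + {#(f, rt T, e)#})"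
        by (simp add: ends_tl_items m')
      then have "cl (ld (tl_items ((ltails T)[i := (a, f)])) (?V + {#(f, rt T, e)#})) = clos a (cshape []) (shape T) i"
        by (rule cl_eq_clos[where ws = "[]", rotated 2]) (use xe that i in simp_all)
      then show ?thesis by simp
    qed
    then show "(if fst (ltails T ! i) = a
        then cl (ld ([] @ tl_items ((ltails T)[i := (a, f)]) @ []) (?V + {#(f, rt T, snd (ltails T ! i))#})) else 0) =
        (if leaves (shape T) ! i = a then clos a [] (shape T) i else 0)"
      using fst_ltails_nth[OF i(1)] xe by auto
  qed (simp add: length_ltails)
  finally show ?thesis
    using cl_planted[OF assms, of a] by (simp add: planted_def)
qed

lemma sum_lessThan_add: "(\<Sum>i<m + n. f i) = (\<Sum>i<m. f i) + (\<Sum>i<n. f (m + i))" for f :: "nat \<Rightarrow> 'b :: comm_monoid_add"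
  by (induction n) (simp_all add: add.assoc)

text \<open>When \<open>[s, t] = s t - t s\<close> is expanded along the path, the leaf that is
  closed up becomes the last letter of the word, with the same signs as in \<open>clos\<close>. The
  trees beside the path become the factors before it, and \<open>WH_expand\<close> turns them into
  letters. This is the decomposition by last letters that defines the divergence.\<close>

lemma sum_clos:
  "(\<Sum>i<length (leaves t). if leaves t ! i = a then clos a us t i else 0) =
    lin (\<lambda>w. if last w = a then WH (Leaf a # us @ map Leaf (butlast w)) else 0) (nc_tree t)"
proof (induction t arbitrary: us)
  case (Leaf x)
  then show ?case by (simp add: nc_gen_def)
next
  case (Br s t)
  let ?\<phi> = "\<lambda>us w. if last w = a then WH (Leaf a # us @ map Leaf (butlast w)) else 0"
  have prod: "lin (?\<phi> us) (nc_tree s \<odot> nc_tree t) = lin (?\<phi> (us @ [s])) (nc_tree t)" for s t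
  proof -
    have "lin (?\<phi> us) (nc_tree s \<odot> nc_tree t) = lin (\<lambda>v. lin (\<lambda>u. ?\<phi> us (u @ v)) (nc_tree s)) (nc_tree t)"
      by (simp only: lin_nc_mult fsupp_nc_tree) (rule lin_swap)
    also have "\<dots> = lin (?\<phi> (us @ [s])) (nc_tree t)"
    proof (rule lin_cong)
      fix v assume "nc_tree t v \<noteq> 0"
      then have v: "v \<noteq> []" using nc_tree_eq_0[of v t] by auto
      show "lin (\<lambda>u. ?\<phi> us (u @ v)) (nc_tree s) = ?\<phi> (us @ [s]) v"
        using WH_expand[of "Leaf a # us" s "map Leaf (butlast v)"] v
        by (simp add: butlast_append lin_def)
    qed
    finally show ?thesis .
  qed
  have "(\<Sum>i<length (leaves (Br s t)). if leaves (Br s t) ! i = a then clos a us (Br s t) i else 0) =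
      - (\<Sum>i<length (leaves s). if leaves s ! i = a then clos a (us @ [t]) s i else 0) +
      (\<Sum>i<length (leaves t). if leaves t ! i = a then clos a (us @ [s]) t i else 0)"
    unfolding sum_negf[symmetric] leaves.simps length_append sum_lessThan_add
    by (intro arg_cong2[of _ _ _ _ "(+)"] sum.cong) (auto simp: nth_append)
  also have "\<dots> = lin (?\<phi> us) (nc_tree (Br s t))"
    by (simp add: Br.IH nc_bracket_def lin_diff prod)
  finally show ?case .
qed

section \<open>From trees and wheels to Lie series and cyclic words\<close>

section \<open>Lie series in the completed algebra of diagrams\<close>

subsection \<open>Series in a finite alphabet and derivations\<close>

definition alph :: "'a set \<Rightarrow> 'a ncs set" where
  "alph S = {f. \<forall>w. f w \<noteq> 0 \<longrightarrow> set w \<subseteq> S}"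

text \<open>Congruence modulo degrees above \<open>n\<close>. The bracket and the derivations
  preserve it, which reduces identities between infinite series to finite combinations of
  trees.\<close>

definition agree :: "nat \<Rightarrow> 'a ncs \<Rightarrow> 'a ncs \<Rightarrow> bool" where
  "agree n f g \<longleftrightarrow> (\<forall>w. length w \<le> n \<longrightarrow> f w = g w)"

lemma alph_0 [simp]: "0 \<in> alph S"
  and alph_add: "f \<in> alph S \<Longrightarrow> g \<in> alph S \<Longrightarrow> f + g \<in> alph S"
  and alph_diff: "f \<in> alph S \<Longrightarrow> g \<in> alph S \<Longrightarrow> f - g \<in> alph S"
  and alph_scale: "f \<in> alph S \<Longrightarrow> scale r f \<in> alph S"
  and alph_single: "set w \<subseteq> S \<Longrightarrow> single w \<in> alph S"
  unfolding alph_def mem_Collect_eq fun_apply scale_def single_def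
  by simp_all (metis add_0 diff_0_right diff_self)+

lemma alph_sum: "(\<And>i. i \<in> A \<Longrightarrow> h i \<in> alph S) \<Longrightarrow> (\<Sum>i\<in>A. h i) \<in> alph S"
  by (induction A rule: infinite_finite_induct) (auto intro: alph_add)

lemma alph_mult: "f \<in> alph S \<Longrightarrow> g \<in> alph S \<Longrightarrow> f \<odot> g \<in> alph S"
  using nc_mult_support[of f g _ S S] by (auto simp: alph_def)

lemma alph_bracket: "f \<in> alph S \<Longrightarrow> g \<in> alph S \<Longrightarrow> nc_bracket f g \<in> alph S"
  by (simp add: nc_bracket_def alph_mult alph_diff)

lemma alph_nc_tree: "set (leaves t) \<subseteq> S \<Longrightarrow> nc_tree t \<in> alph S"
  using nc_tree_support by (fastforce simp: alph_def)

lemma FL_alph: "finite S \<Longrightarrow> f \<in> FL S \<Longrightarrow> f \<in> alph S"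
  using FL_support by (auto simp: alph_def)

lemma FLS_alph: "finite S \<Longrightarrow> L \<in> FLS S \<Longrightarrow> L a \<in> alph S"
  using FL_alph by (cases "a \<in> S") (auto simp: FLS_def)

lemma finite_words_le: "finite S \<Longrightarrow> finite {w. set w \<subseteq> S \<and> length w \<le> n}"
  by (rule finite_lists_length_le)

lemma fsupp_nc_part: "finite S \<Longrightarrow> f \<in> alph S \<Longrightarrow> fsupp (nc_part n f)"
  unfolding fsupp_def
  by (rule finite_subset[OF _ finite_words_le[of S n]]) (auto simp: nc_part_def alph_def)

lemma nc_part_linear: "nc_part n (f + g) = nc_part n f + nc_part n g"
  "nc_part n (f - g) = nc_part n f - nc_part n g" "nc_part n (scale r f) = scale r (nc_part n f)"
  "nc_part n 0 = 0" "nc_part n (- f) = - nc_part n f"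
  by (auto simp: nc_part_def fun_eq_iff scale_def fun_apply)

lemma agree_nc_part: "agree n f g \<Longrightarrow> nc_part n f = nc_part n g"
  by (auto simp: agree_def nc_part_def fun_eq_iff)

lemma agree_refl [simp]: "agree n f f"
  by (simp add: agree_def)

lemma agree_add: "agree n f f' \<Longrightarrow> agree n g g' \<Longrightarrow> agree n (f + g) (f' + g')"
  and agree_diff: "agree n f f' \<Longrightarrow> agree n g g' \<Longrightarrow> agree n (f - g) (f' - g')"
  by (auto simp: agree_def fun_apply)

lemma agree_sum: "(\<And>i. i \<in> A \<Longrightarrow> agree n (h i) (h' i)) \<Longrightarrow> agree n (\<Sum>i\<in>A. h i) (\<Sum>i\<in>A. h' i)"
  by (induction A rule: infinite_finite_induct) (auto intro: agree_add)

lemma agree_mult: "agree n f f' \<Longrightarrow> agree n g g' \<Longrightarrow> agree n (f \<odot> g) (f' \<odot> g')"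
  by (auto simp: agree_def nc_mult_def intro!: sum.cong)

lemma agree_bracket: "agree n f f' \<Longrightarrow> agree n g g' \<Longrightarrow> agree n (nc_bracket f g) (nc_bracket f' g')"
  by (simp add: nc_bracket_def agree_mult agree_diff)

definition trunc :: "nat \<Rightarrow> 'a ncs \<Rightarrow> 'a ncs" where
  "trunc n f = (\<lambda>w. if length w \<le> n then f w else 0)"

lemma agree_trunc: "agree n f (trunc n f)"
  by (simp add: agree_def trunc_def)

lemma trunc_alph: "f \<in> alph S \<Longrightarrow> trunc n f \<in> alph S"
  by (auto simp: alph_def trunc_def)

lemma fsupp_trunc: "finite S \<Longrightarrow> f \<in> alph S \<Longrightarrow> fsupp (trunc n f)"
  unfolding fsupp_def
  by (rule finite_subset[OF _ finite_words_le[of S n]]) (auto simp: trunc_def alph_def)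

definition dw :: "('a \<Rightarrow> 'a ncs) \<Rightarrow> 'a list \<Rightarrow> 'a ncs" where
  "dw L w = (\<Sum>i<length w.
     single (take i w) \<odot> nc_bracket (nc_gen (w ! i)) (L (w ! i)) \<odot> single (drop (Suc i) w))"

lemma nc_der_eq_extend: "nc_der L = nc_extend (dw L)"
  by (simp add: nc_der_def dw_def[abs_def])

lemma nc_mult_length:
  assumes "(f \<odot> g) w \<noteq> 0" "\<And>w. f w \<noteq> 0 \<Longrightarrow> m \<le> length w" "\<And>w. g w \<noteq> 0 \<Longrightarrow> n \<le> length w"
  shows "m + n \<le> length w"
proof -
  obtain i where i: "i \<le> length w" "f (take i w) * g (drop i w) \<noteq> 0"
    using assms(1) unfolding nc_mult_def by (auto elim: sum.not_neutral_contains_not_neutral)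
  then have "m \<le> length (take i w)" "n \<le> length (drop i w)"
    using assms(2)[of "take i w"] assms(3)[of "drop i w"] by auto
  then show ?thesis using i(1) by simp
qed

lemma nc_bracket_gen_length: "nc_bracket (nc_gen x) f w \<noteq> 0 \<Longrightarrow> 1 \<le> length w"
  by (cases w) (auto simp: nc_bracket_def nc_mult_def fun_apply)

lemma dw_length: "dw L w v \<noteq> 0 \<Longrightarrow> length w \<le> length v"
proof -
  assume "dw L w v \<noteq> 0"
  then obtain i where i: "i < length w"
    "(single (take i w) \<odot> nc_bracket (nc_gen (w ! i)) (L (w ! i)) \<odot> single (drop (Suc i) w)) v \<noteq> 0"
    by (auto simp: dw_def sum_fun_apply elim: sum.not_neutral_contains_not_neutral)
  have s: "length u \<le> length w" if "single u w \<noteq> 0" for u w :: "'a list"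
    using that by (auto simp: single_def split: if_splits)
  have "length (take i w) + 1 + length (drop (Suc i) w) \<le> length v"
    using i(2)
  proof (rule nc_mult_length)
    fix w' assume "(single (take i w) \<odot> nc_bracket (nc_gen (w ! i)) (L (w ! i))) w' \<noteq> 0"
    then show "length (take i w) + 1 \<le> length w'"
      by (rule nc_mult_length) (use s in blast, rule nc_bracket_gen_length)
  qed (use s in blast)
  then show ?thesis using i(1) by simp
qed

lemma dw_alph:
  assumes "set w \<subseteq> S" "\<And>a. L a \<in> alph S"
  shows "dw L w \<in> alph S"
  unfolding dw_def nc_gen_def
proof (intro alph_sum alph_mult alph_bracket alph_single assms)
  fix i assume "i \<in> {..<length w}"
  then show "set (take i w) \<subseteq> S" "set [w ! i] \<subseteq> S" "set (drop (Suc i) w) \<subseteq> S"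
    using assms(1) by (auto dest: in_set_takeD in_set_dropD)
qed

lemma dw_append: "dw L (u @ v) = dw L u \<odot> single v + single u \<odot> dw L v"
proof -
  have sum_mult: "(\<Sum>i\<in>A. f i) \<odot> g = (\<Sum>i\<in>A. f i \<odot> g)" "g \<odot> (\<Sum>i\<in>A. f i) = (\<Sum>i\<in>A. g \<odot> f i)"
    for f :: "nat \<Rightarrow> 'a ncs" and g A
    by (induction A rule: infinite_finite_induct) (auto simp: nc_mult_add_left nc_mult_add_right)
  show ?thesis
    unfolding dw_def length_append sum_lessThan_add sum_mult
    by (intro arg_cong2[of _ _ _ _ "(+)"] sum.cong)
       (simp_all add: nth_append nc_mult_assoc, simp_all flip: nc_mult_assoc)
qed

lemma dw_add: "dw (L + M) w = dw L w + dw M w"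
  by (simp add: dw_def fun_apply nc_bracket_add_right nc_mult_add_left nc_mult_add_right sum.distrib)

lemma dw_0: "dw 0 w = 0"
  by (simp add: dw_def fun_apply)

lemma agree_dw: "(\<And>a. agree n (L a) (M a)) \<Longrightarrow> agree n (dw L w) (dw M w)"
  unfolding dw_def by (intro agree_sum agree_mult agree_bracket agree_refl)

text \<open>The definition sums over the support of \<open>f\<close>, which varies with
  \<open>f\<close>; a fixed finite set of words makes additivity visible.\<close>

lemma nc_der_apply:
  assumes "finite S" "f \<in> alph S" "length v \<le> n"
  shows "nc_der L f v = (\<Sum>w | set w \<subseteq> S \<and> length w \<le> n. f w * dw L w v)"
  unfolding nc_der_eq_extend nc_extend_def
proof (rule sum.mono_neutral_left[OF finite_words_le[OF assms(1)]])
  show "{w. f w \<noteq> 0 \<and> length w \<le> length v} \<subseteq> {w. set w \<subseteq> S \<and> length w \<le> n}"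
    using assms by (auto simp: alph_def)
  show "\<forall>w\<in>{w. set w \<subseteq> S \<and> length w \<le> n} - {w. f w \<noteq> 0 \<and> length w \<le> length v}. f w * dw L w v = 0"
    using dw_length[of L _ v] by auto
qed

lemma nc_der_fsupp: "fsupp f \<Longrightarrow> nc_der L f = (\<Sum>w | f w \<noteq> 0. scale (f w) (dw L w))"
proof
  fix v assume f: "fsupp f"
  have "nc_der L f v = (\<Sum>w | f w \<noteq> 0. f w * dw L w v)"
    unfolding nc_der_eq_extend nc_extend_def
    by (rule sum.mono_neutral_left) (use f dw_length[of L _ v] in \<open>auto simp: fsupp_def\<close>)
  then show "nc_der L f v = (\<Sum>w | f w \<noteq> 0. scale (f w) (dw L w)) v"
    by (simp add: sum_fun_apply scale_def)
qed

lemma nc_der_add_left: "nc_der (L + M) f = nc_der L f + nc_der M f"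
  by (rule ext) (simp add: nc_der_eq_extend nc_extend_def dw_add fun_apply algebra_simps sum.distrib)

lemma nc_der_0_left [simp]: "nc_der 0 f = 0"
  by (rule ext) (simp add: nc_der_eq_extend nc_extend_def dw_0 fun_apply)

lemma nc_der_add_right:
  assumes "finite S" "f \<in> alph S" "g \<in> alph S"
  shows "nc_der L (f + g) = nc_der L f + nc_der L g"
proof
  fix v
  show "nc_der L (f + g) v = (nc_der L f + nc_der L g) v"
    by (simp add: nc_der_apply[OF assms(1) _ order_refl] assms alph_add fun_apply algebra_simps sum.distrib)
qed

lemma nc_der_0_right [simp]: "nc_der L 0 = 0"
  by (rule ext) (simp add: nc_der_eq_extend nc_extend_def fun_apply)

lemma nc_der_scale_right: "nc_der L (scale r f) = scale r (nc_der L f)"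
  by (cases "r = 0")
     (auto simp: fun_eq_iff nc_der_eq_extend nc_extend_def scale_def sum_distrib_left mult.assoc)

lemma nc_der_single [simp]: "nc_der L (single w) = dw L w"
proof -
  have "{v. single w v \<noteq> 0} = {w}"
    by (auto simp: single_def)
  then show ?thesis
    by (simp add: nc_der_fsupp) (simp add: single_def)
qed

lemma nc_der_alph: "finite S \<Longrightarrow> f \<in> alph S \<Longrightarrow> (\<And>a. L a \<in> alph S) \<Longrightarrow> nc_der L f \<in> alph S"
proof -
  assume *: "finite S" "f \<in> alph S" "\<And>a. L a \<in> alph S"
  show ?thesis
    unfolding alph_def
  proof (intro CollectI allI impI)
    fix v assume "nc_der L f v \<noteq> 0"
    then obtain w where "set w \<subseteq> S" "dw L w v \<noteq> 0"
      unfolding nc_der_apply[OF *(1,2) order_refl] by (auto elim: sum.not_neutral_contains_not_neutral)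
    then show "set v \<subseteq> S"
      using dw_alph[of w S L] *(3) by (auto simp: alph_def)
  qed
qed

lemma agree_nc_der:
  assumes "finite S" "f \<in> alph S" "g \<in> alph S" "agree n f g" "\<And>a. agree n (L a) (M a)"
  shows "agree n (nc_der L f) (nc_der M g)"
  unfolding agree_def
proof (intro allI impI)
  fix v :: "'a list" assume "length v \<le> n"
  then show "nc_der L f v = nc_der M g v"
    using assms agree_dw[of n L M]
    by (simp add: nc_der_apply[OF assms(1) _ order_refl]) (auto simp: agree_def intro!: sum.cong)
qed

lemma nc_der_add_fsupp: "fsupp f \<Longrightarrow> fsupp g \<Longrightarrow> nc_der L (f + g) = nc_der L f + nc_der L g"
proof -
  assume *: "fsupp f" "fsupp g"
  let ?S = "\<Union>(set ` ({w. f w \<noteq> 0} \<union> {w. g w \<noteq> 0}))"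
  have "finite ?S" "f \<in> alph ?S" "g \<in> alph ?S"
    using * by (auto simp: fsupp_def alph_def)
  then show ?thesis
    by (rule nc_der_add_right)
qed

lemma nc_der_mult:
  assumes "fsupp f" "fsupp g"
  shows "nc_der L (f \<odot> g) = nc_der L f \<odot> g + f \<odot> nc_der L g"
  using assms(1)
proof (induction rule: fsupp_induct)
  case (add c u f)
  have "nc_der L (single u \<odot> g) = dw L u \<odot> g + single u \<odot> nc_der L g"
    using assms(2)
  proof (induction rule: fsupp_induct)
    case (add d v g)
    then show ?case
      by (simp add: nc_mult_add_right nc_mult_scale_right nc_der_add_fsupp
          nc_der_scale_right dw_append series.scale_right_distrib)
  qed simp
  with add assms(2) show ?case
    by (simp add: nc_mult_add_left nc_mult_scale_left nc_der_add_fsupp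
          nc_der_scale_right series.scale_right_distrib)
qed simp

lemma nc_der_diff_fsupp: "fsupp f \<Longrightarrow> fsupp g \<Longrightarrow> nc_der L (f - g) = nc_der L f - nc_der L g"
proof -
  assume "fsupp f" "fsupp g"
  then have "nc_der L (f + scale (-1) g) = nc_der L f + nc_der L (scale (-1) g)"
    by (intro nc_der_add_fsupp fsupp_scale)
  then show ?thesis
    unfolding nc_der_scale_right by simp
qed

lemma nc_der_bracket:
  "fsupp f \<Longrightarrow> fsupp g \<Longrightarrow> nc_der L (nc_bracket f g) = nc_bracket (nc_der L f) g + nc_bracket f (nc_der L g)"
  by (simp add: nc_bracket_def nc_der_diff_fsupp nc_der_mult algebra_simps)

definition tree_at :: "'a \<Rightarrow> rat \<Rightarrow> 'a btree \<Rightarrow> 'a \<Rightarrow> 'a ncs" where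
  "tree_at a c t = (\<lambda>x. if x = a then scale c (nc_tree t) else 0)"

lemma nc_bracket_sum: "nc_bracket (\<Sum>i\<in>A. f i) g = (\<Sum>i\<in>A. nc_bracket (f i) g)"
  "nc_bracket g (\<Sum>i\<in>A. f i) = (\<Sum>i\<in>A. nc_bracket g (f i))"
  by (induction A rule: infinite_finite_induct) (simp_all add: nc_bracket_add_left nc_bracket_add_right)

text \<open>By the Leibniz rule the derivation acts on one leaf at a time, and \<open>bsub\<close>
  is the result at a leaf. The sum has the form of the corrections in
  \<open>PT_commutator\<close>.\<close>

lemma nc_der_nc_tree:
  "nc_der (tree_at a c s) (nc_tree t) = (\<Sum>i<length (leaves t). if leaves t ! i = a then scale c (nc_tree (bsub i s t)) else 0)"
proof (induction t)
  case (Leaf x)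
  then show ?case
    by (simp add: nc_gen_def dw_def tree_at_def nc_bracket_scale_right flip: nc_one_def)
next
  case (Br t u)
  have "nc_der (tree_at a c s) (nc_tree (Br t u)) =
      (\<Sum>i<length (leaves t). nc_bracket (if leaves t ! i = a then scale c (nc_tree (bsub i s t)) else 0) (nc_tree u)) +
      (\<Sum>i<length (leaves u). nc_bracket (nc_tree t) (if leaves u ! i = a then scale c (nc_tree (bsub i s u)) else 0))"
    by (simp add: nc_der_bracket Br nc_bracket_sum)
  also have "\<dots> = (\<Sum>i<length (leaves (Br t u)). if leaves (Br t u) ! i = a then scale c (nc_tree (bsub i s (Br t u))) else 0)"
    unfolding leaves.simps length_append sum_lessThan_add
    by (intro arg_cong2[of _ _ _ _ "(+)"] sum.cong)
       (auto simp: nth_append nc_bracket_scale_left nc_bracket_scale_right)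
  finally show ?case .
qed

lemma leaves_bsub: "i < length (leaves t) \<Longrightarrow> length (leaves (bsub i s t)) = length (leaves s) + length (leaves t) \<and>
    set (leaves (bsub i s t)) \<subseteq> set (leaves s) \<union> set (leaves t)"
proof (induction t arbitrary: i)
  case (Br t u)
  show ?case
  proof (cases "i < length (leaves t)")
    case True
    with Br.IH(1)[of i] show ?thesis by auto
  next
    case False
    then have "i - length (leaves t) < length (leaves u)"
      using Br.prems by simp
    from Br.IH(2)[OF this] False show ?thesis by auto
  qed
qed simp


subsection \<open>Finite approximations of families of Lie series\<close>

lemma FL_0: "0 \<in> FL S" if "finite S"
  unfolding FL_iff[OF that] by (simp add: nc_part_linear lie_span_0)

lemma FL_add: "finite S \<Longrightarrow> f \<in> FL S \<Longrightarrow> g \<in> FL S \<Longrightarrow> f + g \<in> FL S"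
  and FL_diff: "finite S \<Longrightarrow> f \<in> FL S \<Longrightarrow> g \<in> FL S \<Longrightarrow> f - g \<in> FL S"
  and FL_scale: "finite S \<Longrightarrow> f \<in> FL S \<Longrightarrow> scale r f \<in> FL S"
  by (simp_all add: FL_iff nc_part_linear lie_span_add lie_span_diff lie_span_scale)

lemma nc_part_nc_tree: "nc_part n (nc_tree t) = (if n = length (leaves t) then nc_tree t else 0)"
  by (auto simp: nc_part_def fun_eq_iff nc_tree_eq_0 fun_apply)

lemma FL_nc_tree: "finite S \<Longrightarrow> set (leaves t) \<subseteq> S \<Longrightarrow> nc_tree t \<in> FL S"
  by (auto simp: FL_iff nc_part_nc_tree lie_span_0 intro: nc_tree_in_lie_span)

lemma FL_agree: "finite S \<Longrightarrow> (\<And>n. \<exists>g\<in>FL S. agree n f g) \<Longrightarrow> f \<in> FL S"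
proof -
  assume *: "finite S" "\<And>n. \<exists>g\<in>FL S. agree n f g"
  show "f \<in> FL S"
    unfolding FL_iff[OF *(1)]
  proof
    fix n
    obtain g where "g \<in> FL S" "agree n f g" using *(2) by blast
    then show "nc_part n f \<in> lie_span S n"
      using agree_nc_part FL_iff[OF *(1)] by metis
  qed
qed

lemma FL_approx:
  assumes "finite S" "f \<in> FL S"
  shows "\<exists>c. agree n f (\<Sum>t | set (leaves t) \<subseteq> S \<and> length (leaves t) \<le> n. scale (c t) (nc_tree t))"
proof -
  obtain T where T: "f = nc_trees T" "T \<in> tree_series S"
    using assms(2) by (auto simp: FL_def)
  have "f w = (\<Sum>t | set (leaves t) \<subseteq> S \<and> length (leaves t) \<le> n. T t * nc_tree t w)" if "length w \<le> n" for w
    unfolding T(1) nc_trees_def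
  proof (rule sum.mono_neutral_left[OF finite_trees_le[OF assms(1)]])
    have "T t * nc_tree t w = 0" if "T t = 0 \<or> length (leaves t) \<noteq> length w" for t
      using that nc_tree_eq_0[of w t] by auto
    then show "\<forall>t\<in>{t. set (leaves t) \<subseteq> S \<and> length (leaves t) \<le> n} - {t. T t \<noteq> 0 \<and> length (leaves t) = length w}.
        T t * nc_tree t w = 0"
      by blast
  qed (use that T(2) in \<open>auto simp: tree_series_def\<close>)
  then show ?thesis
    by (intro exI[of _ T]) (simp add: agree_def sum_fun_apply scale_def)
qed

text \<open>Finite sums of elementary functions; induction over this predicate reduces bilinear
  identities to single trees.\<close>

inductive fin_FLS :: "'a set \<Rightarrow> ('a \<Rightarrow> 'a ncs) \<Rightarrow> bool" for S where
  zero: "fin_FLS S 0"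
| add: "a \<in> S \<Longrightarrow> set (leaves t) \<subseteq> S \<Longrightarrow> fin_FLS S L \<Longrightarrow> fin_FLS S (tree_at a c t + L)"

text \<open>There are finitely many trees with at most \<open>n\<close> leaves over a finite
  alphabet, so a truncation involves finitely many pairs of a strand and a tree.\<close>

lemma fin_FLS_approx:
  assumes "finite S" "L \<in> FLS S"
  shows "\<exists>M. fin_FLS S M \<and> (\<forall>a. agree n (L a) (M a))"
proof -
  let ?B = "{t. set (leaves t) \<subseteq> S \<and> length (leaves t) \<le> n}"
  have "\<exists>c. agree n (L a) (\<Sum>t\<in>?B. scale (c t) (nc_tree t))" if "a \<in> S" for a
    by (rule FL_approx) (use assms that in \<open>auto simp: FLS_def\<close>)
  then have "\<exists>c. \<forall>a\<in>S. agree n (L a) (\<Sum>t\<in>?B. scale (c a t) (nc_tree t))"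
    by (intro bchoice ballI)
  then obtain c where c: "agree n (L a) (\<Sum>t\<in>?B. scale (c a t) (nc_tree t))" if "a \<in> S" for a
    by blast
  have "fin_FLS S (\<Sum>p\<in>A. tree_at (fst p) (c (fst p) (snd p)) (snd p))" if "finite A" "A \<subseteq> S \<times> ?B" for A
    using that by (induction A) (auto intro: fin_FLS.intros)
  from this[of "S \<times> ?B"] have "fin_FLS S (\<Sum>p\<in>S \<times> ?B. tree_at (fst p) (c (fst p) (snd p)) (snd p))"
    using assms(1) finite_trees_le by blast
  moreover have "(\<Sum>p\<in>S \<times> ?B. tree_at (fst p) (c (fst p) (snd p)) (snd p)) a =
      (if a \<in> S then \<Sum>t\<in>?B. scale (c a t) (nc_tree t) else 0)" for a
  proof -
    have "(\<Sum>p\<in>S \<times> ?B. tree_at (fst p) (c (fst p) (snd p)) (snd p)) a = (\<Sum>b\<in>S. \<Sum>t\<in>?B. tree_at b (c b t) t a)"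
      by (simp add: sum_fun_apply sum.cartesian_product case_prod_beta)
    also have "\<dots> = (\<Sum>b\<in>S. if b = a then \<Sum>t\<in>?B. scale (c a t) (nc_tree t) else 0)"
      by (intro sum.cong) (auto simp: tree_at_def)
    finally show ?thesis using assms(1) by simp
  qed
  ultimately show ?thesis
    using c assms(2) by (intro exI[of _ "\<Sum>p\<in>S \<times> ?B. tree_at (fst p) (c (fst p) (snd p)) (snd p)"]) (auto simp: FLS_def)
qed

lemma FLS_0: "finite S \<Longrightarrow> 0 \<in> FLS S"
  and FLS_add: "finite S \<Longrightarrow> L \<in> FLS S \<Longrightarrow> M \<in> FLS S \<Longrightarrow> L + M \<in> FLS S"
  and FLS_te: "finite S \<Longrightarrow> a \<in> S \<Longrightarrow> set (leaves t) \<subseteq> S \<Longrightarrow> tree_at a c t \<in> FLS S"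
  by (auto simp: FLS_def fun_apply tree_at_def FL_0 FL_add FL_scale FL_nc_tree)

lemma fin_FLS_FLS: "finite S \<Longrightarrow> fin_FLS S L \<Longrightarrow> L \<in> FLS S"
  by (erule fin_FLS.induct) (auto intro: FLS_0 FLS_add FLS_te)

lemma FLS_agree:
  assumes "finite S" "\<And>n. \<exists>M\<in>FLS S. \<forall>a. agree n (L a) (M a)"
  shows "L \<in> FLS S"
  unfolding FLS_def
proof (intro CollectI conjI ballI allI impI)
  fix a assume a: "a \<in> S"
  show "L a \<in> FL S"
  proof (rule FL_agree[OF assms(1)])
    fix n
    obtain M where "M \<in> FLS S" "agree n (L a) (M a)"
      using assms(2) by blast
    then show "\<exists>g\<in>FL S. agree n (L a) g"
      using a by (intro bexI[of _ "M a"]) (auto simp: FLS_def)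
  qed
next
  fix a assume a: "a \<notin> S"
  show "L a = 0"
  proof
    fix w :: "'a list"
    obtain M where "M \<in> FLS S" "agree (length w) (L a) (M a)"
      using assms(2) by blast
    then show "L a w = 0 w"
      using a by (auto simp: FLS_def agree_def)
  qed
qed

subsection \<open>The images of Lie series and of cyclic words\<close>

text \<open>The extension is made separately in every degree, where a series in a finite alphabet
  has finite support; the exponent of the variable keeps the degrees apart.\<close>

definition wlin :: "('a list \<Rightarrow> 'v :: rat_module) \<Rightarrow> 'a ncs \<Rightarrow> 'v fps" where
  "wlin \<phi> f = Abs_fps (\<lambda>n. lin \<phi> (nc_part n f))"

definition gmono :: "nat \<Rightarrow> 'v :: zero \<Rightarrow> 'v fps" where
  "gmono n x = Abs_fps (\<lambda>m. if m = n then x else 0)"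

lemma wlin_nth [simp]: "wlin \<phi> f $ n = lin \<phi> (nc_part n f)"
  by (simp add: wlin_def)

lemma gmono_nth [simp]: "gmono n x $ m = (if m = n then x else 0)"
  by (simp add: gmono_def)

lemma wlin_0 [simp]: "wlin \<phi> 0 = 0"
  by (simp add: fps_eq_iff nc_part_linear)

lemma wlin_add: "finite S \<Longrightarrow> f \<in> alph S \<Longrightarrow> g \<in> alph S \<Longrightarrow> wlin \<phi> (f + g) = wlin \<phi> f + wlin \<phi> g"
  by (simp add: fps_eq_iff nc_part_linear lin_add fsupp_nc_part)

lemma wlin_scale: "wlin \<phi> (scale r f) = r *q wlin \<phi> f" for \<phi> :: "'a list \<Rightarrow> 'v :: rat_algebra"
  by (simp add: fps_eq_iff nc_part_linear lin_scale)

lemma wlin_agree: "agree n f g \<Longrightarrow> m \<le> n \<Longrightarrow> wlin \<phi> f $ m = wlin \<phi> g $ m"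
  using agree_nc_part[of m f g] by (simp add: agree_def)

lemma gmono_mult: "gmono m x * gmono n y = gmono (m + n) (x * y)" for x :: "'v :: rat_algebra"
proof (rule fps_ext)
  fix k
  have "(\<Sum>i=0..k. gmono m x $ i * gmono n y $ (k - i)) = (\<Sum>i=0..k. if i = m then (if k = m + n then x * y else 0) else 0)"
    by (rule sum.cong) auto
  then show "(gmono m x * gmono n y) $ k = gmono (m + n) (x * y) $ k"
    by (auto simp: fps_mult_nth)
qed

lemma gmono_linear: "gmono n (x + y) = gmono n x + gmono n y" "gmono n (x - y) = gmono n x - gmono n y"
  "gmono n (- x) = - gmono n x" "gmono n (r *q x) = r *q gmono n x" "gmono n 0 = 0"
    for x y :: "'v :: rat_algebra"
  by (auto simp: fps_eq_iff)

lemma gmono_sum: "gmono n (\<Sum>i\<in>A. f i) = (\<Sum>i\<in>A. gmono n (f i))" for f :: "_ \<Rightarrow> 'v :: rat_algebra"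
  by (induction A rule: infinite_finite_induct) (auto simp: gmono_linear)

lemma wlin_homogeneous:
  assumes "\<And>w. f w \<noteq> 0 \<Longrightarrow> length w = n"
  shows "wlin \<phi> f = gmono n (lin \<phi> f)"
proof -
  have "nc_part m f = (if m = n then f else 0)" for m
    using assms by (auto simp: nc_part_def fun_eq_iff fun_apply)
  then show ?thesis by (simp add: fps_eq_iff)
qed

lemma wlin_nc_tree: "wlin \<phi> (nc_tree t) = gmono (length (leaves t)) (lin \<phi> (nc_tree t))"
  by (rule wlin_homogeneous) (metis nc_tree_eq_0)

lemma single_nonzero: "single v w \<noteq> 0 \<Longrightarrow> w = v"
  by (simp add: single_def split: if_splits)

lemma wlin_single: "wlin \<phi> (single w) = gmono (length w) (\<phi> w)"
  by (subst wlin_homogeneous[of _ "length w"]) (auto dest: single_nonzero)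

lemma wlin_minus: "wlin \<phi> (- f) = - wlin \<phi> f" for \<phi> :: "'a list \<Rightarrow> 'v :: rat_algebra"
  using wlin_scale[of \<phi> "-1" f] by simp

lemma fps_mult_nth_cong:
  "(\<And>m. m \<le> n \<Longrightarrow> x $ m = x' $ m) \<Longrightarrow> (\<And>m. m \<le> n \<Longrightarrow> y $ m = y' $ m) \<Longrightarrow> (x * y) $ n = (x' * y') $ n"
  by (auto simp: fps_mult_nth intro!: sum.cong)

lemma ad_nth_cong:
  "(\<And>m. m \<le> n \<Longrightarrow> x $ m = x' $ m) \<Longrightarrow> (\<And>m. m \<le> n \<Longrightarrow> y $ m = y' $ m) \<Longrightarrow> ad x y $ n = ad x' y' $ n"
  using fps_mult_nth_cong[of n x x' y y'] fps_mult_nth_cong[of n y y' x x'] by (simp add: ad_def)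

definition tword :: "'a \<Rightarrow> 'a list \<Rightarrow> 'a dq" where
  "tword a w = (1 / of_nat (length w)) *q PT a (rnorm w)"

text \<open>
  The image of \<open>l\<close> as a power series. By the theorem of Dynkin, Specht and Wever, \<open>tword\<close>
  makes it the restriction of a linear functional on words, so that it does not depend on the
  choice of bracket trees.
\<close>

definition LS :: "'a set \<Rightarrow> ('a \<Rightarrow> 'a ncs) \<Rightarrow> 'a dq fps" where
  "LS S L = (\<Sum>a\<in>S. wlin (tword a) (L a))"

text \<open>\<open>iota\<close> on words instead of cyclic words, including its sign. It can be
  applied to the result of a derivation before passing to cyclic classes.\<close>

definition IS :: "'a ncs \<Rightarrow> 'a dq fps" where
  "IS = wlin (\<lambda>w. - WH (map Leaf w))"

lemma lin_tword: "lin (tword a) (nc_tree t) = PT a t"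
  unfolding tword_def by (rule PT.dynkin[symmetric])

lemma LS_0 [simp]: "LS S 0 = 0"
  by (simp add: LS_def fun_apply)

lemma LS_add: "finite S \<Longrightarrow> L \<in> FLS S \<Longrightarrow> M \<in> FLS S \<Longrightarrow> LS S (L + M) = LS S L + LS S M"
  by (simp add: LS_def fun_apply wlin_add[of S] FLS_alph sum.distrib)

lemma LS_te: "finite S \<Longrightarrow> a \<in> S \<Longrightarrow> LS S (tree_at a c t) = c *q gmono (length (leaves t)) (PT a t)"
  by (simp add: LS_def tree_at_def if_distrib[of "wlin _"] wlin_scale wlin_nc_tree lin_tword cong: if_cong)

lemma LS_agree: "(\<And>a. agree n (L a) (M a)) \<Longrightarrow> m \<le> n \<Longrightarrow> LS S L $ m = LS S M $ m"
  unfolding LS_def fps_sum_nth by (intro sum.cong refl wlin_agree)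

lemma FLS_scale: "finite S \<Longrightarrow> L \<in> FLS S \<Longrightarrow> (\<lambda>a. scale r (L a)) \<in> FLS S"
  by (auto simp: FLS_def FL_scale)

lemma FLS_uminus: "finite S \<Longrightarrow> L \<in> FLS S \<Longrightarrow> - L \<in> FLS S"
  using FLS_scale[of S L "-1"] by (simp add: fun_Compl_def)

lemma LS_uminus: "LS S (- L) = - LS S L"
  by (simp add: LS_def fun_apply wlin_minus sum_negf)

lemma FLS_diff: "finite S \<Longrightarrow> L \<in> FLS S \<Longrightarrow> M \<in> FLS S \<Longrightarrow> L - M \<in> FLS S"
  using FLS_add[of S L "- M"] FLS_uminus[of S M] by simp

lemma LS_diff: "finite S \<Longrightarrow> L \<in> FLS S \<Longrightarrow> M \<in> FLS S \<Longrightarrow> LS S (L - M) = LS S L - LS S M"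
  using LS_add[of S L "- M"] FLS_uminus[of S M] by (simp add: LS_uminus)

lemma FLS_LS_sum:
  "finite S \<Longrightarrow> (\<And>i. i \<in> A \<Longrightarrow> h i \<in> FLS S) \<Longrightarrow>
    (\<Sum>i\<in>A. h i) \<in> FLS S \<and> LS S (\<Sum>i\<in>A. h i) = (\<Sum>i\<in>A. LS S (h i))"
  by (induction A rule: infinite_finite_induct) (auto simp: FLS_0 FLS_add LS_add)

lemma tree_at_apply: "tree_at a c t x = (if x = a then scale c (nc_tree t) else 0)"
  by (simp add: tree_at_def)

text \<open>The three terms come from the componentwise bracket and the two derivations; the shape
  is that of \<open>PT_commutator\<close>, for comparison term by term.\<close>

lemma tb_bracket_te:
  "tb_bracket (tree_at a c s) (tree_at b d t) = (if a = b then tree_at a (c * d) (Br s t) else 0) +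
    (\<Sum>i<length (leaves t). if leaves t ! i = a then tree_at b (c * d) (bsub i s t) else 0) -
    (\<Sum>i<length (leaves s). if leaves s ! i = b then tree_at a (c * d) (bsub i t s) else 0)"
proof
  fix x
  have 1: "nc_bracket (tree_at a c s x) (tree_at b d t x) = (if a = b then tree_at a (c * d) (Br s t) else 0) x"
    by (auto simp: tree_at_def nc_bracket_scale_left nc_bracket_scale_right fun_apply)
  have 2: "nc_der (tree_at a c s) (tree_at b d t x) =
      (\<Sum>i<length (leaves t). if leaves t ! i = a then tree_at b (c * d) (bsub i s t) else 0) x" for a b c d s t
  proof -
    have "(\<Sum>i<length (leaves t). if leaves t ! i = a then tree_at b (c * d) (bsub i s t) else 0) x =
        (\<Sum>i<length (leaves t). if leaves t ! i = a then tree_at b (c * d) (bsub i s t) x else 0)"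
      by (subst sum_fun_apply, rule sum.cong) (auto simp: zero_fun_def)
    also have "\<dots> = nc_der (tree_at a c s) (tree_at b d t x)"
    proof (cases "x = b")
      case True
      have "(\<Sum>i<length (leaves t). if leaves t ! i = a then tree_at b (c * d) (bsub i s t) x else 0) =
          scale d (\<Sum>i<length (leaves t). if leaves t ! i = a then scale c (nc_tree (bsub i s t)) else 0)"
        unfolding series.scale_sum_right using True
        by (intro sum.cong refl) (simp add: tree_at_apply mult.commute)
      then show ?thesis
        using True by (simp add: nc_der_scale_right nc_der_nc_tree tree_at_apply)
    next
      case False
      then show ?thesis
        unfolding tree_at_apply by (simp add: if_distrib cong: if_cong)
    qed
    finally show ?thesis ..
  qed
  show "tb_bracket (tree_at a c s) (tree_at b d t) x = ((if a = b then tree_at a (c * d) (Br s t) else 0) +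
    (\<Sum>i<length (leaves t). if leaves t ! i = a then tree_at b (c * d) (bsub i s t) else 0) -
    (\<Sum>i<length (leaves s). if leaves s ! i = b then tree_at a (c * d) (bsub i t s) else 0)) x"
    unfolding tb_bracket_def 1 2[of a c s b d t] 2[of b d t a c s] mult.commute[of d c]
    by (simp add: fun_apply)
qed

lemma tb_bracket_add_left:
  "finite S \<Longrightarrow> L \<in> FLS S \<Longrightarrow> M \<in> FLS S \<Longrightarrow> tb_bracket (L + M) K = tb_bracket L K + tb_bracket M K"
  and tb_bracket_add_right:
  "finite S \<Longrightarrow> L \<in> FLS S \<Longrightarrow> M \<in> FLS S \<Longrightarrow> tb_bracket K (L + M) = tb_bracket K L + tb_bracket K M"
  and tb_bracket_0: "tb_bracket 0 K = 0" "tb_bracket K 0 = 0"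
  by (auto simp: tb_bracket_def fun_eq_iff fun_apply nc_bracket_add_left nc_bracket_add_right
      nc_der_add_left nc_der_add_right[of S] FLS_alph)

lemma tb_bracket_te_LS:
  assumes S: "finite S" "a \<in> S" "b \<in> S" "set (leaves s) \<subseteq> S" "set (leaves t) \<subseteq> S"
  shows "tb_bracket (tree_at a c s) (tree_at b d t) \<in> FLS S \<and>
    ad (LS S (tree_at a c s)) (LS S (tree_at b d t)) = LS S (tb_bracket (tree_at a c s) (tree_at b d t))"
proof -
  let ?n = "length (leaves s) + length (leaves t)"
  define h1 where "h1 = (if a = b then tree_at a (c * d) (Br s t) else 0)"
  define h2 where "h2 i = (if leaves t ! i = a then tree_at b (c * d) (bsub i s t) else 0)" for i
  define h3 where "h3 i = (if leaves s ! i = b then tree_at a (c * d) (bsub i t s) else 0)" for i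
  have b2: "length (leaves (bsub i s t)) = ?n" "set (leaves (bsub i s t)) \<subseteq> S" if "i < length (leaves t)" for i
    using leaves_bsub[OF that, of s] S by auto
  have b3: "length (leaves (bsub i t s)) = ?n" "set (leaves (bsub i t s)) \<subseteq> S" if "i < length (leaves s)" for i
    using leaves_bsub[OF that, of t] S by auto
  have h1: "h1 \<in> FLS S" "LS S h1 = (c * d) *q gmono ?n (if a = b then PT a (Br s t) else 0)"
    using S by (auto simp: h1_def FLS_0 FLS_te LS_te gmono_linear)
  have h2: "h2 i \<in> FLS S" "LS S (h2 i) = (c * d) *q gmono ?n (if leaves t ! i = a then PT b (bsub i s t) else 0)"
    if "i \<in> {..<length (leaves t)}" for i
    using S b2[of i] that by (auto simp: h2_def FLS_0 FLS_te LS_te gmono_linear)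
  have h3: "h3 i \<in> FLS S" "LS S (h3 i) = (c * d) *q gmono ?n (if leaves s ! i = b then PT a (bsub i t s) else 0)"
    if "i \<in> {..<length (leaves s)}" for i
    using S b3[of i] that by (auto simp: h3_def FLS_0 FLS_te LS_te gmono_linear)
  have eq: "tb_bracket (tree_at a c s) (tree_at b d t) = h1 + (\<Sum>i<length (leaves t). h2 i) - (\<Sum>i<length (leaves s). h3 i)"
    unfolding tb_bracket_te h1_def h2_def h3_def ..
  note s2 = FLS_LS_sum[OF S(1), of "{..<length (leaves t)}" h2, OF h2(1)]
  note s3 = FLS_LS_sum[OF S(1), of "{..<length (leaves s)}" h3, OF h3(1)]
  have "ad (LS S (tree_at a c s)) (LS S (tree_at b d t)) = (c * d) *q gmono ?n (PT a s * PT b t - PT b t * PT a s)"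
    using S by (simp add: LS_te ad_def gmono_mult gmono_linear qscale_distribs add.commute mult.commute)
  also have "\<dots> = LS S h1 + (\<Sum>i<length (leaves t). LS S (h2 i)) - (\<Sum>i<length (leaves s). LS S (h3 i))"
    unfolding PT_commutator using h2(2) h3(2)
    by (simp add: h1 gmono_linear gmono_sum qscale_distribs qvs.scale_sum_right)
  finally show ?thesis
    using s2 s3 h1(1) S(1) by (simp add: eq FLS_add FLS_diff LS_add LS_diff)
qed

lemma ad_LS_fin:
  assumes S: "finite S" and L: "fin_FLS S L" and M: "fin_FLS S M"
  shows "tb_bracket L M \<in> FLS S \<and> ad (LS S L) (LS S M) = LS S (tb_bracket L M)"
  using L
proof induction
  case zero
  then show ?case by (simp add: tb_bracket_0 FLS_0[OF S])
next
  case (add a s L c)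
  have tree_at: "tree_at a c s \<in> FLS S"
    using add S by (simp add: FLS_te)
  have "tb_bracket (tree_at a c s) M \<in> FLS S \<and> ad (LS S (tree_at a c s)) (LS S M) = LS S (tb_bracket (tree_at a c s) M)"
    using M
  proof induction
    case zero
    then show ?case by (simp add: tb_bracket_0 FLS_0[OF S])
  next
    case (add b t M d)
    then show ?case
      using tb_bracket_te_LS[OF S \<open>a \<in> S\<close> add(1) \<open>set (leaves s) \<subseteq> S\<close> add(2), of c d] fin_FLS_FLS[OF S add(3)] S
      by (simp add: tb_bracket_add_right[OF S FLS_te] FLS_te LS_add ad_add_right FLS_add)
  qed
  then show ?case
    using add tree_at fin_FLS_FLS[OF S add(3)] S
    by (simp add: tb_bracket_add_left LS_add ad_add_left FLS_add)
qed

lemma agree_tb_bracket: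
  assumes "finite S" "L \<in> FLS S" "M \<in> FLS S" "L' \<in> FLS S" "M' \<in> FLS S"
    and "\<And>a. agree n (L a) (L' a)" "\<And>a. agree n (M a) (M' a)"
  shows "agree n (tb_bracket L M a) (tb_bracket L' M' a)"
  unfolding tb_bracket_def
  by (intro agree_add agree_diff agree_bracket agree_nc_der[of S] FLS_alph assms)

text \<open>In degree \<open>n\<close> both sides depend only on the parts of \<open>L\<close> and
  \<open>M\<close> up to degree \<open>n\<close>, so finite approximations suffice; they also show
  that the bracket stays in \<open>FL(S)^S\<close>.\<close>

lemma ad_LS:
  assumes S: "finite S" and L: "L \<in> FLS S" and M: "M \<in> FLS S"
  shows "tb_bracket L M \<in> FLS S" "ad (LS S L) (LS S M) = LS S (tb_bracket L M)"
proof -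
  have *: "\<exists>K\<in>FLS S. (\<forall>a. agree n (tb_bracket L M a) (K a)) \<and> ad (LS S L) (LS S M) $ n = LS S K $ n" for n
  proof -
    obtain L' where L': "fin_FLS S L'" "\<And>a. agree n (L a) (L' a)"
      using fin_FLS_approx[OF S L] by blast
    obtain M' where M': "fin_FLS S M'" "\<And>a. agree n (M a) (M' a)"
      using fin_FLS_approx[OF S M] by blast
    have "ad (LS S L) (LS S M) $ n = ad (LS S L') (LS S M') $ n"
      using LS_agree L'(2) M'(2) by (intro ad_nth_cong) blast+
    then show ?thesis
      using ad_LS_fin[OF S L'(1) M'(1)] agree_tb_bracket[OF S L M fin_FLS_FLS[OF S L'(1)] fin_FLS_FLS[OF S M'(1)]]
        L'(2) M'(2)
      by (intro bexI[of _ "tb_bracket L' M'"]) auto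
  qed
  then show "tb_bracket L M \<in> FLS S"
    by (intro FLS_agree[OF S]) blast
  show "ad (LS S L) (LS S M) = LS S (tb_bracket L M)"
  proof (rule fps_ext)
    fix n
    obtain K where "\<And>a. agree n (tb_bracket L M a) (K a)" "ad (LS S L) (LS S M) $ n = LS S K $ n"
      using *[of n] by blast
    then show "ad (LS S L) (LS S M) $ n = LS S (tb_bracket L M) $ n"
      using LS_agree[of n "tb_bracket L M" K n S] by simp
  qed
qed

lemma IS_0 [simp]: "IS 0 = 0"
  by (simp add: IS_def)

lemma IS_add: "finite S \<Longrightarrow> f \<in> alph S \<Longrightarrow> g \<in> alph S \<Longrightarrow> IS (f + g) = IS f + IS g"
  and IS_scale: "IS (scale r f) = r *q IS f"
  and IS_single: "IS (single w) = gmono (length w) (- WH (map Leaf w))"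
  by (simp_all add: IS_def wlin_add wlin_scale wlin_single)

lemma IS_agree: "agree n f g \<Longrightarrow> m \<le> n \<Longrightarrow> IS f $ m = IS g $ m"
  unfolding IS_def by (rule wlin_agree)

lemma IS_commute: "IS f * IS g = IS g * IS f"
proof (rule fps_ext)
  fix n
  have "IS f $ i * IS g $ j = IS g $ j * IS f $ i" for i j
    unfolding IS_def wlin_nth lin_def sum_product
    by (subst sum.swap) (simp add: WH_commute mult.commute)
  then have "(IS f * IS g) $ n = (\<Sum>i=0..n. IS g $ (n - i) * IS f $ i)"
    by (simp add: fps_mult_nth)
  also have "\<dots> = (\<Sum>i=0..n. IS g $ i * IS f $ (n - i))"
    by (rule sum.reindex_bij_witness[of _ "\<lambda>i. n - i" "\<lambda>i. n - i"]) auto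
  finally show "(IS f * IS g) $ n = (IS g * IS f) $ n"
    by (simp add: fps_mult_nth)
qed

lemma nc_mult_length_eq:
  assumes "(f \<odot> g) w \<noteq> 0" "\<And>w. f w \<noteq> 0 \<Longrightarrow> length w = m" "\<And>w. g w \<noteq> 0 \<Longrightarrow> length w = n"
  shows "length w = m + n"
proof -
  obtain i where i: "i \<le> length w" "f (take i w) * g (drop i w) \<noteq> 0"
    using assms(1) unfolding nc_mult_def by (auto elim: sum.not_neutral_contains_not_neutral)
  then show ?thesis
    using assms(2)[of "take i w"] assms(3)[of "drop i w"] by auto
qed

lemma lin_WH_insert:
  "lin (\<lambda>w. WH (map Leaf w)) (single u \<odot> nc_tree t \<odot> single v) = WH (map Leaf u @ [t] @ map Leaf v)"
  using WH_expand[of "map Leaf u" t "map Leaf v"] by (simp add: lin_nc_mult)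

lemma ad_LS_IS_te:
  assumes S: "finite S" "a \<in> S" "set (leaves s) \<subseteq> S" "set w \<subseteq> S"
  shows "ad (LS S (tree_at a c s)) (IS (single w)) = IS (dw (tree_at a c s) w)"
proof -
  let ?n = "length (leaves s) + length w"
  define h where "h i = (if w ! i = a then scale c (single (take i w) \<odot> nc_tree (Br (Leaf a) s) \<odot> single (drop (Suc i) w)) else 0)" for i
  have dwh: "dw (tree_at a c s) w = (\<Sum>i<length w. h i)"
    unfolding dw_def h_def
    by (rule sum.cong) (auto simp: tree_at_def nc_bracket_scale_right nc_mult_scale_left nc_mult_scale_right)
  have h: "IS (h i) = c *q gmono ?n (- (if w ! i = a then WH ((map Leaf w)[i := Br (Leaf a) s]) else 0)) \<and> h i \<in> alph S"
    if "i < length w" for i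
  proof (cases "w ! i = a")
    case True
    have "length v = ?n" if "(single (take i w) \<odot> nc_tree (Br (Leaf a) s) \<odot> single (drop (Suc i) w)) v \<noteq> 0" for v
    proof -
      have "length v = length (take i w) + length (leaves (Br (Leaf a) s)) + length (drop (Suc i) w)"
        using that
        by (elim nc_mult_length_eq) (metis single_nonzero, metis nc_tree_eq_0, metis single_nonzero)
      then show ?thesis using \<open>i < length w\<close> by simp
    qed
    then have "IS (single (take i w) \<odot> nc_tree (Br (Leaf a) s) \<odot> single (drop (Suc i) w)) =
        gmono ?n (lin (\<lambda>w. - WH (map Leaf w)) (single (take i w) \<odot> nc_tree (Br (Leaf a) s) \<odot> single (drop (Suc i) w)))"
      unfolding IS_def by (rule wlin_homogeneous)
    also have "lin (\<lambda>w. - WH (map Leaf w)) (single (take i w) \<odot> nc_tree (Br (Leaf a) s) \<odot> single (drop (Suc i) w)) =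
        - WH ((map Leaf w)[i := Br (Leaf a) s])"
      using lin_WH_insert[of "take i w" "Br (Leaf a) s" "drop (Suc i) w"] that
        lin_scale_fun[of "-1" "\<lambda>w. WH (map Leaf w)" "single (take i w) \<odot> nc_tree (Br (Leaf a) s) \<odot> single (drop (Suc i) w)"]
      by (simp add: upd_conv_take_nth_drop take_map drop_map)
    finally have "IS (h i) = c *q gmono ?n (- WH ((map Leaf w)[i := Br (Leaf a) s]))"
      using True by (simp add: h_def IS_scale)
    moreover have "h i \<in> alph S"
      unfolding h_def using S True
      by (auto intro!: alph_scale alph_mult alph_single alph_nc_tree simp del: nc_tree.simps dest: in_set_takeD in_set_dropD)
    ultimately show ?thesis using True by simp
  qed (simp add: h_def gmono_linear)
  have "(\<Sum>i\<in>A. h i) \<in> alph S \<and> IS (\<Sum>i\<in>A. h i) = (\<Sum>i\<in>A. IS (h i))" if "finite A" "A \<subseteq> {..<length w}" for A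
    using that h by (induction A) (auto simp: IS_add[OF S(1)] alph_add)
  from this[of "{..<length w}"] have "IS (dw (tree_at a c s) w) =
      (\<Sum>i<length w. c *q gmono ?n (- (if w ! i = a then WH ((map Leaf w)[i := Br (Leaf a) s]) else 0)))"
    using h by (simp add: dwh)
  also have "\<dots> = c *q gmono ?n (- (PT a s * WH (map Leaf w) - WH (map Leaf w) * PT a s))"
    unfolding PT_WH_commutator by (simp add: gmono_linear gmono_sum qvs.scale_sum_right sum_negf)
  also have "\<dots> = ad (LS S (tree_at a c s)) (IS (single w))"
    using S by (simp add: LS_te IS_single ad_def gmono_mult gmono_linear qscale_distribs add.commute)
  finally show ?thesis ..
qed

text \<open>A derivation replaces one letter \<open>a\<close> of a word at a time by
  \<open>[a, s]\<close>, and \<open>PT_WH_commutator\<close> produces the same spokes. Truncation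
  extends this from finite sums to series.\<close>

lemma ad_LS_IS:
  assumes S: "finite S" and L: "L \<in> FLS S" and f: "f \<in> alph S"
  shows "ad (LS S L) (IS f) = IS (nc_der L f)"
proof (rule fps_ext)
  fix n
  obtain M where M: "fin_FLS S M" "\<And>a. agree n (L a) (M a)"
    using fin_FLS_approx[OF S L] by blast
  have fsg: "fsupp g \<Longrightarrow> g \<in> alph S \<Longrightarrow> ad (LS S M) (IS g) = IS (nc_der M g)" for g
  proof -
    assume g: "fsupp g" "g \<in> alph S"
    have base: "ad (LS S M) (IS (single w)) = IS (dw M w)" if w: "set w \<subseteq> S" for w
      using M(1)
    proof induction
      case (add a s M c)
      have tree_at: "tree_at a c s \<in> FLS S" "M \<in> FLS S"
        using add S fin_FLS_FLS by (auto simp: FLS_te)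
      then show ?case
        using add ad_LS_IS_te[OF S add(1,2) w, of c] dw_alph[OF w, of M] dw_alph[OF w, of "tree_at a c s"] FLS_alph[OF S]
        by (simp add: LS_add S ad_add_left dw_add IS_add[OF S])
    qed (simp add: dw_0)
    have "ad (LS S M) (IS (\<Sum>w\<in>A. scale (g w) (single w))) = IS (\<Sum>w\<in>A. scale (g w) (dw M w)) \<and>
        (\<Sum>w\<in>A. scale (g w) (single w)) \<in> alph S \<and> (\<Sum>w\<in>A. scale (g w) (dw M w)) \<in> alph S"
      if "finite A" "\<forall>w\<in>A. set w \<subseteq> S" for A
      using that
    proof (induction A)
      case (insert w A)
      have "scale (g w) (single w) \<in> alph S" "scale (g w) (dw M w) \<in> alph S"
        using insert.prems FLS_alph[OF S fin_FLS_FLS[OF S M(1)]] by (auto intro!: alph_scale alph_single dw_alph)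
      with insert show ?case
        by (simp add: IS_add[OF S] IS_scale ad_add_right ad_qscale_right base alph_add)
    qed simp
    from this[of "{w. g w \<noteq> 0}"] g show ?thesis
      by (simp add: nc_der_fsupp fsupp_expand) (simp add: fsupp_def alph_def fsupp_expand[unfolded fsupp_def])
  qed
  let ?g = "trunc n f"
  have "ad (LS S L) (IS f) $ n = ad (LS S M) (IS ?g) $ n"
    by (rule ad_nth_cong) (erule LS_agree[OF M(2)], erule IS_agree[OF agree_trunc])
  also have "\<dots> = IS (nc_der M ?g) $ n"
    by (simp add: fsg[OF fsupp_trunc[OF S f] trunc_alph[OF f]])
  also have "\<dots> = IS (nc_der L f) $ n"
    by (rule IS_agree[symmetric, OF agree_nc_der[OF S f trunc_alph[OF f] agree_trunc M(2)]]) simp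
  finally show "ad (LS S L) (IS f) $ n = IS (nc_der L f) $ n" .
qed


subsection \<open>Cyclic words\<close>

lemma cyc_eq_iff: "v \<in> cyc w \<longleftrightarrow> cyc v = cyc w"
proof
  assume "v \<in> cyc w"
  then obtain n where n: "v = rotate n w" by (auto simp: cyc_def)
  let ?m = "length w - n mod length w"
  have m: "rotate ?m v = w"
  proof (cases "w = []")
    case False
    have "(?m + n) mod length w = (?m + n mod length w) mod length w"
      by (simp add: mod_simps)
    also have "?m + n mod length w = length w"
      using False by simp
    finally show ?thesis
      by (simp add: n rotate_rotate rotate_id)
  qed (simp add: n)
  have "rotate k v \<in> cyc w" for k
    unfolding cyc_def n rotate_rotate by blast
  moreover have "rotate k w \<in> cyc v" for k
    unfolding cyc_def by (subst m[symmetric], subst rotate_rotate) blast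
  ultimately show "cyc v = cyc w"
    unfolding cyc_def[of v] cyc_def[of w] by auto
next
  assume "cyc v = cyc w"
  moreover have "v \<in> cyc v"
    by (auto simp: cyc_def intro!: exI[of _ 0])
  ultimately show "v \<in> cyc w" by simp
qed

lemma cyc_refl [simp]: "w \<in> cyc w"
  by (simp add: cyc_eq_iff)

lemma cw_word_cyc: "cyc (cw_word (cyc w)) = cyc w"
  using someI[of "\<lambda>v. v \<in> cyc w" w] by (simp add: cw_word_def cyc_eq_iff)

lemma cyc_length: "cyc v = cyc w \<Longrightarrow> length v = length w"
  and cyc_set: "cyc v = cyc w \<Longrightarrow> set v = set w"
  using cyc_eq_iff[of v w] by (auto simp: cyc_def)

lemma WH_cyc: "cyc v = cyc w \<Longrightarrow> WH (map Leaf v) = WH (map Leaf w)"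
proof -
  assume "cyc v = cyc w"
  then obtain n where "v = rotate n w"
    using cyc_eq_iff[of v w] by (auto simp: cyc_def)
  moreover have "WH (map Leaf (rotate n w)) = WH (map Leaf w)" for n
  proof (induction n)
    case (Suc n)
    have "WH (map Leaf (rotate1 u)) = WH (map Leaf u)" for u :: "'a list"
      using WH_rotate[of "[Leaf (hd u)]" "map Leaf (tl u)"] by (cases u) auto
    then show ?case using Suc by simp
  qed simp
  ultimately show ?thesis by simp
qed

lemma cw_word_length: "length (cw_word (cyc w)) = length w"
  by (rule cyc_length[OF cw_word_cyc])

lemma cyc_in_cwords_iff: "cyc w \<in> cwords S \<longleftrightarrow> w \<noteq> [] \<and> set w \<subseteq> S"
proof
  assume "cyc w \<in> cwords S"
  then obtain v where "cyc w = cyc v" "v \<noteq> []" "set v \<subseteq> S"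
    unfolding cwords_def by blast
  then show "w \<noteq> [] \<and> set w \<subseteq> S"
    using cyc_length[of w v] cyc_set[of w v] by auto
qed (auto simp: cwords_def)

lemma cwordsE: "c \<in> cwords S \<Longrightarrow> (\<And>w. c = cyc w \<Longrightarrow> w \<noteq> [] \<Longrightarrow> set w \<subseteq> S \<Longrightarrow> P) \<Longrightarrow> P"
  unfolding cwords_def by blast

lemma CW_lift_alph: "\<omega> \<in> CW S \<Longrightarrow> cw_lift \<omega> \<in> alph S"
  by (simp add: alph_def CW_def cw_lift_def) (metis cyc_in_cwords_iff)

lemma cw_lift_Nil [simp]: "cw_lift \<omega> [] = 0"
  by (simp add: cw_lift_def)

lemma cw_class_CW: "f \<in> alph S \<Longrightarrow> cw_class f \<in> CW S"
  unfolding CW_def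
proof (intro CollectI allI impI)
  fix c assume f: "f \<in> alph S" and "cw_class f c \<noteq> 0"
  then have "c \<in> cwords UNIV" "(\<Sum>w\<in>c. f w) \<noteq> 0"
    by (auto simp: cw_class_def split: if_splits)
  then obtain w v where w: "c = cyc w" "w \<noteq> []" "v \<in> c" "f v \<noteq> 0"
    by (metis cwordsE sum.not_neutral_contains_not_neutral)
  then have "c = cyc v" by (simp add: cyc_eq_iff)
  then show "c \<in> cwords S"
    using w f cyc_length[of w v] by (auto simp: cyc_in_cwords_iff alph_def)
qed

definition IC :: "'a cws \<Rightarrow> 'a dq fps" where
  "IC \<omega> = IS (cw_lift \<omega>)"

text \<open>\<open>WH\<close> is invariant under rotation, so the coefficients of a whole cyclic
  class can be collected on the word that \<open>cw_lift\<close> selects. The empty word represents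
  no cyclic word, while its wheel is the unit; so its coefficient has to vanish.\<close>

lemma IC_cw_class:
  assumes S: "finite S" and f: "f \<in> alph S" "f [] = 0"
  shows "IC (cw_class f) = IS f"
proof (rule fps_ext)
  fix n
  let ?W = "{w. set w \<subseteq> S \<and> length w = n}"
  let ?r = "\<lambda>w. cw_word (cyc w)"
  have fin: "finite ?W" using S by (rule finite_lists_length_eq)
  have lin: "IS g $ n = (\<Sum>w\<in>?W. g w *q - WH (map Leaf w))" if "g \<in> alph S" for g
  proof -
    have "IS g $ n = (\<Sum>w\<in>?W. nc_part n g w *q - WH (map Leaf w))"
      unfolding IS_def wlin_nth using that by (intro lin_superset fin) (auto simp: nc_part_def alph_def split: if_splits)
    then show ?thesis by (simp add: nc_part_def)
  qed
  have rW: "?r w \<in> ?W" if "w \<in> ?W" for w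
    using that cyc_set[OF cw_word_cyc, of w] cw_word_length[of w] by auto
  have fib: "{v \<in> ?W. ?r v = w} = (if w = ?r w then cyc w else {})" if "w \<in> ?W" for w
  proof -
    have "v \<in> ?W \<and> ?r v = w \<longleftrightarrow> w = ?r w \<and> v \<in> cyc w" for v
      using that cw_word_cyc[of v] cyc_length[of v w] cyc_set[of v w] by (auto simp: cyc_eq_iff)
    then show ?thesis by auto
  qed
  have "IS f $ n = (\<Sum>v\<in>?W. f v *q - WH (map Leaf (?r v)))"
    unfolding lin[OF f(1)] WH_cyc[OF cw_word_cyc] by simp
  also have "\<dots> = (\<Sum>w\<in>?W. \<Sum>v\<in>{v \<in> ?W. ?r v = w}. f v *q - WH (map Leaf (?r v)))"
    by (rule sum.group[symmetric, OF fin fin]) (use rW in blast)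
  also have "\<dots> = (\<Sum>w\<in>?W. cw_lift (cw_class f) w *q - WH (map Leaf w))"
  proof (rule sum.cong[OF refl])
    fix w assume w: "w \<in> ?W"
    have "cw_lift (cw_class f) w = (if w = ?r w then (\<Sum>v\<in>cyc w. f v) else 0)"
    proof (cases "w = []")
      case True
      then have "cyc w = {[]}" by (auto simp: cyc_def)
      with True f(2) show ?thesis by simp
    next
      case False
      then show ?thesis
        by (auto simp: cw_lift_def cw_class_def cyc_in_cwords_iff)
    qed
    then show "(\<Sum>v\<in>{v \<in> ?W. ?r v = w}. f v *q - WH (map Leaf (?r v))) = cw_lift (cw_class f) w *q - WH (map Leaf w)"
      unfolding fib[OF w] by (auto simp: qvs.scale_sum_left cyc_eq_iff sum_negf intro!: sum.cong)
  qed
  also have "\<dots> = IC (cw_class f) $ n"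
    unfolding IC_def by (rule lin[symmetric]) (rule CW_lift_alph[OF cw_class_CW[OF f(1)]])
  finally show "IC (cw_class f) $ n = IS f $ n" ..
qed

lemma nc_der_Nil: "finite S \<Longrightarrow> f \<in> alph S \<Longrightarrow> nc_der L f [] = 0"
proof -
  have "dw L w [] = 0" for w
    using dw_length[of L w "[]"] by (cases "w = []") (auto simp: dw_def fun_apply)
  then show "finite S \<Longrightarrow> f \<in> alph S \<Longrightarrow> nc_der L f [] = 0"
    by (simp add: nc_der_apply[of S f "[]" 0])
qed

lemma cw_der_CW: "finite S \<Longrightarrow> L \<in> FLS S \<Longrightarrow> \<omega> \<in> CW S \<Longrightarrow> cw_der L \<omega> \<in> CW S"
  unfolding cw_der_def by (intro cw_class_CW nc_der_alph CW_lift_alph FLS_alph)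

lemma ad_LS_IC:
  assumes "finite S" "L \<in> FLS S" "\<omega> \<in> CW S"
  shows "ad (LS S L) (IC \<omega>) = IC (cw_der L \<omega>)"
proof -
  note f = CW_lift_alph[OF assms(3)]
  have "ad (LS S L) (IC \<omega>) = IS (nc_der L (cw_lift \<omega>))"
    unfolding IC_def by (rule ad_LS_IS[OF assms(1,2) f])
  also have "\<dots> = IC (cw_der L \<omega>)"
    unfolding cw_der_def
    by (rule IC_cw_class[symmetric, OF assms(1) nc_der_alph[OF assms(1) f FLS_alph[OF assms(1,2)]] nc_der_Nil[OF assms(1) f]])
  finally show ?thesis .
qed

section \<open>Lifting ends to other strands, reversal, and the sign of the degree as maps of the
  diagram algebra\<close>

section \<open>Operations\<close>

subsection \<open>Lifting the ends of a diagram\<close>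

text \<open>An empty \<open>m x\<close> annihilates every list in which \<open>x\<close> occurs;
  this is how deletion of a strand arises as a lifting.\<close>

fun lsum :: "('a \<Rightarrow> 'a set) \<Rightarrow> ('a items \<Rightarrow> 'v :: comm_monoid_add) \<Rightarrow> 'a items \<Rightarrow> 'v" where
  "lsum m h [] = h []"
| "lsum m h (i # its) = (\<Sum>y\<in>m (fst i). lsum m (\<lambda>js. h ((y, snd i) # js)) its)"

lemma lsum_append: "lsum m h (us @ vs) = lsum m (\<lambda>u. lsum m (\<lambda>v. h (u @ v)) vs) us"
  by (induction us arbitrary: h) simp_all

lemma lsum_cong:
  "(\<And>js. map snd js = map snd its \<Longrightarrow> h js = h' js) \<Longrightarrow> lsum m h its = lsum m h' its"
proof (induction its arbitrary: h h')
  case (Cons i its)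
  show ?case
    unfolding lsum.simps by (intro sum.cong refl Cons.IH Cons.prems) simp
qed simp

lemma lsum_add: "lsum m (\<lambda>js. h js + h' js) its = lsum m h its + lsum m h' its"
  by (induction its arbitrary: h h') (simp_all add: sum.distrib)

lemma lsum_0: "lsum m (\<lambda>js. 0) its = 0"
  by (induction its) simp_all

lemma lsum_minus: "lsum m (\<lambda>js. - h js) its = - lsum m h its" for h :: "_ \<Rightarrow> 'v :: ab_group_add"
  by (induction its arbitrary: h) (simp_all add: sum_negf)

lemma lsum_mult: "lsum m (\<lambda>js. h js * c) its = lsum m h its * c"
  "lsum m (\<lambda>js. c * h js) its = c * lsum m h its" for c :: "'v :: semiring_0"
  by (induction its arbitrary: h) (simp_all add: sum_distrib_right sum_distrib_left)

lemma lsum_ren: "lsum m h (ren_items \<pi> its) = lsum m (\<lambda>js. h (ren_items \<pi> js)) its"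
  by (induction its arbitrary: h) (simp_all add: ren_items_def case_prod_beta)

text \<open>Invariance under exactly the exchanges of neighbours that \<open>ld\<close> does not
  see.\<close>

definition swapinv :: "('a items \<Rightarrow> 'v) \<Rightarrow> bool" where
  "swapinv h \<longleftrightarrow> (\<forall>us a x b y vs. a \<noteq> b \<longrightarrow> h (us @ (a, x) # (b, y) # vs) = h (us @ (b, y) # (a, x) # vs))"

lemma swapinv_Cons: "swapinv h \<Longrightarrow> swapinv (\<lambda>js. h (i # js))"
  unfolding swapinv_def by (metis append_Cons)

lemma swapinv_ld: "swapinv (\<lambda>js. f (ld js V))"
  unfolding swapinv_def by (metis ld_swap)

lemma nc_mult_sum: "(\<Sum>i\<in>A. f i) \<odot> g = (\<Sum>i\<in>A. f i \<odot> g)" "g \<odot> (\<Sum>i\<in>A. f i) = (\<Sum>i\<in>A. g \<odot> f i)"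
  by (induction A rule: infinite_finite_induct) (simp_all add: nc_mult_add_left nc_mult_add_right)

lemma good_stack: "good D \<Longrightarrow> good E \<Longrightarrow> good (stack D E)"
proof -
  assume "good D" "good E"
  then obtain its V its' V' where D: "D = ld its V" "agood (ends its) V" and E: "E = ld its' V'" "agood (ends its') V'"
    unfolding good_def by blast
  show ?thesis
    unfolding D(1) E(1) stack_ld good_ld ends_simps ends_ren
    by (intro agood_union agood_ren D E) (auto simp: names_ren)
qed

definition dmap :: "('v \<Rightarrow> 'w) \<Rightarrow> 'v fps \<Rightarrow> 'w fps" where
  "dmap h X = Abs_fps (\<lambda>n. h (X $ n))"

lemma dmap_nth [simp]: "dmap h X $ n = h (X $ n)"
  by (simp add: dmap_def)

lemma dlift_sum: "resp \<phi> \<Longrightarrow> dlift \<phi> (\<Sum>i\<in>A. f i) = (\<Sum>i\<in>A. dlift \<phi> (f i))"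
  by (induction A rule: infinite_finite_induct) (simp_all add: dlift_add dlift_0)

lemma dlift_lin_fun: "resp \<phi> \<Longrightarrow> dlift \<phi> (lin \<psi> f) = lin (\<lambda>x. dlift \<phi> (\<psi> x)) f"
  by (simp add: lin_def dlift_sum dlift_scale)

lemma dlift_minus: "resp \<phi> \<Longrightarrow> dlift \<phi> (- x) = - dlift \<phi> x"
  for \<phi> :: "_ \<Rightarrow> 'b dq"
  using dlift_scale[of \<phi> "-1" x] by simp

fun tlifts :: "('a \<Rightarrow> 'a set) \<Rightarrow> 'a btree \<Rightarrow> 'a btree set" where
  "tlifts m (Leaf x) = Leaf ` m x"
| "tlifts m (Br s t) = (\<lambda>(s, t). Br s t) ` (tlifts m s \<times> tlifts m t)"

lemma sum_tlifts_Leaf: "(\<Sum>t'\<in>tlifts m (Leaf x). h t') = (\<Sum>y\<in>m x. h (Leaf y))"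
  by (simp add: sum.reindex inj_on_def)

lemma sum_tlifts_Br: "(\<Sum>t'\<in>tlifts m (Br s t). h t') = (\<Sum>s'\<in>tlifts m s. \<Sum>t'\<in>tlifts m t. h (Br s' t'))"
  by (subst sum.cartesian_product) (simp add: sum.reindex inj_on_def case_prod_beta)

lemma tlifts_leaves: "t' \<in> tlifts m t \<Longrightarrow> length (leaves t') = length (leaves t) \<and> set (leaves t') \<subseteq> (\<Union>x. m x)"
  by (induction t arbitrary: t') fastforce+

text \<open>The names in a labelled tree depend on its shape only, so lifting its tails with the
  vertices kept is the same as lifting the letters of the tree.\<close>

lemma lsum_lab:
  "lsum m (\<lambda>js. h js (lverts (lab e t))) (tl_items (ltails (lab e t))) =
    (\<Sum>t'\<in>tlifts m t. h (tl_items (ltails (lab e t'))) (lverts (lab e t')))"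
proof (induction t arbitrary: e h)
  case (Leaf x)
  then show ?case by (simp add: sum_tlifts_Leaf del: tlifts.simps)
next
  case (Br s t)
  let ?x = "{#(0 # e, 1 # e, e)#}"
  have "lsum m (\<lambda>js. h js (lverts (lab e (Br s t)))) (tl_items (ltails (lab e (Br s t)))) =
      lsum m (\<lambda>u. lsum m (\<lambda>v. h (u @ v) (?x + lverts (lab (0 # e) s) + lverts (lab (1 # e) t)))
        (tl_items (ltails (lab (1 # e) t)))) (tl_items (ltails (lab (0 # e) s)))"
    by (simp add: lsum_append)
  also have "\<dots> = lsum m (\<lambda>u. \<Sum>t'\<in>tlifts m t. h (u @ tl_items (ltails (lab (1 # e) t')))
        (?x + lverts (lab (0 # e) s) + lverts (lab (1 # e) t'))) (tl_items (ltails (lab (0 # e) s)))"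
    by (subst Br.IH(2)) (rule refl)
  also have "\<dots> = (\<Sum>s'\<in>tlifts m s. \<Sum>t'\<in>tlifts m t. h (tl_items (ltails (lab (0 # e) s')) @ tl_items (ltails (lab (1 # e) t')))
        (?x + lverts (lab (0 # e) s') + lverts (lab (1 # e) t')))"
    by (rule Br.IH(1))
  finally show ?case
    by (simp add: sum_tlifts_Br del: tlifts.simps)
qed

lemma wheel_eq_zip:
  "wheel w = ld (zip w (map (\<lambda>i. Tail [0, i]) [0..<length w]))
    (mset (map (\<lambda>i. ([0, i], [1, Suc i mod length w], [1, i])) [0..<length w]))"
proof -
  have "zip w (map f [0..<length w]) = map (\<lambda>i. (w ! i, f i)) [0..<length w]" for f :: "nat \<Rightarrow> arrow_end"
    by (rule nth_equalityI) simp_all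
  moreover have "[Tail [0, i]. i \<leftarrow> is, w ! i = b] = map snd (filter (\<lambda>i. fst i = b) (map (\<lambda>i. (w ! i, Tail [0, i])) is))"
    for b "is"
    by (induction "is") simp_all
  ultimately show ?thesis
    by (simp add: wheel_def ld_def)
qed

text \<open>
  The strands in \<open>S'\<close> replace the strand to which \<open>u\<close> maps them. Deleting, renaming
  and doubling a strand \<open>a\<close> are the cases in which it has zero, one and two preimages.
\<close>

locale relabelling =
  fixes S' :: "'a set" and u :: "'a \<Rightarrow> 'a"
  assumes fin: "finite S'"
begin

definition pre :: "'a \<Rightarrow> 'a set" where
  "pre x = {y \<in> S'. u y = x}"

lemma finite_pre [simp]: "finite (pre x)"
  using fin by (simp add: pre_def)

lemma pre_disjoint: "y \<in> pre x \<Longrightarrow> y \<in> pre z \<Longrightarrow> x = z"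
  by (simp add: pre_def)

lemma lsum_swap:
  assumes "swapinv h" "x \<noteq> z"
  shows "lsum pre h ((x, d) # (z, e) # vs) = lsum pre h ((z, e) # (x, d) # vs)"
proof -
  have "h ([] @ (y, d) # (y', e) # js) = h ([] @ (y', e) # (y, d) # js)" if "y \<in> pre x" "y' \<in> pre z" for y y' js
  proof -
    have "y \<noteq> y'"
      using assms(2) that pre_disjoint by blast
    then show ?thesis
      using assms(1) unfolding swapinv_def by (elim allE) (erule mp)
  qed
  then have "lsum pre h ((x, d) # (z, e) # vs) =
      (\<Sum>y\<in>pre x. \<Sum>y'\<in>pre z. lsum pre (\<lambda>js. h ((y', e) # (y, d) # js)) vs)"
    by simp
  then show ?thesis
    by (simp add: sum.swap[of _ "pre x"])
qed

lemma lsum_front: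
  assumes "swapinv h" "x \<notin> fst ` set us"
  shows "lsum pre h (us @ (x, e) # vs) = lsum pre h ((x, e) # us @ vs)"
  using assms
proof (induction us arbitrary: h)
  case (Cons i us)
  obtain z d where i: "i = (z, d)" by (cases i)
  have "lsum pre h ((i # us) @ (x, e) # vs) = lsum pre h ((z, d) # (x, e) # us @ vs)"
    using Cons.IH[OF swapinv_Cons[OF Cons.prems(1)]] Cons.prems(2) by (simp add: i)
  then show ?case
    using lsum_swap[OF Cons.prems(1), of z x d e "us @ vs"] not_sym Cons.prems(2) by (simp only: i append_Cons) auto
qed simp

text \<open>Independence of the linearisation: ends on different strands stay on different strands
  when lifted, because preimages of different labels are disjoint.\<close>

lemma lsum_eq:
  assumes "swapinv h" "\<And>b. map snd (filter (\<lambda>i. fst i = b) its) = map snd (filter (\<lambda>i. fst i = b) its')"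
  shows "lsum pre h its = lsum pre h its'"
  using assms
proof (induction its arbitrary: h its')
  case Nil
  then have "its' = []"
    by (cases its') (auto, metis list.distinct(1) list.simps(9))
  then show ?case by simp
next
  case (Cons i its)
  obtain x e where i: "i = (x, e)" by (cases i)
  have "filter (\<lambda>i. fst i = x) its' \<noteq> []"
    using Cons.prems(2)[of x] by (auto simp: i)
  then have "\<exists>j\<in>set its'. fst j = x"
    by (auto simp: filter_empty_conv)
  \<comment> \<open>As the strands coincide, the first entry of \<open>its'\<close> on strand
    \<open>x\<close> is the end \<open>e\<close>; everything before it lies on other strands and can
    be passed.\<close>
  from split_list_first_prop[OF this] obtain us j vs where
    its': "its' = us @ j # vs" "fst j = x" and "\<forall>y\<in>set us. fst y \<noteq> x"
    by (elim exE conjE)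
  then have x: "x \<notin> fst ` set us" by force
  have us: "filter (\<lambda>i. fst i = x) us = []"
    using x by (auto simp: filter_empty_conv)
  have j: "j = (x, e)"
    using Cons.prems(2)[of x] its'(2) us by (cases j) (simp add: i its'(1))
  have "map snd (filter (\<lambda>i. fst i = b) its) = map snd (filter (\<lambda>i. fst i = b) (us @ vs))" for b
    using Cons.prems(2)[of b] us by (cases "b = x") (simp_all add: i its'(1) j)
  then have "lsum pre (\<lambda>js. h ((y, e) # js)) its = lsum pre (\<lambda>js. h ((y, e) # js)) (us @ vs)" for y
    by (rule Cons.IH[OF swapinv_Cons[OF Cons.prems(1)]])
  then show ?case
    using lsum_front[OF Cons.prems(1) x] by (simp add: i its'(1) j)
qed

definition lift_op :: "'a diagram \<Rightarrow> 'a dq" where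
  "lift_op D = lsum pre (\<lambda>js. cl (ld js (verts D))) (SOME its. D = ld its (verts D))"

lemma lift_op_ld: "lift_op (ld its V) = lsum pre (\<lambda>js. cl (ld js V)) its"
proof -
  let ?its = "SOME its'. ld its V = ld its' V"
  have "ld its V = ld ?its V"
    by (rule someI[of _ its]) (rule refl)
  then have "map snd (filter (\<lambda>i. fst i = b) its) = map snd (filter (\<lambda>i. fst i = b) ?its)" for b
    unfolding strand_ld[of _ V, symmetric] by (rule arg_cong)
  then show ?thesis
    unfolding lift_op_def verts_ld by (intro lsum_eq[symmetric] swapinv_ld)
qed

text \<open>Two adjacent ends that are lifted to different strands may be exchanged freely. Only the
  liftings of both to the same strand \<open>y\<close> see the relation, so the term with the new
  vertex is lifted as a single end.\<close>

lemma lsum_STU: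
  assumes "swapinv h"
    and "\<And>us' y vs'. map snd us' = map snd us \<Longrightarrow> map snd vs' = map snd vs \<Longrightarrow>
      h (us' @ (y, p) # (y, q) # vs') = h (us' @ (y, q) # (y, p) # vs') + k us' y vs'"
  shows "lsum pre h (us @ (a, p) # (a, q) # vs) = lsum pre h (us @ (a, q) # (a, p) # vs) +
    lsum pre (\<lambda>us'. \<Sum>y\<in>pre a. lsum pre (\<lambda>vs'. k us' y vs') vs) us"
  unfolding lsum_append lsum_add[symmetric]
proof (rule lsum_cong)
  fix us' :: "'a items" assume us': "map snd us' = map snd us"
  have "lsum pre (\<lambda>v. h (us' @ (y, p) # (y', q) # v)) vs = lsum pre (\<lambda>v. h (us' @ (y', q) # (y, p) # v)) vs +
      (if y' = y then lsum pre (k us' y) vs else 0)" for y y'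
  proof (cases "y' = y")
    case True
    then show ?thesis
      by (simp add: lsum_add[symmetric] cong: lsum_cong) (rule lsum_cong, rule assms(2)[OF us'])
  next
    case False
    then show ?thesis
      using assms(1) by (simp add: swapinv_def)
  qed
  then have "(\<Sum>y\<in>pre a. \<Sum>y'\<in>pre a. lsum pre (\<lambda>v. h (us' @ (y, p) # (y', q) # v)) vs) =
      (\<Sum>y\<in>pre a. \<Sum>y'\<in>pre a. lsum pre (\<lambda>v. h (us' @ (y', q) # (y, p) # v)) vs) + (\<Sum>y\<in>pre a. lsum pre (k us' y) vs)"
    by (simp add: sum.distrib)
  also have "(\<Sum>y\<in>pre a. \<Sum>y'\<in>pre a. lsum pre (\<lambda>v. h (us' @ (y', q) # (y, p) # v)) vs) =
      (\<Sum>y'\<in>pre a. \<Sum>y\<in>pre a. lsum pre (\<lambda>v. h (us' @ (y', q) # (y, p) # v)) vs)"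
    by (rule sum.swap)
  finally show "lsum pre (\<lambda>v. h (us' @ v)) ((a, p) # (a, q) # vs) =
      lsum pre (\<lambda>v. h (us' @ v)) ((a, q) # (a, p) # vs) + (\<Sum>y\<in>pre a. lsum pre (\<lambda>vs'. k us' y vs') vs)"
    by simp
qed

lemma resp_lift_op: "resp lift_op"
proof (rule respI; unfold lift_op_ld)
  fix its :: "'a items" and V and \<pi> :: "edge \<Rightarrow> edge"
  assume "agood (ends its) V" "inj_on \<pi> (names (ends its) V)"
  then show "lsum pre (\<lambda>js. cl (ld js V)) its = lsum pre (\<lambda>js. cl (ld js (ren_verts \<pi> V))) (ren_items \<pi> its)"
    unfolding lsum_ren by (intro lsum_cong resp_iso[OF resp_cl]) (simp_all add: ends_def)
next
  fix its :: "'a items" and V p q r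
  assume "agood (ends its) (V + {#(p, q, r)#})"
  then show "lsum pre (\<lambda>js. cl (ld js (V + {#(p, q, r)#}))) its = - lsum pre (\<lambda>js. cl (ld js (V + {#(q, p, r)#}))) its"
    unfolding lsum_minus[symmetric] by (intro lsum_cong resp_AS[OF resp_cl]) (simp add: ends_def)
next
  fix its :: "'a items" and V p q x r y
  assume g: "agood (ends its) (V + {#(p, q, x), (x, r, y)#})"
  show "lsum pre (\<lambda>js. cl (ld js (V + {#(p, q, x), (x, r, y)#}))) its + lsum pre (\<lambda>js. cl (ld js (V + {#(q, r, x), (x, p, y)#}))) its +
    lsum pre (\<lambda>js. cl (ld js (V + {#(r, p, x), (x, q, y)#}))) its = 0"
    unfolding lsum_add[symmetric]
    by (subst lsum_0[symmetric], rule lsum_cong, rule resp_IHX[OF resp_cl]) (use g in \<open>simp add: ends_def\<close>)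
next
  fix us vs :: "'a items" and a p q V e
  assume g: "agood (ends (us @ [(a, Head p), (a, Head q)] @ vs)) V"
    "agood (ends (us @ [(a, Head e)] @ vs)) (V + {#(p, q, e)#})"
  have "lsum pre (\<lambda>js. cl (ld js V)) (us @ (a, Head p) # (a, Head q) # vs) =
      lsum pre (\<lambda>js. cl (ld js V)) (us @ (a, Head q) # (a, Head p) # vs) +
      lsum pre (\<lambda>us'. \<Sum>y\<in>pre a. lsum pre (\<lambda>vs'. cl (ld (us' @ (y, Head e) # vs') (V + {#(p, q, e)#}))) vs) us"
  proof (rule lsum_STU[OF swapinv_ld[of cl]])
    fix us' vs' :: "'a items" and y
    assume "map snd us' = map snd us" "map snd vs' = map snd vs"
    then show "cl (ld (us' @ (y, Head p) # (y, Head q) # vs') V) = cl (ld (us' @ (y, Head q) # (y, Head p) # vs') V) +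
        cl (ld (us' @ (y, Head e) # vs') (V + {#(p, q, e)#}))"
      using resp_STU1[OF resp_cl, of us' y p q vs' V e] g by (simp add: ends_def)
  qed
  then show "lsum pre (\<lambda>js. cl (ld js V)) (us @ [(a, Head p), (a, Head q)] @ vs) =
      lsum pre (\<lambda>js. cl (ld js V)) (us @ [(a, Head q), (a, Head p)] @ vs) +
      lsum pre (\<lambda>js. cl (ld js (V + {#(p, q, e)#}))) (us @ [(a, Head e)] @ vs)"
    by (simp add: lsum_append[of _ _ us "(a, Head e) # vs"])
next
  fix us vs :: "'a items" and a p e V f
  assume g: "agood (ends (us @ [(a, Head p), (a, Tail e)] @ vs)) V"
    "agood (ends (us @ [(a, Tail f)] @ vs)) (V + {#(f, p, e)#})"
  have "lsum pre (\<lambda>js. cl (ld js V)) (us @ (a, Head p) # (a, Tail e) # vs) =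
      lsum pre (\<lambda>js. cl (ld js V)) (us @ (a, Tail e) # (a, Head p) # vs) +
      lsum pre (\<lambda>us'. \<Sum>y\<in>pre a. lsum pre (\<lambda>vs'. cl (ld (us' @ (y, Tail f) # vs') (V + {#(f, p, e)#}))) vs) us"
  proof (rule lsum_STU[OF swapinv_ld[of cl]])
    fix us' vs' :: "'a items" and y
    assume "map snd us' = map snd us" "map snd vs' = map snd vs"
    then show "cl (ld (us' @ (y, Head p) # (y, Tail e) # vs') V) = cl (ld (us' @ (y, Tail e) # (y, Head p) # vs') V) +
        cl (ld (us' @ (y, Tail f) # vs') (V + {#(f, p, e)#}))"
      using resp_STU2[OF resp_cl, of us' y p e vs' V f] g by (simp add: ends_def)
  qed
  then show "lsum pre (\<lambda>js. cl (ld js V)) (us @ [(a, Head p), (a, Tail e)] @ vs) =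
      lsum pre (\<lambda>js. cl (ld js V)) (us @ [(a, Tail e), (a, Head p)] @ vs) +
      lsum pre (\<lambda>js. cl (ld js (V + {#(f, p, e)#}))) (us @ [(a, Tail f)] @ vs)"
    by (simp add: lsum_append[of _ _ us "(a, Tail f) # vs"])
next
  fix us vs :: "'a items" and a d e V
  assume g: "agood (ends (us @ [(a, Tail d), (a, Tail e)] @ vs)) V"
  have "lsum pre (\<lambda>js. cl (ld js V)) (us @ (a, Tail d) # (a, Tail e) # vs) =
      lsum pre (\<lambda>js. cl (ld js V)) (us @ (a, Tail e) # (a, Tail d) # vs) +
      lsum pre (\<lambda>us'. \<Sum>y\<in>pre a. lsum pre (\<lambda>vs'. 0) vs) us"
  proof (rule lsum_STU[OF swapinv_ld[of cl]])
    fix us' vs' :: "'a items" and y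
    assume "map snd us' = map snd us" "map snd vs' = map snd vs"
    then show "cl (ld (us' @ (y, Tail d) # (y, Tail e) # vs') V) = cl (ld (us' @ (y, Tail e) # (y, Tail d) # vs') V) + 0"
      using resp_TC[OF resp_cl, of us' y d e vs' V] g by (simp add: ends_def)
  qed
  then show "lsum pre (\<lambda>js. cl (ld js V)) (us @ [(a, Tail d), (a, Tail e)] @ vs) =
      lsum pre (\<lambda>js. cl (ld js V)) (us @ [(a, Tail e), (a, Tail d)] @ vs)"
    by (simp add: lsum_0)
qed

definition lift_dq :: "'a dq \<Rightarrow> 'a dq" where
  "lift_dq = dlift lift_op"

lemma lift_dq_linear: "lift_dq (x + y) = lift_dq x + lift_dq y" "lift_dq (r *q x) = r *q lift_dq x" "lift_dq 0 = 0" "lift_dq (- x) = - lift_dq x"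
  "lift_dq (\<Sum>i\<in>A. f i) = (\<Sum>i\<in>A. lift_dq (f i))"
  by (simp_all add: lift_dq_def dlift_add dlift_scale dlift_0 dlift_minus dlift_sum resp_lift_op)

lemma lift_dq_lin: "lift_dq (lin \<psi> f) = lin (\<lambda>x. lift_dq (\<psi> x)) f"
  by (simp add: lift_dq_def dlift_lin_fun resp_lift_op)

lemma lift_dq_cl: "good D \<Longrightarrow> lift_dq (cl D) = lift_op D"
  by (simp add: lift_dq_def dlift_cl resp_lift_op)

lemma lift_op_stack:
  assumes "good D" "good E"
  shows "lift_op (stack D E) = lift_op D * lift_op E"
proof -
  obtain its V where D: "D = ld its V" "agood (ends its) V"
    using assms(1) by (auto simp: good_def)
  obtain its' V' where E: "E = ld its' V'" "agood (ends its') V'"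
    using assms(2) by (auto simp: good_def)
  have "lift_op (stack D E) = lsum pre (\<lambda>js. lsum pre (\<lambda>js'. cl (stack (ld js V) (ld js' V'))) its') its"
    by (simp add: D E stack_ld lift_op_ld lsum_append lsum_ren)
  also have "\<dots> = lsum pre (\<lambda>js. lsum pre (\<lambda>js'. cl (ld js V) * cl (ld js' V')) its') its"
    by (intro lsum_cong mult_cl[symmetric]) (use D E in \<open>simp_all add: good_ld ends_def\<close>)
  also have "\<dots> = lift_op D * lift_op E"
    by (simp add: D E lift_op_ld lsum_mult)
  finally show ?thesis .
qed

lemma lift_dq_mult: "lift_dq (x * y) = lift_dq x * lift_dq y"
proof (induction x rule: dq_induct)
  case (add c D x)
  have "lift_dq (cl D * y) = lift_dq (cl D) * lift_dq y"
  proof (induction y rule: dq_induct)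
    case (add d E y)
    have "good (stack D E)"
      using \<open>good D\<close> \<open>good E\<close> by (rule good_stack)
    with add \<open>good D\<close> show ?case
      by (simp add: lift_dq_linear qscale_distribs distrib_left mult_cl lift_dq_cl lift_op_stack)
  qed (simp add: lift_dq_linear)
  with add show ?case
    by (simp add: lift_dq_linear qscale_distribs distrib_right)
qed (simp add: lift_dq_linear)

lemma lift_dq_1: "lift_dq 1 = 1"
  by (simp add: one_dq_def lift_dq_cl good_ld lift_op_ld)

lemma lift_dq_PT: "lift_dq (PT a t) = (\<Sum>y\<in>pre a. \<Sum>t'\<in>tlifts pre t. PT y t')"
proof -
  have "plant a t = ld ((a, Head []) # tl_items (ltails (lab [] t))) (lverts (lab [] t))" for a :: 'a and t
    unfolding plant_eq_planted planted_def by simp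
  then show ?thesis
    using good_plant[of a t] lsum_lab[where h = "\<lambda>js V. cl (ld ((_, Head []) # js) V)" and m = pre and e = "[]"]
    by (simp only: PT_def lift_dq_cl lift_op_ld lsum.simps fst_conv snd_conv)
qed

definition wl :: "'a list \<Rightarrow> 'a list set" where
  "wl w = {v. set v \<subseteq> S' \<and> map u v = w}"

lemma wl_simps: "wl [] = {[]}" "wl (x # w) = (\<lambda>(y, v). y # v) ` (pre x \<times> wl w)"
  by (auto simp: wl_def pre_def image_iff map_eq_Cons_conv)

lemma finite_wl [simp]: "finite (wl w)"
  by (induction w) (simp_all add: wl_simps)

lemma sum_wl_Cons: "(\<Sum>v\<in>wl (x # w). h v) = (\<Sum>y\<in>pre x. \<Sum>v\<in>wl w. h (y # v))"
  unfolding wl_simps by (subst sum.cartesian_product) (simp add: sum.reindex inj_on_def case_prod_beta)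

lemma lsum_zip: "length es = length w \<Longrightarrow> lsum pre h (zip w es) = (\<Sum>v\<in>wl w. h (zip v es))"
proof (induction w arbitrary: es h)
  case (Cons x w)
  then show ?case by (cases es) (simp_all add: sum_wl_Cons)
qed (simp add: wl_simps)

lemma lift_dq_WH: "lift_dq (WH (map Leaf w)) = (\<Sum>v\<in>wl w. WH (map Leaf v))"
proof -
  have "lift_dq (WH (map Leaf w)) = lift_op (wheel w)"
    using good_wheel[of w] by (simp add: lift_dq_cl flip: cl_wheel)
  also have "\<dots> = (\<Sum>v\<in>wl w. cl (wheel v))"
    unfolding wheel_eq_zip lift_op_ld by (subst lsum_zip) (auto simp: wl_def intro!: sum.cong)
  finally show ?thesis by (simp add: cl_wheel)
qed

text \<open>Substituting for \<open>x\<close> the sum of its preimages is dual to applying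
  \<open>u\<close> to words: the coefficient at \<open>v\<close> is that of
  \<open>map u v\<close>.\<close>

definition pb :: "'a ncs \<Rightarrow> 'a ncs" where
  "pb f = (\<lambda>v. if set v \<subseteq> S' then f (map u v) else 0)"

lemma lin_pb:
  assumes "fsupp f"
  shows "lin \<phi> (pb f) = lin (\<lambda>w. \<Sum>v\<in>wl w. \<phi> v) f"
proof -
  let ?W = "{w. f w \<noteq> 0}"
  have f: "finite ?W" using assms by (simp add: fsupp_def)
  have "lin \<phi> (pb f) = (\<Sum>v\<in>(\<Union>w\<in>?W. wl w). pb f v *q \<phi> v)"
  proof (rule lin_superset)
    show "finite (\<Union>w\<in>?W. wl w)" using f by simp
  qed (auto simp: pb_def wl_def split: if_splits)
  also have "\<dots> = (\<Sum>w\<in>?W. \<Sum>v\<in>wl w. pb f v *q \<phi> v)"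
    using f finite_wl by (intro sum.UNION_disjoint) (blast, blast, auto simp: wl_def)
  also have "\<dots> = (\<Sum>w\<in>?W. \<Sum>v\<in>wl w. f w *q \<phi> v)"
    by (intro sum.cong refl) (simp add: wl_def pb_def)
  finally show ?thesis
    by (simp add: lin_def qvs.scale_sum_right)
qed

lemma nc_part_pb: "nc_part n (pb f) = pb (nc_part n f)"
  by (auto simp: nc_part_def pb_def)

lemma lift_dq_IS: "finite S \<Longrightarrow> f \<in> alph S \<Longrightarrow> dmap lift_dq (IS f) = IS (pb f)"
  by (simp add: fps_eq_iff IS_def nc_part_pb lin_pb[OF fsupp_nc_part] lift_dq_lin lift_dq_linear lift_dq_WH sum_negf)

lemma pb_linear: "pb (f + g) = pb f + pb g" "pb (f - g) = pb f - pb g" "pb (scale c f) = scale c (pb f)" "pb 0 = 0"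
  by (auto simp: pb_def fun_eq_iff fun_apply scale_def)

lemma pb_mult: "pb (f \<odot> g) = pb f \<odot> pb g"
proof
  fix v
  show "pb (f \<odot> g) v = (pb f \<odot> pb g) v"
  proof (cases "set v \<subseteq> S'")
    case True
    then have "set (take i v) \<subseteq> S'" "set (drop i v) \<subseteq> S'" for i
      by (auto dest: in_set_takeD in_set_dropD)
    with True show ?thesis
      by (simp add: pb_def nc_mult_def take_map drop_map)
  next
    case False
    have "\<not> set (take i v) \<subseteq> S' \<or> \<not> set (drop i v) \<subseteq> S'" for i
      using False set_append[of "take i v" "drop i v"] by auto
    then have "pb f (take i v) * pb g (drop i v) = 0" for i
      by (auto simp: pb_def)
    then have "(pb f \<odot> pb g) v = 0"
      unfolding nc_mult_def by (intro sum.neutral ballI)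
    then show ?thesis
      using False by (simp add: pb_def[of "f \<odot> g"])
  qed
qed

lemma pb_nc_tree: "pb (nc_tree t) = (\<Sum>t'\<in>tlifts pre t. nc_tree t')"
proof (induction t)
  case (Leaf x)
  have "pb (nc_gen x) = (\<Sum>y\<in>pre x. nc_gen y)"
  proof
    fix v
    have "(\<Sum>y\<in>pre x. single [y] v) = (if \<exists>y\<in>pre x. v = [y] then 1 else 0 :: rat)"
      by (auto simp: single_def sum.If_cases)
    then show "pb (nc_gen x) v = (\<Sum>y\<in>pre x. nc_gen y) v"
      by (auto simp: pb_def nc_gen_def sum_fun_apply single_def pre_def map_eq_Cons_conv)
  qed
  then show ?case by (simp add: sum_tlifts_Leaf del: tlifts.simps)
next
  case (Br s t)
  then show ?case
    by (simp add: nc_bracket_def[of "nc_tree s"] pb_linear pb_mult sum_tlifts_Br del: tlifts.simps)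
       (simp add: nc_bracket_sum sum.swap[of _ "tlifts pre t"] flip: nc_bracket_def)
qed

definition plift :: "('a \<Rightarrow> 'a ncs) \<Rightarrow> 'a \<Rightarrow> 'a ncs" where
  "plift L = (\<lambda>y. if y \<in> S' then pb (L (u y)) else 0)"

lemma plift_te: "plift (tree_at a c t) = (\<Sum>y\<in>pre a. \<Sum>t'\<in>tlifts pre t. tree_at y c t')"
proof
  fix z
  have "(\<Sum>y\<in>pre a. \<Sum>t'\<in>tlifts pre t. tree_at y c t') z = (\<Sum>y\<in>pre a. if y = z then (\<Sum>t'\<in>tlifts pre t. scale c (nc_tree t')) else 0)"
    by (subst sum_fun_apply, rule sum.cong[OF refl], subst sum_fun_apply) (auto simp: tree_at_def)
  also have "\<dots> = (if z \<in> pre a then scale c (pb (nc_tree t)) else 0)"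
    by (simp add: pb_nc_tree series.scale_sum_right)
  also have "\<dots> = plift (tree_at a c t) z"
    by (auto simp: plift_def tree_at_def pre_def pb_linear)
  finally show "plift (tree_at a c t) z = (\<Sum>y\<in>pre a. \<Sum>t'\<in>tlifts pre t. tree_at y c t') z" ..
qed

lemma plift_add: "plift (L + M) = plift L + plift M"
  and plift_0: "plift 0 = 0"
  by (auto simp: plift_def fun_eq_iff[of "\<lambda>y. _ y"] fun_apply pb_linear)

lemma lift_dq_LS_fin:
  assumes S: "finite S" and L: "fin_FLS S L"
  shows "plift L \<in> FLS S' \<and> dmap lift_dq (LS S L) = LS S' (plift L)"
  using L
proof induction
  case zero
  then show ?case by (simp add: plift_0 FLS_0 fin fps_eq_iff lift_dq_linear)
next
  case (add a t L c)
  have t': "length (leaves t') = length (leaves t)" "set (leaves t') \<subseteq> S'" if "t' \<in> tlifts pre t" for t'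
    using tlifts_leaves[OF that] by (auto simp: pre_def)
  have tree_at: "tree_at y c t' \<in> FLS S'" "LS S' (tree_at y c t') = c *q gmono (length (leaves t)) (PT y t')"
    if "y \<in> pre a" "t' \<in> tlifts pre t" for y t'
    using that t'[of t'] by (auto simp: pre_def FLS_te fin LS_te)
  note inner = FLS_LS_sum[OF fin, of "tlifts pre t", OF tree_at(1)]
  note outer = FLS_LS_sum[OF fin, of "pre a" "\<lambda>y. \<Sum>t'\<in>tlifts pre t. tree_at y c t'"]
  have o: "plift (tree_at a c t) \<in> FLS S'"
    "LS S' (plift (tree_at a c t)) = c *q gmono (length (leaves t)) (lift_dq (PT a t))"
    using outer inner tree_at(2) unfolding plift_te lift_dq_PT
    by (simp_all add: gmono_sum qvs.scale_sum_right cong: sum.cong)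
  have "dmap lift_dq (LS S (tree_at a c t + L)) = dmap lift_dq (LS S (tree_at a c t)) + dmap lift_dq (LS S L)"
    using add S by (simp add: LS_add FLS_te fin_FLS_FLS fps_eq_iff lift_dq_linear)
  also have "dmap lift_dq (LS S (tree_at a c t)) = LS S' (plift (tree_at a c t))"
    using add by (simp add: o(2) LS_te S fps_eq_iff lift_dq_linear fps_qscale_nth)
  finally show ?case
    using add.IH o(1) by (simp add: plift_add FLS_add LS_add fin)
qed

lemma agree_pb: "agree n f g \<Longrightarrow> agree n (pb f) (pb g)"
  by (simp add: agree_def pb_def)

lemma lift_dq_LS:
  assumes S: "finite S" and L: "L \<in> FLS S"
  shows "plift L \<in> FLS S'" "dmap lift_dq (LS S L) = LS S' (plift L)"
proof -
  have *: "\<exists>M\<in>FLS S'. (\<forall>a. agree n (plift L a) (M a)) \<and> dmap lift_dq (LS S L) $ n = LS S' M $ n" for n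
  proof -
    obtain L' where L': "fin_FLS S L'" "\<And>a. agree n (L a) (L' a)"
      using fin_FLS_approx[OF S L] by blast
    have "dmap lift_dq (LS S L) $ n = dmap lift_dq (LS S L') $ n"
      using LS_agree[OF L'(2)] by simp
    then show ?thesis
      using lift_dq_LS_fin[OF S L'(1)] L'(2)
      by (intro bexI[of _ "plift L'"]) (auto simp: plift_def agree_pb)
  qed
  then show "plift L \<in> FLS S'"
    by (intro FLS_agree[OF fin]) blast
  show "dmap lift_dq (LS S L) = LS S' (plift L)"
  proof (rule fps_ext)
    fix n
    obtain M where "\<And>a. agree n (plift L a) (M a)" "dmap lift_dq (LS S L) $ n = LS S' M $ n"
      using *[of n] by blast
    then show "dmap lift_dq (LS S L) $ n = LS S' (plift L) $ n"
      using LS_agree[of n "plift L" M n S'] by simp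
  qed
qed

lemma foldr_wl:
  assumes "\<And>x. x \<in> set w \<Longrightarrow> \<sigma> x = (\<Sum>y\<in>pre x. nc_gen y)"
  shows "foldr (\<lambda>x g. \<sigma> x \<odot> g) w nc_one = (\<Sum>v\<in>wl w. single v)"
  using assms
proof (induction w)
  case (Cons x w)
  from Cons show ?case
    by (simp add: nc_mult_sum sum_wl_Cons nc_gen_def) (simp add: sum.swap[of _ "wl w"])
qed (simp add: wl_simps nc_one_def)

lemma nc_subst_eq_pb:
  assumes S: "finite S" "f \<in> alph S" "\<And>x. x \<in> S \<Longrightarrow> \<sigma> x = (\<Sum>y\<in>pre x. nc_gen y)"
  shows "nc_subst \<sigma> f = pb f"
proof
  fix v
  have "f w * foldr (\<lambda>x g. \<sigma> x \<odot> g) w nc_one v = (if v \<in> wl w then f w else 0)" if "f w \<noteq> 0" for w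
  proof -
    have "foldr (\<lambda>x g. \<sigma> x \<odot> g) w nc_one = (\<Sum>v\<in>wl w. single v)"
      using S that by (intro foldr_wl) (auto simp: alph_def)
    then show ?thesis
      by (simp add: sum_fun_apply single_def)
  qed
  then have "nc_subst \<sigma> f v = (\<Sum>w | f w \<noteq> 0 \<and> length w \<le> length v. if v \<in> wl w then f w else 0)"
    unfolding nc_subst_def nc_extend_def by (intro sum.cong) auto
  also have "\<dots> = pb f v"
  proof (cases "set v \<subseteq> S' \<and> f (map u v) \<noteq> 0")
    case True
    have "finite {w. f w \<noteq> 0 \<and> length w \<le> length v}"
      by (rule finite_subset[OF _ finite_words_le[OF S(1), of "length v"]]) (use S(2) in \<open>auto simp: alph_def\<close>)
    then have "(\<Sum>w | f w \<noteq> 0 \<and> length w \<le> length v. if v \<in> wl w then f w else 0) = (\<Sum>w\<in>{map u v}. f w)"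
      using True by (intro sum.mono_neutral_cong_right) (auto simp: wl_def)
    with True show ?thesis by (simp add: pb_def)
  next
    case False
    then show ?thesis
      by (intro trans[OF sum.neutral]) (auto simp: wl_def pb_def)
  qed
  finally show "nc_subst \<sigma> f v = pb f v" .
qed

lemma dmap_th_mult: "dmap lift_dq (X * Y) = dmap lift_dq X * dmap lift_dq Y"
  by (simp add: fps_eq_iff fps_mult_nth lift_dq_linear lift_dq_mult)

lemma dmap_th_gexp: "dmap lift_dq (gexp X) = gexp (dmap lift_dq X)"
proof (rule gexp_hom)
  show "dmap lift_dq (X ^ n) = dmap lift_dq X ^ n" for n
  proof (induction n)
    case 0
    show ?case by (simp add: fps_eq_iff lift_dq_1 lift_dq_linear)
  qed (simp add: dmap_th_mult)
qed (auto simp: fps_eq_iff lift_dq_linear fps_qscale_nth gpart_fps_def)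

end

subsection \<open>Reversing strands\<close>

text \<open>\<open>dA\<close> for all strands at once. Empty strands are not changed by reversal, so
  \<open>UNIV\<close> can take the place of the label set.\<close>

definition rev_op :: "'a diagram \<Rightarrow> 'a dq" where
  "rev_op D = (-1) ^ size (heads D) *q cl (reverse_strands UNIV D)"

lemma rev_op_ld: "rev_op (ld its V) = (-1) ^ size (hds (ends its)) *q cl (ld (rev its) V)"
  by (simp add: rev_op_def heads_ld) (simp add: reverse_strands_def ld_def rev_map rev_filter)

text \<open>Reversal exchanges the two sides of an STU difference, and the diagram with the new
  vertex has one head less than the other two; these two signs cancel.\<close>

lemma resp_rev_op: "resp rev_op"
proof (rule respI; unfold rev_op_ld)
  fix its :: "'a items" and V and \<pi> :: "edge \<Rightarrow> edge"
  assume "agood (ends its) V" "inj_on \<pi> (names (ends its) V)"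
  then have "cl (ld (rev its) V) = cl (ld (ren_items \<pi> (rev its)) (ren_verts \<pi> V))"
    by (intro resp_iso[OF resp_cl]) simp_all
  then show "(-1) ^ size (hds (ends its)) *q cl (ld (rev its) V) =
      (-1) ^ size (hds (ends (ren_items \<pi> its))) *q cl (ld (rev (ren_items \<pi> its)) (ren_verts \<pi> V))"
    by (simp only: ends_ren hds_ren size_image_mset) (simp add: ren_items_def rev_map)
next
  fix its :: "'a items" and V p q r
  assume "agood (ends its) (V + {#(p, q, r)#})"
  then show "(-1) ^ size (hds (ends its)) *q cl (ld (rev its) (V + {#(p, q, r)#})) =
      - ((-1) ^ size (hds (ends its)) *q cl (ld (rev its) (V + {#(q, p, r)#})))"
    using resp_AS[OF resp_cl, of "rev its" V p q r] by simp
next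
  fix its :: "'a items" and V p q x r y
  assume g: "agood (ends its) (V + {#(p, q, x), (x, r, y)#})"
  show "(-1) ^ size (hds (ends its)) *q cl (ld (rev its) (V + {#(p, q, x), (x, r, y)#})) +
      (-1) ^ size (hds (ends its)) *q cl (ld (rev its) (V + {#(q, r, x), (x, p, y)#})) +
      (-1) ^ size (hds (ends its)) *q cl (ld (rev its) (V + {#(r, p, x), (x, q, y)#})) = 0"
    unfolding qvs.scale_right_distrib[symmetric]
    by (subst resp_IHX[OF resp_cl]) (use g in simp_all)
next
  fix us vs :: "'a items" and a p q V e
  assume g: "agood (ends (us @ [(a, Head p), (a, Head q)] @ vs)) V"
    "agood (ends (us @ [(a, Head e)] @ vs)) (V + {#(p, q, e)#})"
  have "cl (ld (rev vs @ [(a, Head p), (a, Head q)] @ rev us) V) =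
      cl (ld (rev vs @ [(a, Head q), (a, Head p)] @ rev us) V) + cl (ld (rev vs @ [(a, Head e)] @ rev us) (V + {#(p, q, e)#}))"
    by (rule resp_STU1[OF resp_cl]) (use g in \<open>simp_all add: union_commute\<close>)
  then show "(-1) ^ size (hds (ends (us @ [(a, Head p), (a, Head q)] @ vs))) *q cl (ld (rev (us @ [(a, Head p), (a, Head q)] @ vs)) V) =
      (-1) ^ size (hds (ends (us @ [(a, Head q), (a, Head p)] @ vs))) *q cl (ld (rev (us @ [(a, Head q), (a, Head p)] @ vs)) V) +
      (-1) ^ size (hds (ends (us @ [(a, Head e)] @ vs))) *q cl (ld (rev (us @ [(a, Head e)] @ vs)) (V + {#(p, q, e)#}))"
    by (simp add: qscale_distribs)
next
  fix us vs :: "'a items" and a p e V f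
  assume g: "agood (ends (us @ [(a, Head p), (a, Tail e)] @ vs)) V"
    "agood (ends (us @ [(a, Tail f)] @ vs)) (V + {#(f, p, e)#})"
  have "cl (ld (rev vs @ [(a, Head p), (a, Tail e)] @ rev us) V) =
      cl (ld (rev vs @ [(a, Tail e), (a, Head p)] @ rev us) V) + cl (ld (rev vs @ [(a, Tail f)] @ rev us) (V + {#(f, p, e)#}))"
    by (rule resp_STU2[OF resp_cl]) (use g in \<open>simp_all add: union_commute\<close>)
  then show "(-1) ^ size (hds (ends (us @ [(a, Head p), (a, Tail e)] @ vs))) *q cl (ld (rev (us @ [(a, Head p), (a, Tail e)] @ vs)) V) =
      (-1) ^ size (hds (ends (us @ [(a, Tail e), (a, Head p)] @ vs))) *q cl (ld (rev (us @ [(a, Tail e), (a, Head p)] @ vs)) V) +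
      (-1) ^ size (hds (ends (us @ [(a, Tail f)] @ vs))) *q cl (ld (rev (us @ [(a, Tail f)] @ vs)) (V + {#(f, p, e)#}))"
    by (simp add: qscale_distribs)
next
  fix us vs :: "'a items" and a d e V
  assume g: "agood (ends (us @ [(a, Tail d), (a, Tail e)] @ vs)) V"
  have "cl (ld (rev vs @ [(a, Tail d), (a, Tail e)] @ rev us) V) = cl (ld (rev vs @ [(a, Tail e), (a, Tail d)] @ rev us) V)"
    by (rule resp_TC[OF resp_cl]) (use g in \<open>simp_all add: union_commute\<close>)
  then show "(-1) ^ size (hds (ends (us @ [(a, Tail d), (a, Tail e)] @ vs))) *q cl (ld (rev (us @ [(a, Tail d), (a, Tail e)] @ vs)) V) =
      (-1) ^ size (hds (ends (us @ [(a, Tail e), (a, Tail d)] @ vs))) *q cl (ld (rev (us @ [(a, Tail e), (a, Tail d)] @ vs)) V)"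
    by simp
qed

definition rev_dq :: "'a dq \<Rightarrow> 'a dq" where
  "rev_dq = dlift rev_op"

lemma rev_dq_linear: "rev_dq (x + y) = rev_dq x + rev_dq y" "rev_dq (r *q x) = r *q rev_dq x" "rev_dq 0 = 0" "rev_dq (- x) = - rev_dq x"
  "rev_dq (\<Sum>i\<in>A. f i) = (\<Sum>i\<in>A. rev_dq (f i))"
  by (simp_all add: rev_dq_def dlift_add dlift_scale dlift_0 dlift_minus dlift_sum resp_rev_op)

lemma rev_dq_lin: "rev_dq (lin \<psi> f) = lin (\<lambda>x. rev_dq (\<psi> x)) f"
  by (simp add: rev_dq_def dlift_lin_fun resp_rev_op)

lemma rev_dq_cl: "good D \<Longrightarrow> rev_dq (cl D) = rev_op D"
  by (simp add: rev_dq_def dlift_cl resp_rev_op)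

lemma rev_op_stack:
  assumes "good D" "good E"
  shows "rev_op (stack D E) = rev_op E * rev_op D"
proof -
  obtain its V where D: "D = ld its V" "agood (ends its) V"
    using assms(1) by (auto simp: good_def)
  obtain its' V' where E: "E = ld its' V'" "agood (ends its') V'"
    using assms(2) by (auto simp: good_def)
  let ?D = "ld (ren_items ((#) 0) its) (ren_verts ((#) 0) V)" and ?E = "ld (ren_items ((#) 1) its') (ren_verts ((#) 1) V')"
  have "rev_op D = rev_op ?D" "rev_op E = rev_op ?E"
    unfolding D(1) E(1) by (intro resp_iso[OF resp_rev_op] D E; simp)+
  moreover have "cl (ld (rev (ren_items ((#) 1) its')) (ren_verts ((#) 1) V')) * cl (ld (rev (ren_items ((#) 0) its)) (ren_verts ((#) 0) V)) =
      cl (ld (rev (ren_items ((#) 1) its') @ rev (ren_items ((#) 0) its)) (ren_verts ((#) 1) V' + ren_verts ((#) 0) V))"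
  proof (rule mult_cl_ld)
    show "names (ends (rev (ren_items ((#) 1) its'))) (ren_verts ((#) 1) V') \<inter>
        names (ends (rev (ren_items ((#) 0) its))) (ren_verts ((#) 0) V) = {}"
      by (auto simp: ends_ren names_ren)
  qed (simp_all add: ends_ren agood_ren D E)
  ultimately show ?thesis
    by (simp add: D(1) E(1) stack_ld rev_op_ld power_add union_commute mult.commute)
qed

lemma rev_dq_mult: "rev_dq (x * y) = rev_dq y * rev_dq x"
proof (induction x rule: dq_induct)
  case (add c D x)
  have "rev_dq (cl D * y) = rev_dq y * rev_dq (cl D)"
  proof (induction y rule: dq_induct)
    case (add d E y)
    have "good (stack D E)"
      using \<open>good D\<close> \<open>good E\<close> by (rule good_stack)
    with add \<open>good D\<close> show ?case
      by (simp add: rev_dq_linear qscale_distribs distrib_left distrib_right mult_cl rev_dq_cl rev_op_stack)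
  qed (simp add: rev_dq_linear)
  with add show ?case
    by (simp add: rev_dq_linear qscale_distribs distrib_left distrib_right)
qed (simp add: rev_dq_linear)

lemma rev_dq_1: "rev_dq 1 = 1"
  by (simp add: one_dq_def rev_dq_cl good_ld rev_op_ld)

lemma rev_dq_WH: "rev_dq (WH (map Leaf w)) = WH (map Leaf w)"
proof -
  let ?ts = "ctails (wlab (map Leaf w))" and ?V = "wverts (wlab (map Leaf w))"
  have "cl (ld ([] @ tl_items (rev ?ts) @ []) ?V) = cl (ld ([] @ tl_items ?ts @ []) ?V)"
    using agood_wlab'[of "map Leaf w"] by (intro cl_permute_tails) (simp_all add: ends_tl_items)
  moreover have "hds (ends (tl_items ts)) = {#}" for ts :: "('a \<times> edge) list"
    by (induction ts) auto
  ultimately have "rev_op (wheel w) = cl (wheel w)"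
    unfolding wheel_eq rev_op_ld by (simp add: rev_tl_items)
  then show ?thesis
    using rev_dq_cl[OF good_wheel[of w]] by (simp add: cl_wheel)
qed

text \<open>The single head gives the sign -1, so the closed-up wheels of
  \<open>cl_rev_planted\<close> appear with a plus. As \<open>iota\<close> carries a factor -1, they
  amount to minus \<open>iota\<close> of the divergence.\<close>

lemma rev_dq_PT: "rev_dq (PT a t) =
    - PT a t + lin (\<lambda>w. if last w = a then WH (map Leaf (a # butlast w)) else 0) (nc_tree t)"
proof -
  have "plant a t = ld ((a, Head (rt (lab [] t))) # tl_items (ltails (lab [] t))) (lverts (lab [] t))"
    unfolding plant_eq_planted planted_def ..
  moreover have "hds (ends (tl_items ts)) = {#}" for ts :: "('a \<times> edge) list"
    by (induction ts) auto
  ultimately have "rev_op (plant a t) = - (PT a t -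
      lin (\<lambda>w. if last w = a then WH (Leaf a # [] @ map Leaf (butlast w)) else 0) (nc_tree t))"
    using cl_rev_planted[OF distinct_lnames_lab, of a "[]" t]
    by (simp only: rev_op_ld sum_clos lab_simps(2)) simp
  then show ?thesis
    using rev_dq_cl[OF good_plant[of a t]] by (simp add: PT_def cong: if_cong)
qed

text \<open>The divergence before passing to cyclic words, so that it can be handled by linear
  functionals on words.\<close>

definition div_words :: "'a set \<Rightarrow> ('a \<Rightarrow> 'a ncs) \<Rightarrow> 'a ncs" where
  "div_words S L = (\<Sum>u\<in>S. nc_gen u \<odot> (\<lambda>w. L u (w @ [u])))"

lemma nc_gen_mult: "(nc_gen x \<odot> f) [] = 0" "(nc_gen x \<odot> f) (y # w) = (if x = y then f w else 0)"
proof -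
  have 1: "nc_gen x (take i (y # w)) = (if i = 1 \<and> x = y then 1 else 0)" if "i \<le> length (y # w)" for i
    using that by (cases i; cases "i - 1"; cases w) (auto simp: nc_gen_def single_def)
  have "(nc_gen x \<odot> f) (y # w) = (\<Sum>i\<le>length (y # w). if i = 1 then (if x = y then f w else 0) else 0)"
    unfolding nc_mult_def by (rule sum.cong) (simp_all add: 1)
  then show "(nc_gen x \<odot> f) (y # w) = (if x = y then f w else 0)"
    by (subst (asm) sum.delta) simp_all
qed (simp add: nc_mult_def nc_gen_def single_def)

lemma div_words_simps: "div_words S L [] = 0" "finite S \<Longrightarrow> div_words S L (y # w) = (if y \<in> S then L y (w @ [y]) else 0)"
  by (simp_all add: div_words_def sum_fun_apply nc_gen_mult)

lemma div_words_linear: "finite S \<Longrightarrow> div_words S (L + M) = div_words S L + div_words S M" "finite S \<Longrightarrow> div_words S 0 = 0"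
proof -
  assume S: "finite S"
  show "div_words S (L + M) = div_words S L + div_words S M"
  proof
    fix w show "div_words S (L + M) w = (div_words S L + div_words S M) w"
      by (cases w) (auto simp: div_words_simps S fun_apply)
  qed
  show "div_words S 0 = 0"
  proof
    fix w show "div_words S 0 w = (0 :: 'a ncs) w"
      by (cases w) (auto simp: div_words_simps S fun_apply)
  qed
qed

lemma div_words_alph: "finite S \<Longrightarrow> L \<in> FLS S \<Longrightarrow> div_words S L \<in> alph S"
  unfolding alph_def
proof (intro CollectI allI impI)
  fix w assume *: "finite S" "L \<in> FLS S" "div_words S L w \<noteq> 0"
  then obtain y v where "w = y # v" "y \<in> S" "L y (v @ [y]) \<noteq> 0"
    by (cases w) (auto simp: div_words_simps split: if_splits)
  then show "set w \<subseteq> S"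
    using FLS_alph[OF *(1,2), of y] by (force simp: alph_def)
qed

lemma agree_dv: "finite S \<Longrightarrow> (\<And>a. agree n (L a) (M a)) \<Longrightarrow> agree n (div_words S L) (div_words S M)"
  unfolding agree_def
proof (intro allI impI)
  fix w :: "'a list"
  assume *: "finite S" "\<And>a. \<forall>w. length w \<le> n \<longrightarrow> L a w = M a w" "length w \<le> n"
  then show "div_words S L w = div_words S M w"
    by (cases w) (simp_all add: div_words_simps)
qed

lemma lin_dv_te:
  assumes "finite S" "a \<in> S"
  shows "lin \<phi> (div_words S (tree_at a c t)) = c *q lin (\<lambda>w. if last w = a then \<phi> (a # butlast w) else 0) (nc_tree t)"
proof -
  let ?W = "{w. nc_tree t w \<noteq> 0}"
  have fin: "finite ?W" using fsupp_nc_tree[of t] by (simp add: fsupp_def)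
  have ne: "w \<noteq> []" if "nc_tree t w \<noteq> 0" for w
    using that nc_tree_eq_0[of w t] by auto
  have "lin \<phi> (div_words S (tree_at a c t)) = (\<Sum>v\<in>(\<lambda>w. a # butlast w) ` {w \<in> ?W. last w = a}. div_words S (tree_at a c t) v *q \<phi> v)"
  proof (rule lin_superset)
    fix v assume v: "div_words S (tree_at a c t) v \<noteq> 0"
    then obtain w where "v = a # w" "nc_tree t (w @ [a]) \<noteq> 0"
      using assms by (cases v) (auto simp: div_words_simps tree_at_def scale_def fun_apply split: if_splits)
    then show "v \<in> (\<lambda>w. a # butlast w) ` {w \<in> ?W. last w = a}"
      by (intro image_eqI[of _ _ "w @ [a]"]) auto
  qed (use fin in simp)
  also have "\<dots> = (\<Sum>w\<in>{w \<in> ?W. last w = a}. div_words S (tree_at a c t) (a # butlast w) *q \<phi> (a # butlast w))"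
    by (rule sum.reindex_cong[OF _ refl refl]) (auto simp: inj_on_def dest!: ne, metis append_butlast_last_id)
  also have "\<dots> = (\<Sum>w\<in>{w \<in> ?W. last w = a}. (c * nc_tree t w) *q \<phi> (a # butlast w))"
    by (rule sum.cong) (use assms in \<open>auto simp: div_words_simps tree_at_def scale_def dest!: ne\<close>)
  also have "\<dots> = c *q lin (\<lambda>w. if last w = a then \<phi> (a # butlast w) else 0) (nc_tree t)"
    unfolding lin_def qvs.scale_sum_right using fin
    by (simp add: sum.inter_filter[symmetric] if_distrib cong: if_cong)
  finally show ?thesis .
qed

lemma cw_class_add: "cw_class (f + g) = cw_class f + cw_class g"
  by (auto simp: cw_class_def fun_eq_iff fun_apply sum.distrib)

lemma cw_class_0 [simp]: "cw_class 0 = 0"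
  by (auto simp: cw_class_def fun_eq_iff fun_apply)

lemma cw_class_sum: "cw_class (\<Sum>i\<in>A. f i) = (\<Sum>i\<in>A. cw_class (f i))"
  by (induction A rule: infinite_finite_induct) (simp_all add: cw_class_add)

lemma fls_div_eq: "fls_div S L = cw_class (div_words S L)"
  by (simp add: fls_div_def div_at_def div_words_def cw_class_sum)

lemma fls_div_CW: "finite S \<Longrightarrow> L \<in> FLS S \<Longrightarrow> fls_div S L \<in> CW S"
  by (simp add: fls_div_eq cw_class_CW div_words_alph)

lemma rev_dq_LS_fin:
  assumes S: "finite S" and L: "fin_FLS S L"
  shows "dmap rev_dq (LS S L) = - LS S L - IS (div_words S L)"
  using L
proof induction
  case zero
  then show ?case by (simp add: div_words_linear S fps_eq_iff rev_dq_linear)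
next
  case (add a t L c)
  have tree_at: "tree_at a c t \<in> FLS S" using add S by (simp add: FLS_te)
  have "IS (div_words S (tree_at a c t)) = gmono (length (leaves t)) (lin (\<lambda>w. - WH (map Leaf w)) (div_words S (tree_at a c t)))"
    unfolding IS_def
  proof (rule wlin_homogeneous)
    fix w assume "div_words S (tree_at a c t) w \<noteq> 0"
    then show "length w = length (leaves t)"
      using nc_tree_eq_0[of "tl w @ [a]" t] S
      by (cases w) (auto simp: div_words_simps tree_at_def scale_def fun_apply split: if_splits)
  qed
  also have "lin (\<lambda>w. - WH (map Leaf w)) (div_words S (tree_at a c t)) =
      c *q lin (\<lambda>w. (-1) *q (if last w = a then WH (map Leaf (a # butlast w)) else 0)) (nc_tree t)"
    using S add(1) by (simp add: lin_dv_te if_distrib cong: if_cong)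
  also have "\<dots> = - (c *q lin (\<lambda>w. if last w = a then WH (map Leaf (a # butlast w)) else 0) (nc_tree t))"
    by (subst lin_scale_fun) simp
  finally have "dmap rev_dq (LS S (tree_at a c t)) = - LS S (tree_at a c t) - IS (div_words S (tree_at a c t))"
    using S add(1) by (simp add: LS_te fps_eq_iff fps_qscale_nth rev_dq_linear rev_dq_PT qscale_distribs)
  then show ?case
    using add tree_at S fin_FLS_FLS[OF S add(3)]
    by (simp add: LS_add div_words_linear IS_add div_words_alph fps_eq_iff rev_dq_linear)
qed

lemma rev_dq_LS:
  assumes S: "finite S" and L: "L \<in> FLS S"
  shows "dmap rev_dq (LS S L) = - LS S L - IC (fls_div S L)"
proof (rule fps_ext)
  fix n
  obtain L' where L': "fin_FLS S L'" "\<And>a. agree n (L a) (L' a)"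
    using fin_FLS_approx[OF S L] by blast
  have "IC (fls_div S L) = IS (div_words S L)"
    by (simp add: fls_div_eq IC_cw_class[OF S div_words_alph[OF S L] div_words_simps(1)])
  then show "dmap rev_dq (LS S L) $ n = (- LS S L - IC (fls_div S L)) $ n"
    using arg_cong[OF rev_dq_LS_fin[OF S L'(1)], of "\<lambda>X. X $ n"]
      LS_agree[of n L L' n S, OF L'(2)] IS_agree[OF agree_dv[OF S L'(2)], of n]
    by simp
qed

lemma rev_dq_IC: "dmap rev_dq (IC \<omega>) = IC \<omega>"
  by (simp add: fps_eq_iff IC_def IS_def rev_dq_lin rev_dq_linear rev_dq_WH)

lemma dmap_rv_mult: "dmap rev_dq (X * Y) = dmap rev_dq Y * dmap rev_dq X"
proof (rule fps_ext)
  fix n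
  have "dmap rev_dq (X * Y) $ n = (\<Sum>i=0..n. rev_dq (Y $ (n - i)) * rev_dq (X $ i))"
    by (simp add: fps_mult_nth rev_dq_linear rev_dq_mult)
  also have "\<dots> = (\<Sum>i=0..n. rev_dq (Y $ i) * rev_dq (X $ (n - i)))"
    by (rule sum.reindex_bij_witness[of _ "\<lambda>i. n - i" "\<lambda>i. n - i"]) auto
  finally show "dmap rev_dq (X * Y) $ n = (dmap rev_dq Y * dmap rev_dq X) $ n"
    by (simp add: fps_mult_nth)
qed

lemma dmap_rv_gexp: "dmap rev_dq (gexp X) = gexp (dmap rev_dq X)"
proof (rule gexp_hom)
  show "dmap rev_dq (X ^ n) = dmap rev_dq X ^ n" for n
  proof (induction n)
    case 0
    show ?case by (simp add: fps_eq_iff rev_dq_1 rev_dq_linear)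
  qed (simp add: dmap_rv_mult power_commutes)
qed (auto simp: fps_eq_iff rev_dq_linear fps_qscale_nth gpart_fps_def)


subsection \<open>Signs\<close>

definition sign_fps :: "'v :: rat_algebra fps \<Rightarrow> 'v fps" where
  "sign_fps X = Abs_fps (\<lambda>n. (-1) ^ n *q X $ n)"

lemma sign_fps_nth [simp]: "sign_fps X $ n = (-1) ^ n *q X $ n"
  by (simp add: sign_fps_def)

lemma sign_fps_mult: "sign_fps (X * Y) = sign_fps X * sign_fps Y"
proof (rule fps_ext)
  fix n
  have "(-1) ^ n *q (X $ i * Y $ (n - i)) = ((-1) ^ i *q X $ i) * ((-1) ^ (n - i) *q Y $ (n - i))" if "i \<le> n" for i
    using that by (simp flip: power_add)
  then show "sign_fps (X * Y) $ n = (sign_fps X * sign_fps Y) $ n"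
    unfolding sign_fps_nth fps_mult_nth qvs.scale_sum_right by (intro sum.cong) auto
qed

lemma sign_fps_gexp: "sign_fps (gexp X) = gexp (sign_fps X)"
proof (rule gexp_hom)
  show "sign_fps (X ^ n) = sign_fps X ^ n" for n
  proof (induction n)
    case 0
    show ?case by (simp add: fps_eq_iff)
  qed (simp add: sign_fps_mult)
qed (auto simp: fps_eq_iff fps_qscale_nth gpart_fps_def qscale_distribs mult.commute)

lemma nc_part_sign: "nc_part n (nc_sign_deg f) = scale ((-1) ^ n) (nc_part n f)"
  by (auto simp: nc_part_def nc_sign_deg_def scale_def)

lemma wlin_sign: "wlin \<phi> (nc_sign_deg f) = sign_fps (wlin \<phi> f)" for \<phi> :: "_ \<Rightarrow> 'v :: rat_algebra"
  by (simp add: fps_eq_iff nc_part_sign lin_scale)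

lemma FLS_sign: "finite S \<Longrightarrow> L \<in> FLS S \<Longrightarrow> (\<lambda>a. nc_sign_deg (L a)) \<in> FLS S"
  by (auto simp: FLS_def FL_iff nc_part_sign lie_span_scale) (simp add: nc_sign_deg_def fun_eq_iff fun_apply)

lemma sign_fps_LS: "sign_fps (LS S L) = LS S (\<lambda>a. nc_sign_deg (L a))"
  by (simp add: LS_def wlin_sign) (simp add: fps_eq_iff fps_sum_nth qvs.scale_sum_right)

lemma cw_lift_sign: "cw_lift (cw_sign_deg \<omega>) = nc_sign_deg (cw_lift \<omega>)"
  by (auto simp: cw_lift_def cw_sign_deg_def nc_sign_deg_def fun_eq_iff cw_word_length)

lemma sign_fps_IC: "sign_fps (IC \<omega>) = IC (cw_sign_deg \<omega>)"
  by (simp add: IC_def IS_def cw_lift_sign wlin_sign)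

lemma CW_sign: "\<omega> \<in> CW S \<Longrightarrow> cw_sign_deg \<omega> \<in> CW S"
  by (simp add: CW_def cw_sign_deg_def)

section \<open>Identities between products of exponentials, and their transfer to
  \<open>E_l\<close>\<close>

section \<open>The bijection in terms of power series\<close>

definition E_fps :: "'a set \<Rightarrow> ('a \<Rightarrow> 'a ncs) \<Rightarrow> 'a cws \<Rightarrow> 'a dq fps" where
  "E_fps S L \<omega> = gexp (LS S L) * gexp (IC \<omega>)"

lemma FLS_nc_part:
  fixes L :: "'a \<Rightarrow> 'a ncs"
  assumes "finite S" "\<And>n. \<exists>M\<in>FLS S. \<forall>a. nc_part n (L a) = nc_part n (M a)"
  shows "L \<in> FLS S"
  unfolding FLS_def
proof (intro CollectI conjI ballI allI impI)
  fix a assume "a \<in> S"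
  show "L a \<in> FL S"
    unfolding FL_iff[OF assms(1)]
  proof
    fix n
    obtain M where "M \<in> FLS S" "nc_part n (L a) = nc_part n (M a)"
      using assms(2)[of n] by blast
    then show "nc_part n (L a) \<in> lie_span S n"
      using \<open>a \<in> S\<close> by (simp add: FLS_def FL_iff assms(1))
  qed
next
  fix a assume a: "a \<notin> S"
  show "L a = 0"
  proof
    fix w :: "'a list"
    obtain M where "M \<in> FLS S" "nc_part (length w) (L a) = nc_part (length w) (M a)"
      using assms(2)[of "length w"] by blast
    then show "L a w = 0 w"
      using a fun_cong[of "nc_part (length w) (L a)" "nc_part (length w) (M a)" w]
      unfolding FLS_def nc_part_def by simp
  qed
qed

lemma LS_nth_cong: "(\<And>a. a \<in> S \<Longrightarrow> nc_part n (L a) = nc_part n (M a)) \<Longrightarrow> LS S L $ n = LS S M $ n"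
  unfolding LS_def fps_sum_nth wlin_nth by (intro sum.cong refl) simp

lemma gord_LS: "finite S \<Longrightarrow> L \<in> FLS S \<Longrightarrow> gord 1 (LS S L)"
proof -
  assume *: "finite S" "L \<in> FLS S"
  then have "nc_part 0 (L a) = 0" for a
    using FL_eq_0[of S "L a"] by (cases "a \<in> S") (auto simp: FLS_def nc_part_def fun_eq_iff fun_apply)
  then show ?thesis
    by (simp add: gord_fps_iff LS_def fps_sum_nth)
qed

lemma gord_IC: "gord 1 (IC \<omega>)"
proof -
  have "nc_part 0 (cw_lift \<omega>) = 0"
    by (auto simp: nc_part_def fun_eq_iff fun_apply)
  then show ?thesis
    by (simp add: gord_fps_iff IC_def IS_def)
qed

lemmas gord_Suc [simp] = gord_IC[unfolded One_nat_def] gord_LS[unfolded One_nat_def]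

lemma CW_linear: "\<omega> \<in> CW S \<Longrightarrow> \<omega>' \<in> CW S \<Longrightarrow> \<omega> + \<omega>' \<in> CW S" "\<omega> \<in> CW S \<Longrightarrow> \<omega>' \<in> CW S \<Longrightarrow> \<omega> - \<omega>' \<in> CW S"
  by (auto simp: CW_def fun_apply) (metis add_0 diff_0_right diff_self)+

lemma IC_add: "finite S \<Longrightarrow> \<omega> \<in> CW S \<Longrightarrow> \<omega>' \<in> CW S \<Longrightarrow> IC (\<omega> + \<omega>') = IC \<omega> + IC \<omega>'"
proof -
  have "cw_lift (\<omega> + \<omega>') = cw_lift \<omega> + cw_lift \<omega>'"
    by (auto simp: cw_lift_def fun_eq_iff fun_apply)
  then show "finite S \<Longrightarrow> \<omega> \<in> CW S \<Longrightarrow> \<omega>' \<in> CW S \<Longrightarrow> ?thesis"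
    by (simp add: IC_def IS_add CW_lift_alph)
qed

lemma IC_diff: "finite S \<Longrightarrow> \<omega> \<in> CW S \<Longrightarrow> \<omega>' \<in> CW S \<Longrightarrow> IC (\<omega> - \<omega>') = IC \<omega> - IC \<omega>'"
  using IC_add[of S "\<omega> - \<omega>'" \<omega>'] CW_linear(2)[of \<omega> S \<omega>'] by simp

lemma IC_commute: "IC \<omega> * IC \<omega>' = IC \<omega>' * IC \<omega>"
  by (simp add: IC_def IS_commute)

lemma cw_der_pow:
  assumes "finite S" "L \<in> FLS S" "\<omega> \<in> CW S"
  shows "(cw_der L ^^ j) \<omega> \<in> CW S \<and> IC ((cw_der L ^^ j) \<omega>) = (ad (LS S L) ^^ j) (IC \<omega>)"
  by (induction j) (simp_all add: assms cw_der_CW ad_LS_IC[OF assms(1,2), symmetric])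

text \<open>The cut-off at the length of a cyclic word matches the cut-off of \<open>gsum\<close> at
  the degree. The two uses are the exponential of a derivation (\<open>r = fact\<close>) and the
  series in \<open>j\<close>.\<close>

lemma IC_series:
  assumes S: "finite S" and \<omega>: "\<And>j. \<Omega> j \<in> CW S"
  shows "(\<lambda>c. \<Sum>j\<le>cw_length c. \<Omega> j c / r j) \<in> CW S"
    "IC (\<lambda>c. \<Sum>j\<le>cw_length c. \<Omega> j c / r j) = gsum (\<lambda>j. (1 / r j) *q IC (\<Omega> j))"
proof -
  let ?\<omega> = "\<lambda>c. \<Sum>j\<le>cw_length c. \<Omega> j c / r j"
  show "?\<omega> \<in> CW S"
    unfolding CW_def
  proof (intro CollectI allI impI)
    fix c assume "?\<omega> c \<noteq> 0"
    then obtain j where "\<Omega> j c / r j \<noteq> 0"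
      by (rule sum.not_neutral_contains_not_neutral)
    then show "c \<in> cwords S"
      using \<omega>[of j] by (simp add: CW_def)
  qed
  show "IC ?\<omega> = gsum (\<lambda>j. (1 / r j) *q IC (\<Omega> j))"
  proof (rule fps_ext)
    fix n
    let ?f = "\<lambda>A. \<Sum>j\<in>A. scale (1 / r j) (cw_lift (\<Omega> j))"
    have *: "?f A \<in> alph S \<and> IS (?f A) = (\<Sum>j\<in>A. (1 / r j) *q IC (\<Omega> j))" if "finite A" for A
      using that by induction
        (simp_all add: alph_add alph_scale CW_lift_alph[OF \<omega>] IS_add[OF S] IS_scale IC_def)
    have "nc_part n (cw_lift ?\<omega>) = nc_part n (?f {..n})"
      by (auto simp: fun_eq_iff nc_part_def cw_lift_def cw_word_length sum_fun_apply scale_def intro!: sum.cong)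
    then have "IC ?\<omega> $ n = IS (?f {..n}) $ n"
      by (simp add: IC_def IS_def)
    then show "IC ?\<omega> $ n = gsum (\<lambda>j. (1 / r j) *q IC (\<Omega> j)) $ n"
      using *[of "{..n}"] by (simp add: fps_gsum_nth fps_sum_nth)
  qed
qed

lemma IC_exp_op:
  assumes "finite S" "L \<in> FLS S" "\<omega> \<in> CW S"
  shows "cw_exp_op (cw_der L) \<omega> \<in> CW S"
    "IC (cw_exp_op (cw_der L) \<omega>) = gexp (LS S L) * IC \<omega> * gexp (- LS S L)"
  using IC_series[OF assms(1), of "\<lambda>j. (cw_der L ^^ j) \<omega>" fact] cw_der_pow[OF assms] gord_LS[OF assms(1,2)]
  by (simp_all add: cw_exp_op_def gexp_conjugate_ad)

lemma IC_j:
  assumes "finite S" "L \<in> FLS S"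
  shows "fls_j S L \<in> CW S"
    "IC (fls_j S L) = gsum (\<lambda>i. (1 / fact (Suc i)) *q (ad (LS S L) ^^ i) (IC (fls_div S L)))"
  using IC_series[OF assms(1), of "\<lambda>j. (cw_der L ^^ j) (fls_div S L)" "\<lambda>j. fact (Suc j)"]
    cw_der_pow[OF assms fls_div_CW[OF assms]]
  by (simp_all only: fls_j_def cw_expm1_quot_op_def)

text \<open>Reversal produces \<open>e^\<omega> e^(-l-d)\<close> with \<open>d\<close> the image of
  the divergence. The semidirect formula for \<open>e^(l+d)\<close>, inverted, splits the second
  factor as \<open>e^(-l) e^(-J)\<close>. Moving \<open>e^\<omega>\<close> to the right of
  \<open>e^(-l)\<close> conjugates it by \<open>e^l\<close>; the remaining wheel factors commute, so
  their exponents add.\<close>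

lemma E_fps_reverse:
  assumes S: "finite S" and L: "L \<in> FLS S" and \<omega>: "\<omega> \<in> CW S"
  shows "dmap rev_dq (E_fps S L \<omega>) = E_fps S (- L) (cw_exp_op (cw_der L) \<omega> - fls_j S L)"
proof -
  let ?l = "LS S L" and ?d = "IC (fls_div S L)" and ?J = "IC (fls_j S L)" and ?e = "IC (cw_exp_op (cw_der L) \<omega>)"
  note gl = gord_LS[OF S L]
  have inv: "gexp (- ?l) * gexp ?l = 1" "gexp ?l * gexp (- ?l) = 1"
    using gl by (simp_all add: gexp_minus_mult gexp_mult_minus)
  have "gexp (?l + ?d) = gexp ?J * gexp ?l"
    unfolding IC_j(2)[OF S L]
  proof (rule gexp_semidirect[OF gl gord_IC])
    \<comment> \<open>Iterated commutators with \<open>l\<close> are again images of cyclic words,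
      and wheels commute.\<close>
    show "?d * (ad ?l ^^ i) ?d = (ad ?l ^^ i) ?d * ?d" for i
      using cw_der_pow[OF S L fls_div_CW[OF S L], of i] IC_commute by metis
  qed
  then have "gexp (- ?l) * gexp (- ?J) * gexp (?l + ?d) = gexp (- ?l) * (gexp (- ?J) * gexp ?J) * gexp ?l"
    by (simp add: mult.assoc)
  also have "\<dots> = 1"
    by (simp add: gexp_minus_mult gord_IC inv)
  finally have "gexp (- ?l) * gexp (- ?J) * gexp (?l + ?d) * gexp (- (?l + ?d)) = gexp (- (?l + ?d))"
    by simp
  then have neg: "gexp (- ?l - ?d) = gexp (- ?l) * gexp (- ?J)"
    using gexp_mult_minus[of "?l + ?d"] gord_add[OF gl gord_IC] by (simp add: mult.assoc)
  have "gexp (- ?l) * gexp ?e = gexp (- ?l) * (gexp ?l * gexp (IC \<omega>) * gexp (- ?l))"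
    unfolding IC_exp_op(2)[OF S L \<omega>] by (subst gexp_conjugate[OF inv(2,1) gord_IC]) (rule refl)
  also have "\<dots> = gexp (IC \<omega>) * gexp (- ?l)"
    unfolding mult.assoc[symmetric] inv(1) by simp
  finally have "gexp (IC \<omega>) * gexp (- ?l - ?d) = gexp (- ?l) * (gexp ?e * gexp (- ?J))"
    unfolding neg by (simp add: mult.assoc[symmetric])
  also have "gexp ?e * gexp (- ?J) = gexp (?e + - ?J)"
    by (rule gexp_add[symmetric]) (simp_all add: gord_IC gord_minus IC_commute)
  also have "?e + - ?J = IC (cw_exp_op (cw_der L) \<omega> - fls_j S L)"
    using IC_diff[OF S IC_exp_op(1)[OF S L \<omega>] IC_j(1)[OF S L]] by simp
  finally show ?thesis
    by (simp add: E_fps_def dmap_rv_mult dmap_rv_gexp rev_dq_LS[OF S L] rev_dq_IC LS_uminus)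
qed

lemma E_fps_sign:
  "sign_fps (E_fps S L \<omega>) = E_fps S (\<lambda>a. nc_sign_deg (L a)) (cw_sign_deg \<omega>)"
  by (simp add: E_fps_def sign_fps_mult sign_fps_gexp sign_fps_LS sign_fps_IC)

lemma nc_der_uminus: "nc_der (- L) f = - nc_der L f"
  using nc_der_add_left[of "- L" L f] by (simp add: eq_neg_iff_add_eq_0)

lemma cw_class_uminus: "cw_class (- f) = - cw_class f"
  using cw_class_add[of "- f" f] by (simp add: eq_neg_iff_add_eq_0)

lemma as_trees:
  assumes "g \<in> FL S"
  shows "as_trees S g \<in> tree_series S" "nc_trees (as_trees S g) = g"
proof -
  have "\<exists>T. T \<in> tree_series S \<and> nc_trees T = g"
    using assms by (auto simp: FL_def)
  from someI_ex[OF this] show "as_trees S g \<in> tree_series S" "nc_trees (as_trees S g) = g"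
    unfolding as_trees_def by blast+
qed

lemma E_fps_mult:
  assumes S: "finite S" and L: "L1 \<in> FLS S" "L2 \<in> FLS S" and \<omega>: "\<omega>1 \<in> CW S" "\<omega>2 \<in> CW S"
  shows "E_fps S L1 \<omega>1 * E_fps S L2 \<omega>2 = E_fps S (BCH_tb L1 L2) (cw_exp_op (\<lambda>\<omega>. - cw_der L2 \<omega>) \<omega>1 + \<omega>2)"
    and "BCH_tb L1 L2 \<in> FLS S" "cw_exp_op (\<lambda>\<omega>. - cw_der L2 \<omega>) \<omega>1 + \<omega>2 \<in> CW S"
proof -
  define T where "T = as_trees UNIV bch_series"
  have T: "nc_trees T = bch_series"
    unfolding T_def by (rule as_trees(2)[OF bch_series_in_FL])
  have tree_at: "tb_eval L1 L2 t \<in> FLS S \<and> LS S (tb_eval L1 L2 t) = tree_eval (\<lambda>y. LS S (if y then L2 else L1)) t" for t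
  proof (induction t)
    case (Br s t)
    then show ?case by (simp add: ad_LS[OF S] flip: ad_LS(2)[OF S])
  qed (simp add: L)
  \<comment> \<open>A finite sum that agrees with \<open>BCH_tb\<close> in degree \<open>n\<close>;
    \<open>LS\<close> is additive on such sums.\<close>
  define B where "B n = (\<Sum>t | length (leaves t) \<le> n. (\<lambda>a. scale (T t) (tb_eval L1 L2 t a)))" for n
  have fin: "finite {t :: bool btree. length (leaves t) \<le> n}" for n
    using finite_trees_le[of "UNIV :: bool set" n] by simp
  have LS_scale: "LS S (\<lambda>a. scale r (L a)) = r *q LS S L" for r L
    by (simp add: LS_def wlin_scale qvs.scale_sum_right)
  have B: "B n \<in> FLS S" "LS S (B n) = (\<Sum>t | length (leaves t) \<le> n. T t *q tree_eval (\<lambda>y. LS S (if y then L2 else L1)) t)" for n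
    using FLS_LS_sum[OF S, of "{t. length (leaves t) \<le> n}" "\<lambda>t a. scale (T t) (tb_eval L1 L2 t a)"] tree_at
    unfolding B_def by (simp_all add: FLS_scale[OF S] LS_scale)
  have part: "nc_part n (BCH_tb L1 L2 a) = nc_part n (B n a)" for n a
    by (auto simp: fun_eq_iff nc_part_def BCH_tb_def B_def T_def sum_fun_apply scale_def)
  show BCH: "BCH_tb L1 L2 \<in> FLS S"
    by (rule FLS_nc_part[OF S]) (use part B(1) in blast)
  have nth: "LS S (BCH_tb L1 L2) $ n = (\<Sum>t | length (leaves t) \<le> n. T t *q tree_eval (\<lambda>y. LS S (if y then L2 else L1)) t $ n)" for n
    using LS_nth_cong[of S n, OF part] by (simp add: B(2) fps_sum_nth)
  have 1: "gexp (LS S L1) * gexp (LS S L2) = gexp (LS S (BCH_tb L1 L2))"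
    using gexp_mult_gexp_bch[of "\<lambda>y. LS S (if y then L2 else L1)" T "LS S (BCH_tb L1 L2)"]
    by (simp add: gord_LS S L T fps_eq_iff gpart_fps_def nth fps_sum_nth if_distrib sum.If_cases cong: if_cong)
  let ?e = "cw_exp_op (\<lambda>\<omega>. - cw_der L2 \<omega>) \<omega>1"
  \<comment> \<open>The derivation depends linearly on its coefficients, so the exponential of its
    negative is the exponential for \<open>- L2\<close>.\<close>
  have "(\<lambda>\<omega>. - cw_der L2 \<omega>) = cw_der (- L2)"
    by (simp add: fun_eq_iff[of "\<lambda>\<omega>. _ \<omega>"] cw_der_def nc_der_uminus cw_class_uminus)
  then have e: "?e \<in> CW S" "IC ?e = gexp (- LS S L2) * IC \<omega>1 * gexp (LS S L2)"
    using IC_exp_op[OF S FLS_uminus[OF S L(2)] \<omega>(1)] by (simp_all add: LS_uminus)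
  show "?e + \<omega>2 \<in> CW S"
    by (intro CW_linear e \<omega>)
  have inv: "gexp (- LS S L2) * gexp (LS S L2) = 1" "gexp (LS S L2) * gexp (- LS S L2) = 1"
    by (simp_all add: gexp_minus_mult gexp_mult_minus gord_LS S L)
  \<comment> \<open>In \<open>e^(l1) e^(\<omega>1) e^(l2) e^(\<omega>2)\<close> the two middle
    factors have to change places, at the cost of conjugating \<open>\<omega>1\<close>.\<close>
  have "gexp (LS S L2) * gexp (IC ?e) = gexp (LS S L2) * (gexp (- LS S L2) * gexp (IC \<omega>1) * gexp (LS S L2))"
    unfolding e(2) by (subst gexp_conjugate[OF inv gord_IC]) (rule refl)
  also have "\<dots> = gexp (IC \<omega>1) * gexp (LS S L2)"
    unfolding mult.assoc[symmetric] inv(2) by simp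
  finally have "E_fps S L1 \<omega>1 * E_fps S L2 \<omega>2 = gexp (LS S L1) * (gexp (LS S L2) * gexp (IC ?e)) * gexp (IC \<omega>2)"
    unfolding E_fps_def by (simp add: mult.assoc)
  also have "\<dots> = gexp (LS S (BCH_tb L1 L2)) * (gexp (IC ?e) * gexp (IC \<omega>2))"
    unfolding 1[symmetric] by (simp add: mult.assoc)
  also have "gexp (IC ?e) * gexp (IC \<omega>2) = gexp (IC (?e + \<omega>2))"
    unfolding IC_add[OF S e(1) \<omega>(2)] by (rule gexp_add[symmetric]) (simp_all add: gord_IC IC_commute)
  finally show "E_fps S L1 \<omega>1 * E_fps S L2 \<omega>2 = E_fps S (BCH_tb L1 L2) (?e + \<omega>2)"
    by (simp add: E_fps_def)
qed

lemma FL_mono: "S \<subseteq> S' \<Longrightarrow> FL S \<subseteq> FL S'"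
  by (auto simp: FL_def tree_series_def)

lemma FLS_mono: "finite S' \<Longrightarrow> S \<subseteq> S' \<Longrightarrow> L \<in> FLS S \<Longrightarrow> L \<in> FLS S'"
  using FL_mono[of S S'] FL_0[of S'] unfolding FLS_def by (cases "\<forall>a. a \<notin> S \<longrightarrow> L a = 0") auto

lemma LS_mono: "finite S' \<Longrightarrow> S \<subseteq> S' \<Longrightarrow> L \<in> FLS S \<Longrightarrow> LS S' L = LS S L"
  unfolding LS_def by (rule sum.mono_neutral_right) (auto simp: FLS_def)

lemma CW_mono: "S \<subseteq> S' \<Longrightarrow> \<omega> \<in> CW S \<Longrightarrow> \<omega> \<in> CW S'"
  unfolding CW_def cwords_def by blast

lemma nc_der_disjoint:
  assumes "\<And>a. a \<in> S \<Longrightarrow> L a = 0" "f \<in> alph S"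
  shows "nc_der L f = 0"
proof -
  have "f w * dw L w v = 0" for w v
  proof (cases "f w = 0")
    case False
    then have "set w \<subseteq> S"
      using assms(2) by (simp add: alph_def)
    then have "L (w ! i) = 0" if "i < length w" for i
      using that by (intro assms(1)) auto
    then show ?thesis by (simp add: dw_def fun_apply)
  qed simp
  then show ?thesis
    unfolding nc_der_eq_extend nc_extend_def by (simp only: sum.neutral_const) (simp add: fun_eq_iff fun_apply)
qed

text \<open>\<open>L1\<close> and \<open>L2\<close> have no common component and neither derivation
  moves a letter of the other, so their bracket vanishes; likewise \<open>L2\<close> acts trivially
  on \<open>\<omega>1\<close>. Hence the factors may be reordered and the exponents add.\<close>

lemma E_fps_union:
  assumes S: "finite S1" "finite S2" "S1 \<inter> S2 = {}"
    and L: "L1 \<in> FLS S1" "L2 \<in> FLS S2" and \<omega>: "\<omega>1 \<in> CW S1" "\<omega>2 \<in> CW S2"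
  shows "E_fps S1 (L1 :: 'a \<Rightarrow> 'a ncs) \<omega>1 * E_fps S2 L2 \<omega>2 = E_fps (S1 \<union> S2) (fls_union S1 L1 L2) (\<omega>1 + \<omega>2)"
    and "fls_union S1 L1 L2 \<in> FLS (S1 \<union> S2)" "\<omega>1 + \<omega>2 \<in> CW (S1 \<union> S2)"
proof -
  let ?S = "S1 \<union> S2"
  have S': "finite ?S" using S by simp
  have L': "L1 \<in> FLS ?S" "L2 \<in> FLS ?S"
    using FLS_mono[OF S'] L by blast+
  have w': "\<omega>1 \<in> CW ?S" "\<omega>2 \<in> CW ?S"
    using CW_mono[of _ ?S] \<omega> by blast+
  have z1: "L1 a = 0" if "a \<in> S2" for a
    using that S(3) L(1) by (auto simp: FLS_def)
  have z2: "L2 a = 0" if "a \<in> S1" for a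
    using that S(3) L(2) by (auto simp: FLS_def)
  have LS: "LS S1 L1 = LS ?S L1" "LS S2 L2 = LS ?S L2"
    using LS_mono[OF S'] L by fastforce+
  have un: "fls_union S1 L1 L2 = L1 + L2"
    using L z2 unfolding fls_union_def FLS_def by (auto intro!: ext[of "\<lambda>a. if a \<in> S1 then L1 a else L2 a"] simp: fun_apply)
  show "fls_union S1 L1 L2 \<in> FLS ?S" "\<omega>1 + \<omega>2 \<in> CW ?S"
    unfolding un by (intro FLS_add S' L' CW_linear w')+
  have "nc_bracket (L1 a) (L2 a) = 0" for a
    using z1[of a] L(2) by (cases "a \<in> S2") (auto simp: FLS_def nc_bracket_def)
  then have "tb_bracket L1 L2 = 0"
    using nc_der_disjoint[OF z1 FLS_alph[OF S(2) L(2)]] nc_der_disjoint[OF z2 FLS_alph[OF S(1) L(1)]]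
    by (simp add: tb_bracket_def fun_eq_iff[of "\<lambda>a. _ a"] fun_apply)
  then have LL: "LS ?S L1 * LS ?S L2 = LS ?S L2 * LS ?S L1"
    using ad_LS(2)[OF S' L'] by (simp add: ad_def)
  have "cw_der L2 \<omega>1 = 0"
    using nc_der_disjoint[OF z2 CW_lift_alph[OF \<omega>(1)]] by (simp add: cw_der_def)
  moreover have "IC 0 = (0 :: 'a dq fps)"
  proof -
    have "cw_lift 0 = (0 :: 'a ncs)"
      by (auto simp: cw_lift_def fun_eq_iff fun_apply)
    then show ?thesis by (simp add: IC_def)
  qed
  ultimately have "ad (LS ?S L2) (IC \<omega>1) = 0"
    using ad_LS_IC[OF S' L'(2) w'(1)] by simp
  then have LI: "LS ?S L2 * IC \<omega>1 = IC \<omega>1 * LS ?S L2"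
    by (simp add: ad_def)
  have "gexp (IC \<omega>1) * gexp (LS ?S L2) = gexp (IC \<omega>1 + LS ?S L2)"
    by (rule gexp_add[symmetric]) (simp_all add: gord_IC S L' LI)
  also have "\<dots> = gexp (LS ?S L2) * gexp (IC \<omega>1)"
    by (subst add.commute, rule gexp_add) (simp_all add: gord_IC S L' LI)
  finally have "E_fps S1 L1 \<omega>1 * E_fps S2 L2 \<omega>2 = (gexp (LS ?S L1) * gexp (LS ?S L2)) * (gexp (IC \<omega>1) * gexp (IC \<omega>2))"
    unfolding E_fps_def LS by (metis mult.assoc)
  also have "gexp (LS ?S L1) * gexp (LS ?S L2) = gexp (LS ?S (L1 + L2))"
    unfolding LS_add[OF S' L'] by (rule gexp_add[symmetric]) (simp_all add: S L' LL)
  also have "gexp (IC \<omega>1) * gexp (IC \<omega>2) = gexp (IC (\<omega>1 + \<omega>2))"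
    unfolding IC_add[OF S' w'] by (rule gexp_add[symmetric]) (simp_all add: gord_IC IC_commute)
  finally show "E_fps S1 L1 \<omega>1 * E_fps S2 L2 \<omega>2 = E_fps ?S (fls_union S1 L1 L2) (\<omega>1 + \<omega>2)"
    by (simp add: E_fps_def un)
qed

subsection \<open>Series of diagrams as power series\<close>

definition Psi :: "('a diagram \<Rightarrow> rat) \<Rightarrow> 'a dq fps" where
  "Psi f = Abs_fps (\<lambda>n. lin cl (degree_part n f))"

lemma Psi_nth [simp]: "Psi f $ n = lin cl (degree_part n f)"
  by (simp add: Psi_def)

text \<open>Elements of \<open>A^w(S)\<close> as fibres of \<open>Psi\<close>. A power series
  outside the image has an empty fibre, hence the nonemptiness hypotheses below.\<close>

definition aws :: "'a set \<Rightarrow> 'a dq fps \<Rightarrow> 'a aw" where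
  "aws S X = {f \<in> diagram_series S. Psi f = X}"

lemma degree_part_diff: "degree_part n (f - g) = degree_part n f - degree_part n g"
  by (auto simp: degree_part_def fun_apply)

lemma diagram_series_part:
  assumes "finite S" "f \<in> diagram_series S"
  shows "fsupp (degree_part n f)" "degree_part n f \<in> dcarrier"
    "\<And>D. degree_part n f D \<noteq> 0 \<Longrightarrow> arrow_diagram S D \<and> degree D = n"
proof -
  show *: "\<And>D. degree_part n f D \<noteq> 0 \<Longrightarrow> arrow_diagram S D \<and> degree D = n"
    using assms(2) by (auto simp: degree_part_def diagram_series_def split: if_splits)
  have "{D. degree_part n f D \<noteq> 0} = {D. f D \<noteq> 0 \<and> degree D = n}"
    by (auto simp: degree_part_def)
  then show "fsupp (degree_part n f)"
    using assms(2) by (simp add: fsupp_def diagram_series_def)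
  then show "degree_part n f \<in> dcarrier"
    using * arrow_diagram_imp_good[OF assms(1)] by (auto simp: dcarrier_def)
qed

lemma diagram_series_diff_part:
  assumes "f \<in> diagram_series S" "g \<in> diagram_series S" "degree_part n (f - g) D \<noteq> 0"
  shows "arrow_diagram S D"
proof (rule ccontr)
  assume "\<not> arrow_diagram S D"
  then have "f D = 0" "g D = 0"
    using assms(1,2) by (auto simp: diagram_series_def)
  then show False
    using assms(3) by (simp add: degree_part_def fun_apply split: if_splits)
qed

text \<open>Here the two sets of relations meet: equality of power series is tested in each degree
  by \<open>ldrel\<close>, equality in \<open>A^w(S)\<close> by \<open>relators S\<close>, and
  restriction to \<open>S\<close> identifies the two.\<close>

lemma Psi_eq_iff:
  assumes S: "finite S" and f: "f \<in> diagram_series S" and g: "g \<in> diagram_series S"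
  shows "Psi f = Psi g \<longleftrightarrow> (f, g) \<in> aw_rel S"
proof -
  have "degree_part n (f - g) \<in> series.span ldrel \<longleftrightarrow> degree_part n (f - g) \<in> series.span (relators S)" for n
  proof
    assume "degree_part n (f - g) \<in> series.span ldrel"
    moreover have "restrict S (degree_part n (f - g)) = degree_part n (f - g)"
    proof
      fix D
      show "restrict S (degree_part n (f - g)) D = degree_part n (f - g) D"
        using diagram_series_diff_part[OF f g, of n D]
        by (auto simp: restrict_def on_strands_def arrow_diagram_def)
    qed
    ultimately show "degree_part n (f - g) \<in> series.span (relators S)"
      using restrict_span_ldrel by metis
  next
    assume "degree_part n (f - g) \<in> series.span (relators S)"
    then show "degree_part n (f - g) \<in> series.span ldrel"
      using series.span_mono[OF relators_subset_ldrel[OF S]] by blast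
  qed
  then show ?thesis
    using f g by (simp add: fps_eq_iff aw_rel_def lin_cl_eq_iff diagram_series_part(2)[OF S]
        flip: degree_part_diff)
qed

lemma aw_class_eq: "finite S \<Longrightarrow> f \<in> diagram_series S \<Longrightarrow> aw_class S f = aws S (Psi f)"
proof -
  assume S: "finite S" and f: "f \<in> diagram_series S"
  have "g \<in> diagram_series S" if "(f, g) \<in> aw_rel S" for g
    using that by (simp add: aw_rel_def)
  then show ?thesis
    using Psi_eq_iff[OF S f] unfolding aw_class_def aws_def by (metis (mono_tags, lifting) Collect_cong Image_singleton)
qed

text \<open>Operations on classes are unions over representatives. The union of a constant family is
  its value only if there is a representative at all.\<close>

lemma UN_aws:
  assumes "aws S X \<noteq> {}" "\<And>f. f \<in> diagram_series S \<Longrightarrow> Psi f = X \<Longrightarrow> h f = C"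
  shows "(\<Union>f\<in>aws S X. h f) = C"
  using assms by (auto simp: aws_def)

lemma arrow_diagram_stack:
  assumes "finite S1" "finite S2" "arrow_diagram S1 D" "arrow_diagram S2 E"
  shows "arrow_diagram (S1 \<union> S2) (stack D E)" "degree (stack D E) = degree D + degree E"
proof -
  obtain its V where D: "D = ld its V" "fst ` set its \<subseteq> S1" "agood (ends its) V"
    using arrow_diagram_eq_ld[OF assms(1,3)] by blast
  obtain its' V' where E: "E = ld its' V'" "fst ` set its' \<subseteq> S2" "agood (ends its') V'"
    using arrow_diagram_eq_ld[OF assms(2,4)] by blast
  have r: "fst ` set (ren_items \<pi> js) = fst ` set js" for \<pi> and js :: "'a items"
    by (force simp: ren_items_def)
  have g: "good (stack D E)"
    using D E by (intro good_stack) (simp_all add: good_ld)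
  then show "arrow_diagram (S1 \<union> S2) (stack D E)"
    unfolding D(1) E(1) stack_ld good_ld arrow_diagram_ld using D(2) E(2) by (auto simp: image_Un r)
  have t: "size (tls (ends (ren_items \<pi> js))) = size (tls (ends js))" for \<pi> and js :: "'a items"
    by (simp add: ends_ren tls_ren)
  show "degree (stack D E) = degree D + degree E"
    using g D(3) E(3) unfolding D(1) E(1) stack_ld good_ld
    by (simp only: degree_ld ends_simps filter_union_mset image_mset_union size_union t)
qed

text \<open>Degrees add under stacking, so finitely many pairs of diagrams contribute to each degree
  and the coefficient is a Cauchy product.\<close>

lemma series_stack_closed:
  assumes S: "finite S1" "finite S2" and f: "f \<in> diagram_series S1" and g: "g \<in> diagram_series S2"
  shows "series_stack f g \<in> diagram_series (S1 \<union> S2)" "Psi (series_stack f g) = Psi f * Psi g"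
proof -
  define A where "A i = {D. f D \<noteq> 0 \<and> degree D = i}" for i
  define B where "B i = {D. g D \<noteq> 0 \<and> degree D = i}" for i
  have fin: "finite (A i)" "finite (B i)" for i
    using f g by (simp_all add: A_def B_def diagram_series_def)
  have AD: "arrow_diagram S1 D" "degree D = i" "good D" if "D \<in> A i" for D i
    using that f arrow_diagram_imp_good[OF S(1)] by (auto simp: A_def diagram_series_def)
  have BD: "arrow_diagram S2 D" "degree D = i" "good D" if "D \<in> B i" for D i
    using that g arrow_diagram_imp_good[OF S(2)] by (auto simp: B_def diagram_series_def)
  define P where "P n = {(D, E). f D \<noteq> 0 \<and> g E \<noteq> 0 \<and> degree D + degree E = n}" for n
  have P: "P n = (\<Union>i\<in>{0..n}. A i \<times> B (n - i))" for n
    by (auto simp: P_def A_def B_def)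
  have finP: "finite (P n)" for n
    unfolding P using fin by auto
  have PD: "arrow_diagram (S1 \<union> S2) (stack D E)" "degree (stack D E) = n" if "(D, E) \<in> P n" for D E n
    using that arrow_diagram_stack[OF S AD(1) BD(1), of D "degree D" E "degree E"] by (auto simp: P_def A_def B_def)
  have part: "degree_part n (series_stack f g) = (\<Sum>(D, E)\<in>P n. scale (f D * g E) (single (stack D E)))" for n
  proof
    fix F
    have "(\<Sum>(D, E)\<in>P n. f D * g E * single (stack D E) F) = 0" if "degree F \<noteq> n"
      using that PD(2)[of _ _ n] by (intro sum.neutral) (auto simp: single_def)
    then show "degree_part n (series_stack f g) F = (\<Sum>(D, E)\<in>P n. scale (f D * g E) (single (stack D E))) F"
      by (simp add: degree_part_def series_stack_def sum_fun_apply case_prod_beta scale_def P_def)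
  qed
  have supp: "F \<in> (\<lambda>(D, E). stack D E) ` P (degree F)" if "series_stack f g F \<noteq> 0" for F
  proof -
    have "(\<Sum>(D, E)\<in>P (degree F). scale (f D * g E) (single (stack D E))) F \<noteq> 0"
      using that unfolding part[symmetric] by (simp add: degree_part_def)
    then obtain p where "p \<in> P (degree F)" "single (stack (fst p) (snd p)) F \<noteq> 0"
      unfolding sum_fun_apply
      by (elim sum.not_neutral_contains_not_neutral) (auto simp: scale_def)
    then show ?thesis
      by (intro image_eqI[of _ _ p]) (auto simp: single_def case_prod_beta split: if_splits)
  qed
  show "series_stack f g \<in> diagram_series (S1 \<union> S2)"
    unfolding diagram_series_def
  proof (intro CollectI conjI allI impI)
    fix F assume "series_stack f g F \<noteq> 0"
    then show "arrow_diagram (S1 \<union> S2) F"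
      using supp[of F] PD(1) by auto
  next
    fix n show "finite {F. series_stack f g F \<noteq> 0 \<and> degree F = n}"
      by (rule finite_subset[OF _ finite_imageI[OF finP[of n]]]) (use supp in blast)
  qed
  show "Psi (series_stack f g) = Psi f * Psi g"
  proof (rule fps_ext)
    fix n
    have lf: "lin cl (degree_part i f) = (\<Sum>D\<in>A i. f D *q cl D)" for i
      by (subst lin_superset[OF fin(1)[of i]]) (auto simp: A_def degree_part_def split: if_splits intro!: sum.cong)
    have lg: "lin cl (degree_part i g) = (\<Sum>D\<in>B i. g D *q cl D)" for i
      by (subst lin_superset[OF fin(2)[of i]]) (auto simp: B_def degree_part_def split: if_splits intro!: sum.cong)
    have "Psi (series_stack f g) $ n = (\<Sum>(D, E)\<in>P n. (f D * g E) *q cl (stack D E))"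
      unfolding Psi_nth part by (subst lin_sum) (auto simp: lin_scale fsupp_scale case_prod_beta)
    also have "\<dots> = (\<Sum>i=0..n. \<Sum>(D, E)\<in>A i \<times> B (n - i). (f D * g E) *q cl (stack D E))"
      unfolding P by (rule sum.UNION_disjoint) (use fin in \<open>auto simp: A_def\<close>)
    also have "\<dots> = (\<Sum>i=0..n. \<Sum>D\<in>A i. \<Sum>E\<in>B (n - i). (f D *q cl D) * (g E *q cl E))"
      unfolding sum.cartesian_product[symmetric]
      by (intro sum.cong refl) (use AD(3) BD(3) in \<open>simp add: mult_cl mult.commute\<close>)
    also have "\<dots> = (Psi f * Psi g) $ n"
      by (simp add: fps_mult_nth lf lg sum_product)
    finally show "Psi (series_stack f g) $ n = (Psi f * Psi g) $ n" .
  qed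
qed

lemma series_pow_closed:
  assumes "finite S" "f \<in> diagram_series S"
  shows "series_pow f k \<in> diagram_series S \<and> Psi (series_pow f k) = Psi f ^ k"
proof (induction k)
  case 0
  have e: "(Diagram (\<lambda>a. []) {#} :: 'a diagram) = ld [] {#}"
    by (simp add: ld_def)
  have "{D. single (ld [] {#}) D \<noteq> 0 \<and> degree D = n} \<subseteq> {ld [] {#}}" for n
    by (auto simp: single_def)
  then have "finite {D :: 'a diagram. single (ld [] {#}) D \<noteq> 0 \<and> degree D = n}" for n
    by (rule finite_subset) simp
  then have "single (ld [] {#}) \<in> diagram_series S"
    by (auto simp: diagram_series_def single_def arrow_diagram_ld split: if_splits)
  moreover have "degree_part n (single (ld [] {#} :: 'a diagram)) = (if n = 0 then single (ld [] {#}) else 0)" for n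
    by (auto simp: degree_part_def single_def fun_eq_iff fun_apply degree_ld)
  ultimately show ?case
    by (simp add: e fps_eq_iff one_dq_def)
next
  case (Suc k)
  then show ?case
    using series_stack_closed[OF assms(1,1,2), of "series_pow f k"] by simp
qed

lemma series_exp_closed:
  assumes S: "finite S" and f: "f \<in> diagram_series S"
  shows "series_exp f \<in> diagram_series S" "Psi (series_exp f) = gexp (Psi f)"
proof -
  note pow = series_pow_closed[OF assms]
  have supp: "\<exists>k\<le>degree D. series_pow f k D \<noteq> 0" if "series_exp f D \<noteq> 0" for D
    using that unfolding series_exp_def by (elim sum.not_neutral_contains_not_neutral) auto
  show "series_exp f \<in> diagram_series S"
    unfolding diagram_series_def
  proof (intro CollectI conjI allI impI)
    fix D assume "series_exp f D \<noteq> 0"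
    then show "arrow_diagram S D"
      using supp[of D] pow by (auto simp: diagram_series_def)
  next
    fix n
    have "{D. series_exp f D \<noteq> 0 \<and> degree D = n} \<subseteq> (\<Union>k\<le>n. {D. series_pow f k D \<noteq> 0 \<and> degree D = n})"
      using supp by fastforce
    moreover have "finite (\<Union>k\<le>n. {D. series_pow f k D \<noteq> 0 \<and> degree D = n})"
      using pow by (auto simp: diagram_series_def)
    ultimately show "finite {D. series_exp f D \<noteq> 0 \<and> degree D = n}"
      by (rule finite_subset)
  qed
  have part: "degree_part n (series_exp f) = (\<Sum>k\<le>n. scale (1 / fact k) (degree_part n (series_pow f k)))" for n
    by (auto simp: degree_part_def series_exp_def fun_eq_iff sum_fun_apply scale_def)
  have fs: "fsupp (degree_part n (series_pow f k))" for n k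
    using diagram_series_part(1)[OF S] pow by blast
  have "lin cl (degree_part n (series_pow f k)) = (Psi f ^ k) $ n" for n k
    using pow[of k] by (metis Psi_nth)
  then show "Psi (series_exp f) = gexp (Psi f)"
    by (simp add: fps_eq_iff part lin_sum lin_scale fsupp_scale fs gexp_def fps_gsum_nth)
qed

lemma degree_plant: "degree (plant a t) = length (leaves t)"
  and degree_wheel: "degree (wheel w) = length w"
  and arrow_diagram_plant: "a \<in> S \<Longrightarrow> set (leaves t) \<subseteq> S \<Longrightarrow> arrow_diagram S (plant a t)"
  and arrow_diagram_wheel: "set w \<subseteq> S \<Longrightarrow> arrow_diagram S (wheel w)"
proof -
  have tl: "tls (ends (tl_items ts)) = mset (map snd ts)" and f: "fst ` set (tl_items ts) = fst ` set ts"
    for ts :: "('a \<times> edge) list"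
    by (induction ts) (auto simp: tl_items_def image_image case_prod_beta)
  have p: "plant a t = ld ((a, Head (rt (lab [] t))) # tl_items (ltails (lab [] t))) (lverts (lab [] t))"
    unfolding plant_eq_planted planted_def ..
  have g: "agood (ends ((a, Head (rt (lab [] t))) # tl_items (ltails (lab [] t)))) (lverts (lab [] t))"
    using good_plant[of a t] unfolding p good_ld .
  have l: "map fst (tree_leaves e t) = leaves t" for e
    by (induction t arbitrary: e) auto
  then have len: "length (tree_leaves e t) = length (leaves t)" for e
    by (metis length_map)
  show "degree (plant a t) = length (leaves t)"
    unfolding p degree_ld[OF g] by (simp add: tl len)
  show "a \<in> S \<Longrightarrow> set (leaves t) \<subseteq> S \<Longrightarrow> arrow_diagram S (plant a t)"
    using g arg_cong[OF l[of "[]"], of set] unfolding p arrow_diagram_ld by (simp add: f)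
  let ?its = "zip w (map (\<lambda>i. Tail [0, i]) [0..<length w])"
  have g: "agood (ends ?its) (verts (wheel w))"
    using good_wheel[of w] unfolding wheel_eq_zip good_ld by simp
  have "tls (ends ?its) = mset (map (\<lambda>i. [0, i]) [0..<length w])"
    unfolding ends_def by (subst map_snd_zip) (simp_all add: filter_mset_eq_conv o_def flip: mset_filter mset_map)
  then show "degree (wheel w) = length w"
    using degree_ld[OF g] unfolding wheel_eq_zip by simp
  show "set w \<subseteq> S \<Longrightarrow> arrow_diagram S (wheel w)"
    using g set_zip_leftD unfolding wheel_eq_zip arrow_diagram_ld by fastforce
qed

text \<open>\<open>as_trees\<close> picks the bracket trees arbitrarily; by \<open>lin_tword\<close>
  the sum of the planted trees depends on the Lie series alone.\<close>

lemma l_map_closed: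
  assumes S: "finite S" and L: "L \<in> FLS S"
  shows "l_map S L \<in> diagram_series S" "Psi (l_map S L) = LS S L"
proof -
  define T where "T a = as_trees S (L a)" for a
  have "L a \<in> FL S" if "a \<in> S" for a
    using that L by (simp add: FLS_def)
  note T = as_trees[OF this, folded T_def]
  define B where "B a n = {t. T a t \<noteq> 0 \<and> length (leaves t) = n}" for a n
  have BS: "set (leaves t) \<subseteq> S" if "a \<in> S" "t \<in> B a n" for a t n
    using T(1)[OF that(1)] that(2) by (simp add: tree_series_def B_def)
  have fin: "finite (B a n)" if "a \<in> S" for a n
    by (rule finite_subset[OF _ finite_trees[OF S, of n]]) (use BS[OF that] in \<open>auto simp: B_def\<close>)
  have part: "degree_part n (l_map S L) = (\<Sum>a\<in>S. \<Sum>t\<in>B a n. scale (T a t) (single (plant a t)))" for n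
  proof
    fix D
    have "(\<Sum>a\<in>S. \<Sum>t\<in>B a n. T a t * single (plant a t) D) = 0" if "degree D \<noteq> n"
      using that by (intro sum.neutral ballI) (auto simp: single_def B_def degree_plant)
    then show "degree_part n (l_map S L) D = (\<Sum>a\<in>S. \<Sum>t\<in>B a n. scale (T a t) (single (plant a t))) D"
      by (simp add: degree_part_def l_map_def sum_fun_apply scale_def B_def T_def)
  qed
  have supp: "D \<in> (\<Union>a\<in>S. plant a ` B a (degree D))" if nz: "l_map S L D \<noteq> 0" for D
  proof -
    have "(\<Sum>a\<in>S. \<Sum>t\<in>B a (degree D). scale (T a t) (single (plant a t)) D) \<noteq> 0"
      using nz fun_cong[OF part[of "degree D"], of D] by (simp add: degree_part_def sum_fun_apply)
    then obtain a where a: "a \<in> S" "(\<Sum>t\<in>B a (degree D). scale (T a t) (single (plant a t)) D) \<noteq> 0"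
      by (rule sum.not_neutral_contains_not_neutral)
    from a(2) obtain t where "t \<in> B a (degree D)" "scale (T a t) (single (plant a t)) D \<noteq> 0"
      by (rule sum.not_neutral_contains_not_neutral)
    then show ?thesis
      using a(1) by (auto simp: scale_def single_def split: if_splits)
  qed
  show "l_map S L \<in> diagram_series S"
    unfolding diagram_series_def
  proof (intro CollectI conjI allI impI)
    fix D assume "l_map S L D \<noteq> 0"
    from supp[OF this] obtain a t where at: "a \<in> S" "t \<in> B a (degree D)" "D = plant a t"
      by (elim UN_E imageE)
    show "arrow_diagram S D"
      unfolding at(3) by (rule arrow_diagram_plant[OF at(1) BS[OF at(1,2)]])
  next
    fix n
    have "finite (\<Union>a\<in>S. plant a ` B a n)"
      using S fin by auto
    then show "finite {D. l_map S L D \<noteq> 0 \<and> degree D = n}"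
      by (rule rev_finite_subset) (use supp in blast)
  qed
  show "Psi (l_map S L) = LS S L"
  proof (rule fps_ext)
    fix n
    have "lin (tword a) (nc_part n (L a)) = (\<Sum>t\<in>B a n. T a t *q PT a t)" if "a \<in> S" for a
    proof -
      have "nc_part n (L a) = (\<Sum>t\<in>B a n. scale (T a t) (nc_tree t))"
      proof
        fix w
        have "(\<Sum>t\<in>B a n. T a t * nc_tree t w) = 0" if "length w \<noteq> n"
          using that by (intro sum.neutral ballI) (auto simp: B_def nc_tree_eq_0)
        then show "nc_part n (L a) w = (\<Sum>t\<in>B a n. scale (T a t) (nc_tree t)) w"
          by (simp add: nc_part_def sum_fun_apply scale_def B_def nc_trees_def flip: T(2)[OF that])
      qed
      then show ?thesis
        by (simp add: lin_sum lin_scale lin_tword fsupp_scale)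
    qed
    then show "Psi (l_map S L) $ n = LS S L $ n"
      by (simp add: part lin_sum fsupp_sum fsupp_scale lin_scale PT_def LS_def fps_sum_nth)
  qed
qed

lemma iota_closed:
  assumes S: "finite S" and \<omega>: "\<omega> \<in> CW S"
  shows "iota \<omega> \<in> diagram_series S" "Psi (iota \<omega>) = IC \<omega>"
proof -
  define C where "C n = {c. \<omega> c \<noteq> 0 \<and> cw_length c = n}" for n
  have CS: "cyc (cw_word c) = c \<and> set (cw_word c) \<subseteq> S \<and> cw_word c \<noteq> []" if c: "c \<in> C n" for c n
  proof -
    have "c \<in> cwords S"
      using c \<omega> by (simp add: C_def CW_def)
    then obtain w where w: "c = cyc w" "w \<noteq> []" "set w \<subseteq> S"
      by (rule cwordsE)
    then show ?thesis
      using cw_word_cyc[of w] cyc_set[OF cw_word_cyc, of w] cw_word_length[of w] by auto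
  qed
  have inj: "inj_on cw_word (C n)" for n
    by (rule inj_on_inverseI[of _ cyc]) (use CS in blast)
  have fin: "finite (C n)" for n
  proof (rule inj_on_finite[OF inj])
    show "cw_word ` C n \<subseteq> {w. set w \<subseteq> S \<and> length w = n}"
      using CS by (auto simp: C_def)
  qed (rule finite_lists_length_eq[OF S])
  have part: "degree_part n (iota \<omega>) = (\<Sum>c\<in>C n. scale (- \<omega> c) (single (wheel (cw_word c))))" for n
  proof
    fix D
    have "(\<Sum>c\<in>C n. - \<omega> c * single (wheel (cw_word c)) D) = 0" if "degree D \<noteq> n"
      using that by (intro sum.neutral ballI) (auto simp: single_def C_def degree_wheel)
    then show "degree_part n (iota \<omega>) D = (\<Sum>c\<in>C n. scale (- \<omega> c) (single (wheel (cw_word c)))) D"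
      by (simp add: degree_part_def iota_def sum_fun_apply scale_def C_def)
  qed
  have supp: "D \<in> (\<lambda>c. wheel (cw_word c)) ` C (degree D)" if nz: "iota \<omega> D \<noteq> 0" for D
  proof -
    have "(\<Sum>c\<in>C (degree D). scale (- \<omega> c) (single (wheel (cw_word c))) D) \<noteq> 0"
      using nz fun_cong[OF part[of "degree D"], of D] by (simp add: degree_part_def sum_fun_apply)
    then obtain c where "c \<in> C (degree D)" "scale (- \<omega> c) (single (wheel (cw_word c))) D \<noteq> 0"
      by (rule sum.not_neutral_contains_not_neutral)
    then show ?thesis
      by (auto simp: scale_def single_def split: if_splits)
  qed
  show "iota \<omega> \<in> diagram_series S"
    unfolding diagram_series_def
  proof (intro CollectI conjI allI impI)
    fix D assume "iota \<omega> D \<noteq> 0"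
    then show "arrow_diagram S D"
      using supp[of D] CS arrow_diagram_wheel by fastforce
  next
    fix n
    have "finite ((\<lambda>c. wheel (cw_word c)) ` C n)"
      using fin by blast
    then show "finite {D. iota \<omega> D \<noteq> 0 \<and> degree D = n}"
      by (rule rev_finite_subset) (use supp in blast)
  qed
  show "Psi (iota \<omega>) = IC \<omega>"
  proof (rule fps_ext)
    fix n
    have sup: "w \<in> cw_word ` C n" if "nc_part n (cw_lift \<omega>) w \<noteq> 0" for w
    proof -
      have "length w = n" "w = cw_word (cyc w)" "\<omega> (cyc w) \<noteq> 0"
        using that by (auto simp: nc_part_def cw_lift_def split: if_splits)
      then show ?thesis
        by (intro image_eqI[of _ _ "cyc w"]) (auto simp: C_def)
    qed
    have "IC \<omega> $ n = (\<Sum>w\<in>cw_word ` C n. nc_part n (cw_lift \<omega>) w *q - WH (map Leaf w))"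
      unfolding IC_def IS_def wlin_nth by (rule lin_superset) (use fin sup in auto)
    also have "\<dots> = (\<Sum>c\<in>C n. nc_part n (cw_lift \<omega>) (cw_word c) *q - WH (map Leaf (cw_word c)))"
      by (simp add: sum.reindex[OF inj])
    also have "\<dots> = (\<Sum>c\<in>C n. - \<omega> c *q WH (map Leaf (cw_word c)))"
    proof (rule sum.cong[OF refl])
      fix c assume c: "c \<in> C n"
      then have "nc_part n (cw_lift \<omega>) (cw_word c) = \<omega> c"
        using CS[OF c] by (simp add: nc_part_def cw_lift_def C_def)
      then show "nc_part n (cw_lift \<omega>) (cw_word c) *q - WH (map Leaf (cw_word c)) = - \<omega> c *q WH (map Leaf (cw_word c))"
        by simp
    qed
    also have "\<dots> = Psi (iota \<omega>) $ n"
      unfolding Psi_nth part by (subst lin_sum) (simp_all only: lin_scale fsupp_scale fsupp_single lin_single cl_wheel)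
    finally show "Psi (iota \<omega>) $ n = IC \<omega> $ n" ..
  qed
qed

lemma aw_stack_aws:
  assumes "finite S" "aws S X \<noteq> {}" "aws S Y \<noteq> {}"
  shows "aw_stack S (aws S X) (aws S Y) = aws S (X * Y)"
  unfolding aw_stack_def
  by (intro UN_aws assms) (use series_stack_closed[OF assms(1,1)] in \<open>simp add: aw_class_eq[OF assms(1)]\<close>)

lemma aw_disjoint_union_aws:
  assumes "finite S1" "finite S2" "aws S1 X \<noteq> {}" "aws S2 Y \<noteq> {}"
  shows "aw_disjoint_union S1 S2 (aws S1 X) (aws S2 Y) = aws (S1 \<union> S2) (X * Y)"
  unfolding aw_disjoint_union_def
  by (intro UN_aws assms) (use series_stack_closed[OF assms(1,2)] assms(1,2) in \<open>simp add: aw_class_eq\<close>)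

lemma E_l_eq:
  assumes "finite S" "L \<in> FLS S" "\<omega> \<in> CW S"
  shows "E_l S L \<omega> = aws S (E_fps S L \<omega>)" "aws S (E_fps S L \<omega>) \<noteq> {}"
proof -
  note l = series_exp_closed[OF assms(1) l_map_closed(1)[OF assms(1,2)], unfolded l_map_closed(2)[OF assms(1,2)]]
  note i = series_exp_closed[OF assms(1) iota_closed(1)[OF assms(1,3)], unfolded iota_closed(2)[OF assms(1,3)]]
  have "aws S (gexp (LS S L)) \<noteq> {}" "aws S (gexp (IC \<omega>)) \<noteq> {}"
    using l i by (auto simp: aws_def)
  then show "E_l S L \<omega> = aws S (E_fps S L \<omega>)"
    using l i assms(1) by (simp add: E_l_def aw_class_eq aw_stack_aws E_fps_def)
  show "aws S (E_fps S L \<omega>) \<noteq> {}"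
    using series_stack_closed[OF assms(1,1) l(1) i(1)] l(2) i(2) by (auto simp: aws_def E_fps_def)
qed

text \<open>\<open>\<phi>\<close> may depend on the degree, because \<open>dS\<close> involves the
  sign of the degree in addition to reversal.\<close>

lemma aw_map_aws:
  assumes S: "finite S" "finite S'" and X: "aws S X \<noteq> {}"
    and \<phi>: "\<And>n. resp (\<phi> n)"
    and F: "\<And>D. arrow_diagram S D \<Longrightarrow> fsupp (F D) \<and> lin cl (F D) = \<phi> (degree D) D \<and>
      (\<forall>E. F D E \<noteq> 0 \<longrightarrow> arrow_diagram S' E \<and> degree E = degree D)"
  shows "aw_map S' F (aws S X) = aws S' (Abs_fps (\<lambda>n. dlift (\<phi> n) (X $ n)))"
  unfolding aw_map_def
proof (rule UN_aws[OF X])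
  fix f assume f: "f \<in> diagram_series S" "Psi f = X"
  define A where "A n = {D. f D \<noteq> 0 \<and> degree D = n}" for n
  have fin: "finite (A n)" for n
    using f by (simp add: A_def diagram_series_def)
  have AD: "arrow_diagram S D" "degree D = n" if "D \<in> A n" for D n
    using that f by (auto simp: A_def diagram_series_def)
  have part: "degree_part n (diagram_extend F f) = (\<Sum>D\<in>A n. scale (f D) (F D))" for n
  proof
    fix E
    have "F D E = 0" if "degree E \<noteq> n" "D \<in> A n" for D
      using that F[OF AD(1), of D n] AD(2)[of D n] by auto
    then show "degree_part n (diagram_extend F f) E = (\<Sum>D\<in>A n. scale (f D) (F D)) E"
      by (auto simp: degree_part_def diagram_extend_def A_def sum_fun_apply scale_def)
  qed
  have supp: "\<exists>D\<in>A (degree E). F D E \<noteq> 0" if nz: "diagram_extend F f E \<noteq> 0" for E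
    using nz unfolding diagram_extend_def A_def
    by (elim sum.not_neutral_contains_not_neutral) auto
  have closed: "diagram_extend F f \<in> diagram_series S'"
    unfolding diagram_series_def
  proof (intro CollectI conjI allI impI)
    fix E assume "diagram_extend F f E \<noteq> 0"
    then show "arrow_diagram S' E"
      using supp[of E] F AD by blast
  next
    fix n
    have "finite (\<Union>D\<in>A n. {E. F D E \<noteq> 0})"
      using fin F AD by (auto simp: fsupp_def)
    then show "finite {E. diagram_extend F f E \<noteq> 0 \<and> degree E = n}"
      by (rule rev_finite_subset) (use supp in blast)
  qed
  have "Psi (diagram_extend F f) = Abs_fps (\<lambda>n. dlift (\<phi> n) (X $ n))"
  proof (rule fps_ext)
    fix n
    have "Psi (diagram_extend F f) $ n = (\<Sum>D\<in>A n. f D *q \<phi> n D)"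
      unfolding Psi_nth part using F AD
      by (subst lin_sum) (auto simp: fsupp_scale lin_scale intro!: sum.cong)
    also have "\<dots> = lin (\<phi> n) (degree_part n f)"
      by (subst lin_superset[OF fin[of n]]) (auto simp: A_def degree_part_def split: if_splits intro!: sum.cong)
    also have "\<dots> = dlift (\<phi> n) (X $ n)"
      using dlift_lin[OF \<phi> diagram_series_part(2)[OF S(1) f(1)], of n n] by (simp flip: f(2))
    finally show "Psi (diagram_extend F f) $ n = Abs_fps (\<lambda>n. dlift (\<phi> n) (X $ n)) $ n"
      by simp
  qed
  then show "aw_class S' (diagram_extend F f) = aws S' (Abs_fps (\<lambda>n. dlift (\<phi> n) (X $ n)))"
    by (simp add: aw_class_eq[OF S(2) closed])
qed

subsection \<open>The operations on power series\<close>

lemma lsum_single: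
  "fsupp (lsum m (\<lambda>js. single (ld js V)) its)"
  "lin cl (lsum m (\<lambda>js. single (ld js V)) its) = lsum m (\<lambda>js. cl (ld js V)) its"
  "lsum m (\<lambda>js. single (ld js V)) its E \<noteq> 0 \<Longrightarrow>
    \<exists>js. E = ld js V \<and> map snd js = map snd its \<and> fst ` set js \<subseteq> (\<Union>x. m x)"
proof -
  have "fsupp (lsum m h its) \<and> lin cl (lsum m h its) = lsum m (\<lambda>js. lin cl (h js)) its"
    if "\<And>js. fsupp (h js)" for h :: "'a items \<Rightarrow> 'a diagram \<Rightarrow> rat"
    using that by (induction its arbitrary: h) (auto simp: lin_sum fsupp_sum intro!: sum.cong)
  from this[of "\<lambda>js. single (ld js V)"] show "fsupp (lsum m (\<lambda>js. single (ld js V)) its)"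
    "lin cl (lsum m (\<lambda>js. single (ld js V)) its) = lsum m (\<lambda>js. cl (ld js V)) its"
    by simp_all
  have "\<exists>js. h js E \<noteq> 0 \<and> map snd js = map snd its \<and> fst ` set js \<subseteq> (\<Union>x. m x)"
    if "lsum m h its E \<noteq> 0" for h :: "'a items \<Rightarrow> 'a diagram \<Rightarrow> rat"
    using that
  proof (induction its arbitrary: h)
    case (Cons i its)
    then obtain y where y: "y \<in> m (fst i)" "lsum m (\<lambda>js. h ((y, snd i) # js)) its E \<noteq> 0"
      unfolding lsum.simps sum_fun_apply by (rule_tac sum.not_neutral_contains_not_neutral)
    from Cons.IH[OF y(2)] obtain js where "h ((y, snd i) # js) E \<noteq> 0" "map snd js = map snd its"
      "fst ` set js \<subseteq> (\<Union>x. m x)" by blast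
    then show ?case
      using y(1) by (intro exI[of _ "(y, snd i) # js"]) auto
  qed (auto intro: exI[of _ "[]"])
  from this[of "\<lambda>js. single (ld js V)"] show "lsum m (\<lambda>js. single (ld js V)) its E \<noteq> 0 \<Longrightarrow>
      \<exists>js. E = ld js V \<and> map snd js = map snd its \<and> fst ` set js \<subseteq> (\<Union>x. m x)"
    by (auto simp: single_def split: if_splits)
qed

text \<open>For operations on the single strand \<open>a\<close>: with its ends listed first, they
  can be lifted apart from the others.\<close>

lemma arrow_diagram_split:
  assumes "finite S" "arrow_diagram S D"
  shows "\<exists>rest. D = ld (map (Pair a) (strand D a) @ rest) (verts D) \<and> fst ` set rest \<subseteq> S - {a}"
proof -
  obtain its where its: "D = ld its (verts D)" "fst ` set its \<subseteq> S"
    using arrow_diagram_eq_ld[OF assms] by blast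
  let ?rest = "filter (\<lambda>i. fst i \<noteq> a) its"
  have "strand D b = map snd (filter (\<lambda>i. fst i = b) (map (Pair a) (strand D a) @ ?rest))" for b
  proof -
    have "filter (\<lambda>i. fst i = b) ?rest = (if b = a then [] else filter (\<lambda>i. fst i = b) its)"
      by (auto simp: filter_empty_conv intro: filter_cong)
    moreover have "strand D b = map snd (filter (\<lambda>i. fst i = b) its)"
      by (subst its(1)) (rule strand_ld)
    ultimately show ?thesis
      by (auto simp: filter_map o_def)
  qed
  then have "strand D = strand (ld (map (Pair a) (strand D a) @ ?rest) (verts D))"
    unfolding strand_ld by (rule ext)
  then have "D = ld (map (Pair a) (strand D a) @ ?rest) (verts D)"
    by (rule diagram.expand[OF conjI]) (rule verts_ld[symmetric])
  moreover have "fst ` set ?rest \<subseteq> S - {a}"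
    using its(2) by auto
  ultimately show ?thesis by blast
qed

lemma lsum_fix: "(\<And>i. i \<in> set its \<Longrightarrow> m (fst i) = {fst i}) \<Longrightarrow> lsum m h its = h its"
  by (induction its arbitrary: h) simp_all

lemma lsum_cong_labels:
  "(\<And>js. fst ` set js \<subseteq> (\<Union>i\<in>set its. m (fst i)) \<Longrightarrow> h js = h' js) \<Longrightarrow> lsum m h its = lsum m h' its"
proof (induction its arbitrary: h h')
  case (Cons i its)
  show ?case
    unfolding lsum.simps by (intro sum.cong refl Cons.IH Cons.prems) auto
qed simp

lemma (in relabelling) aw_map_lift:
  assumes S: "finite S" and X: "aws S X \<noteq> {}"
    and F: "\<And>D. arrow_diagram S D \<Longrightarrow>
      \<exists>its. D = ld its (verts D) \<and> F D = lsum pre (\<lambda>js. single (ld js (verts D))) its"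
  shows "aw_map S' F (aws S X) = aws S' (dmap lift_dq X)"
proof -
  have "aw_map S' F (aws S X) = aws S' (Abs_fps (\<lambda>n. dlift lift_op (X $ n)))"
  proof (rule aw_map_aws[OF S fin X resp_lift_op])
    fix D assume D: "arrow_diagram S D"
    then obtain its where its: "D = ld its (verts D)" "F D = lsum pre (\<lambda>js. single (ld js (verts D))) its"
      using F by blast
    have "agood (ends its) (verts D)"
      using D by (subst (asm) its(1)) (simp add: arrow_diagram_ld)
    then have "arrow_diagram S' E \<and> degree E = degree D" if "F D E \<noteq> 0" for E
    proof -
      have "lsum pre (\<lambda>js. single (ld js (verts D))) its E \<noteq> 0"
        using that by (simp only: its(2)) simp
      from lsum_single(3)[OF this] obtain js where
        js: "E = ld js (verts D)" "map snd js = map snd its" "fst ` set js \<subseteq> (\<Union>x. pre x)"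
        by (elim exE conjE)
      have e: "ends js = ends its"
        using js(2) by (simp add: ends_def)
      have "(\<Union>x. pre x) \<subseteq> S'"
        by (auto simp: pre_def)
      moreover have "degree D = degree (ld its (verts D))"
        by (rule arg_cong[OF its(1)])
      ultimately show ?thesis
        using js(3) e \<open>agood (ends its) (verts D)\<close> unfolding js(1) by (auto simp: arrow_diagram_ld degree_ld)
    qed
    moreover have "lift_op D = lsum pre (\<lambda>js. cl (ld js (verts D))) its"
      by (subst its(1)) (rule lift_op_ld)
    ultimately show "fsupp (F D) \<and> lin cl (F D) = lift_op D \<and> (\<forall>E. F D E \<noteq> 0 \<longrightarrow> arrow_diagram S' E \<and> degree E = degree D)"
      by (simp add: its(2) lsum_single(1,2))
  qed
  then show ?thesis
    by (simp add: dmap_def lift_dq_def)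
qed

lemma (in relabelling) E_fps_lift:
  assumes S: "finite S" and L: "L \<in> FLS S" and \<omega>: "\<omega> \<in> CW S"
    and \<sigma>: "\<And>x. x \<in> S \<Longrightarrow> \<sigma> x = (\<Sum>y\<in>pre x. nc_gen y)"
    and M: "\<And>y. M y = (if y \<in> S' then L (u y) else 0)"
  shows "dmap lift_dq (E_fps S L \<omega>) = E_fps S' (\<lambda>x. nc_subst \<sigma> (M x)) (cw_subst \<sigma> \<omega>)"
    "(\<lambda>x. nc_subst \<sigma> (M x)) \<in> FLS S'" "cw_subst \<sigma> \<omega> \<in> CW S'"
proof -
  have pb: "nc_subst \<sigma> f = pb f" if "f \<in> alph S" for f
    by (rule nc_subst_eq_pb[OF S that \<sigma>])
  have "nc_subst \<sigma> (M y) = plift L y" for y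
    using pb[OF FLS_alph[OF S L]] pb[of 0] by (simp add: M plift_def pb_linear)
  then have lift: "(\<lambda>x. nc_subst \<sigma> (M x)) = plift L"
    by blast
  show "(\<lambda>x. nc_subst \<sigma> (M x)) \<in> FLS S'"
    unfolding lift by (rule lift_dq_LS(1)[OF S L])
  have w: "cw_lift \<omega> \<in> alph S"
    by (rule CW_lift_alph[OF \<omega>])
  have pw: "pb (cw_lift \<omega>) \<in> alph S'" "pb (cw_lift \<omega>) [] = 0"
    by (auto simp: alph_def pb_def)
  show "cw_subst \<sigma> \<omega> \<in> CW S'"
    unfolding cw_subst_def pb[OF w] by (rule cw_class_CW[OF pw(1)])
  have "dmap lift_dq (IC \<omega>) = IC (cw_subst \<sigma> \<omega>)"
    unfolding cw_subst_def pb[OF w] IC_cw_class[OF fin pw] unfolding IC_def by (rule lift_dq_IS[OF S w])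
  then show "dmap lift_dq (E_fps S L \<omega>) = E_fps S' (\<lambda>x. nc_subst \<sigma> (M x)) (cw_subst \<sigma> \<omega>)"
    unfolding E_fps_def lift by (simp add: dmap_th_mult dmap_th_gexp lift_dq_LS(2)[OF S L])
qed

lemma (in relabelling) lift_E_l:
  assumes "finite S" "L \<in> FLS S" "\<omega> \<in> CW S"
    and "\<And>x. x \<in> S \<Longrightarrow> \<sigma> x = (\<Sum>y\<in>pre x. nc_gen y)"
    and "\<And>y. M y = (if y \<in> S' then L (u y) else 0)"
    and "\<And>D. arrow_diagram S D \<Longrightarrow>
      \<exists>its. D = ld its (verts D) \<and> F D = lsum pre (\<lambda>js. single (ld js (verts D))) its"
  shows "aw_map S' F (E_l S L \<omega>) = E_l S' (\<lambda>x. nc_subst \<sigma> (M x)) (cw_subst \<sigma> \<omega>)"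
proof -
  note lift = E_fps_lift[OF assms(1-5)]
  have "aw_map S' F (aws S (E_fps S L \<omega>)) = aws S' (dmap lift_dq (E_fps S L \<omega>))"
    by (rule aw_map_lift[OF assms(1) E_l_eq(2)[OF assms(1-3)] assms(6)])
  also have "dmap lift_dq (E_fps S L \<omega>) = E_fps S' (\<lambda>x. nc_subst \<sigma> (M x)) (cw_subst \<sigma> \<omega>)"
    by (rule lift(1))
  also have "aws S' (E_fps S' (\<lambda>x. nc_subst \<sigma> (M x)) (cw_subst \<sigma> \<omega>)) = E_l S' (\<lambda>x. nc_subst \<sigma> (M x)) (cw_subst \<sigma> \<omega>)"
    by (rule E_l_eq(1)[symmetric, OF fin lift(2,3)])
  finally show ?thesis
    unfolding E_l_eq(1)[OF assms(1-3)] .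
qed

lemma d_eta_E_l:
  assumes S: "finite S" and L: "L \<in> FLS S" and \<omega>: "\<omega> \<in> CW S" and a: "a \<in> S"
  shows "d_eta S a (E_l S L \<omega>) =
    E_l (S - {a}) (\<lambda>x. nc_subst (nc_gen(a := 0)) ((L(a := 0)) x)) (cw_subst (nc_gen(a := 0)) \<omega>)"
proof -
  \<comment> \<open>With the identity on \<open>S - {a}\<close> the strand \<open>a\<close> has no
    preimage, so diagrams with an end on it are sent to 0.\<close>
  interpret relabelling "S - {a}" "\<lambda>x. x"
    by standard (simp add: S)
  have pre: "pre x = (if x \<in> S - {a} then {x} else {})" for x
    by (auto simp: pre_def)
  show ?thesis
    unfolding d_eta_def
  proof (rule lift_E_l[OF S L \<omega>])
    fix D assume D: "arrow_diagram S D"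
    obtain rest where r: "D = ld (map (Pair a) (strand D a) @ rest) (verts D)" "fst ` set rest \<subseteq> S - {a}"
      using arrow_diagram_split[OF S D] by blast
    have "lsum pre h rest = h rest" for h :: "'a items \<Rightarrow> 'a diagram \<Rightarrow> rat"
      by (rule lsum_fix) (use r(2) in \<open>auto simp: pre\<close>)
    then have "(if strand D a = [] then single D else 0) =
        lsum pre (\<lambda>js. single (ld js (verts D))) (map (Pair a) (strand D a) @ rest)"
      using r(1) by (cases "strand D a") (auto simp: pre lsum_append)
    with r(1) show "\<exists>its. D = ld its (verts D) \<and> (if strand D a = [] then single D else 0) =
        lsum pre (\<lambda>js. single (ld js (verts D))) its"
      by blast
  next
    fix y show "(L(a := 0)) y = (if y \<in> S - {a} then L y else 0)"
      using L by (auto simp: FLS_def)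
  qed (auto simp: pre)
qed

lemma d_sigma_E_l:
  assumes S: "finite S" and L: "L \<in> FLS S" and \<omega>: "\<omega> \<in> CW S" and a: "a \<in> S" and b: "b \<notin> S - {a}"
  shows "d_sigma S a b (E_l S L \<omega>) =
    E_l (S - {a} \<union> {b}) (\<lambda>x. nc_subst (nc_gen(a := nc_gen b)) ((L(a := 0, b := L a)) x))
      (cw_subst (nc_gen(a := nc_gen b)) \<omega>)"
proof -
  define S' where "S' = S - {a} \<union> {b}"
  \<comment> \<open>The new strand \<open>b\<close> lies over \<open>a\<close>. The case
    \<open>b = a\<close> is included; then \<open>u\<close> is the identity.\<close>
  define u where "u x = (if x = b then a else x)" for x
  interpret relabelling S' u
    by standard (simp add: S'_def S)
  have pre: "pre x = (if x = a then {b} else {x})" if "x \<in> S" for x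
    unfolding pre_def unfolding S'_def u_def using that b by auto
  show ?thesis
    unfolding d_sigma_def S'_def[symmetric]
  proof (rule lift_E_l[OF S L \<omega>])
    fix D assume D: "arrow_diagram S D"
    obtain rest where r: "D = ld (map (Pair a) (strand D a) @ rest) (verts D)" "fst ` set rest \<subseteq> S - {a}"
      using arrow_diagram_split[OF S D] by blast
    have 1: "lsum pre h rest = h rest" for h :: "'a items \<Rightarrow> 'a diagram \<Rightarrow> rat"
      by (rule lsum_fix, subst pre) (use r(2) in auto)
    have 2: "lsum pre h (map (Pair a) xs) = h (map (Pair b) xs)" for h :: "'a items \<Rightarrow> 'a diagram \<Rightarrow> rat" and xs
      by (induction xs arbitrary: h) (simp_all add: pre[OF a])
    have s: "strand D x = map snd (filter (\<lambda>i. fst i = x) rest)" if "x \<noteq> a" for x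
      using that by (subst r(1)) (auto simp: strand_ld filter_map o_def filter_empty_conv)
    have e: "filter (\<lambda>i. fst i = b) rest = []" "filter (\<lambda>i. fst i = a) rest = []"
      using r(2) b by (auto simp: filter_empty_conv)
    have "map snd (filter (\<lambda>i. fst i = x) (map (Pair b) xs @ rest)) = ((strand D)(a := [], b := xs)) x" for x xs
      by (cases "x = b"; cases "x = a") (simp_all add: e s filter_map o_def)
    then have "ld (map (Pair b) (strand D a) @ rest) (verts D) =
        Diagram ((strand D)(a := [], b := strand D a)) (verts D)"
      unfolding ld_def by presburger
    then have "single (Diagram ((strand D)(a := [], b := strand D a)) (verts D)) =
        lsum pre (\<lambda>js. single (ld js (verts D))) (map (Pair a) (strand D a) @ rest)"
      by (simp add: lsum_append 1 2)
    with r(1) show "\<exists>its. D = ld its (verts D) \<and> single (Diagram ((strand D)(a := [], b := strand D a)) (verts D)) =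
        lsum pre (\<lambda>js. single (ld js (verts D))) its"
      by blast
  next
    fix y show "(L(a := 0, b := L a)) y = (if y \<in> S' then L (u y) else 0)"
      using L by (auto simp: FLS_def S'_def u_def)
  qed (simp only: pre, simp)
qed

text \<open>Subsets are split by whether they contain 0, to match the recursion of
  \<open>nths\<close> on the first element of a list.\<close>

lemma sum_Pow_Suc:
  "(\<Sum>I\<in>Pow {..<Suc n}. g I) = (\<Sum>I\<in>Pow {..<n}. g (insert 0 (Suc ` I))) + (\<Sum>I\<in>Pow {..<n}. g (Suc ` I))"
  for g :: "nat set \<Rightarrow> 'v :: comm_monoid_add"
proof -
  let ?P = "(\<lambda>I. Suc ` I) ` Pow {..<n}"
  have P: "Pow (Suc ` {..<n}) = ?P"
    by (rule image_Pow_surj[symmetric]) simp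
  have inj: "inj_on (\<lambda>I. Suc ` I) (Pow {..<n})" "inj_on (insert 0) ?P"
    by (auto simp: inj_on_def inj_image_eq_iff)
  have "Pow {..<Suc n} = insert 0 ` ?P \<union> ?P"
    unfolding lessThan_Suc_eq_insert_0 Pow_insert P by auto
  moreover have "insert 0 ` ?P \<inter> ?P = {}"
    by auto
  ultimately have "(\<Sum>I\<in>Pow {..<Suc n}. g I) = (\<Sum>I\<in>insert 0 ` ?P. g I) + (\<Sum>I\<in>?P. g I)"
    by (simp add: sum.union_disjoint)
  then show ?thesis
    by (simp add: sum.reindex[OF inj(1)] sum.reindex[OF inj(2)] sum.reindex[OF inj(1), of "\<lambda>I. g (insert 0 I)", unfolded o_def])
qed

text \<open>A lifting of the ends on \<open>a\<close> amounts to the set of positions that go to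
  \<open>b\<close>; the choice for the first end decides whether 0 belongs to it.\<close>

lemma lsum_nths:
  fixes H :: "arrow_end list \<Rightarrow> arrow_end list \<Rightarrow> 'v :: comm_monoid_add"
  assumes m: "m a = {b, c}" "b \<noteq> c"
  shows "lsum m (\<lambda>js. H (map snd (filter (\<lambda>i. fst i = b) js)) (map snd (filter (\<lambda>i. fst i = c) js))) (map (Pair a) xs) =
    (\<Sum>I\<in>Pow {..<length xs}. H (nths xs I) (nths xs (- I)))"
proof (induction xs arbitrary: H)
  case (Cons x xs)
  have "0 \<in> insert 0 (Suc ` I)" "{j. Suc j \<in> insert 0 (Suc ` I)} = I" "0 \<notin> - insert 0 (Suc ` I)"
    "{j. Suc j \<in> - insert 0 (Suc ` I)} = - I" "0 \<notin> Suc ` I" "{j. Suc j \<in> Suc ` I} = I" "0 \<in> - Suc ` I"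
    "{j. Suc j \<in> - Suc ` I} = - I" for I
    by auto
  then have n: "nths (x # xs) (insert 0 (Suc ` I)) = x # nths xs I" "nths (x # xs) (- insert 0 (Suc ` I)) = nths xs (- I)"
    "nths (x # xs) (Suc ` I) = nths xs I" "nths (x # xs) (- Suc ` I) = x # nths xs (- I)" for I
    unfolding nths_Cons by (simp_all only: if_True if_False append_Cons append_Nil)
  show ?case
    using m Cons.IH[of "\<lambda>B C. H (x # B) C"] Cons.IH[of "\<lambda>B C. H B (x # C)"]
    by (simp only: length_Cons sum_Pow_Suc n) simp
qed simp

lemma d_Delta_E_l:
  assumes S: "finite S" and L: "L \<in> FLS S" and \<omega>: "\<omega> \<in> CW S" and a: "a \<in> S"
    and bc: "b \<noteq> c" "b \<notin> S - {a}" "c \<notin> S - {a}"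
  shows "d_Delta S a b c (E_l S L \<omega>) =
    E_l (S - {a} \<union> {b, c}) (\<lambda>x. nc_subst (nc_gen(a := nc_gen b + nc_gen c)) ((L(a := 0, b := L a, c := L a)) x))
      (cw_subst (nc_gen(a := nc_gen b + nc_gen c)) \<omega>)"
proof -
  define S' where "S' = S - {a} \<union> {b, c}"
  \<comment> \<open>Two preimages of \<open>a\<close> double the strand. One of \<open>b\<close> and
    \<open>c\<close> may be \<open>a\<close> itself, since the later function updates override the
    removal of \<open>a\<close>.\<close>
  define u where "u x = (if x = b \<or> x = c then a else x)" for x
  interpret relabelling S' u
    by standard (simp add: S'_def S)
  have pre: "pre x = (if x = a then {b, c} else {x})" if "x \<in> S" for x
    unfolding pre_def unfolding S'_def u_def using that bc by auto
  show ?thesis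
    unfolding d_Delta_def S'_def[symmetric]
  proof (rule lift_E_l[OF S L \<omega>])
    fix D assume D: "arrow_diagram S D"
    obtain rest where r: "D = ld (map (Pair a) (strand D a) @ rest) (verts D)" "fst ` set rest \<subseteq> S - {a}"
      using arrow_diagram_split[OF S D] by blast
    have 1: "lsum pre h rest = h rest" for h :: "'a items \<Rightarrow> 'a diagram \<Rightarrow> rat"
      by (rule lsum_fix, subst pre) (use r(2) in auto)
    have s: "strand D x = map snd (filter (\<lambda>i. fst i = x) rest)" if "x \<noteq> a" for x
      using that by (subst r(1)) (auto simp: strand_ld filter_map o_def filter_empty_conv)
    define H where "H B C = single (Diagram ((strand D)(a := [], b := B, c := C)) (verts D))" for B C
    have e: "filter (\<lambda>i. fst i = b) rest = []" "filter (\<lambda>i. fst i = c) rest = []" "filter (\<lambda>i. fst i = a) rest = []"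
      using r(2) bc by (auto simp: filter_empty_conv)
    have "ld (js @ rest) (verts D) = Diagram ((strand D)(a := [], b := map snd (filter (\<lambda>i. fst i = b) js),
        c := map snd (filter (\<lambda>i. fst i = c) js))) (verts D)" if js: "fst ` set js \<subseteq> {b, c}" for js
    proof -
      have "filter (\<lambda>i. fst i = x) js = []" if "x \<noteq> b" "x \<noteq> c" for x
        using that js by (auto simp: filter_empty_conv)
      then have "map snd (filter (\<lambda>i. fst i = x) (js @ rest)) = ((strand D)(a := [], b := map snd (filter (\<lambda>i. fst i = b) js),
          c := map snd (filter (\<lambda>i. fst i = c) js))) x" for x
        using bc(1) by (cases "x = b"; cases "x = c"; cases "x = a") (simp_all add: e s)
      then show ?thesis
        unfolding ld_def by presburger
    qed
    then have h: "single (ld (js @ rest) (verts D)) =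
        H (map snd (filter (\<lambda>i. fst i = b) js)) (map snd (filter (\<lambda>i. fst i = c) js))" if "fst ` set js \<subseteq> {b, c}" for js
      using that by (simp add: H_def)
    have "lsum pre (\<lambda>js. single (ld js (verts D))) (map (Pair a) (strand D a) @ rest) =
        lsum pre (\<lambda>js. single (ld (js @ rest) (verts D))) (map (Pair a) (strand D a))"
      unfolding lsum_append 1 ..
    also have "\<dots> = lsum pre (\<lambda>js. H (map snd (filter (\<lambda>i. fst i = b) js)) (map snd (filter (\<lambda>i. fst i = c) js)))
        (map (Pair a) (strand D a))"
    proof (rule lsum_cong_labels, rule h)
      have "(\<Union>i\<in>set (map (Pair a) (strand D a)). pre (fst i)) \<subseteq> {b, c}"
        using pre[OF a] by auto
      then show "fst ` set js \<subseteq> {b, c}" if "fst ` set js \<subseteq> (\<Union>i\<in>set (map (Pair a) (strand D a)). pre (fst i))" for js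
        by (rule order_trans[OF that])
    qed
    also have "\<dots> = (\<Sum>I\<in>Pow {..<length (strand D a)}. H (nths (strand D a) I) (nths (strand D a) (- I)))"
      by (rule lsum_nths) (simp_all add: pre[OF a] bc(1))
    finally have "lsum pre (\<lambda>js. single (ld js (verts D))) (map (Pair a) (strand D a) @ rest) =
        (\<Sum>I\<in>Pow {..<length (strand D a)}. H (nths (strand D a) I) (nths (strand D a) (- I)))" .
    with r(1) show "\<exists>its. D = ld its (verts D) \<and> (\<Sum>I\<in>Pow {..<length (strand D a)}.
        single (Diagram ((strand D)(a := [], b := nths (strand D a) I, c := nths (strand D a) (- I))) (verts D))) =
        lsum pre (\<lambda>js. single (ld js (verts D))) its"
      unfolding H_def by metis
  next
    fix y show "(L(a := 0, b := L a, c := L a)) y =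
        (if y \<in> S' then L (u y) else 0)"
      using L by (auto simp: FLS_def S'_def u_def)
  qed (simp only: pre, use bc in simp)
qed

lemma size_sum_mset: "finite A \<Longrightarrow> size (\<Sum>a\<in>A. f a) = (\<Sum>a\<in>A. size (f a))" for f :: "_ \<Rightarrow> 'b multiset"
  by (induction A rule: finite_induct) simp_all

text \<open>The number of tails is the degree, so the exponent of the sign in \<open>dS\<close>
  exceeds the one in \<open>dA\<close> by the degree.\<close>

lemma arrow_diagram_counts:
  assumes "finite S" "arrow_diagram S D"
  shows "(\<Sum>a\<in>S. length (filter is_head (strand D a))) = size (heads D)"
    "(\<Sum>a\<in>S. length (strand D a)) = size (heads D) + degree D"
    "reverse_strands S D = reverse_strands UNIV D"
    "arrow_diagram S (reverse_strands UNIV D)" "degree (reverse_strands UNIV D) = degree D"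
proof -
  obtain its where its: "D = ld its (verts D)" "fst ` set its \<subseteq> S" "agood (ends its) (verts D)"
    using arrow_diagram_eq_ld[OF assms] by blast
  have *: "(\<Sum>a\<in>S. length (filter P (strand D a))) = size (filter_mset P (ends its))" for P
  proof -
    have "strand D a = map snd (filter (\<lambda>i. fst i = a) its)" for a
      by (subst its(1)) (rule strand_ld)
    then show ?thesis
      using arg_cong[OF sum_strands[OF assms(1) its(2), of id P], of size]
      by (simp only: size_sum_mset[OF assms(1)] list.map_id size_mset multiset.map_id)
  qed
  have h: "heads D = hds (ends its)"
    by (subst its(1)) (rule heads_ld)
  then show "(\<Sum>a\<in>S. length (filter is_head (strand D a))) = size (heads D)"
    by (simp add: *)
  have d: "degree D = size (tls (ends its))"
    by (subst its(1)) (rule degree_ld[OF its(3)])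
  have "size (ends its) = size (filter_mset is_head (ends its)) + size (filter_mset (Not \<circ> is_head) (ends its))"
    by (induction its) auto
  then show "(\<Sum>a\<in>S. length (strand D a)) = size (heads D) + degree D"
    using *[of "\<lambda>_. True"] by (simp add: h d)
  show "reverse_strands S D = reverse_strands UNIV D"
    using assms(2) by (auto simp: reverse_strands_def arrow_diagram_def fun_eq_iff)
  have r: "reverse_strands UNIV D = ld (rev its) (verts D)"
    by (subst its(1)) (simp add: reverse_strands_def ld_def rev_map rev_filter)
  show "arrow_diagram S (reverse_strands UNIV D)" "degree (reverse_strands UNIV D) = degree D"
    unfolding r d using its by (simp_all add: arrow_diagram_ld degree_ld)
qed

lemma dlift_scaled:
  assumes "resp \<phi>"
  shows "resp (\<lambda>D. r *q \<phi> D)" "dlift (\<lambda>D. r *q \<phi> D) x = r *q dlift \<phi> x"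
proof -
  show r: "resp (\<lambda>D. r *q \<phi> D)"
    using assms by (simp add: resp_def lin_scale_fun)
  obtain f where "f \<in> dcarrier" "x = lin cl f"
    using dq_rep by blast
  then show "dlift (\<lambda>D. r *q \<phi> D) x = r *q dlift \<phi> x"
    by (simp add: dlift_lin assms r lin_scale_fun)
qed

lemma d_A_E_l:
  assumes S: "finite S" and L: "L \<in> FLS S" and \<omega>: "\<omega> \<in> CW S"
  shows "d_A S S (E_l S L \<omega>) = E_l S (- L) (cw_exp_op (cw_der L) \<omega> - fls_j S L)"
proof -
  have "d_A S S (aws S (E_fps S L \<omega>)) = aws S (Abs_fps (\<lambda>n. dlift rev_op (E_fps S L \<omega> $ n)))"
    unfolding d_A_def
  proof (rule aw_map_aws[OF S S E_l_eq(2)[OF assms] resp_rev_op])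
    fix D assume "arrow_diagram S D"
    note c = arrow_diagram_counts[OF S this]
    show "fsupp (scale ((-1) ^ (\<Sum>a\<in>S. length (filter is_head (strand D a)))) (single (reverse_strands S D))) \<and>
      lin cl (scale ((-1) ^ (\<Sum>a\<in>S. length (filter is_head (strand D a)))) (single (reverse_strands S D))) = rev_op D \<and>
      (\<forall>E. scale ((-1) ^ (\<Sum>a\<in>S. length (filter is_head (strand D a)))) (single (reverse_strands S D)) E \<noteq> 0 \<longrightarrow>
        arrow_diagram S E \<and> degree E = degree D)"
      unfolding c(1,3) using c(4,5) by (simp add: fsupp_scale lin_scale rev_op_def) (simp add: scale_def single_def)
  qed
  also have "Abs_fps (\<lambda>n. dlift rev_op (E_fps S L \<omega> $ n)) = dmap rev_dq (E_fps S L \<omega>)"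
    by (simp add: dmap_def rev_dq_def)
  finally show ?thesis
    using E_l_eq(1)[OF assms] E_l_eq(1)[OF S FLS_uminus[OF S L] CW_linear(2)[OF IC_exp_op(1)[OF assms] IC_j(1)[OF S L]]]
    by (simp add: E_fps_reverse[OF assms])
qed

lemma d_S_E_l:
  assumes S: "finite S" and L: "L \<in> FLS S" and \<omega>: "\<omega> \<in> CW S"
  shows "d_S S S (E_l S L \<omega>) =
    E_l S (\<lambda>a. - nc_sign_deg (L a)) (cw_sign_deg (cw_exp_op (cw_der L) \<omega> - fls_j S L))"
proof -
  let ?\<phi> = "\<lambda>n D. (-1) ^ n *q rev_op D"
  have "d_S S S (aws S (E_fps S L \<omega>)) = aws S (Abs_fps (\<lambda>n. dlift (?\<phi> n) (E_fps S L \<omega> $ n)))"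
    unfolding d_S_def
  proof (rule aw_map_aws[OF S S E_l_eq(2)[OF assms] dlift_scaled(1)[OF resp_rev_op]])
    fix D assume "arrow_diagram S D"
    note c = arrow_diagram_counts[OF S this]
    show "fsupp (scale ((-1) ^ (\<Sum>a\<in>S. length (strand D a))) (single (reverse_strands S D))) \<and>
      lin cl (scale ((-1) ^ (\<Sum>a\<in>S. length (strand D a))) (single (reverse_strands S D))) = ?\<phi> (degree D) D \<and>
      (\<forall>E. scale ((-1) ^ (\<Sum>a\<in>S. length (strand D a))) (single (reverse_strands S D)) E \<noteq> 0 \<longrightarrow>
        arrow_diagram S E \<and> degree E = degree D)"
      unfolding c(2,3) using c(4,5)
      by (simp add: fsupp_scale lin_scale rev_op_def power_add mult.commute) (simp add: scale_def single_def)
  qed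
  also have "Abs_fps (\<lambda>n. dlift (?\<phi> n) (E_fps S L \<omega> $ n)) = sign_fps (dmap rev_dq (E_fps S L \<omega>))"
    by (simp add: fps_eq_iff dlift_scaled(2)[OF resp_rev_op] rev_dq_def)
  finally have "d_S S S (E_l S L \<omega>) = aws S (E_fps S (\<lambda>a. nc_sign_deg ((- L) a)) (cw_sign_deg (cw_exp_op (cw_der L) \<omega> - fls_j S L)))"
    by (simp add: E_l_eq(1)[OF assms] E_fps_reverse[OF assms] E_fps_sign)
  moreover have "(\<lambda>a. nc_sign_deg ((- L) a)) = (\<lambda>a. - nc_sign_deg (L a))"
    by (auto simp: fun_eq_iff nc_sign_deg_def fun_apply)
  ultimately show ?thesis
    using E_l_eq(1)[OF S FLS_sign[OF S FLS_uminus[OF S L]]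
      CW_sign[OF CW_linear(2)[OF IC_exp_op(1)[OF assms] IC_j(1)[OF S L]]]] by simp
qed

lemma E_l_stack:
  assumes S: "finite S" and one: "L1 \<in> FLS S" "\<omega>1 \<in> CW S" and two: "L2 \<in> FLS S" "\<omega>2 \<in> CW S"
  shows "aw_stack S (E_l S L1 \<omega>1) (E_l S L2 \<omega>2) =
    E_l S (BCH_tb L1 L2) (cw_exp_op (\<lambda>\<omega>. - cw_der L2 \<omega>) \<omega>1 + \<omega>2)"
  using E_l_eq[OF S one] E_l_eq[OF S two] E_fps_mult[OF S one(1) two(1) one(2) two(2)] S
  by (simp add: aw_stack_aws E_l_eq(1))

lemma E_l_disjoint_union:
  assumes S: "finite S1" "finite S2" "S1 \<inter> S2 = {}"
    and one: "L1 \<in> FLS S1" "\<omega>1 \<in> CW S1" and two: "L2 \<in> FLS S2" "\<omega>2 \<in> CW S2"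
  shows "aw_disjoint_union S1 S2 (E_l S1 L1 \<omega>1) (E_l S2 L2 \<omega>2) =
    E_l (S1 \<union> S2) (fls_union S1 L1 L2) (\<omega>1 + \<omega>2)"
  using E_l_eq[OF S(1) one] E_l_eq[OF S(2) two] E_fps_union[OF S one(1) two(1) one(2) two(2)] S(1,2)
  by (simp add: aw_disjoint_union_aws E_l_eq(1))


theorem mainTheorem2:
  shows
    "(\<forall>S1 S2 :: 'a set. \<forall>L1 L2 \<omega>1 \<omega>2.
        finite S1 \<and> finite S2 \<and> S1 \<inter> S2 = {} \<and>
        L1 \<in> FLS S1 \<and> \<omega>1 \<in> CW S1 \<and> L2 \<in> FLS S2 \<and> \<omega>2 \<in> CW S2 \<longrightarrow>
        aw_disjoint_union S1 S2 (E_l S1 L1 \<omega>1) (E_l S2 L2 \<omega>2) =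
          E_l (S1 \<union> S2) (fls_union S1 L1 L2) (\<omega>1 + \<omega>2))
     \<and>
     (\<forall>S :: 'a set. \<forall>L1 L2 \<omega>1 \<omega>2.
        finite S \<and> L1 \<in> FLS S \<and> \<omega>1 \<in> CW S \<and> L2 \<in> FLS S \<and> \<omega>2 \<in> CW S \<longrightarrow>
        aw_stack S (E_l S L1 \<omega>1) (E_l S L2 \<omega>2) =
          E_l S (BCH_tb L1 L2) (cw_exp_op (\<lambda>\<omega>. - cw_der L2 \<omega>) \<omega>1 + \<omega>2))
     \<and>
     (\<forall>S :: 'a set. \<forall>L \<omega> a.
        finite S \<and> L \<in> FLS S \<and> \<omega> \<in> CW S \<and> a \<in> S \<longrightarrow>
        d_eta S a (E_l S L \<omega>) =
          (let \<sigma> = nc_gen(a := 0) in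
           E_l (S - {a}) (\<lambda>x. nc_subst \<sigma> ((L(a := 0)) x)) (cw_subst \<sigma> \<omega>)))
     \<and>
     (\<forall>S :: 'a set. \<forall>L \<omega>.
        finite S \<and> L \<in> FLS S \<and> \<omega> \<in> CW S \<longrightarrow>
        d_A S S (E_l S L \<omega>) = E_l S (- L) (cw_exp_op (cw_der L) \<omega> - fls_j S L))
     \<and>
     (\<forall>S :: 'a set. \<forall>L \<omega>.
        finite S \<and> L \<in> FLS S \<and> \<omega> \<in> CW S \<longrightarrow>
        d_S S S (E_l S L \<omega>) =
          E_l S (\<lambda>a. - nc_sign_deg (L a)) (cw_sign_deg (cw_exp_op (cw_der L) \<omega> - fls_j S L)))
     \<and>
     (\<forall>S :: 'a set. \<forall>L \<omega> a b c.
        finite S \<and> L \<in> FLS S \<and> \<omega> \<in> CW S \<and> a \<in> S \<and>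
        b \<noteq> c \<and> b \<notin> S - {a} \<and> c \<notin> S - {a} \<longrightarrow>
        d_Delta S a b c (E_l S L \<omega>) =
          (let \<sigma> = nc_gen(a := nc_gen b + nc_gen c) in
           E_l (S - {a} \<union> {b, c})
             (\<lambda>x. nc_subst \<sigma> ((L(a := 0, b := L a, c := L a)) x)) (cw_subst \<sigma> \<omega>)))
     \<and>
     (\<forall>S :: 'a set. \<forall>L \<omega> a b.
        finite S \<and> L \<in> FLS S \<and> \<omega> \<in> CW S \<and> a \<in> S \<and> b \<notin> S - {a} \<longrightarrow>
        d_sigma S a b (E_l S L \<omega>) =
          (let \<sigma> = nc_gen(a := nc_gen b) in
           E_l (S - {a} \<union> {b})
             (\<lambda>x. nc_subst \<sigma> ((L(a := 0, b := L a)) x)) (cw_subst \<sigma> \<omega>)))"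
proof (intro conjI allI impI)
  fix S1 S2 :: "'a set" and L1 L2 \<omega>1 \<omega>2
  assume "finite S1 \<and> finite S2 \<and> S1 \<inter> S2 = {} \<and>
    L1 \<in> FLS S1 \<and> \<omega>1 \<in> CW S1 \<and> L2 \<in> FLS S2 \<and> \<omega>2 \<in> CW S2"
  then show "aw_disjoint_union S1 S2 (E_l S1 L1 \<omega>1) (E_l S2 L2 \<omega>2) =
      E_l (S1 \<union> S2) (fls_union S1 L1 L2) (\<omega>1 + \<omega>2)"
    by (elim conjE) (rule E_l_disjoint_union)
next
  fix S :: "'a set" and L1 L2 \<omega>1 \<omega>2
  assume "finite S \<and> L1 \<in> FLS S \<and> \<omega>1 \<in> CW S \<and> L2 \<in> FLS S \<and> \<omega>2 \<in> CW S"
  then show "aw_stack S (E_l S L1 \<omega>1) (E_l S L2 \<omega>2) =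
      E_l S (BCH_tb L1 L2) (cw_exp_op (\<lambda>\<omega>. - cw_der L2 \<omega>) \<omega>1 + \<omega>2)"
    by (elim conjE) (rule E_l_stack)
next
  fix S :: "'a set" and L \<omega> a
  assume "finite S \<and> L \<in> FLS S \<and> \<omega> \<in> CW S \<and> a \<in> S"
  then show "d_eta S a (E_l S L \<omega>) =
      (let \<sigma> = nc_gen(a := 0) in
       E_l (S - {a}) (\<lambda>x. nc_subst \<sigma> ((L(a := 0)) x)) (cw_subst \<sigma> \<omega>))"
    unfolding Let_def by (elim conjE) (rule d_eta_E_l)
next
  fix S :: "'a set" and L \<omega>
  assume "finite S \<and> L \<in> FLS S \<and> \<omega> \<in> CW S"
  then show "d_A S S (E_l S L \<omega>) = E_l S (- L) (cw_exp_op (cw_der L) \<omega> - fls_j S L)"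
    by (elim conjE) (rule d_A_E_l)
next
  fix S :: "'a set" and L \<omega>
  assume "finite S \<and> L \<in> FLS S \<and> \<omega> \<in> CW S"
  then show "d_S S S (E_l S L \<omega>) =
      E_l S (\<lambda>a. - nc_sign_deg (L a)) (cw_sign_deg (cw_exp_op (cw_der L) \<omega> - fls_j S L))"
    by (elim conjE) (rule d_S_E_l)
next
  fix S :: "'a set" and L \<omega> a b c
  assume "finite S \<and> L \<in> FLS S \<and> \<omega> \<in> CW S \<and> a \<in> S \<and>
    b \<noteq> c \<and> b \<notin> S - {a} \<and> c \<notin> S - {a}"
  then show "d_Delta S a b c (E_l S L \<omega>) =
      (let \<sigma> = nc_gen(a := nc_gen b + nc_gen c) in
       E_l (S - {a} \<union> {b, c})
         (\<lambda>x. nc_subst \<sigma> ((L(a := 0, b := L a, c := L a)) x)) (cw_subst \<sigma> \<omega>))"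
    unfolding Let_def by (elim conjE) (rule d_Delta_E_l)
next
  fix S :: "'a set" and L \<omega> a b
  assume "finite S \<and> L \<in> FLS S \<and> \<omega> \<in> CW S \<and> a \<in> S \<and> b \<notin> S - {a}"
  then show "d_sigma S a b (E_l S L \<omega>) =
      (let \<sigma> = nc_gen(a := nc_gen b) in
       E_l (S - {a} \<union> {b})
         (\<lambda>x. nc_subst \<sigma> ((L(a := 0, b := L a)) x)) (cw_subst \<sigma> \<omega>))"
    unfolding Let_def by (elim conjE) (rule d_sigma_E_l)
qed

end
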